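(* Let $(X,\hat g)$ be a generalized pseudo-Riemannian manifold. Then there exists a unique generalized connection $\hat D$ on $X$ such that (D4) $[\xi,\eta]=\hat D_\xi\eta-\hat D_\eta\xi$ and (D5) $\xi\,\hat g(\eta,\zeta)=\hat g(\hat D_\xi\eta,\zeta)+\hat g(\eta,\hat D_\xi\zeta)$ hold for all $\xi,\eta,\zeta\in\mathcal G^1_0(X)$. This $\hat D$ (called the generalized Levi-Civita connection of $X$) is characterized by the Koszul formula $$2\hat g(\hat D_\xi\eta,\zeta)=\xi\,\hat g(\eta,\zeta)+\eta\,\hat g(\zeta,\xi)-\zeta\,\hat g(\xi,\eta)-\hat g(\xi,[\eta,\zeta])+\hat g(\eta,[\zeta,\xi])+\hat g(\zeta,[\xi,\eta])$$ for all $\xi,\eta,\zeta\in\mathcal G^1_0(X)$.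
   Context: $X$ is a paracompact smooth Hausdorff manifold; all functions and tensor fields are real. $\mathcal G(X):=\mathcal E_M(X)/\mathcal N(X)$, where $\mathcal E_M(X)$ is the set of nets $(u_\varepsilon)_{\varepsilon\in(0,1]}$ in $C^\infty(X)$ such that for every compact $K\subset X$ and every linear differential operator $P$ there is $N\in\mathbb N$ with $\sup_K|Pu_\varepsilon|=O(\varepsilon^{-N})$ as $\varepsilon\to0$; $\mathcal N(X)$ consists of those with $\sup_K|u_\varepsilon|=O(\varepsilon^m)$ for all compact $K$ and all $m\in\mathbb N_0$. $\mathcal R$ denotes the ring of generalized real numbers (real nets with $|r_\varepsilon|=O(\varepsilon^{-N})$ for some $N$, modulo nets with $|r_\varepsilon|=O(\varepsilon^m)$ for all $m$). The $\mathcal G(X)$-module $\mathcal G^r_s(X)$ (generalized $(r,s)$-tensor fields) is defined analogously to $\mathcal G(X)$: nets $(s_\varepsilon)_\varepsilon$ of smooth $(r,s)$-tensor fields with $\sup_K\|Ps_\varepsilon\|=O(\varepsilon^{-N})$ for each compact $K$ and linear differential operator $P$ on $(r,s)$-tensor fields (some $N$), modulo those with $\sup_K\|s_\varepsilon\|=O(\varepsilon^m)$ for all $K$, $m$. $\mathcal G^1_0(X)$ is the module of generalized vector fields. Operations are $\varepsilon$-wise on representatives: $\hat g(\xi,\eta)=[(\hat g_\varepsilon(\xi_\varepsilon,\eta_\varepsilon))_\varepsilon]$, $\xi(u)=\xi u=[(\xi_\varepsilon(u_\varepsilon))_\varepsilon]$ for $u\in\mathcal G(X)$, $[\xi,\eta]=[([\xi_\varepsilon,\eta_\varepsilon])_\varepsilon]$.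 $\hat g\in\mathcal G^0_2(X)$ is a generalized pseudo-Riemannian metric, and $(X,\hat g)$ a generalized pseudo-Riemannian manifold, if (1) in every chart the determinant of the matrix of components of $\hat g$ is invertible in the Colombeau algebra over the chart domain, (2) for each relatively compact open $V\subseteq X$ there are a representative $(\hat g_\varepsilon)_\varepsilon$ of $\hat g$ and $\varepsilon_0>0$ such that $\hat g_\varepsilon|_V$ is a smooth pseudo-Riemannian metric for all $\varepsilon<\varepsilon_0$, and (3) $\hat g$ possesses an index $j$, different from $0$: the representatives in (2) can be chosen so that $\hat g_\varepsilon|_V$ has index $j$, with the same $j$ for all $V$. A generalized connection $\hat D$ on $X$ is a map $\mathcal G^1_0(X)\times\mathcal G^1_0(X)\to\mathcal G^1_0(X)$, $(\xi,\eta)\mapsto\hat D_\xi\eta$, such that (D1) $\hat D_\xi\eta$ is $\mathcal R$-linear in $\eta$; (D2) $\hat D_\xi\eta$ is $\mathcal G(X)$-linear in $\xi$; (D3) $\hat D_\xi(u\eta)=u\hat D_\xi\eta+\xi(u)\eta$ for all $u\in\mathcal G(X)$. *)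

theory Defs
  imports "HOL-Analysis.Analysis" "HOL-Library.Function_Algebras"
begin

section \<open>Smooth maps between Euclidean spaces\<close>

primrec pderivs :: "'n::finite list \<Rightarrow> (real^'n \<Rightarrow> 'b::real_normed_vector) \<Rightarrow> real^'n \<Rightarrow> 'b" where
  "pderivs [] f = f"
| "pderivs (i # is) f = (\<lambda>x. frechet_derivative (pderivs is f) (at x) (axis i 1))"

text \<open>Smoothness on an \<^emph>\<open>open\<close> set: all iterated partial derivatives are Frechet differentiable
  (hence in particular continuous), so this is the class of infinitely differentiable maps.\<close>

definition smooth_on :: "(real^'n::finite) set \<Rightarrow> (real^'n \<Rightarrow> 'b::real_normed_vector) \<Rightarrow> bool" where
  "smooth_on S f \<longleftrightarrow> (\<forall>is. \<forall>x\<in>S. pderivs is f differentiable (at x))"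


section \<open>Smooth manifolds\<close>

definition paracompact_space :: "'a topology \<Rightarrow> bool" where
  "paracompact_space X \<longleftrightarrow>
     (\<forall>\<U>. (\<forall>U\<in>\<U>. openin X U) \<and> \<Union>\<U> = topspace X \<longrightarrow>
       (\<exists>\<V>. (\<forall>V\<in>\<V>. openin X V \<and> (\<exists>U\<in>\<U>. V \<subseteq> U)) \<and> \<Union>\<V> = topspace X \<and>
            locally_finite_in X \<V>))"

text \<open>A chart is a pair of a domain and a coordinate map; the values of the coordinate map outside
  the domain are irrelevant.\<close>

type_synonym ('a, 'n) chart = "'a set \<times> ('a \<Rightarrow> real^'n)"

definition chart_inv :: "('a, 'n::finite) chart \<Rightarrow> real^'n \<Rightarrow> 'a" where
  "chart_inv c = inv_into (fst c) (snd c)"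

definition transition :: "('a, 'n::finite) chart \<Rightarrow> ('a, 'n) chart \<Rightarrow> real^'n \<Rightarrow> real^'n" where
  "transition c d = snd d \<circ> chart_inv c"

definition is_chart :: "'a topology \<Rightarrow> ('a, 'n::finite) chart \<Rightarrow> bool" where
  "is_chart X c \<longleftrightarrow> openin X (fst c) \<and> open (snd c ` fst c) \<and>
     homeomorphic_map (subtopology X (fst c)) (top_of_set (snd c ` fst c)) (snd c)"

definition compatible :: "('a, 'n::finite) chart \<Rightarrow> ('a, 'n) chart \<Rightarrow> bool" where
  "compatible c d \<longleftrightarrow> smooth_on (snd c ` (fst c \<inter> fst d)) (transition c d) \<and>
     smooth_on (snd d ` (fst c \<inter> fst d)) (transition d c)"

record ('a, 'n::finite) manifold =
  mtop :: "'a topology"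
  charts :: "('a, 'n) chart set"

text \<open>The atlas is required to be maximal, so ``every chart'' ranges over the whole smooth
  structure.  The dimension is \<open>CARD('n)\<close>.\<close>

definition smooth_manifold :: "('a, 'n::finite) manifold \<Rightarrow> bool" where
  "smooth_manifold M \<longleftrightarrow>
     Hausdorff_space (mtop M) \<and> paracompact_space (mtop M) \<and>
     (\<forall>c\<in>charts M. is_chart (mtop M) c) \<and>
     (\<Union>c\<in>charts M. fst c) = topspace (mtop M) \<and>
     (\<forall>c\<in>charts M. \<forall>d\<in>charts M. compatible c d) \<and>
     (\<forall>c. is_chart (mtop M) c \<and> (\<forall>d\<in>charts M. compatible c d) \<longrightarrow> c \<in> charts M)"

definition open_submanifold :: "('a, 'n::finite) manifold \<Rightarrow> 'a set \<Rightarrow> ('a, 'n) manifold" where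
  "open_submanifold M U =
     \<lparr>mtop = subtopology (mtop M) U, charts = {c \<in> charts M. fst c \<subseteq> U}\<rparr>"

text \<open>The functions below that are computed in \<open>chart_at M p\<close> have the same value in every chart
  around \<open>p\<close>.\<close>

definition chart_at :: "('a, 'n::finite) manifold \<Rightarrow> 'a \<Rightarrow> ('a, 'n) chart" where
  "chart_at M p = (SOME c. c \<in> charts M \<and> p \<in> fst c)"


section \<open>Smooth functions and tensor fields\<close>

text \<open>A tangent vector at \<open>p\<close> is a family of component vectors, one for each chart around \<open>p\<close>, that
  transforms with the Jacobian matrices of the coordinate changes; similarly for tensors of type
  (0,2).  Accordingly a tensor field assigns components to every chart \<open>c\<close> and every \<open>p \<in> fst c\<close>;
  the values at other arguments are irrelevant.\<close>

type_synonym ('a, 'n) vfield = "('a, 'n) chart \<Rightarrow> 'a \<Rightarrow> real^'n"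
type_synonym ('a, 'n) tfield = "('a, 'n) chart \<Rightarrow> 'a \<Rightarrow> real^'n^'n"

definition jacobian :: "('a, 'n::finite) chart \<Rightarrow> ('a, 'n) chart \<Rightarrow> 'a \<Rightarrow> real^'n^'n" where
  "jacobian c d p = matrix (frechet_derivative (transition c d) (at (snd c p)))"

definition smooth_in_chart ::
    "('a, 'n::finite) chart \<Rightarrow> ('a \<Rightarrow> 'b::real_normed_vector) \<Rightarrow> bool" where
  "smooth_in_chart c f \<longleftrightarrow> smooth_on (snd c ` fst c) (f \<circ> chart_inv c)"

definition smooth_functions :: "('a, 'n::finite) manifold \<Rightarrow> ('a \<Rightarrow> real) set" where
  "smooth_functions M = {u. \<forall>c\<in>charts M. smooth_in_chart c u}"

definition smooth_vfields :: "('a, 'n::finite) manifold \<Rightarrow> ('a, 'n) vfield set" where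
  "smooth_vfields M = {\<xi>. (\<forall>c\<in>charts M. smooth_in_chart c (\<xi> c)) \<and>
     (\<forall>c\<in>charts M. \<forall>d\<in>charts M. \<forall>p\<in>fst c \<inter> fst d. \<xi> d p = jacobian c d p *v \<xi> c p)}"

definition smooth_tfields :: "('a, 'n::finite) manifold \<Rightarrow> ('a, 'n) tfield set" where
  "smooth_tfields M = {g. (\<forall>c\<in>charts M. smooth_in_chart c (g c)) \<and>
     (\<forall>c\<in>charts M. \<forall>d\<in>charts M. \<forall>p\<in>fst c \<inter> fst d.
        g c p = transpose (jacobian c d p) ** g d p ** jacobian c d p)}"

definition tfield_apply ::
    "('a, 'n::finite) manifold \<Rightarrow> ('a, 'n) tfield \<Rightarrow> ('a, 'n) vfield \<Rightarrow> ('a, 'n) vfield \<Rightarrow> 'a \<Rightarrow> real"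
  where
  "tfield_apply M g \<xi> \<eta> p = (let c = chart_at M p in \<xi> c p \<bullet> (g c p *v \<eta> c p))"

definition chart_deriv ::
    "('a, 'n::finite) chart \<Rightarrow> 'a \<Rightarrow> real^'n \<Rightarrow> ('a \<Rightarrow> 'b::real_normed_vector) \<Rightarrow> 'b" where
  "chart_deriv c p v f = frechet_derivative (f \<circ> chart_inv c) (at (snd c p)) v"

definition vfield_apply ::
    "('a, 'n::finite) manifold \<Rightarrow> ('a, 'n) vfield \<Rightarrow> ('a \<Rightarrow> real) \<Rightarrow> 'a \<Rightarrow> real" where
  "vfield_apply M \<xi> u p = (let c = chart_at M p in chart_deriv c p (\<xi> c p) u)"

definition lie_bracket :: "('a, 'n::finite) vfield \<Rightarrow> ('a, 'n) vfield \<Rightarrow> ('a, 'n) vfield" where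
  "lie_bracket \<xi> \<eta> c p = chart_deriv c p (\<xi> c p) (\<eta> c) - chart_deriv c p (\<eta> c p) (\<xi> c)"


section \<open>Metrics\<close>

definition sym_form :: "real^'n^'n::finite \<Rightarrow> bool" where
  "sym_form B \<longleftrightarrow> (\<forall>v w. v \<bullet> (B *v w) = w \<bullet> (B *v v))"

definition nondegenerate_form :: "real^'n^'n::finite \<Rightarrow> bool" where
  "nondegenerate_form B \<longleftrightarrow> (\<forall>v. (\<forall>w. v \<bullet> (B *v w) = 0) \<longrightarrow> v = 0)"

text \<open>The index of a symmetric bilinear form: the largest dimension of a subspace on which it is
  negative definite.\<close>

definition form_index :: "real^'n^'n::finite \<Rightarrow> nat" where
  "form_index B = Max {dim W | W. subspace W \<and> (\<forall>w\<in>W. w \<noteq> 0 \<longrightarrow> w \<bullet> (B *v w) < 0)}"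

definition pseudo_riemannian_on ::
    "('a, 'n::finite) manifold \<Rightarrow> 'a set \<Rightarrow> nat \<Rightarrow> ('a, 'n) tfield \<Rightarrow> bool" where
  "pseudo_riemannian_on M V j g \<longleftrightarrow> g \<in> smooth_tfields (open_submanifold M V) \<and>
     (\<forall>c\<in>charts M. \<forall>p\<in>fst c \<inter> V.
        sym_form (g c p) \<and> nondegenerate_form (g c p) \<and> form_index (g c p) = j)"

definition riemannian :: "('a, 'n::finite) manifold \<Rightarrow> ('a, 'n) tfield \<Rightarrow> bool" where
  "riemannian M h \<longleftrightarrow> h \<in> smooth_tfields M \<and>
     (\<forall>c\<in>charts M. \<forall>p\<in>fst c. sym_form (h c p) \<and> (\<forall>v. v \<noteq> 0 \<longrightarrow> 0 < v \<bullet> (h c p *v v)))"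


section \<open>The Colombeau construction\<close>

text \<open>The construction is carried out once for all kinds of fields.  A kind of field consists of a
  manifold, the set of smooth sections, the map taking a section to its components in a chart, and
  the set of admissible norms on the fibres, expressed as functions of the components in a chart.\<close>

record ('a, 'n::finite, 's, 'c) field_kind =
  base :: "('a, 'n) manifold"
  sections :: "'s set"
  comps :: "'s \<Rightarrow> ('a, 'n) chart \<Rightarrow> 'a \<Rightarrow> 'c"
  fibre_norms :: "(('a, 'n) chart \<Rightarrow> 'a \<Rightarrow> 'c \<Rightarrow> real) set"

text \<open>Linear differential operators: in every chart a sum of iterated partial derivatives (encoded
  by lists of directions) with smooth coefficients, which act linearly on the components.  Linearity
  is a consequence of the local formula.\<close>

definition diff_op ::
    "('a, 'n::finite, 's, 'c::real_normed_vector) field_kind \<Rightarrow> ('s \<Rightarrow> 's) \<Rightarrow> bool" where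
  "diff_op F P \<longleftrightarrow> (\<forall>s\<in>sections F. P s \<in> sections F) \<and>
     (\<exists>m::nat. \<forall>c\<in>charts (base F). \<exists>a :: 'n list \<Rightarrow> real^'n \<Rightarrow> ('c \<Rightarrow>\<^sub>L 'c).
        (\<forall>is. smooth_on (snd c ` fst c) (a is)) \<and>
        (\<forall>s\<in>sections F. \<forall>p\<in>fst c.
           comps F (P s) c p =
             (\<Sum>is | length is \<le> m.
                blinfun_apply (a is (snd c p)) (pderivs is (comps F s c \<circ> chart_inv c) (snd c p)))))"

text \<open>\<open>sup_bound F K s \<nu> b\<close> means that the supremum over \<open>K\<close> of the norm of \<open>s\<close> is at most \<open>b\<close>
  (also correct for empty \<open>K\<close>); the norm at \<open>p\<close> may be computed in any chart around \<open>p\<close>.\<close>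

definition sup_bound ::
    "('a, 'n::finite, 's, 'c) field_kind \<Rightarrow> 'a set \<Rightarrow> 's \<Rightarrow> (('a, 'n) chart \<Rightarrow> 'a \<Rightarrow> 'c \<Rightarrow> real) \<Rightarrow>
     real \<Rightarrow> bool" where
  "sup_bound F K s \<nu> b \<longleftrightarrow>
     (\<forall>p\<in>K. \<forall>c\<in>charts (base F). p \<in> fst c \<longrightarrow> \<nu> c p (comps F s c p) \<le> b)"

text \<open>Nets are indexed by \<open>(0,1]\<close>; their values at other real numbers are irrelevant.\<close>

definition moderate ::
    "('a, 'n::finite, 's, 'c::real_normed_vector) field_kind \<Rightarrow> (real \<Rightarrow> 's) \<Rightarrow> bool" where
  "moderate F u \<longleftrightarrow> (\<forall>\<epsilon>\<in>{0<..1}. u \<epsilon> \<in> sections F) \<and>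
     (\<forall>K P. \<forall>\<nu>\<in>fibre_norms F. compactin (mtop (base F)) K \<and> diff_op F P \<longrightarrow>
        (\<exists>N::nat. \<exists>C. \<forall>\<^sub>F \<epsilon> in at_right 0. sup_bound F K (P (u \<epsilon>)) \<nu> (C / \<epsilon> ^ N)))"

definition negligible_net ::
    "('a, 'n::finite, 's, 'c::real_normed_vector) field_kind \<Rightarrow> (real \<Rightarrow> 's) \<Rightarrow> bool" where
  "negligible_net F u \<longleftrightarrow> moderate F u \<and>
     (\<forall>K. \<forall>\<nu>\<in>fibre_norms F. compactin (mtop (base F)) K \<longrightarrow>
        (\<forall>m::nat. \<exists>C. \<forall>\<^sub>F \<epsilon> in at_right 0. sup_bound F K (u \<epsilon>) \<nu> (C * \<epsilon> ^ m)))"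

definition net_rel ::
    "('a, 'n::finite, 's::minus, 'c::real_normed_vector) field_kind \<Rightarrow> (real \<Rightarrow> 's) rel" where
  "net_rel F = {(u, v). moderate F u \<and> moderate F v \<and> negligible_net F (\<lambda>\<epsilon>. u \<epsilon> - v \<epsilon>)}"

definition gen_fields ::
    "('a, 'n::finite, 's::minus, 'c::real_normed_vector) field_kind \<Rightarrow> (real \<Rightarrow> 's) set set" where
  "gen_fields F = Collect (moderate F) // net_rel F"

definition gclass ::
    "('a, 'n::finite, 's::minus, 'c::real_normed_vector) field_kind \<Rightarrow> (real \<Rightarrow> 's) \<Rightarrow>
     (real \<Rightarrow> 's) set" where
  "gclass F u = net_rel F `` {u}"

text \<open>Operations are \<open>\<epsilon>\<close>-wise on representatives.  The union over all representatives
  is the usual encoding of a function on equivalence classes: for an operation that respects the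
  equivalence all the united classes coincide.\<close>

definition lift1 ::
    "('a, 'n::finite, 's::minus, 'c::real_normed_vector) field_kind \<Rightarrow> ('s1 \<Rightarrow> 's) \<Rightarrow>
     (real \<Rightarrow> 's1) set \<Rightarrow> (real \<Rightarrow> 's) set" where
  "lift1 F f U = (\<Union>u\<in>U. gclass F (\<lambda>\<epsilon>. f (u \<epsilon>)))"

definition lift2 ::
    "('a, 'n::finite, 's::minus, 'c::real_normed_vector) field_kind \<Rightarrow> ('s1 \<Rightarrow> 's2 \<Rightarrow> 's) \<Rightarrow>
     (real \<Rightarrow> 's1) set \<Rightarrow> (real \<Rightarrow> 's2) set \<Rightarrow> (real \<Rightarrow> 's) set" where
  "lift2 F f U V = (\<Union>u\<in>U. \<Union>v\<in>V. gclass F (\<lambda>\<epsilon>. f (u \<epsilon>) (v \<epsilon>)))"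

definition gplus ::
    "(real \<Rightarrow> 's) set \<Rightarrow> ('a, 'n::finite, 's::{plus,minus}, 'c::real_normed_vector) field_kind \<Rightarrow>
     (real \<Rightarrow> 's) set \<Rightarrow> (real \<Rightarrow> 's) set" ("(_ \<boxplus>\<^bsub>_\<^esub> _)" [65, 0, 66] 65) where
  "U \<boxplus>\<^bsub>F\<^esub> V = lift2 F (+) U V"

definition gminus ::
    "(real \<Rightarrow> 's) set \<Rightarrow> ('a, 'n::finite, 's::minus, 'c::real_normed_vector) field_kind \<Rightarrow>
     (real \<Rightarrow> 's) set \<Rightarrow> (real \<Rightarrow> 's) set" ("(_ \<boxminus>\<^bsub>_\<^esub> _)" [65, 0, 66] 65) where
  "U \<boxminus>\<^bsub>F\<^esub> V = lift2 F (-) U V"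


section \<open>Generalized functions, vector fields and (0,2)-tensor fields\<close>

definition Fun :: "('a, 'n::finite) manifold \<Rightarrow> ('a, 'n, 'a \<Rightarrow> real, real) field_kind" where
  "Fun M = \<lparr>base = M, sections = smooth_functions M, comps = (\<lambda>u c. u),
            fibre_norms = {\<lambda>c p x. \<bar>x\<bar>}\<rparr>"

text \<open>The norms on the fibres of the tensor bundles are those induced by the Riemannian metrics
  on the manifold.  Riemannian metrics exist by paracompactness, and any two of them give
  equivalent norms over a compact set, so it is immaterial that the growth
  conditions are imposed for all of them.\<close>

definition Vec :: "('a, 'n::finite) manifold \<Rightarrow> ('a, 'n, ('a, 'n) vfield, real^'n) field_kind" where
  "Vec M = \<lparr>base = M, sections = smooth_vfields M, comps = (\<lambda>\<xi>. \<xi>),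
            fibre_norms = {\<lambda>c p v. sqrt (v \<bullet> (h c p *v v)) | h. riemannian M h}\<rparr>"

definition Ten :: "('a, 'n::finite) manifold \<Rightarrow> ('a, 'n, ('a, 'n) tfield, real^'n^'n) field_kind"
  where
  "Ten M = \<lparr>base = M, sections = smooth_tfields M, comps = (\<lambda>g. g),
            fibre_norms =
              {\<lambda>c p t. let H = matrix_inv (h c p) in
                 sqrt (\<Sum>i\<in>UNIV. \<Sum>j\<in>UNIV. \<Sum>k\<in>UNIV. \<Sum>l\<in>UNIV.
                         H $ i $ k * H $ j $ l * t $ i $ j * t $ k $ l)
               | h. riemannian M h}\<rparr>"

definition gfun_mult ::
    "('a, 'n::finite) manifold \<Rightarrow> (real \<Rightarrow> 'a \<Rightarrow> real) set \<Rightarrow> (real \<Rightarrow> 'a \<Rightarrow> real) set \<Rightarrow>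
     (real \<Rightarrow> 'a \<Rightarrow> real) set" where
  "gfun_mult M = lift2 (Fun M) (*)"

definition gfun_one :: "('a, 'n::finite) manifold \<Rightarrow> (real \<Rightarrow> 'a \<Rightarrow> real) set" where
  "gfun_one M = gclass (Fun M) (\<lambda>\<epsilon> p. 1)"

definition gfun_two_times ::
    "('a, 'n::finite) manifold \<Rightarrow> (real \<Rightarrow> 'a \<Rightarrow> real) set \<Rightarrow> (real \<Rightarrow> 'a \<Rightarrow> real) set" where
  "gfun_two_times M = lift1 (Fun M) (\<lambda>u p. 2 * u p)"

definition gvec_smult ::
    "('a, 'n::finite) manifold \<Rightarrow> (real \<Rightarrow> 'a \<Rightarrow> real) set \<Rightarrow> (real \<Rightarrow> ('a, 'n) vfield) set \<Rightarrow>
     (real \<Rightarrow> ('a, 'n) vfield) set" where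
  "gvec_smult M = lift2 (Vec M) (\<lambda>u \<xi> c p. u p *\<^sub>R \<xi> c p)"

definition gvec_apply ::
    "('a, 'n::finite) manifold \<Rightarrow> (real \<Rightarrow> ('a, 'n) vfield) set \<Rightarrow> (real \<Rightarrow> 'a \<Rightarrow> real) set \<Rightarrow>
     (real \<Rightarrow> 'a \<Rightarrow> real) set" where
  "gvec_apply M = lift2 (Fun M) (vfield_apply M)"

definition gbracket ::
    "('a, 'n::finite) manifold \<Rightarrow> (real \<Rightarrow> ('a, 'n) vfield) set \<Rightarrow> (real \<Rightarrow> ('a, 'n) vfield) set \<Rightarrow>
     (real \<Rightarrow> ('a, 'n) vfield) set" where
  "gbracket M = lift2 (Vec M) lie_bracket"

definition gten_apply ::
    "('a, 'n::finite) manifold \<Rightarrow> (real \<Rightarrow> ('a, 'n) tfield) set \<Rightarrow> (real \<Rightarrow> ('a, 'n) vfield) set \<Rightarrow>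
     (real \<Rightarrow> ('a, 'n) vfield) set \<Rightarrow> (real \<Rightarrow> 'a \<Rightarrow> real) set" where
  "gten_apply M G X Y =
     (\<Union>g\<in>G. \<Union>\<xi>\<in>X. \<Union>\<eta>\<in>Y. gclass (Fun M) (\<lambda>\<epsilon>. tfield_apply M (g \<epsilon>) (\<xi> \<epsilon>) (\<eta> \<epsilon>)))"


section \<open>Generalized real numbers\<close>

definition moderate_real :: "(real \<Rightarrow> real) \<Rightarrow> bool" where
  "moderate_real r \<longleftrightarrow> (\<exists>N::nat. \<exists>C. \<forall>\<^sub>F \<epsilon> in at_right 0. \<bar>r \<epsilon>\<bar> \<le> C / \<epsilon> ^ N)"

definition negligible_real :: "(real \<Rightarrow> real) \<Rightarrow> bool" where
  "negligible_real r \<longleftrightarrow> (\<forall>m::nat. \<exists>C. \<forall>\<^sub>F \<epsilon> in at_right 0. \<bar>r \<epsilon>\<bar> \<le> C * \<epsilon> ^ m)"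

definition gen_reals :: "(real \<Rightarrow> real) set set" where
  "gen_reals = Collect moderate_real //
     {(r, s). moderate_real r \<and> moderate_real s \<and> negligible_real (\<lambda>\<epsilon>. r \<epsilon> - s \<epsilon>)}"

definition gvec_rmult ::
    "('a, 'n::finite) manifold \<Rightarrow> (real \<Rightarrow> real) set \<Rightarrow> (real \<Rightarrow> ('a, 'n) vfield) set \<Rightarrow>
     (real \<Rightarrow> ('a, 'n) vfield) set" where
  "gvec_rmult M = lift2 (Vec M) (\<lambda>r \<xi> c p. r *\<^sub>R \<xi> c p)"


section \<open>Generalized metrics and connections\<close>

definition gten_det ::
    "('a, 'n::finite) manifold \<Rightarrow> ('a, 'n) chart \<Rightarrow> (real \<Rightarrow> ('a, 'n) tfield) set \<Rightarrow>
     (real \<Rightarrow> 'a \<Rightarrow> real) set" where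
  "gten_det M c = lift1 (Fun (open_submanifold M (fst c))) (\<lambda>g p. det (g c p))"

definition gfun_invertible ::
    "('a, 'n::finite) manifold \<Rightarrow> (real \<Rightarrow> 'a \<Rightarrow> real) set \<Rightarrow> bool" where
  "gfun_invertible M u \<longleftrightarrow> (\<exists>v\<in>gen_fields (Fun M). gfun_mult M u v = gfun_one M)"

text \<open>In the last clause the quantifier over \<open>j\<close> precedes the one over \<open>V\<close>, so the clause
  expresses both the local existence of pseudo-Riemannian representatives and that
  they can be chosen with one common index \<open>j \<noteq> 0\<close>.\<close>

definition gen_pseudo_riemannian_metric ::
    "('a, 'n::finite) manifold \<Rightarrow> (real \<Rightarrow> ('a, 'n) tfield) set \<Rightarrow> bool" where
  "gen_pseudo_riemannian_metric M G \<longleftrightarrow>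
     G \<in> gen_fields (Ten M) \<and>
     (\<forall>c\<in>charts M. gfun_invertible (open_submanifold M (fst c)) (gten_det M c G)) \<and>
     (\<exists>j. j \<noteq> 0 \<and>
        (\<forall>V. openin (mtop M) V \<and> compactin (mtop M) (mtop M closure_of V) \<longrightarrow>
           (\<exists>g\<in>G. \<exists>\<epsilon>0>0. \<forall>\<epsilon>\<in>{0<..1}. \<epsilon> < \<epsilon>0 \<longrightarrow> pseudo_riemannian_on M V j (g \<epsilon>))))"

type_synonym ('a, 'n) gconn =
  "(real \<Rightarrow> ('a, 'n) vfield) set \<times> (real \<Rightarrow> ('a, 'n) vfield) set \<Rightarrow> (real \<Rightarrow> ('a, 'n) vfield) set"

text \<open>Extensional functions, so that equality of elements is equality of maps on the stated
  domain.\<close>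

definition gvec_maps :: "('a, 'n::finite) manifold \<Rightarrow> ('a, 'n) gconn set" where
  "gvec_maps M = (gen_fields (Vec M) \<times> gen_fields (Vec M)) \<rightarrow>\<^sub>E gen_fields (Vec M)"

definition gen_connection :: "('a, 'n::finite) manifold \<Rightarrow> ('a, 'n) gconn \<Rightarrow> bool" where
  "gen_connection M D \<longleftrightarrow> D \<in> gvec_maps M \<and>
     (\<forall>\<xi>\<in>gen_fields (Vec M). \<forall>\<eta>\<in>gen_fields (Vec M). \<forall>\<eta>'\<in>gen_fields (Vec M).
        D (\<xi>, \<eta> \<boxplus>\<^bsub>Vec M\<^esub> \<eta>') = D (\<xi>, \<eta>) \<boxplus>\<^bsub>Vec M\<^esub> D (\<xi>, \<eta>')) \<and>
     (\<forall>r\<in>gen_reals. \<forall>\<xi>\<in>gen_fields (Vec M). \<forall>\<eta>\<in>gen_fields (Vec M).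
        D (\<xi>, gvec_rmult M r \<eta>) = gvec_rmult M r (D (\<xi>, \<eta>))) \<and>
     (\<forall>\<xi>\<in>gen_fields (Vec M). \<forall>\<xi>'\<in>gen_fields (Vec M). \<forall>\<eta>\<in>gen_fields (Vec M).
        D (\<xi> \<boxplus>\<^bsub>Vec M\<^esub> \<xi>', \<eta>) = D (\<xi>, \<eta>) \<boxplus>\<^bsub>Vec M\<^esub> D (\<xi>', \<eta>)) \<and>
     (\<forall>u\<in>gen_fields (Fun M). \<forall>\<xi>\<in>gen_fields (Vec M). \<forall>\<eta>\<in>gen_fields (Vec M).
        D (gvec_smult M u \<xi>, \<eta>) = gvec_smult M u (D (\<xi>, \<eta>))) \<and>
     (\<forall>u\<in>gen_fields (Fun M). \<forall>\<xi>\<in>gen_fields (Vec M). \<forall>\<eta>\<in>gen_fields (Vec M).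
        D (\<xi>, gvec_smult M u \<eta>) =
          gvec_smult M u (D (\<xi>, \<eta>)) \<boxplus>\<^bsub>Vec M\<^esub> gvec_smult M (gvec_apply M \<xi> u) \<eta>)"

definition torsion_free :: "('a, 'n::finite) manifold \<Rightarrow> ('a, 'n) gconn \<Rightarrow> bool" where
  "torsion_free M D \<longleftrightarrow>
     (\<forall>\<xi>\<in>gen_fields (Vec M). \<forall>\<eta>\<in>gen_fields (Vec M).
        gbracket M \<xi> \<eta> = D (\<xi>, \<eta>) \<boxminus>\<^bsub>Vec M\<^esub> D (\<eta>, \<xi>))"

definition metric_connection ::
    "('a, 'n::finite) manifold \<Rightarrow> (real \<Rightarrow> ('a, 'n) tfield) set \<Rightarrow> ('a, 'n) gconn \<Rightarrow> bool" where
  "metric_connection M G D \<longleftrightarrow>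
     (\<forall>\<xi>\<in>gen_fields (Vec M). \<forall>\<eta>\<in>gen_fields (Vec M). \<forall>\<zeta>\<in>gen_fields (Vec M).
        gvec_apply M \<xi> (gten_apply M G \<eta> \<zeta>) =
          gten_apply M G (D (\<xi>, \<eta>)) \<zeta> \<boxplus>\<^bsub>Fun M\<^esub> gten_apply M G \<eta> (D (\<xi>, \<zeta>)))"

definition koszul_formula ::
    "('a, 'n::finite) manifold \<Rightarrow> (real \<Rightarrow> ('a, 'n) tfield) set \<Rightarrow> ('a, 'n) gconn \<Rightarrow> bool" where
  "koszul_formula M G D \<longleftrightarrow>
     (\<forall>\<xi>\<in>gen_fields (Vec M). \<forall>\<eta>\<in>gen_fields (Vec M). \<forall>\<zeta>\<in>gen_fields (Vec M).
        gfun_two_times M (gten_apply M G (D (\<xi>, \<eta>)) \<zeta>) =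
          gvec_apply M \<xi> (gten_apply M G \<eta> \<zeta>)
          \<boxplus>\<^bsub>Fun M\<^esub> gvec_apply M \<eta> (gten_apply M G \<zeta> \<xi>)
          \<boxminus>\<^bsub>Fun M\<^esub> gvec_apply M \<zeta> (gten_apply M G \<xi> \<eta>)
          \<boxminus>\<^bsub>Fun M\<^esub> gten_apply M G \<xi> (gbracket M \<eta> \<zeta>)
          \<boxplus>\<^bsub>Fun M\<^esub> gten_apply M G \<eta> (gbracket M \<zeta> \<xi>)
          \<boxplus>\<^bsub>Fun M\<^esub> gten_apply M G \<zeta> (gbracket M \<xi> \<eta>))"

end

theory Submission
  imports Defs
begin

text \<open>
  As in the smooth case, the identities for torsion and metric, written for three cyclically permuted
  fields, combine to the Koszul formula; a nondegenerate metric allows the covariant derivative to be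
  recovered from this formula, and the field so obtained is checked to have all the properties of a
  connection.  The work lies in making sense of each step up to negligible nets.

  Reduction to charts.  Growth of nets is defined by global differential operators and by fibre norms
  that come from Riemannian metrics.  Both can be replaced by partial derivatives and norms in
  charts (\<open>moderate_imp_moderate_on\<close>, \<open>moderateI\<close>, \<open>negligible_imp_negligible_on\<close>, \<open>negligibleI\<close>): partial
  derivatives cut off by a bump function are global differential operators, compact sets are
  covered by finitely many charts, and continuous families of norms over a compact set are uniformly
  equivalent.  This needs at least one Riemannian metric, since without any fibre norm the growth
  conditions would be empty; paracompactness provides it (\<open>riemannian_metric_exists\<close>).

  Well-definedness.  Negligibility bounds only the values of a net, but a moderate net with negligible
  values has negligible derivatives (\<open>negligible_on_pd\<close>).  Hence equality up to negligible nets is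
  compatible with all operations, and calculations with classes become calculations with
  representatives in a chart.

  The metric.  The definition provides symmetric representatives only on relatively compact sets and
  only for small parameters, but symmetrizing an arbitrary representative changes it by a negligible net
  (\<open>symmetric_representative\<close>).  Invertibility of the determinant in the Colombeau algebra means that
  it does not decay faster than every power of the parameter; by Cramer's rule, such a matrix can be
  cancelled in equalities up to negligible nets (\<open>net_eq_cancel_matrix\<close>).

  The formula.  In a chart, the right hand side of the Koszul formula is the inner product of \<open>\<zeta>\<close>
  with a covector \<open>koszul_form\<close> that is free of \<open>\<zeta>\<close> (\<open>koszul_identity\<close>).  Testing with fields that are
  constant up to a bump function shows that the formula holds for all \<open>\<zeta>\<close> iff twice the lowered
  covariant derivative equals \<open>koszul_form\<close> up to negligible nets in every chart
  (\<open>koszul_iff_lowers_to\<close>).  Uniqueness is now cancellation of the metric, and the properties of a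
  connection follow from pointwise identities for \<open>koszul_form\<close>.

  Existence.  For a single value of the parameter the representative of the metric may be degenerate at
  some points, so that the inverse matrix need not exist globally.  The index is raised with the
  regularized inverse of the determinant
  \<open>det g / ((det g)\<^sup>2 + exp (-1/\<epsilon>) (det h)\<^sup>2)\<close>, where \<open>h\<close> is a Riemannian metric; it is defined
  everywhere and produces only a negligible error (\<open>raise_index\<close>).
\<close>

section \<open>Partial derivatives\<close>

definition pd :: "'n::finite \<Rightarrow> (real^'n \<Rightarrow> 'b::real_normed_vector) \<Rightarrow> real^'n \<Rightarrow> 'b" where
  "pd i f x = frechet_derivative f (at x) (axis i 1)"

lemma pderivs_Cons_pd: "pderivs (i # is) f = pd i (pderivs is f)"
  by (simp add: pd_def fun_eq_iff)

lemma pderivs_snoc: "pderivs (is @ [i]) f = pderivs is (pd i f)"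
proof (induction "is")
  case (Cons j js)
  then show ?case unfolding append_Cons pderivs_Cons_pd by simp
qed (simp add: pd_def fun_eq_iff)

lemma pd_eq: "(f has_derivative D) (at x) \<Longrightarrow> pd i f x = D (axis i 1)"
  unfolding pd_def by (metis frechet_derivative_at)

lemma frechet_derivative_cong_open:
  assumes "open S" "x \<in> S" "\<And>y. y \<in> S \<Longrightarrow> f y = g y"
  shows "frechet_derivative f (at x) = frechet_derivative g (at x)"
proof -
  have "(f has_derivative D) (at x) \<longleftrightarrow> (g has_derivative D) (at x)" for D
    using has_derivative_transform_within_open[of f D x UNIV S g]
      has_derivative_transform_within_open[of g D x UNIV S f] assms by auto
  then show ?thesis by (simp add: frechet_derivative_def)
qed

lemma pd_cong_open:
  assumes "open S" "x \<in> S" "\<And>y. y \<in> S \<Longrightarrow> f y = g y"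
  shows "pd i f x = pd i g x"
  unfolding pd_def using frechet_derivative_cong_open[OF assms] by simp

lemma differentiable_cong_open:
  assumes "open S" "x \<in> S" "\<And>y. y \<in> S \<Longrightarrow> f y = g y" "f differentiable at x"
  shows "g differentiable at x"
  using assms has_derivative_transform_within_open[of f _ x UNIV S g]
  unfolding differentiable_def by blast

lemma pderivs_cong_open:
  assumes "open S" "\<And>y. y \<in> S \<Longrightarrow> f y = g y" "x \<in> S"
  shows "pderivs is f x = pderivs is g x"
  using assms(3)
proof (induction "is" arbitrary: x)
  case (Cons i js)
  then show ?case
    unfolding pderivs_Cons_pd by (intro pd_cong_open[OF assms(1)]) auto
qed (use assms in auto)

lemma frechet_derivative_eq_sum_pd:
  assumes "f differentiable at x"
  shows "frechet_derivative f (at x) v = (\<Sum>i\<in>UNIV. v $ i *\<^sub>R pd i f x)"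
proof -
  interpret linear "frechet_derivative f (at x)"
    using assms by (rule linear_frechet_derivative)
  have "frechet_derivative f (at x) v
      = frechet_derivative f (at x) (\<Sum>i\<in>UNIV. v $ i *\<^sub>R axis i 1)"
    using basis_expansion[of v] by (simp add: scalar_mult_eq_scaleR)
  then show ?thesis by (simp add: sum scaleR pd_def)
qed

section \<open>Growth of nets on compact sets\<close>

text \<open>For the small parameters that matter, a constant factor can be absorbed by one more power of
  the parameter; hence the estimates are stated without constants.\<close>

definition tempered_on :: "'x::topological_space set \<Rightarrow> (real \<Rightarrow> 'x \<Rightarrow> 'b::real_normed_vector) \<Rightarrow> bool"
  where
  "tempered_on S f \<longleftrightarrow> (\<forall>K. compact K \<and> K \<subseteq> S \<longrightarrow>
     (\<exists>N. \<forall>\<^sub>F \<epsilon> in at_right 0. \<forall>x\<in>K. norm (f \<epsilon> x) \<le> (1 / \<epsilon>) ^ N))"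

definition negligible_on :: "'x::topological_space set \<Rightarrow> (real \<Rightarrow> 'x \<Rightarrow> 'b::real_normed_vector) \<Rightarrow> bool"
  where
  "negligible_on S f \<longleftrightarrow> (\<forall>K. compact K \<and> K \<subseteq> S \<longrightarrow>
     (\<forall>m. \<forall>\<^sub>F \<epsilon> in at_right 0. \<forall>x\<in>K. norm (f \<epsilon> x) \<le> \<epsilon> ^ m))"

lemma eventually_small:
  assumes "0 < (r::real)" shows "\<forall>\<^sub>F \<epsilon> in at_right 0. 0 < \<epsilon> \<and> \<epsilon> < r"
  using eventually_at_right_real[OF assms] by eventually_elim auto

lemma eventually_absorb_pos:
  "\<forall>\<^sub>F \<epsilon> in at_right (0::real). 0 < \<epsilon> \<and> \<epsilon> < 1 \<and> C * (1 / \<epsilon>) ^ N \<le> (1 / \<epsilon>) ^ Suc N"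
proof -
  have "0 < 1 / (\<bar>C\<bar> + 1)" by (simp add: add_nonneg_pos)
  from eventually_small[OF this] show ?thesis
  proof eventually_elim
    case (elim \<epsilon>)
    then have "\<epsilon> * (\<bar>C\<bar> + 1) < 1" by (simp add: field_simps)
    moreover have "C * \<epsilon> \<le> \<bar>C\<bar> * \<epsilon>" using elim by (intro mult_right_mono) auto
    moreover have "\<epsilon> < 1" using elim by (smt (verit) divide_le_eq_1)
    moreover have "\<bar>C\<bar> * \<epsilon> = \<epsilon> * \<bar>C\<bar>" by simp
    ultimately have "C * \<epsilon> \<le> 1" "\<epsilon> < 1" using elim(1) unfolding ring_distribs by linarith+
    then have "C \<le> 1 / \<epsilon>" "\<epsilon> < 1" using elim by (auto simp: pos_le_divide_eq)
    then have "C * (1 / \<epsilon>) ^ N \<le> 1 / \<epsilon> * (1 / \<epsilon>) ^ N"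
      using elim by (intro mult_right_mono) auto
    with \<open>\<epsilon> < 1\<close> elim show ?case by simp
  qed
qed

lemma eventually_absorb_neg:
  "\<forall>\<^sub>F \<epsilon> in at_right (0::real). 0 < \<epsilon> \<and> \<epsilon> < 1 \<and> C * \<epsilon> ^ Suc m \<le> \<epsilon> ^ m"
  using eventually_absorb_pos[of C 0]
proof eventually_elim
  case (elim \<epsilon>)
  then have "C * \<epsilon> \<le> 1 / \<epsilon> * \<epsilon>" by (intro mult_right_mono) auto
  with elim have "C * \<epsilon> \<le> 1" by simp
  then show ?case using elim mult_right_mono[of "C * \<epsilon>" 1 "\<epsilon> ^ m"] by (auto simp: mult_ac)
qed

lemma inverse_power_mono: "N \<le> M \<Longrightarrow> 0 < \<epsilon> \<Longrightarrow> \<epsilon> < 1 \<Longrightarrow> (1 / \<epsilon> :: real) ^ N \<le> (1 / \<epsilon>) ^ M"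
  by (intro power_increasing) auto

lemma tempered_onI:
  assumes "\<And>K. compact K \<Longrightarrow> K \<subseteq> S \<Longrightarrow>
     \<exists>N C. \<forall>\<^sub>F \<epsilon> in at_right 0. \<forall>x\<in>K. norm (f \<epsilon> x) \<le> C * (1 / \<epsilon>) ^ N"
  shows "tempered_on S f"
  unfolding tempered_on_def
proof (intro allI impI)
  fix K assume "compact K \<and> K \<subseteq> S"
  then obtain N C where "\<forall>\<^sub>F \<epsilon> in at_right 0. \<forall>x\<in>K. norm (f \<epsilon> x) \<le> C * (1 / \<epsilon>) ^ N"
    using assms by blast
  then have "\<forall>\<^sub>F \<epsilon> in at_right 0. \<forall>x\<in>K. norm (f \<epsilon> x) \<le> (1 / \<epsilon>) ^ Suc N"
    using eventually_absorb_pos[of C N] by eventually_elim (blast intro: order_trans)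
  then show "\<exists>N. \<forall>\<^sub>F \<epsilon> in at_right 0. \<forall>x\<in>K. norm (f \<epsilon> x) \<le> (1 / \<epsilon>) ^ N" by blast
qed

lemma tempered_onE:
  assumes "tempered_on S f" "compact K" "K \<subseteq> S"
  obtains N where "\<forall>\<^sub>F \<epsilon> in at_right 0. \<forall>x\<in>K. norm (f \<epsilon> x) \<le> (1 / \<epsilon>) ^ N"
  using assms unfolding tempered_on_def by blast

lemma negligible_onI:
  assumes "\<And>K m. compact K \<Longrightarrow> K \<subseteq> S \<Longrightarrow>
     \<exists>C. \<forall>\<^sub>F \<epsilon> in at_right 0. \<forall>x\<in>K. norm (f \<epsilon> x) \<le> C * \<epsilon> ^ m"
  shows "negligible_on S f"
  unfolding negligible_on_def
proof (intro allI impI)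
  fix K m assume "compact K \<and> K \<subseteq> S"
  then obtain C where "\<forall>\<^sub>F \<epsilon> in at_right 0. \<forall>x\<in>K. norm (f \<epsilon> x) \<le> C * \<epsilon> ^ Suc m"
    using assms by blast
  then show "\<forall>\<^sub>F \<epsilon> in at_right 0. \<forall>x\<in>K. norm (f \<epsilon> x) \<le> \<epsilon> ^ m"
    using eventually_absorb_neg[of C m] by eventually_elim (blast intro: order_trans)
qed

lemma negligible_onD:
  assumes "negligible_on S f" "compact K" "K \<subseteq> S"
  shows "\<forall>\<^sub>F \<epsilon> in at_right 0. \<forall>x\<in>K. norm (f \<epsilon> x) \<le> \<epsilon> ^ m"
  using assms unfolding negligible_on_def by blast

lemma tempered_on_cong:
  assumes "\<And>\<epsilon> x. \<epsilon> \<in> {0<..1} \<Longrightarrow> x \<in> S \<Longrightarrow> f \<epsilon> x = g \<epsilon> x" "tempered_on S f"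
  shows "tempered_on S g"
proof (rule tempered_onI)
  fix K assume K: "compact K" "K \<subseteq> S"
  from tempered_onE[OF assms(2) K] obtain N where
    "\<forall>\<^sub>F \<epsilon> in at_right 0. \<forall>x\<in>K. norm (f \<epsilon> x) \<le> (1 / \<epsilon>) ^ N" .
  then have "\<forall>\<^sub>F \<epsilon> in at_right 0. \<forall>x\<in>K. norm (g \<epsilon> x) \<le> 1 * (1 / \<epsilon>) ^ N"
    using eventually_small[of 1, simplified]
  proof eventually_elim
    case (elim \<epsilon>)
    then have "g \<epsilon> x = f \<epsilon> x" if "x \<in> K" for x using assms(1)[of \<epsilon> x] that K by auto
    with elim show ?case by simp
  qed
  then show "\<exists>N C. \<forall>\<^sub>F \<epsilon> in at_right 0. \<forall>x\<in>K. norm (g \<epsilon> x) \<le> C * (1 / \<epsilon>) ^ N" by blast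
qed

lemma negligible_on_eventually_cong:
  assumes "\<And>K. compact K \<Longrightarrow> K \<subseteq> S \<Longrightarrow> \<forall>\<^sub>F \<epsilon> in at_right 0. \<forall>x\<in>K. f \<epsilon> x = g \<epsilon> x"
    and "negligible_on S f"
  shows "negligible_on S g"
  unfolding negligible_on_def
proof (intro allI impI)
  fix K m assume K: "compact K \<and> K \<subseteq> S"
  show "\<forall>\<^sub>F \<epsilon> in at_right 0. \<forall>x\<in>K. norm (g \<epsilon> x) \<le> \<epsilon> ^ m"
    using assms(1)[of K] negligible_onD[OF assms(2), of K m] K
    by (auto elim: eventually_elim2)
qed

lemma negligible_on_cong:
  assumes "\<And>\<epsilon> x. \<epsilon> \<in> {0<..1} \<Longrightarrow> x \<in> S \<Longrightarrow> f \<epsilon> x = g \<epsilon> x" "negligible_on S f"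
  shows "negligible_on S g"
  using assms(2)
proof (rule negligible_on_eventually_cong[rotated])
  fix K assume K: "compact K" "K \<subseteq> S"
  show "\<forall>\<^sub>F \<epsilon> in at_right 0. \<forall>x\<in>K. f \<epsilon> x = g \<epsilon> x"
    using eventually_small[of 1, simplified] by eventually_elim (use assms(1) K in auto)
qed

lemma tempered_on_add:
  assumes "tempered_on S f" "tempered_on S g"
  shows "tempered_on S (\<lambda>\<epsilon> x. f \<epsilon> x + g \<epsilon> x)"
proof (rule tempered_onI)
  fix K assume K: "compact K" "K \<subseteq> S"
  from tempered_onE[OF assms(1) K] obtain N where
    N: "\<forall>\<^sub>F \<epsilon> in at_right 0. \<forall>x\<in>K. norm (f \<epsilon> x) \<le> (1 / \<epsilon>) ^ N" .
  from tempered_onE[OF assms(2) K] obtain M where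
    M: "\<forall>\<^sub>F \<epsilon> in at_right 0. \<forall>x\<in>K. norm (g \<epsilon> x) \<le> (1 / \<epsilon>) ^ M" .
  have "\<forall>\<^sub>F \<epsilon> in at_right 0. \<forall>x\<in>K. norm (f \<epsilon> x + g \<epsilon> x) \<le> 2 * (1 / \<epsilon>) ^ (N + M)"
    using N M eventually_small[of 1, simplified]
  proof eventually_elim
    case (elim \<epsilon>)
    have "(1 / \<epsilon>) ^ N \<le> (1 / \<epsilon>) ^ (N + M)" "(1 / \<epsilon>) ^ M \<le> (1 / \<epsilon>) ^ (N + M)"
      using elim by (auto intro!: inverse_power_mono simp del: power_divide)
    with elim show ?case by (smt (verit) norm_triangle_ineq)
  qed
  then show "\<exists>N C. \<forall>\<^sub>F \<epsilon> in at_right 0. \<forall>x\<in>K. norm (f \<epsilon> x + g \<epsilon> x) \<le> C * (1 / \<epsilon>) ^ N" by blast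
qed

lemma tempered_on_bilinear:
  assumes "bounded_bilinear B" "tempered_on S f" "tempered_on S g"
  shows "tempered_on S (\<lambda>\<epsilon> x. B (f \<epsilon> x) (g \<epsilon> x))"
proof (rule tempered_onI)
  fix K assume K: "compact K" "K \<subseteq> S"
  from tempered_onE[OF assms(2) K] obtain N where
    N: "\<forall>\<^sub>F \<epsilon> in at_right 0. \<forall>x\<in>K. norm (f \<epsilon> x) \<le> (1 / \<epsilon>) ^ N" .
  from tempered_onE[OF assms(3) K] obtain M where
    M: "\<forall>\<^sub>F \<epsilon> in at_right 0. \<forall>x\<in>K. norm (g \<epsilon> x) \<le> (1 / \<epsilon>) ^ M" .
  obtain C where C: "0 < C" "\<And>a b. norm (B a b) \<le> norm a * norm b * C"
    using bounded_bilinear.pos_bounded[OF assms(1)] by blast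
  have "\<forall>\<^sub>F \<epsilon> in at_right 0. \<forall>x\<in>K. norm (B (f \<epsilon> x) (g \<epsilon> x)) \<le> C * (1 / \<epsilon>) ^ (N + M)"
    using N M eventually_small[of 1, simplified]
  proof eventually_elim
    case (elim \<epsilon>)
    show ?case
    proof
      fix x assume "x \<in> K"
      then have "norm (f \<epsilon> x) * norm (g \<epsilon> x) \<le> (1 / \<epsilon>) ^ N * (1 / \<epsilon>) ^ M"
        using elim by (intro mult_mono) auto
      with C(1) have "norm (f \<epsilon> x) * norm (g \<epsilon> x) * C \<le> (1 / \<epsilon>) ^ N * (1 / \<epsilon>) ^ M * C"
        by (intro mult_right_mono) auto
      with C(2)[of "f \<epsilon> x" "g \<epsilon> x"] show "norm (B (f \<epsilon> x) (g \<epsilon> x)) \<le> C * (1 / \<epsilon>) ^ (N + M)"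
        by (simp add: power_add mult_ac)
    qed
  qed
  then show "\<exists>N C. \<forall>\<^sub>F \<epsilon> in at_right 0. \<forall>x\<in>K. norm (B (f \<epsilon> x) (g \<epsilon> x)) \<le> C * (1 / \<epsilon>) ^ N" by blast
qed

lemma tempered_on_linear:
  assumes "bounded_linear L" "tempered_on S f"
  shows "tempered_on S (\<lambda>\<epsilon> x. L (f \<epsilon> x))"
proof (rule tempered_onI)
  fix K assume K: "compact K" "K \<subseteq> S"
  from tempered_onE[OF assms(2) K] obtain N where
    N: "\<forall>\<^sub>F \<epsilon> in at_right 0. \<forall>x\<in>K. norm (f \<epsilon> x) \<le> (1 / \<epsilon>) ^ N" .
  obtain C where C: "0 < C" "\<And>a. norm (L a) \<le> norm a * C"
    using bounded_linear.pos_bounded[OF assms(1)] by blast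
  from N have "\<forall>\<^sub>F \<epsilon> in at_right 0. \<forall>x\<in>K. norm (L (f \<epsilon> x)) \<le> C * (1 / \<epsilon>) ^ N"
  proof eventually_elim
    case (elim \<epsilon>)
    show ?case
    proof
      fix x assume "x \<in> K"
      then have "norm (f \<epsilon> x) * C \<le> (1 / \<epsilon>) ^ N * C" 
        using C(1) elim by (intro mult_right_mono) auto
      with C(2)[of "f \<epsilon> x"] show "norm (L (f \<epsilon> x)) \<le> C * (1 / \<epsilon>) ^ N" by (simp add: mult_ac)
    qed
  qed
  then show "\<exists>N C. \<forall>\<^sub>F \<epsilon> in at_right 0. \<forall>x\<in>K. norm (L (f \<epsilon> x)) \<le> C * (1 / \<epsilon>) ^ N" by blast
qed

lemma negligible_on_add:
  assumes "negligible_on S f" "negligible_on S g"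
  shows "negligible_on S (\<lambda>\<epsilon> x. f \<epsilon> x + g \<epsilon> x)"
proof (rule negligible_onI)
  fix K m assume K: "compact K" "K \<subseteq> S"
  have "\<forall>\<^sub>F \<epsilon> in at_right 0. \<forall>x\<in>K. norm (f \<epsilon> x + g \<epsilon> x) \<le> 2 * \<epsilon> ^ m"
    using negligible_onD[OF assms(1) K, of m] negligible_onD[OF assms(2) K, of m]
    by eventually_elim (smt (verit) norm_triangle_ineq)
  then show "\<exists>C. \<forall>\<^sub>F \<epsilon> in at_right 0. \<forall>x\<in>K. norm (f \<epsilon> x + g \<epsilon> x) \<le> C * \<epsilon> ^ m" by blast
qed

text \<open>Negligible nets form an ideal: the growth of the moderate factor only costs finitely many
  powers of the parameter.\<close>

lemma negligible_on_bilinear_left: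
  assumes "bounded_bilinear B" "negligible_on S f" "tempered_on S g"
  shows "negligible_on S (\<lambda>\<epsilon> x. B (f \<epsilon> x) (g \<epsilon> x))"
proof (rule negligible_onI)
  fix K m assume K: "compact K" "K \<subseteq> S"
  from tempered_onE[OF assms(3) K] obtain M where
    M: "\<forall>\<^sub>F \<epsilon> in at_right 0. \<forall>x\<in>K. norm (g \<epsilon> x) \<le> (1 / \<epsilon>) ^ M" .
  obtain C where C: "0 < C" "\<And>a b. norm (B a b) \<le> norm a * norm b * C"
    using bounded_bilinear.pos_bounded[OF assms(1)] by blast
  have "\<forall>\<^sub>F \<epsilon> in at_right 0. \<forall>x\<in>K. norm (B (f \<epsilon> x) (g \<epsilon> x)) \<le> C * \<epsilon> ^ m"
    using negligible_onD[OF assms(2) K, of "m + M"] M eventually_small[of 1, simplified]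
  proof eventually_elim
    case (elim \<epsilon>)
    show ?case
    proof
      fix x assume "x \<in> K"
      then have "norm (f \<epsilon> x) * norm (g \<epsilon> x) \<le> \<epsilon> ^ (m + M) * (1 / \<epsilon>) ^ M"
        using elim by (intro mult_mono) auto
      also have "\<dots> = \<epsilon> ^ m" using elim by (simp add: power_add power_divide)
      finally have "norm (f \<epsilon> x) * norm (g \<epsilon> x) * C \<le> \<epsilon> ^ m * C"
        using C(1) by (intro mult_right_mono) auto
      with C(2)[of "f \<epsilon> x" "g \<epsilon> x"] show "norm (B (f \<epsilon> x) (g \<epsilon> x)) \<le> C * \<epsilon> ^ m"
        by (simp add: mult_ac)
    qed
  qed
  then show "\<exists>C. \<forall>\<^sub>F \<epsilon> in at_right 0. \<forall>x\<in>K. norm (B (f \<epsilon> x) (g \<epsilon> x)) \<le> C * \<epsilon> ^ m" by blast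
qed

lemma negligible_on_bilinear_right:
  assumes "bounded_bilinear B" "tempered_on S f" "negligible_on S g"
  shows "negligible_on S (\<lambda>\<epsilon> x. B (f \<epsilon> x) (g \<epsilon> x))"
  using negligible_on_bilinear_left[OF bounded_bilinear.flip[OF assms(1)] assms(3,2)] by simp

lemma negligible_on_linear:
  assumes "bounded_linear L" "negligible_on S f"
  shows "negligible_on S (\<lambda>\<epsilon> x. L (f \<epsilon> x))"
proof (rule negligible_onI)
  fix K m assume K: "compact K" "K \<subseteq> S"
  obtain C where C: "0 < C" "\<And>a. norm (L a) \<le> norm a * C"
    using bounded_linear.pos_bounded[OF assms(1)] by blast
  from negligible_onD[OF assms(2) K, of m] 
  have "\<forall>\<^sub>F \<epsilon> in at_right 0. \<forall>x\<in>K. norm (L (f \<epsilon> x)) \<le> C * \<epsilon> ^ m"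
  proof eventually_elim
    case (elim \<epsilon>)
    show ?case
    proof
      fix x assume "x \<in> K"
      then have "norm (f \<epsilon> x) * C \<le> \<epsilon> ^ m * C" 
        using C(1) elim by (intro mult_right_mono) auto
      with C(2)[of "f \<epsilon> x"] show "norm (L (f \<epsilon> x)) \<le> C * \<epsilon> ^ m" by (simp add: mult_ac)
    qed
  qed
  then show "\<exists>C. \<forall>\<^sub>F \<epsilon> in at_right 0. \<forall>x\<in>K. norm (L (f \<epsilon> x)) \<le> C * \<epsilon> ^ m" by blast
qed

lemma negligible_on_zero: "negligible_on S (\<lambda>\<epsilon> x. 0)"
  unfolding negligible_on_def
proof (intro allI impI)
  fix K :: "'a set" and m
  show "\<forall>\<^sub>F \<epsilon> in at_right 0. \<forall>x\<in>K. norm (0::'b) \<le> \<epsilon> ^ m"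
    using eventually_small[of 1, simplified] by eventually_elim auto
qed

lemma negligible_on_minus: "negligible_on S f \<Longrightarrow> negligible_on S (\<lambda>\<epsilon> x. - f \<epsilon> x)"
  unfolding negligible_on_def by simp

lemma negligible_on_diff:
  "negligible_on S f \<Longrightarrow> negligible_on S g \<Longrightarrow> negligible_on S (\<lambda>\<epsilon> x. f \<epsilon> x - g \<epsilon> x)"
  using negligible_on_add[of S f "\<lambda>\<epsilon> x. - g \<epsilon> x"] negligible_on_minus[of S g] by simp

section \<open>Moderate nets of smooth functions\<close>

text \<open>The bound on the order of the derivatives is there for induction: the derivative of a product or of a
  composition is again built from products and compositions, to which the claim for one order less
  applies.\<close>

primrec moderate_upto ::
    "nat \<Rightarrow> (real^'n::finite) set \<Rightarrow> (real \<Rightarrow> real^'n \<Rightarrow> 'b::real_normed_vector) \<Rightarrow> bool" where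
  "moderate_upto 0 S f \<longleftrightarrow> (\<forall>\<epsilon>\<in>{0<..1}. \<forall>x\<in>S. f \<epsilon> differentiable at x) \<and> tempered_on S f"
| "moderate_upto (Suc k) S f \<longleftrightarrow> (\<forall>\<epsilon>\<in>{0<..1}. \<forall>x\<in>S. f \<epsilon> differentiable at x) \<and> tempered_on S f \<and>
     (\<forall>i. moderate_upto k S (\<lambda>\<epsilon>. pd i (f \<epsilon>)))"

definition moderate_on ::
    "(real^'n::finite) set \<Rightarrow> (real \<Rightarrow> real^'n \<Rightarrow> 'b::real_normed_vector) \<Rightarrow> bool" where
  "moderate_on S f \<longleftrightarrow> (\<forall>k. moderate_upto k S f)"

lemma moderate_upto_imp_0: "moderate_upto k S f \<Longrightarrow> moderate_upto 0 S f"
  by (cases k) auto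

lemma moderate_upto_diff: "moderate_upto k S f \<Longrightarrow> \<epsilon> \<in> {0<..1} \<Longrightarrow> x \<in> S \<Longrightarrow> f \<epsilon> differentiable at x"
  by (drule moderate_upto_imp_0) simp

lemma moderate_upto_tempered: "moderate_upto k S f \<Longrightarrow> tempered_on S f"
  by (drule moderate_upto_imp_0) simp

lemma moderate_upto_mono: "moderate_upto (Suc k) S f \<Longrightarrow> moderate_upto k S f"
proof (induction k arbitrary: f)
  case (Suc k)
  from Suc.prems have "\<forall>i. moderate_upto (Suc k) S (\<lambda>\<epsilon>. pd i (f \<epsilon>))" 
    unfolding moderate_upto.simps(2)[of "Suc k"] by blast
  with Suc.IH have "\<forall>i. moderate_upto k S (\<lambda>\<epsilon>. pd i (f \<epsilon>))" by blast
  with Suc.prems show ?case unfolding moderate_upto.simps(2) by blast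
qed simp

lemma moderate_upto_cong:
  assumes "open S" "\<And>\<epsilon> x. \<epsilon> \<in> {0<..1} \<Longrightarrow> x \<in> S \<Longrightarrow> f \<epsilon> x = g \<epsilon> x" "moderate_upto k S f"
  shows "moderate_upto k S g"
  using assms(2,3)
proof (induction k arbitrary: f g)
  case 0
  then show ?case
    using differentiable_cong_open[OF assms(1), of _ "f _" "g _"] tempered_on_cong[of S f g]
    by fastforce
next
  case (Suc k)
  have "moderate_upto k S (\<lambda>\<epsilon>. pd i (g \<epsilon>))" for i
  proof (rule Suc.IH)
    show "pd i (f \<epsilon>) x = pd i (g \<epsilon>) x" if "\<epsilon> \<in> {0<..1}" "x \<in> S" for \<epsilon> x
      using pd_cong_open[OF assms(1) that(2)] Suc.prems(1) that by blast
    show "moderate_upto k S (\<lambda>\<epsilon>. pd i (f \<epsilon>))" using Suc.prems(2) by simp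
  qed
  moreover have "g \<epsilon> differentiable at x" if "\<epsilon> \<in> {0<..1}" "x \<in> S" for \<epsilon> x
    using differentiable_cong_open[OF assms(1) that(2), of "f \<epsilon>"] Suc.prems that by auto
  moreover have "tempered_on S g" using Suc.prems tempered_on_cong[of S f g] by simp
  ultimately show ?case by simp
qed

lemma moderate_upto_subset:
  "T \<subseteq> S \<Longrightarrow> moderate_upto k S f \<Longrightarrow> moderate_upto k T f"
  by (induction k arbitrary: f) (auto simp: tempered_on_def)

lemma pd_add:
  assumes "f differentiable at x" "g differentiable at x"
  shows "pd i (\<lambda>x. f x + g x) x = pd i f x + pd i g x"
  using pd_eq[OF has_derivative_add[OF assms[unfolded frechet_derivative_works]]]
  by (simp add: pd_def)

lemma pd_diff:
  assumes "f differentiable at x" "g differentiable at x"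
  shows "pd i (\<lambda>x. f x - g x) x = pd i f x - pd i g x"
  using pd_eq[OF has_derivative_diff[OF assms[unfolded frechet_derivative_works]]]
  by (simp add: pd_def)

lemma pd_linear:
  assumes "bounded_linear L" "f differentiable at x"
  shows "pd i (\<lambda>x. L (f x)) x = L (pd i f x)"
  using pd_eq[OF bounded_linear.has_derivative[OF assms(1) assms(2)[unfolded frechet_derivative_works]]]
  by (simp add: pd_def)

lemma pd_bilinear:
  assumes "bounded_bilinear B" "f differentiable at x" "g differentiable at x"
  shows "pd i (\<lambda>x. B (f x) (g x)) x = B (f x) (pd i g x) + B (pd i f x) (g x)"
  using pd_eq[OF bounded_bilinear.FDERIV[OF assms(1) assms(2,3)[unfolded frechet_derivative_works]]]
  by (simp add: pd_def)

lemma differentiable_bilinear: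
  assumes "bounded_bilinear B" "f differentiable at x" "g differentiable at x"
  shows "(\<lambda>x. B (f x) (g x)) differentiable at x"
  using assms(2,3) bounded_bilinear.FDERIV[OF assms(1), of f _ x UNIV g]
  unfolding differentiable_def by blast

lemma differentiable_linear:
  assumes "bounded_linear L" "f differentiable at x"
  shows "(\<lambda>x. L (f x)) differentiable at x"
  using assms bounded_linear.has_derivative unfolding differentiable_def by blast

lemma moderate_upto_add:
  assumes "open S"
  shows "moderate_upto k S f \<Longrightarrow> moderate_upto k S g \<Longrightarrow> moderate_upto k S (\<lambda>\<epsilon> x. f \<epsilon> x + g \<epsilon> x)"
proof (induction k arbitrary: f g)
  case 0
  then show ?case by (auto intro: tempered_on_add)
next
  case (Suc k)
  have "moderate_upto k S (\<lambda>\<epsilon>. pd i (\<lambda>x. f \<epsilon> x + g \<epsilon> x))" for i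
  proof (rule moderate_upto_cong[OF assms])
    show "moderate_upto k S (\<lambda>\<epsilon> x. pd i (f \<epsilon>) x + pd i (g \<epsilon>) x)"
      using Suc by simp
    show "pd i (f \<epsilon>) x + pd i (g \<epsilon>) x = pd i (\<lambda>x. f \<epsilon> x + g \<epsilon> x) x" 
      if "\<epsilon> \<in> {0<..1}" "x \<in> S" for \<epsilon> x
      using Suc.prems that by (simp add: pd_add)
  qed
  with Suc.prems show ?case by (auto intro: tempered_on_add)
qed

lemma moderate_upto_bilinear:
  assumes "open S" "bounded_bilinear B"
  shows "moderate_upto k S f \<Longrightarrow> moderate_upto k S g \<Longrightarrow> moderate_upto k S (\<lambda>\<epsilon> x. B (f \<epsilon> x) (g \<epsilon> x))"
proof (induction k arbitrary: f g)
  case 0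
  then show ?case 
    by (auto intro: tempered_on_bilinear[OF assms(2)] differentiable_bilinear[OF assms(2)])
next
  case (Suc k)
  have "moderate_upto k S (\<lambda>\<epsilon>. pd i (\<lambda>x. B (f \<epsilon> x) (g \<epsilon> x)))" for i
  proof (rule moderate_upto_cong[OF assms(1)])
    show "moderate_upto k S (\<lambda>\<epsilon> x. B (f \<epsilon> x) (pd i (g \<epsilon>) x) + B (pd i (f \<epsilon>) x) (g \<epsilon> x))"
      using Suc.prems moderate_upto_mono[OF Suc.prems(1)] moderate_upto_mono[OF Suc.prems(2)]
      by (intro moderate_upto_add[OF assms(1)] Suc.IH) auto
    show "B (f \<epsilon> x) (pd i (g \<epsilon>) x) + B (pd i (f \<epsilon>) x) (g \<epsilon> x) = pd i (\<lambda>x. B (f \<epsilon> x) (g \<epsilon> x)) x" 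
      if "\<epsilon> \<in> {0<..1}" "x \<in> S" for \<epsilon> x
      using Suc.prems that by (simp add: pd_bilinear[OF assms(2)])
  qed
  with Suc.prems show ?case 
    by (auto intro: tempered_on_bilinear[OF assms(2)] differentiable_bilinear[OF assms(2)])
qed

lemma moderate_upto_linear:
  assumes "open S" "bounded_linear L"
  shows "moderate_upto k S f \<Longrightarrow> moderate_upto k S (\<lambda>\<epsilon> x. L (f \<epsilon> x))"
proof (induction k arbitrary: f)
  case 0
  then show ?case
    by (auto intro: tempered_on_linear[OF assms(2)] differentiable_linear[OF assms(2)])
next
  case (Suc k)
  have "moderate_upto k S (\<lambda>\<epsilon>. pd i (\<lambda>x. L (f \<epsilon> x)))" for i
  proof (rule moderate_upto_cong[OF assms(1)])
    show "moderate_upto k S (\<lambda>\<epsilon> x. L (pd i (f \<epsilon>) x))" using Suc by auto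
    show "L (pd i (f \<epsilon>) x) = pd i (\<lambda>x. L (f \<epsilon> x)) x" if "\<epsilon> \<in> {0<..1}" "x \<in> S" for \<epsilon> x
      using Suc.prems that by (simp add: pd_linear[OF assms(2)])
  qed
  with Suc.prems show ?case
    by (auto intro: tempered_on_linear[OF assms(2)] differentiable_linear[OF assms(2)])
qed

lemma moderate_upto_const:
  assumes "\<forall>\<^sub>F \<epsilon> in at_right 0. norm (r \<epsilon>) \<le> C * (1 / \<epsilon>) ^ N"
  shows "moderate_upto k (S :: (real^'n::finite) set) (\<lambda>\<epsilon> x. r \<epsilon> :: 'b::real_normed_vector)"
  using assms
proof (induction k arbitrary: r C N)
  case 0
  then show ?case by (auto intro!: tempered_onI intro: eventually_mono)
next
  case (Suc k)
  have "moderate_upto k S (\<lambda>\<epsilon> x. 0 :: 'b)" by (rule Suc.IH[of _ 0 0]) simp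
  with Suc show ?case by (auto intro!: tempered_onI intro: eventually_mono simp: pd_def[abs_def])
qed

lemma moderate_upto_zero: "moderate_upto k S (\<lambda>\<epsilon> x. 0)"
  by (rule moderate_upto_const[of _ 0 0]) simp

lemma moderate_upto_sum:
  assumes "open S" "\<And>i. i \<in> I \<Longrightarrow> moderate_upto k S (f i)"
  shows "moderate_upto k S (\<lambda>\<epsilon> x. \<Sum>i\<in>I. f i \<epsilon> x)"
  using assms(2)
proof (induction I rule: infinite_finite_induct)
  case (insert i I)
  then show ?case by (auto intro!: moderate_upto_add[OF assms(1)])
qed (auto intro: moderate_upto_zero)

lemma moderate_upto_iff_pderivs:
  "moderate_upto k S f \<longleftrightarrow> (\<forall>is. length is \<le> k \<longrightarrow>
     (\<forall>\<epsilon>\<in>{0<..1}. \<forall>x\<in>S. pderivs is (f \<epsilon>) differentiable at x) \<and>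
     tempered_on S (\<lambda>\<epsilon>. pderivs is (f \<epsilon>)))"
proof (induction k arbitrary: f)
  case (Suc k)
  show ?case (is "?L \<longleftrightarrow> ?R")
  proof
    assume L: ?L
    show ?R
    proof (intro allI impI)
      fix js :: "'a list" assume "length js \<le> Suc k"
      then show "(\<forall>\<epsilon>\<in>{0<..1}. \<forall>x\<in>S. pderivs js (f \<epsilon>) differentiable at x) \<and>
        tempered_on S (\<lambda>\<epsilon>. pderivs js (f \<epsilon>))"
        using L by (cases js rule: rev_cases) (auto simp: Suc pderivs_snoc)
    qed
  next
    assume R: ?R
    from R[rule_format, of "[]"] R[rule_format, of "_ @ [_]"] show ?L
      by (auto simp: Suc pderivs_snoc)
  qed
qed auto

lemma moderate_on_iff_pderivs:
  "moderate_on S f \<longleftrightarrow> (\<forall>\<epsilon>\<in>{0<..1}. smooth_on S (f \<epsilon>)) \<and>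
     (\<forall>is. tempered_on S (\<lambda>\<epsilon>. pderivs is (f \<epsilon>)))"
  unfolding moderate_on_def moderate_upto_iff_pderivs smooth_on_def by blast

lemma moderate_on_smooth: "moderate_on S f \<Longrightarrow> \<epsilon> \<in> {0<..1} \<Longrightarrow> smooth_on S (f \<epsilon>)"
  unfolding moderate_on_iff_pderivs by blast

lemma moderate_on_tempered: "moderate_on S f \<Longrightarrow> tempered_on S f"
  unfolding moderate_on_def using moderate_upto_tempered by blast

lemma moderate_on_differentiable:
  "moderate_on S f \<Longrightarrow> \<epsilon> \<in> {0<..1} \<Longrightarrow> x \<in> S \<Longrightarrow> f \<epsilon> differentiable at x"
  unfolding moderate_on_def using moderate_upto_diff by blast

lemma moderate_on_pd: "moderate_on S f \<Longrightarrow> moderate_on S (\<lambda>\<epsilon>. pd i (f \<epsilon>))"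
  unfolding moderate_on_def by (metis moderate_upto.simps(2))

lemma moderate_on_cong:
  "open S \<Longrightarrow> (\<And>\<epsilon> x. \<epsilon> \<in> {0<..1} \<Longrightarrow> x \<in> S \<Longrightarrow> f \<epsilon> x = g \<epsilon> x) \<Longrightarrow> moderate_on S f \<Longrightarrow> moderate_on S g"
  unfolding moderate_on_def using moderate_upto_cong[of S f g] by blast

lemma moderate_on_subset: "T \<subseteq> S \<Longrightarrow> moderate_on S f \<Longrightarrow> moderate_on T f"
  unfolding moderate_on_def using moderate_upto_subset by blast

lemma tempered_on_continuous:
  assumes "continuous_on S f" shows "tempered_on S (\<lambda>_. f)"
proof (rule tempered_onI)
  fix K assume "compact K" "K \<subseteq> S"
  then have "bounded (f ` K)"
    by (meson assms compact_continuous_image compact_imp_bounded continuous_on_subset)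
  then obtain C where "\<forall>x\<in>K. norm (f x) \<le> C" by (auto simp: bounded_iff)
  then have "\<forall>\<^sub>F \<epsilon> in at_right (0::real). \<forall>x\<in>K. norm (f x) \<le> C * (1 / \<epsilon>) ^ 0" by simp
  then show "\<exists>N C. \<forall>\<^sub>F \<epsilon> in at_right (0::real). \<forall>x\<in>K. norm (f x) \<le> C * (1 / \<epsilon>) ^ N" by blast
qed

lemma smooth_on_imp_continuous_on_pderivs: "smooth_on S f \<Longrightarrow> continuous_on S (pderivs is f)"
  unfolding smooth_on_def
  by (auto intro!: continuous_at_imp_continuous_on differentiable_imp_continuous_within)

lemma smooth_on_continuous: "smooth_on S f \<Longrightarrow> continuous_on S f"
  using smooth_on_imp_continuous_on_pderivs[of S f "[]"] by simp

text \<open>A constant net of smooth functions is moderate because continuous functions are bounded on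
  compact sets.  All closure properties of smoothness are special cases of those of
  moderateness.\<close>

lemma smooth_on_iff_moderate_on: "smooth_on S f \<longleftrightarrow> moderate_on S (\<lambda>_. f)"
proof -
  have "(\<forall>\<epsilon>\<in>{0<..1::real}. smooth_on S f) \<longleftrightarrow> smooth_on S f"
    using bspec[of "{0<..1::real}" "\<lambda>_. smooth_on S f" 1] by auto
  then show ?thesis
    unfolding moderate_on_iff_pderivs
    using tempered_on_continuous[OF smooth_on_imp_continuous_on_pderivs[of S f]] by auto
qed

lemma smooth_on_differentiable: "smooth_on S f \<Longrightarrow> x \<in> S \<Longrightarrow> f differentiable at x"
  unfolding smooth_on_def by (metis pderivs.simps(1))

lemma smooth_on_pd: "smooth_on S f \<Longrightarrow> smooth_on S (pd i f)"
  unfolding smooth_on_iff_moderate_on by (rule moderate_on_pd)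

lemma smooth_on_cong:
  "open S \<Longrightarrow> (\<And>x. x \<in> S \<Longrightarrow> f x = g x) \<Longrightarrow> smooth_on S f \<Longrightarrow> smooth_on S g"
  unfolding smooth_on_iff_moderate_on by (erule moderate_on_cong) auto

lemma smooth_on_subset: "T \<subseteq> S \<Longrightarrow> smooth_on S f \<Longrightarrow> smooth_on T f"
  unfolding smooth_on_iff_moderate_on by (rule moderate_on_subset)

lemma smooth_on_locally:
  assumes "\<And>x. x \<in> S \<Longrightarrow> \<exists>U. open U \<and> x \<in> U \<and> smooth_on U f"
  shows "smooth_on S f"
  using assms unfolding smooth_on_def by blast

named_theorems moderate_intros

lemma moderate_on_add [moderate_intros]:
  "open S \<Longrightarrow> moderate_on S f \<Longrightarrow> moderate_on S g \<Longrightarrow> moderate_on S (\<lambda>\<epsilon> x. f \<epsilon> x + g \<epsilon> x)"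
  unfolding moderate_on_def using moderate_upto_add by blast

lemma moderate_on_bilinear:
  "bounded_bilinear B \<Longrightarrow> open S \<Longrightarrow> moderate_on S f \<Longrightarrow> moderate_on S g \<Longrightarrow>
   moderate_on S (\<lambda>\<epsilon> x. B (f \<epsilon> x) (g \<epsilon> x))"
  unfolding moderate_on_def using moderate_upto_bilinear by blast

lemma moderate_on_linear:
  "bounded_linear L \<Longrightarrow> open S \<Longrightarrow> moderate_on S f \<Longrightarrow> moderate_on S (\<lambda>\<epsilon> x. L (f \<epsilon> x))"
  unfolding moderate_on_def using moderate_upto_linear by blast

lemma moderate_on_net_const:
  assumes "\<forall>\<^sub>F \<epsilon> in at_right 0. norm (r \<epsilon>) \<le> C * (1 / \<epsilon>) ^ N"
  shows "moderate_on S (\<lambda>\<epsilon> x. r \<epsilon>)"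
  unfolding moderate_on_def using moderate_upto_const[OF assms] by blast

lemma moderate_on_const [moderate_intros]: "moderate_on S (\<lambda>\<epsilon> x. c)"
  by (rule moderate_on_net_const[of _ "norm c" 0]) simp

lemma moderate_on_sum [moderate_intros]:
  "open S \<Longrightarrow> (\<And>i. i \<in> I \<Longrightarrow> moderate_on S (f i)) \<Longrightarrow> moderate_on S (\<lambda>\<epsilon> x. \<Sum>i\<in>I. f i \<epsilon> x)"
  unfolding moderate_on_def by (intro allI moderate_upto_sum) simp_all

lemma moderate_on_minus [moderate_intros]:
  "open S \<Longrightarrow> moderate_on S f \<Longrightarrow> moderate_on S (\<lambda>\<epsilon> x. - f \<epsilon> x)"
  by (rule moderate_on_linear[OF bounded_linear_minus[OF bounded_linear_ident]])

lemma moderate_on_diff [moderate_intros]: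
  "open S \<Longrightarrow> moderate_on S f \<Longrightarrow> moderate_on S g \<Longrightarrow> moderate_on S (\<lambda>\<epsilon> x. f \<epsilon> x - g \<epsilon> x)"
  using moderate_on_add[of S f "\<lambda>\<epsilon> x. - g \<epsilon> x"] moderate_on_minus[of S g] by simp

lemmas moderate_on_scaleR [moderate_intros] = moderate_on_bilinear[OF bounded_bilinear_scaleR]
lemmas moderate_on_mult [moderate_intros] = moderate_on_bilinear[OF bounded_bilinear_mult]
lemmas moderate_on_inner [moderate_intros] = moderate_on_bilinear[OF bounded_bilinear_inner]
lemmas moderate_on_nth [moderate_intros] = moderate_on_linear[OF bounded_linear_vec_nth]

lemma bounded_bilinear_matrix_vector:
  "bounded_bilinear ((*v) :: real^'n^'m \<Rightarrow> real^'n \<Rightarrow> real^'m)"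
  by (subst bilinear_conv_bounded_bilinear[symmetric])
     (auto simp: bilinear_def linear_iff matrix_vector_mult_add_rdistrib matrix_vector_right_distrib
       scaleR_matrix_vector_assoc matrix_vector_mult_scaleR)

lemma bounded_bilinear_matrix_matrix:
  "bounded_bilinear ((**) :: real^'n^'m \<Rightarrow> real^'k^'n \<Rightarrow> real^'k^'m)"
  by (subst bilinear_conv_bounded_bilinear[symmetric])
     (auto simp: bilinear_def linear_iff vec_eq_iff matrix_matrix_mult_def algebra_simps
       sum.distrib sum_distrib_left)

lemma bounded_linear_transpose: "bounded_linear (transpose :: real^'n^'m \<Rightarrow> real^'m^'n)"
  by (subst linear_conv_bounded_linear[symmetric]) (auto simp: linear_iff transpose_def vec_eq_iff)

lemmas moderate_on_matrix_vector [moderate_intros] = moderate_on_bilinear[OF bounded_bilinear_matrix_vector]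
lemmas moderate_on_transpose [moderate_intros] = moderate_on_linear[OF bounded_linear_transpose]

lemma norm_axis [simp]: "norm (axis i y :: 'b::real_normed_vector^'m) = norm y"
proof -
  have "(norm ((axis i y :: 'b^'m) $ j))\<^sup>2 = (if j = i then (norm y)\<^sup>2 else 0)" for j
    by (simp add: axis_def)
  then show ?thesis by (simp add: norm_vec_def L2_set_def)
qed

lemma bounded_linear_axis: "bounded_linear (\<lambda>y::'b::real_normed_vector. axis i y :: 'b^'m)"
  by (rule bounded_linear_intro[where K=1]) (auto simp: vec_eq_iff, auto simp: axis_def)

lemma moderate_on_vec:
  fixes f :: "real \<Rightarrow> real^'n \<Rightarrow> 'b::real_normed_vector^'m"
  assumes "open S" "\<And>i. moderate_on S (\<lambda>\<epsilon> x. f \<epsilon> x $ i)"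
  shows "moderate_on S f"
proof -
  have "moderate_on S (\<lambda>\<epsilon> x. \<Sum>i\<in>UNIV. axis i (f \<epsilon> x $ i))"
    using assms by (intro moderate_on_sum moderate_on_linear[OF bounded_linear_axis])
  moreover have "(\<Sum>i\<in>UNIV. axis i (v $ i)) = v" for v :: "'b^'m"
    by (simp add: vec_eq_iff axis_def)
  ultimately show ?thesis by simp
qed

lemma moderate_on_prod [moderate_intros]:
  fixes f :: "'i \<Rightarrow> real \<Rightarrow> real^'n::finite \<Rightarrow> real"
  assumes "open S" "\<And>i. i \<in> I \<Longrightarrow> moderate_on S (f i)"
  shows "moderate_on S (\<lambda>\<epsilon> x. \<Prod>i\<in>I. f i \<epsilon> x)"
  using assms(2)
proof (induction I rule: infinite_finite_induct)
  case (insert i I)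
  then show ?case by (auto intro!: moderate_on_mult[OF assms(1)])
qed (auto intro: moderate_on_const)

lemma moderate_on_det [moderate_intros]:
  fixes A :: "real \<Rightarrow> real^'n::finite \<Rightarrow> real^'k^'k"
  assumes "open S" "moderate_on S A"
  shows "moderate_on S (\<lambda>\<epsilon> x. det (A \<epsilon> x))"
  unfolding det_def
  by (intro moderate_on_sum moderate_on_mult moderate_on_const moderate_on_prod moderate_on_nth assms)

text \<open>Only the growth of the values of the reciprocal has to be known: its derivatives are polynomials in
  the reciprocal and the derivatives of the given net.\<close>

lemma moderate_on_inverse:
  fixes f :: "real \<Rightarrow> real^'n::finite \<Rightarrow> real"
  assumes "open S" "moderate_on S f" "\<And>\<epsilon> x. \<epsilon> \<in> {0<..1} \<Longrightarrow> x \<in> S \<Longrightarrow> f \<epsilon> x \<noteq> 0"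
    and "tempered_on S (\<lambda>\<epsilon> x. inverse (f \<epsilon> x))"
  shows "moderate_on S (\<lambda>\<epsilon> x. inverse (f \<epsilon> x))"
proof -
  have der: "((\<lambda>x. inverse (f \<epsilon> x)) has_derivative
      (\<lambda>h. - (inverse (f \<epsilon> x) * frechet_derivative (f \<epsilon>) (at x) h * inverse (f \<epsilon> x)))) (at x)"
    if "\<epsilon> \<in> {0<..1}" "x \<in> S" for \<epsilon> x
    by (intro Deriv.has_derivative_inverse assms(3)[OF that]
        moderate_on_differentiable[OF assms(2) that, unfolded frechet_derivative_works])
  have "moderate_upto k S (\<lambda>\<epsilon> x. inverse (f \<epsilon> x))" for k
  proof (induction k)
    case 0
    show ?case using der assms(4) unfolding moderate_upto.simps differentiable_def by blast
  next
    case (Suc k)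
    have "moderate_upto k S (\<lambda>\<epsilon>. pd i (\<lambda>x. inverse (f \<epsilon> x)))" for i
    proof (rule moderate_upto_cong[OF assms(1)])
      have "moderate_upto k S (\<lambda>\<epsilon>. pd i (f \<epsilon>))" 
        using moderate_on_pd[OF assms(2)] unfolding moderate_on_def by blast
      with Suc show "moderate_upto k S (\<lambda>\<epsilon> x. - (inverse (f \<epsilon> x) * pd i (f \<epsilon>) x * inverse (f \<epsilon> x)))"
        by (intro moderate_upto_linear[OF assms(1) bounded_linear_minus[OF bounded_linear_ident]]
              moderate_upto_bilinear[OF assms(1) bounded_bilinear_mult])
      show "- (inverse (f \<epsilon> x) * pd i (f \<epsilon>) x * inverse (f \<epsilon> x)) = pd i (\<lambda>x. inverse (f \<epsilon> x)) x" 
        if "\<epsilon> \<in> {0<..1}" "x \<in> S" for \<epsilon> x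
        using pd_eq[OF der[OF that]] by (simp add: pd_def)
    qed
    with der assms(4) show ?case unfolding moderate_upto.simps differentiable_def by blast
  qed
  then show ?thesis unfolding moderate_on_def by blast
qed

lemma moderate_on_compose:
  fixes T :: "real^'n::finite \<Rightarrow> real^'m::finite"
    and f :: "real \<Rightarrow> real^'m \<Rightarrow> 'b::real_normed_vector"
  assumes "open S" "open S'" "smooth_on S T" "\<And>x. x \<in> S \<Longrightarrow> T x \<in> S'" "moderate_on S' f"
  shows "moderate_on S (\<lambda>\<epsilon> x. f \<epsilon> (T x))"
proof -
  note T = assms(3)[unfolded smooth_on_iff_moderate_on]
  have temp: "tempered_on S (\<lambda>\<epsilon> x. f \<epsilon> (T x))" if "tempered_on S' f" 
    for f :: "real \<Rightarrow> real^'m \<Rightarrow> 'b"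
    unfolding tempered_on_def
  proof (intro allI impI)
    fix K assume K: "compact K \<and> K \<subseteq> S"
    have "compact (T ` K)" "T ` K \<subseteq> S'"
      using K assms(4) continuous_on_subset[OF smooth_on_continuous[OF assms(3)]]
      by (auto intro!: compact_continuous_image)
    from tempered_onE[OF that this] show 
      "\<exists>N. \<forall>\<^sub>F \<epsilon> in at_right 0. \<forall>x\<in>K. norm (f \<epsilon> (T x)) \<le> (1 / \<epsilon>) ^ N" by auto
  qed
  have der: "((\<lambda>x. g (T x)) has_derivative 
      (\<lambda>h. frechet_derivative g (at (T x)) (frechet_derivative T (at x) h))) (at x)"
    if "x \<in> S" "g differentiable at (T x)" for x and g :: "real^'m \<Rightarrow> 'b"
    using diff_chain_at[of T "frechet_derivative T (at x)" x g] that
      smooth_on_differentiable[OF assms(3)] 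
    unfolding frechet_derivative_works o_def by blast
  have "moderate_upto k S' f \<Longrightarrow> moderate_upto k S (\<lambda>\<epsilon> x. f \<epsilon> (T x))" for k
  proof (induction k arbitrary: f)
    case 0
    then show ?case using der assms(4) temp unfolding moderate_upto.simps differentiable_def by blast
  next
    case (Suc k)
    have "moderate_upto k S (\<lambda>\<epsilon>. pd i (\<lambda>x. f \<epsilon> (T x)))" for i
    proof (rule moderate_upto_cong[OF assms(1)])
      have "moderate_upto k S (\<lambda>\<epsilon> x. pd i T x $ j)" for j 
        using moderate_on_nth[OF assms(1) moderate_on_pd[OF T], of i j] unfolding moderate_on_def by blast
      moreover have "moderate_upto k S (\<lambda>\<epsilon> x. pd j (f \<epsilon>) (T x))" for j
        using Suc.prems by (intro Suc.IH) simp
      ultimately show "moderate_upto k S (\<lambda>\<epsilon> x. \<Sum>j\<in>UNIV. pd i T x $ j *\<^sub>R pd j (f \<epsilon>) (T x))"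
        by (intro moderate_upto_sum[OF assms(1)] moderate_upto_bilinear[OF assms(1) bounded_bilinear_scaleR])
      show "(\<Sum>j\<in>UNIV. pd i T x $ j *\<^sub>R pd j (f \<epsilon>) (T x)) = pd i (\<lambda>x. f \<epsilon> (T x)) x" 
        if "\<epsilon> \<in> {0<..1}" "x \<in> S" for \<epsilon> x
      proof -
        have d: "f \<epsilon> differentiable at (T x)" using Suc.prems that assms(4) by auto
        show ?thesis
          unfolding pd_eq[OF der[OF that(2) d]] frechet_derivative_eq_sum_pd[OF d]
          by (simp add: pd_def)
      qed
    qed
    with Suc.prems der assms(4) temp show ?case unfolding moderate_upto.simps differentiable_def by blast
  qed
  with assms(5) show ?thesis unfolding moderate_on_def by blast
qed

lemma smooth_on_compose:
  fixes T :: "real^'n::finite \<Rightarrow> real^'m::finite"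
  assumes "open S" "open S'" "smooth_on S T" "\<And>x. x \<in> S \<Longrightarrow> T x \<in> S'" "smooth_on S' f"
  shows "smooth_on S (\<lambda>x. f (T x))"
  using moderate_on_compose[of S S' T "\<lambda>_. f"] assms unfolding smooth_on_iff_moderate_on by blast

text \<open>A net of smooth functions that is moderate together with its derivatives and small itself has
  small derivatives: by Taylor's formula
  \<open>\<bar>\<partial>f\<bar> \<le> 2 sup \<bar>f\<bar> / t + t sup \<bar>\<partial>\<^sup>2f\<bar>\<close>, where the step \<open>t\<close> may be chosen as any power of
  the parameter.\<close>

lemma norm_pd_le:
  fixes f :: "real^'n::finite \<Rightarrow> 'b::real_normed_vector"
  assumes "0 < t"
    and d1: "\<And>s. s \<in> {0..t} \<Longrightarrow> f differentiable at (x + s *\<^sub>R axis i 1)"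
    and d2: "\<And>s. s \<in> {0..t} \<Longrightarrow> pd i f differentiable at (x + s *\<^sub>R axis i 1)"
    and b0: "norm (f x) \<le> A" "norm (f (x + t *\<^sub>R axis i 1)) \<le> A"
    and b2: "\<And>s. s \<in> {0..t} \<Longrightarrow> norm (pd i (pd i f) (x + s *\<^sub>R axis i 1)) \<le> B"
  shows "norm (pd i f x) \<le> 2 * A / t + t * B"
proof -
  have line: "((\<lambda>s. g (x + s *\<^sub>R axis i 1)) has_vector_derivative pd i g (x + s *\<^sub>R axis i 1)) (at s within T)"
    if "g differentiable at (x + s *\<^sub>R axis i 1)" for g :: "real^'n \<Rightarrow> 'b" and s T
  proof -
    have "((\<lambda>s. x + s *\<^sub>R axis i 1) has_derivative (\<lambda>h. h *\<^sub>R axis i 1)) (at s within T)"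
      by (auto intro!: derivative_eq_intros)
    then have "((\<lambda>s. g (x + s *\<^sub>R axis i 1)) has_derivative
        (\<lambda>h. frechet_derivative g (at (x + s *\<^sub>R axis i 1)) (h *\<^sub>R axis i 1))) (at s within T)"
      using that[unfolded frechet_derivative_works] by (rule has_derivative_compose)
    moreover have "frechet_derivative g (at (x + s *\<^sub>R axis i 1)) (h *\<^sub>R axis i 1)
        = h *\<^sub>R pd i g (x + s *\<^sub>R axis i 1)" for h
      using linear_frechet_derivative[OF that] by (simp add: pd_def linear_scale)
    ultimately show ?thesis by (simp add: has_vector_derivative_def)
  qed
  have "0 \<le> B" using order_trans[OF norm_ge_zero b2[of 0]] assms(1) by simp
  have B: "norm (pd i f (x + s *\<^sub>R axis i 1) - pd i f (x + 0 *\<^sub>R axis i 1)) \<le> t * B" if "s \<in> {0..t}" for s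
  proof -
    have "norm (pd i f (x + s *\<^sub>R axis i 1) - pd i f (x + 0 *\<^sub>R axis i 1)) \<le> B * norm (s - 0)"
    proof (rule differentiable_bound[of "{0..t}" "\<lambda>s. pd i f (x + s *\<^sub>R axis i 1)"
          "\<lambda>s h. h *\<^sub>R pd i (pd i f) (x + s *\<^sub>R axis i 1)"])
      fix r assume r: "r \<in> {0..t}"
      show "((\<lambda>s. pd i f (x + s *\<^sub>R axis i 1)) has_derivative 
          (\<lambda>h. h *\<^sub>R pd i (pd i f) (x + r *\<^sub>R axis i 1))) (at r within {0..t})"
        using line[OF d2[OF r]] by (simp add: has_vector_derivative_def)
      show "onorm (\<lambda>h. h *\<^sub>R pd i (pd i f) (x + r *\<^sub>R axis i 1)) \<le> B"
        using b2[OF r] by (intro onorm_le) (simp add: mult.commute[of B] mult_left_mono)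
    qed (use that assms(1) in auto)
    also have "\<dots> \<le> B * t" using that \<open>0 \<le> B\<close> by (intro mult_left_mono) auto
    finally show ?thesis by (simp add: mult.commute)
  qed
  have "norm (f (x + t *\<^sub>R axis i 1) - f (x + 0 *\<^sub>R axis i 1) - (t - 0) *\<^sub>R pd i f (x + 0 *\<^sub>R axis i 1)) 
      \<le> norm (t - 0) * (t * B)"
    using assms(1) B line[OF d1]
    by (intro vector_differentiable_bound_linearization[of "{0..t}" "\<lambda>s. f (x + s *\<^sub>R axis i 1)"
          "\<lambda>s. pd i f (x + s *\<^sub>R axis i 1)"]) (auto simp: closed_segment_eq_real_ivl)
  then have "norm (t *\<^sub>R pd i f x) \<le> A + A + t * (t * B)"
    using b0 assms(1) norm_triangle_ineq4[of "f (x + t *\<^sub>R axis i 1) - f x"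
        "f (x + t *\<^sub>R axis i 1) - f x - t *\<^sub>R pd i f x"] 
      norm_triangle_ineq4[of "f (x + t *\<^sub>R axis i 1)" "f x"] by simp
  then show ?thesis using assms(1) by (simp add: field_simps)
qed

lemma compact_enlarge:
  fixes K :: "(real^'n::finite) set"
  assumes "compact K" "K \<subseteq> S" "open S"
  obtains r where "0 < r" "compact {x + y | x y. x \<in> K \<and> y \<in> cball 0 r}" 
    "{x + y | x y. x \<in> K \<and> y \<in> cball 0 r} \<subseteq> S"
proof (cases "K = {}")
  case False
  obtain e where e: "0 < e" "(\<Union>x\<in>K. ball x e) \<subseteq> S"
    using compact_subset_open_imp_ball_epsilon_subset[OF assms(1,3,2)] by metis
  have "{x + y | x y. x \<in> K \<and> y \<in> cball 0 (e/2)} \<subseteq> (\<Union>x\<in>K. ball x e)"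
    using e(1) by (auto simp: dist_norm)
  with e show ?thesis by (intro that[of "e/2"] compact_sums assms(1) compact_cball) auto
qed (rule that[of 1], auto)

lemma negligible_on_pd:
  fixes f :: "real \<Rightarrow> real^'n::finite \<Rightarrow> 'b::real_normed_vector"
  assumes "open S" "moderate_on S f" "negligible_on S f"
  shows "negligible_on S (\<lambda>\<epsilon>. pd i (f \<epsilon>))"
proof (rule negligible_onI)
  fix K m assume K: "compact K" "K \<subseteq> S"
  obtain r where r: "0 < r" "compact {x + y | x y. x \<in> K \<and> y \<in> cball 0 r}" 
    "{x + y | x y. x \<in> K \<and> y \<in> cball 0 r} \<subseteq> S"
    using compact_enlarge[OF K assms(1)] by blast
  define L where "L = {x + y | x y. x \<in> K \<and> y \<in> cball 0 r}"
  have L: "compact L" "L \<subseteq> S" using r by (auto simp: L_def)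
  have inL: "x + s *\<^sub>R axis i 1 \<in> L" if "x \<in> K" "s \<in> {0..r}" for x s
    unfolding L_def using that by (intro CollectI exI[of _ x] exI[of _ "s *\<^sub>R axis i 1"]) simp
  have KL: "K \<subseteq> L" using inL[of _ 0] r(1) by auto
  have m1: "moderate_on S (\<lambda>\<epsilon>. pd i (f \<epsilon>))" "moderate_on S (\<lambda>\<epsilon>. pd i (pd i (f \<epsilon>)))"
    using assms(2) by (auto intro: moderate_on_pd)
  obtain N where N: "\<forall>\<^sub>F \<epsilon> in at_right 0. \<forall>x\<in>L. norm (pd i (pd i (f \<epsilon>)) x) \<le> (1 / \<epsilon>) ^ N"
    using tempered_onE[OF moderate_on_tempered[OF m1(2)] L] .
  have "\<forall>\<^sub>F \<epsilon> in at_right 0. \<forall>x\<in>K. norm (pd i (f \<epsilon>) x) \<le> (2 / r + r) * \<epsilon> ^ m"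
    using N negligible_onD[OF assms(3) L, of "(m + N) + m"] eventually_small[of 1, simplified]
  proof eventually_elim
    case (elim \<epsilon>)
    show ?case
    proof
      fix x assume x: "x \<in> K"
      \<comment> \<open>This step balances the two terms of the estimate: with \<open>sup \<bar>f\<bar> \<le> \<epsilon>\<^bsup>2m+N\<^esup>\<close> and
        \<open>sup \<bar>\<partial>\<^sup>2f\<bar> \<le> \<epsilon>\<^bsup>-N\<^esup>\<close> both are of order \<open>\<epsilon>\<^sup>m\<close>.\<close>
      define t where "t = r * \<epsilon> ^ (m + N)"
      have t: "0 < t" "t \<le> r" using elim r(1) by (auto simp: t_def mult_le_cancel_left1 power_le_one)
      have "norm (pd i (f \<epsilon>) x) \<le> 2 * \<epsilon> ^ ((m + N) + m) / t + t * (1 / \<epsilon>) ^ N"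
      proof (rule norm_pd_le[OF t(1)])
        fix s assume "s \<in> {0..t}"
        then have s: "x + s *\<^sub>R axis i 1 \<in> L" using inL[OF x] t by auto
        then show "f \<epsilon> differentiable at (x + s *\<^sub>R axis i 1)"
          "pd i (f \<epsilon>) differentiable at (x + s *\<^sub>R axis i 1)"
          using moderate_on_differentiable[OF assms(2)] moderate_on_differentiable[OF m1(1)] L elim by auto
        show "norm (pd i (pd i (f \<epsilon>)) (x + s *\<^sub>R axis i 1)) \<le> (1 / \<epsilon>) ^ N" using elim s by blast
      qed (use elim KL x inL[OF x, of t] t in auto)
      also have "t * (1 / \<epsilon>) ^ N = r * \<epsilon> ^ m" using elim by (simp add: t_def power_add power_divide)
      also have "2 * \<epsilon> ^ ((m + N) + m) / t = 2 / r * \<epsilon> ^ m" 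
        using elim r(1) by (simp add: t_def power_add)
      finally show "norm (pd i (f \<epsilon>) x) \<le> (2 / r + r) * \<epsilon> ^ m" by (simp add: ring_distribs)
    qed
  qed
  then show "\<exists>C. \<forall>\<^sub>F \<epsilon> in at_right 0. \<forall>x\<in>K. norm (pd i (f \<epsilon>) x) \<le> C * \<epsilon> ^ m" by blast
qed

section \<open>Bump functions\<close>

lemma power_le_fact_exp: "0 \<le> x \<Longrightarrow> x ^ n \<le> fact n * exp (x::real)"
proof -
  assume x: "0 \<le> x"
  have "(\<Sum>k\<in>{n}. x ^ k /\<^sub>R fact k) \<le> (\<Sum>k. x ^ k /\<^sub>R fact k)"
    using x by (intro sum_le_suminf summable_exp_generic) auto
  then show ?thesis by (simp add: exp_def field_simps)
qed

text \<open>This estimate gives both the smoothness of bump functions and the negligibility of \<open>exp (-1/\<epsilon>)\<close>.\<close>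

lemma exp_minus_inverse_le:
  assumes "0 < (t::real)" shows "exp (- 1 / t) \<le> fact n * t ^ n"
  using power_le_fact_exp[of "1 / t" n] assms by (simp add: exp_minus field_simps)

text \<open>The derivatives of \<open>exp (-1/t)\<close>, extended by zero, are combinations of the functions
  \<open>exp (-1/t) / t\<^sup>k\<close>.\<close>

definition flat :: "nat \<Rightarrow> real \<Rightarrow> real" where
  "flat k t = (if t \<le> 0 then 0 else exp (- 1 / t) / t ^ k)"

text \<open>A quadratic bound at \<open>0\<close> is what makes the extension by zero differentiable there.\<close>

lemma flat_le: "\<bar>flat k t\<bar> \<le> fact (k + 2) * t\<^sup>2"
proof (cases "t \<le> 0")
  case False
  then have "exp (- 1 / t) / t ^ k \<le> fact (k + 2) * t ^ (k + 2) / t ^ k"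
    using exp_minus_inverse_le[of t "k + 2"] by (intro divide_right_mono) auto
  with False show ?thesis by (simp add: flat_def power_add power2_eq_square del: fact_Suc)
qed (simp add: flat_def)

lemma flat_has_derivative:
  "(flat k has_real_derivative flat (k + 2) t - real k * flat (k + 1) t) (at t)"
proof -
  consider "t < 0" | "t = 0" | "0 < t" by linarith
  then show ?thesis
  proof cases
    case 1
    have "((\<lambda>_. 0) has_real_derivative 0) (at t)" by simp
    then have "(flat k has_real_derivative 0) (at t)"
      by (rule has_field_derivative_transform_within_open[of _ _ _ "{..<0}"]) (use 1 in \<open>auto simp: flat_def\<close>)
    then show ?thesis using 1 by (simp add: flat_def)
  next
    case 2
    have "((\<lambda>h. flat k h / h) \<longlongrightarrow> 0) (at 0)"
    proof (rule Lim_null_comparison)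
      have "\<forall>\<^sub>F h in at 0. h \<noteq> (0::real)" by (simp add: eventually_at_filter)
      then show "\<forall>\<^sub>F h in at 0. norm (flat k h / h) \<le> fact (k + 2) * \<bar>h\<bar>"
      proof eventually_elim
        case (elim h)
        then have "\<bar>flat k h\<bar> \<le> (fact (k + 2) * \<bar>h\<bar>) * \<bar>h\<bar>"
          using flat_le[of k h] by (simp add: power2_eq_square mult.assoc del: fact_Suc)
        with elim show ?case by (simp add: pos_divide_le_eq)
      qed
      show "((\<lambda>h. fact (k + 2) * \<bar>h\<bar>) \<longlongrightarrow> (0::real)) (at 0)"
        by (auto intro!: tendsto_eq_intros)
    qed
    then show ?thesis using 2 by (simp add: DERIV_def flat_def)
  next
    case 3
    have "((\<lambda>t. exp (- 1 / t) / t ^ k) has_real_derivative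
       exp (- 1 / t) / t ^ (k + 2) - real k * (exp (- 1 / t) / t ^ (k + 1))) (at t)"
    proof (cases k)
      case 0
      then show ?thesis using 3
        by (auto intro!: derivative_eq_intros simp: power2_eq_square)
    next
      case (Suc n)
      then show ?thesis using 3
        apply (auto intro!: derivative_eq_intros simp: power2_eq_square)
        apply (cases n)
        apply (auto simp: field_simps)
        done
    qed
    then have "(flat k has_real_derivative
       exp (- 1 / t) / t ^ (k + 2) - real k * (exp (- 1 / t) / t ^ (k + 1))) (at t)"
      by (rule has_field_derivative_transform_within_open[of _ _ _ "{0<..}"]) (use 3 in \<open>auto simp: flat_def\<close>)
    then show ?thesis using 3 by (simp add: flat_def)
  qed
qed

lemma smooth_on_flat_compose:
  fixes u :: "real^'n::finite \<Rightarrow> real"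
  assumes "open S" "smooth_on S u"
  shows "smooth_on S (\<lambda>x. flat k (u x))"
proof -
  note u = assms(2)[unfolded smooth_on_iff_moderate_on]
  have der: "((\<lambda>x. flat k (u x)) has_derivative
      (\<lambda>h. (flat (k + 2) (u x) - real k * flat (k + 1) (u x)) * frechet_derivative u (at x) h)) (at x)"
    if "x \<in> S" for k x
    using has_derivative_compose[OF smooth_on_differentiable[OF assms(2) that, unfolded frechet_derivative_works]
        flat_has_derivative[of k "u x", unfolded has_field_derivative_def]]
    by simp
  have cont: "continuous_on S (\<lambda>x. flat k (u x))" for k
    using der by (meson differentiable_imp_continuous_on differentiable_at_withinI differentiable_def differentiable_on_def)
  have "moderate_upto n S (\<lambda>_ x. flat k (u x))" for n k
  proof (induction n arbitrary: k)
    case 0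
    show ?case using der tempered_on_continuous[OF cont] unfolding moderate_upto.simps differentiable_def by blast
  next
    case (Suc n)
    have "moderate_upto n S (\<lambda>_. pd i (\<lambda>x. flat k (u x)))" for i
    proof (rule moderate_upto_cong[OF assms(1)])
      have pdu: "moderate_upto n S (\<lambda>_. pd i u)" 
        using moderate_on_pd[OF u] unfolding moderate_on_def by blast
      show "moderate_upto n S (\<lambda>_ x. (flat (k + 2) (u x) + (- real k) * flat (k + 1) (u x)) * pd i u x)"
        by (intro moderate_upto_bilinear[OF assms(1) bounded_bilinear_mult]
              moderate_upto_linear[OF assms(1) bounded_linear_mult_right]
              moderate_upto_add[OF assms(1)] Suc.IH pdu)
      show "(flat (k + 2) (u x) + (- real k) * flat (k + 1) (u x)) * pd i u x = pd i (\<lambda>x. flat k (u x)) x" 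
        if "x \<in> S" for x
        using pd_eq[OF der[OF that]] by (simp add: pd_def)
    qed
    with der tempered_on_continuous[OF cont] show ?case
      unfolding moderate_upto.simps differentiable_def by blast
  qed
  then show ?thesis unfolding smooth_on_iff_moderate_on moderate_on_def by blast
qed

lemma smooth_on_linear:
  assumes "bounded_linear (L :: real^'n::finite \<Rightarrow> 'b::real_normed_vector)"
  shows "smooth_on S L"
proof -
  have "moderate_upto k S (\<lambda>_. L)" for k
  proof (cases k)
    case 0
    then show ?thesis
      using assms by (auto simp: bounded_linear_imp_differentiable intro!: tempered_on_continuous linear_continuous_on)
  next
    case (Suc n)
    have "pd i L = (\<lambda>_. L (axis i 1))" for i 
      using pd_eq[OF bounded_linear_imp_has_derivative[OF assms]] by (simp add: fun_eq_iff)
    then show ?thesis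
      using assms Suc moderate_on_const[unfolded moderate_on_def]
      by (auto simp: bounded_linear_imp_differentiable intro!: tempered_on_continuous linear_continuous_on)
  qed
  then show ?thesis unfolding smooth_on_iff_moderate_on moderate_on_def by blast
qed

lemma smooth_on_ident: "smooth_on S (\<lambda>x::real^'n::finite. x)"
  by (rule smooth_on_linear[OF bounded_linear_ident])

text \<open>Finitely many small balls cover the compact set; \<open>exp (-1/t)\<close> is composed with
  \<open>r\<^sup>2 - \<bar>x - a\<bar>\<^sup>2\<close> for each of them and the results are added.  Being
  positive on the compact set is as good as being \<open>1\<close> there, because one may divide by the minimum.\<close>

lemma bump_exists:
  fixes K :: "(real^'n::finite) set"
  assumes "compact K" "K \<subseteq> S" "open S"
  obtains \<rho> :: "real^'n \<Rightarrow> real" and L where "smooth_on UNIV \<rho>" "\<And>x. 0 \<le> \<rho> x" "\<And>x. x \<in> K \<Longrightarrow> 0 < \<rho> x"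
    "compact L" "L \<subseteq> S" "\<And>x. x \<notin> L \<Longrightarrow> \<rho> x = 0"
proof -
  obtain e where e: "0 < e" "(\<Union>x\<in>K. ball x e) \<subseteq> S"
    using compact_subset_open_imp_ball_epsilon_subset[OF assms(1,3,2)] by metis
  have cov: "K \<subseteq> (\<Union>a\<in>K. ball a (e/2))" using e(1) by (auto intro!: bexI)
  obtain F where F: "F \<subseteq> K" "finite F" "K \<subseteq> (\<Union>a\<in>F. ball a (e/2))"
    by (rule compactE_image[OF assms(1) _ cov]) auto
  define u where "u a x = (e/2)\<^sup>2 - (x - a) \<bullet> (x - a)" for a x :: "real^'n"
  define \<rho> where "\<rho> = (\<lambda>x. \<Sum>a\<in>F. flat 0 (u a x))"
  have u: "0 < u a x \<longleftrightarrow> x \<in> ball a (e/2)" for a x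
  proof -
    have "(norm (x - a))\<^sup>2 < (e/2)\<^sup>2 \<longleftrightarrow> norm (x - a) < e/2"
      using e(1) power2_less_imp_less[of "norm (x - a)" "e/2"] power_strict_mono[of "norm (x - a)" "e/2" 2] by auto
    then show ?thesis by (simp add: u_def dot_square_norm dist_norm norm_minus_commute)
  qed
  have fl: "0 \<le> flat 0 t" "0 < flat 0 t \<longleftrightarrow> 0 < t" for t by (auto simp: flat_def)
  have "smooth_on UNIV (u a)" for a
    unfolding smooth_on_iff_moderate_on u_def[abs_def]
    by (intro moderate_intros open_UNIV smooth_on_ident[unfolded smooth_on_iff_moderate_on])
  then have "smooth_on UNIV (\<lambda>x. flat 0 (u a x))" for a
    by (rule smooth_on_flat_compose[OF open_UNIV])
  then have "smooth_on UNIV \<rho>"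
    unfolding smooth_on_iff_moderate_on \<rho>_def by (intro moderate_intros open_UNIV)
  moreover have "0 \<le> \<rho> x" for x unfolding \<rho>_def by (intro sum_nonneg fl)
  moreover have "0 < \<rho> x" if x: "x \<in> K" for x
  proof -
    obtain a where "a \<in> F" "x \<in> ball a (e/2)" using x F by auto
    then show ?thesis unfolding \<rho>_def using F(2) fl u by (intro sum_pos2[of F a]) auto
  qed
  moreover have "compact (\<Union>a\<in>F. cball a (e/2))" using F(2) by auto
  moreover have "(\<Union>a\<in>F. cball a (e/2)) \<subseteq> S" 
  proof
    fix x assume "x \<in> (\<Union>a\<in>F. cball a (e/2))"
    then obtain a where "a \<in> F" "dist a x \<le> e/2" by auto
    then show "x \<in> S" using e F by (auto intro!: subsetD[OF e(2)] bexI[of _ a])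
  qed
  moreover have "\<rho> x = 0" if "x \<notin> (\<Union>a\<in>F. cball a (e/2))" for x
  proof -
    have "flat 0 (u a x) = 0" if a: "a \<in> F" for a
    proof -
      have "x \<notin> ball a (e/2)" using a \<open>x \<notin> _\<close> by (auto simp: less_imp_le)
      then show ?thesis using u[of a x] by (simp add: flat_def)
    qed
    then show ?thesis by (simp add: \<rho>_def)
  qed
  ultimately show ?thesis by (rule that)
qed

section \<open>Symmetry of second derivatives\<close>

text \<open>The mixed second difference of \<open>f\<close> is, by the mean value theorem applied first in one and
  then in the other direction, a value of the mixed second derivative.  As the difference is
  symmetric in the two directions, both mixed derivatives have the same limit.\<close>

lemma second_difference_eq_pd_pd:
  fixes f :: "real^'n::finite \<Rightarrow> real"
  assumes "smooth_on S f" "0 < t"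
    and S: "\<And>s r. s \<in> {0..t} \<Longrightarrow> r \<in> {0..t} \<Longrightarrow> x + s *\<^sub>R axis i 1 + r *\<^sub>R axis j 1 \<in> S"
  obtains y where "norm (y - x) \<le> 2 * t"
    "f (x + t *\<^sub>R axis i 1 + t *\<^sub>R axis j 1) - f (x + t *\<^sub>R axis i 1) - f (x + t *\<^sub>R axis j 1) + f x
      = t * t * pd j (pd i f) y"
proof -
  have line: "((\<lambda>s. g (z + s *\<^sub>R axis k 1)) has_real_derivative pd k g (z + s *\<^sub>R axis k 1)) (at s)"
    if "smooth_on S g" "z + s *\<^sub>R axis k 1 \<in> S" for g :: "real^'n \<Rightarrow> real" and z s k
  proof -
    note d = smooth_on_differentiable[OF that]
    have "((\<lambda>s. z + s *\<^sub>R axis k 1) has_derivative (\<lambda>h. h *\<^sub>R axis k 1)) (at s)"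
      by (auto intro!: derivative_eq_intros)
    then have "((\<lambda>s. g (z + s *\<^sub>R axis k 1)) has_derivative
        (\<lambda>h. frechet_derivative g (at (z + s *\<^sub>R axis k 1)) (h *\<^sub>R axis k 1))) (at s)"
      using d[unfolded frechet_derivative_works] by (rule has_derivative_compose)
    moreover have "frechet_derivative g (at (z + s *\<^sub>R axis k 1)) (h *\<^sub>R axis k 1)
        = pd k g (z + s *\<^sub>R axis k 1) * h" for h
      using linear_frechet_derivative[OF d] by (simp add: pd_def linear_scale)
    ultimately show ?thesis by (simp add: has_field_derivative_def)
  qed
  define g where "g = (\<lambda>s. f ((x + t *\<^sub>R axis j 1) + s *\<^sub>R axis i 1) - f (x + s *\<^sub>R axis i 1))"
  have S0: "x + s *\<^sub>R axis i 1 \<in> S" "(x + t *\<^sub>R axis j 1) + s *\<^sub>R axis i 1 \<in> S" if "s \<in> {0..t}" for s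
    using S[OF that, of 0] S[OF that, of t] assms(2) by (auto simp: algebra_simps)
  have "\<exists>z>0. z < t \<and> g t - g 0 = (t - 0) * (pd i f ((x + t *\<^sub>R axis j 1) + z *\<^sub>R axis i 1) - pd i f (x + z *\<^sub>R axis i 1))"
    unfolding g_def using S0
    by (intro MVT2[OF assms(2)] DERIV_diff line[OF assms(1)]) auto
  then obtain s where s: "0 < s" "s < t" 
    "g t - g 0 = t * (pd i f ((x + s *\<^sub>R axis i 1) + t *\<^sub>R axis j 1) - pd i f ((x + s *\<^sub>R axis i 1) + 0 *\<^sub>R axis j 1))"
    by (auto simp: algebra_simps)
  have "\<exists>z>0. z < t \<and> pd i f ((x + s *\<^sub>R axis i 1) + t *\<^sub>R axis j 1) - pd i f ((x + s *\<^sub>R axis i 1) + 0 *\<^sub>R axis j 1)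
      = (t - 0) * pd j (pd i f) ((x + s *\<^sub>R axis i 1) + z *\<^sub>R axis j 1)"
    using S[of s] s(1,2)
    by (intro MVT2[OF assms(2), of "\<lambda>r. pd i f ((x + s *\<^sub>R axis i 1) + r *\<^sub>R axis j 1)"]
          line[OF smooth_on_pd[OF assms(1)]]) auto
  then obtain r where r: "0 < r" "r < t" 
    "pd i f ((x + s *\<^sub>R axis i 1) + t *\<^sub>R axis j 1) - pd i f ((x + s *\<^sub>R axis i 1) + 0 *\<^sub>R axis j 1)
      = t * pd j (pd i f) ((x + s *\<^sub>R axis i 1) + r *\<^sub>R axis j 1)" by auto
  show ?thesis
  proof
    show "norm ((x + s *\<^sub>R axis i 1) + r *\<^sub>R axis j 1 - x) \<le> 2 * t"
      using norm_triangle_ineq[of "s *\<^sub>R axis i 1 :: real^'n" "r *\<^sub>R axis j 1"] s r by simp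
    have "g t - g 0 = t * t * pd j (pd i f) ((x + s *\<^sub>R axis i 1) + r *\<^sub>R axis j 1)"
      unfolding s(3) r(3) by simp
    then show "f (x + t *\<^sub>R axis i 1 + t *\<^sub>R axis j 1) - f (x + t *\<^sub>R axis i 1) - f (x + t *\<^sub>R axis j 1) + f x
      = t * t * pd j (pd i f) ((x + s *\<^sub>R axis i 1) + r *\<^sub>R axis j 1)"
      by (simp add: g_def algebra_simps)
  qed
qed

lemma pd_commute:
  fixes f :: "real^'n::finite \<Rightarrow> real"
  assumes "open S" "smooth_on S f" "x \<in> S"
  shows "pd i (pd j f) x = pd j (pd i f) x"
proof (rule ccontr)
  assume ne: "pd i (pd j f) x \<noteq> pd j (pd i f) x"
  define e where "e = \<bar>pd i (pd j f) x - pd j (pd i f) x\<bar> / 2"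
  have e: "0 < e" using ne by (simp add: e_def)
  have c: "isCont (pd a (pd b f)) x" for a b
    using smooth_on_differentiable[OF smooth_on_pd[OF smooth_on_pd[OF assms(2)]] assms(3)]
    by (rule differentiable_imp_continuous_within)
  obtain d0 where d0: "0 < d0" "ball x d0 \<subseteq> S" using assms(1,3) openE by blast
  obtain d1 where d1: "0 < d1" "\<And>y. dist y x < d1 \<Longrightarrow> dist (pd i (pd j f) y) (pd i (pd j f) x) < e"
    using c[of i j] e unfolding continuous_at_eps_delta by blast
  obtain d2 where d2: "0 < d2" "\<And>y. dist y x < d2 \<Longrightarrow> dist (pd j (pd i f) y) (pd j (pd i f) x) < e"
    using c[of j i] e unfolding continuous_at_eps_delta by blast
  define t where "t = min d0 (min d1 d2) / 3"
  have t: "0 < t" "2 * t < d0" "2 * t < d1" "2 * t < d2" using d0 d1 d2 by (auto simp: t_def)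
  have inS: "x + s *\<^sub>R axis a 1 + r *\<^sub>R axis b 1 \<in> S" if "s \<in> {0..t}" "r \<in> {0..t}" for s r a b
  proof -
    have "norm (s *\<^sub>R axis a 1 + r *\<^sub>R axis b 1 :: real^'n) \<le> 2 * t"
      using norm_triangle_ineq[of "s *\<^sub>R axis a 1 :: real^'n" "r *\<^sub>R axis b 1"] that by simp
    then have "x + s *\<^sub>R axis a 1 + r *\<^sub>R axis b 1 \<in> ball x d0" 
      using t(2) norm_minus_cancel[of "s *\<^sub>R axis a 1 + r *\<^sub>R axis b 1 :: real^'n"] by (simp add: dist_norm algebra_simps)
    then show ?thesis using d0(2) by blast
  qed
  obtain y where y: "norm (y - x) \<le> 2 * t"
    "f (x + t *\<^sub>R axis i 1 + t *\<^sub>R axis j 1) - f (x + t *\<^sub>R axis i 1) - f (x + t *\<^sub>R axis j 1) + f x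
      = t * t * pd j (pd i f) y"
    by (rule second_difference_eq_pd_pd[OF assms(2) t(1) inS, of i j])
  obtain z where z: "norm (z - x) \<le> 2 * t"
    "f (x + t *\<^sub>R axis j 1 + t *\<^sub>R axis i 1) - f (x + t *\<^sub>R axis j 1) - f (x + t *\<^sub>R axis i 1) + f x
      = t * t * pd i (pd j f) z"
    by (rule second_difference_eq_pd_pd[OF assms(2) t(1) inS, of j i])
  have "x + t *\<^sub>R axis j 1 + t *\<^sub>R axis i 1 = x + t *\<^sub>R axis i 1 + t *\<^sub>R axis j 1" by (simp add: algebra_simps)
  from y(2) z(2)[unfolded this] have "t * t * pd j (pd i f) y = t * t * pd i (pd j f) z" by linarith
  then have "pd j (pd i f) y = pd i (pd j f) z" using t(1) by simp
  moreover have "dist (pd j (pd i f) y) (pd j (pd i f) x) < e" using y t by (intro d2) (simp add: dist_norm)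
  moreover have "dist (pd i (pd j f) z) (pd i (pd j f) x) < e" using z t by (intro d1) (simp add: dist_norm)
  ultimately have "\<bar>pd i (pd j f) z - pd j (pd i f) x\<bar> < e" "\<bar>pd i (pd j f) z - pd i (pd j f) x\<bar> < e"
    by (simp_all add: dist_real_def)
  then have "\<bar>pd i (pd j f) x - pd j (pd i f) x\<bar> < e + e" by linarith
  then show False by (simp add: e_def)
qed

section \<open>Symmetric matrices and Cramer's rule\<close>

definition cramer_vec :: "real^'n^'n::finite \<Rightarrow> real^'n \<Rightarrow> real^'n" where
  "cramer_vec A b = (\<chi> k. det (\<chi> i j. if j = k then b $ i else A $ i $ j))"

lemma cramer_vec_mult: "cramer_vec A (A *v x) = det A *\<^sub>R x"
  by (simp add: cramer_vec_def vec_eq_iff cramer_lemma)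

lemma mult_cramer_vec:
  assumes "det A \<noteq> 0" shows "A *v cramer_vec A b = det A *\<^sub>R b"
proof -
  have "(\<chi> k. det (\<chi> i j. if j = k then b $ i else A $ i $ j) / det A) = (1 / det A) *\<^sub>R cramer_vec A b"
    by (simp add: vec_eq_iff cramer_vec_def)
  with cramer[OF assms, of "(1 / det A) *\<^sub>R cramer_vec A b" b]
  have "A *v ((1 / det A) *\<^sub>R cramer_vec A b) = b" by simp
  then have "det A *\<^sub>R (A *v ((1 / det A) *\<^sub>R cramer_vec A b)) = det A *\<^sub>R b" by simp
  then show ?thesis using assms by (simp add: matrix_vector_mult_scaleR)
qed

lemma transpose_inner: "(transpose A *v v) \<bullet> w = v \<bullet> (A *v w)"
  for A :: "real^'n::finite^'m::finite"
  by (simp add: dot_lmul_matrix[symmetric] transpose_matrix_vector)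

lemma sym_form_iff_transpose: "sym_form B \<longleftrightarrow> transpose B = B"
proof
  assume "transpose B = B"
  then show "sym_form B" unfolding sym_form_def
    by (metis inner_commute transpose_inner)
next
  assume s: "sym_form B"
  have "v \<bullet> (transpose B *v w) = v \<bullet> (B *v w)" for v w
    using s transpose_inner[of B w v] unfolding sym_form_def by (metis inner_commute)
  then have "transpose B *v w = B *v w" for w by (metis vector_eq_rdot inner_commute)
  then show "transpose B = B" by (simp add: matrix_eq)
qed

text \<open>For a positive definite matrix \<open>h\<close> the form \<open>t \<mapsto> t \<bullet> (h t h)\<close> on matrices is
  positive definite: it is \<open>\<Sum>h\<^sub>i\<^sub>k (t\<^sub>i, t\<^sub>k)\<^sub>h\<close> for the rows of \<open>t\<close>, and a sum of
  this kind is treated by eliminating one index after the other (Schur complement).\<close>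

lemma sum_posdef_pos:
  fixes B :: "'v::real_vector \<Rightarrow> 'v \<Rightarrow> real"
  assumes "finite I" "bilinear B" "\<And>u v. B u v = B v u" "\<And>u. u \<noteq> 0 \<Longrightarrow> 0 < B u u"
    and "\<And>i k. A i k = A k i"
    and "\<And>x. (\<exists>i\<in>I. x i \<noteq> (0::real)) \<Longrightarrow> 0 < (\<Sum>i\<in>I. \<Sum>k\<in>I. A i k * (x i * x k))"
    and "\<exists>i\<in>I. t i \<noteq> 0"
  shows "0 < (\<Sum>i\<in>I. \<Sum>k\<in>I. A i k * B (t i) (t k))"
  using assms(1,5,6,7)
proof (induction I arbitrary: A t rule: finite_induct)
  case (insert a I)
  have Bl: "B (u + v) w = B u w + B v w" "B (c *\<^sub>R u) w = c * B u w" 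
      "B w (u + v) = B w u + B w v" "B w (c *\<^sub>R u) = c * B w u" for u v w c
    using assms(2) by (auto simp: bilinear_ladd bilinear_lmul bilinear_radd bilinear_rmul)
  have split: "(\<Sum>i\<in>insert a I. \<Sum>k\<in>insert a I. A i k * b i k)
      = A a a * b a a + 2 * (\<Sum>k\<in>I. A a k * b a k) + (\<Sum>i\<in>I. \<Sum>k\<in>I. A i k * b i k)"
    if "\<And>i k. b i k = b k i" for b :: "_ \<Rightarrow> _ \<Rightarrow> real"
  proof -
    have "(\<Sum>i\<in>I. A i a * b i a) = (\<Sum>k\<in>I. A a k * b a k)"
      by (intro sum.cong refl) (metis insert.prems(1) that)
    then show ?thesis using insert.hyps by (simp add: sum.distrib)
  qed
  define \<alpha> where "\<alpha> = A a a"
  have \<alpha>: "0 < \<alpha>"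
  proof -
    have "0 < (\<Sum>i\<in>insert a I. \<Sum>k\<in>insert a I. A i k * ((if i = a then 1 else 0) * (if k = a then 1 else 0)))"
      by (rule insert.prems(2)) auto
    also have "\<dots> = A a a"
    proof -
      have "(\<Sum>k\<in>I. A a k * ((if a = a then 1 else 0) * (if k = a then 1 else 0))) = 0"
        "(\<Sum>i\<in>I. \<Sum>k\<in>I. A i k * ((if i = a then 1 else 0) * (if k = a then 1 else 0))) = 0"
        using insert.hyps by (intro sum.neutral ballI; auto)+
      then show ?thesis by (subst split) simp_all
    qed
    finally show ?thesis by (simp add: \<alpha>_def)
  qed
  define A' where "A' = (\<lambda>i k. A i k - A a i * A a k / \<alpha>)"
  have complete: "(\<Sum>i\<in>insert a I. \<Sum>k\<in>insert a I. A i k * b i k)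
      = \<alpha> * (b a a + 2 * (\<Sum>k\<in>I. (A a k / \<alpha>) * b a k) + (\<Sum>i\<in>I. \<Sum>k\<in>I. (A a i / \<alpha>) * (A a k / \<alpha>) * b i k))
        + (\<Sum>i\<in>I. \<Sum>k\<in>I. A' i k * b i k)"
    if "\<And>i k. b i k = b k i" for b :: "_ \<Rightarrow> _ \<Rightarrow> real"
  proof -
    have "(\<Sum>i\<in>I. \<Sum>k\<in>I. A i k * b i k) = 
       \<alpha> * (\<Sum>i\<in>I. \<Sum>k\<in>I. (A a i / \<alpha>) * (A a k / \<alpha>) * b i k) + (\<Sum>i\<in>I. \<Sum>k\<in>I. A' i k * b i k)"
      using \<alpha> by (simp add: A'_def sum_distrib_left sum.distrib[symmetric] field_simps)
    then show ?thesis using \<alpha>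
      by (subst split[OF that]) (simp add: ring_distribs sum_distrib_left \<alpha>_def)
  qed
  have square: "(\<Sum>i\<in>insert a I. \<Sum>k\<in>insert a I. A i k * C (y i) (y k))
      = \<alpha> * C (y a + (\<Sum>k\<in>I. (A a k / \<alpha>) *\<^sub>R y k)) (y a + (\<Sum>k\<in>I. (A a k / \<alpha>) *\<^sub>R y k)) 
        + (\<Sum>i\<in>I. \<Sum>k\<in>I. A' i k * C (y i) (y k))"
    if C: "bilinear C" "\<And>u v. C u v = C v u" for C :: "'w::real_vector \<Rightarrow> 'w \<Rightarrow> real" and y
  proof -
    have Cs: "C (\<Sum>k\<in>I. c k *\<^sub>R y k) w = (\<Sum>k\<in>I. c k * C (y k) w)" 
      "C w (\<Sum>k\<in>I. c k *\<^sub>R y k) = (\<Sum>k\<in>I. c k * C w (y k))" for c w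
    proof -
      have l: "linear (C w)" "linear (\<lambda>v. C v w)" using C(1) by (simp_all add: bilinear_def)
      show "C w (\<Sum>k\<in>I. c k *\<^sub>R y k) = (\<Sum>k\<in>I. c k * C w (y k))"
        using linear_sum[OF l(1), of "\<lambda>k. c k *\<^sub>R y k" I] by (simp add: linear_scale[OF l(1)])
      show "C (\<Sum>k\<in>I. c k *\<^sub>R y k) w = (\<Sum>k\<in>I. c k * C (y k) w)"
        using linear_sum[OF l(2), of "\<lambda>k. c k *\<^sub>R y k" I] by (simp add: linear_scale[OF l(2)])
    qed
    have "C (y a + (\<Sum>k\<in>I. (A a k / \<alpha>) *\<^sub>R y k)) (y a + (\<Sum>k\<in>I. (A a k / \<alpha>) *\<^sub>R y k)) 
      = C (y a) (y a) + 2 * (\<Sum>k\<in>I. (A a k / \<alpha>) * C (y a) (y k))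
        + (\<Sum>i\<in>I. \<Sum>k\<in>I. (A a i / \<alpha>) * (A a k / \<alpha>) * C (y i) (y k))"
    proof -
      define z where "z = (\<Sum>k\<in>I. (A a k / \<alpha>) *\<^sub>R y k)"
      have "C (y a + z) (y a + z) = C (y a) (y a) + 2 * C (y a) z + C z z"
        using C(2)[of z "y a"] by (simp add: bilinear_ladd[OF C(1)] bilinear_radd[OF C(1)])
      moreover have "C (y a) z = (\<Sum>k\<in>I. (A a k / \<alpha>) * C (y a) (y k))"
        unfolding z_def by (rule Cs)
      moreover have "C z z = (\<Sum>i\<in>I. \<Sum>k\<in>I. (A a i / \<alpha>) * (A a k / \<alpha>) * C (y i) (y k))"
      proof -
        have "C z z = (\<Sum>i\<in>I. (A a i / \<alpha>) * C (y i) z)"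
          using Cs(1)[of "\<lambda>k. A a k / \<alpha>" z] by (simp only: z_def)
        also have "\<dots> = (\<Sum>i\<in>I. (A a i / \<alpha>) * (\<Sum>k\<in>I. (A a k / \<alpha>) * C (y i) (y k)))"
          by (simp only: z_def Cs(2))
        finally show ?thesis by (simp only: sum_distrib_left mult.assoc)
      qed
      ultimately show ?thesis by (simp add: z_def)
    qed
    then show ?thesis using complete[of "\<lambda>i k. C (y i) (y k)"] C(2) by simp
  qed
  have bil: "bilinear ((*) :: real \<Rightarrow> real \<Rightarrow> real)"
    by (auto simp: bilinear_def linear_iff algebra_simps)
  have pos': "0 < (\<Sum>i\<in>I. \<Sum>k\<in>I. A' i k * (x i * x k))" if x: "\<exists>i\<in>I. x i \<noteq> (0::real)" for x
  proof -
    define y where "y k = (if k = a then - (\<Sum>k\<in>I. (A a k / \<alpha>) * x k) else x k)" for k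
    have yI: "y k = x k" if "k \<in> I" for k using that insert.hyps by (auto simp: y_def)
    have "(\<Sum>i\<in>insert a I. \<Sum>k\<in>insert a I. A i k * (y i * y k))
      = \<alpha> * ((y a + (\<Sum>k\<in>I. (A a k / \<alpha>) *\<^sub>R y k)) * (y a + (\<Sum>k\<in>I. (A a k / \<alpha>) *\<^sub>R y k))) 
        + (\<Sum>i\<in>I. \<Sum>k\<in>I. A' i k * (y i * y k))"
      using bil by (rule square) simp
    also have "y a + (\<Sum>k\<in>I. (A a k / \<alpha>) *\<^sub>R y k) = 0"
      using yI by (simp add: y_def[of a] cong: sum.cong)
    also have "(\<Sum>i\<in>I. \<Sum>k\<in>I. A' i k * (y i * y k)) = (\<Sum>i\<in>I. \<Sum>k\<in>I. A' i k * (x i * x k))"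
      using yI by (intro sum.cong refl) auto
    finally have eq: "(\<Sum>i\<in>insert a I. \<Sum>k\<in>insert a I. A i k * (y i * y k))
      = (\<Sum>i\<in>I. \<Sum>k\<in>I. A' i k * (x i * x k))" by simp
    obtain i where "i \<in> I" "x i \<noteq> 0" using x by blast
    then have "\<exists>i\<in>insert a I. y i \<noteq> 0" using yI[of i] by (intro bexI[of _ i]) simp_all
    from insert.prems(2)[OF this] show ?thesis unfolding eq .
  qed
  define w where "w = t a + (\<Sum>k\<in>I. (A a k / \<alpha>) *\<^sub>R t k)"
  have tot: "(\<Sum>i\<in>insert a I. \<Sum>k\<in>insert a I. A i k * B (t i) (t k))
      = \<alpha> * B w w + (\<Sum>i\<in>I. \<Sum>k\<in>I. A' i k * B (t i) (t k))"
    unfolding w_def using assms(2,3) by (rule square)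
  have w0: "0 \<le> \<alpha> * B w w" using \<alpha> assms(4)[of w] Bl(2)[of 0 w w] by (cases "w = 0") auto
  show ?case
  proof (cases "\<exists>i\<in>I. t i \<noteq> 0")
    case True
    then have "0 < (\<Sum>i\<in>I. \<Sum>k\<in>I. A' i k * B (t i) (t k))"
      using pos' insert.prems(1) by (intro insert.IH) (auto simp: A'_def)
    then show ?thesis unfolding tot using w0 by linarith
  next
    case False
    then have "w = t a" "t a \<noteq> 0" using insert.prems(3) by (auto simp: w_def)
    moreover have "(\<Sum>i\<in>I. \<Sum>k\<in>I. A' i k * B (t i) (t k)) = 0"
      using False Bl(2)[of 0 0] by (intro sum.neutral ballI) auto
    ultimately show ?thesis unfolding tot using \<alpha> assms(4) by simp
  qed
qed simp

definition posdef :: "real^'n^'n::finite \<Rightarrow> bool" where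
  "posdef h \<longleftrightarrow> transpose h = h \<and> (\<forall>v. v \<noteq> 0 \<longrightarrow> 0 < v \<bullet> (h *v v))"

lemma inner_matrix_sum: "v \<bullet> (h *v w) = (\<Sum>i\<in>UNIV. \<Sum>k\<in>UNIV. h $ i $ k * (v $ i * w $ k))"
  by (simp add: inner_vec_def matrix_vector_mult_def sum_distrib_left mult_ac)

lemma posdef_sandwich:
  assumes "posdef h" "t \<noteq> 0"
  shows "0 < t \<bullet> (h ** t ** h)"
proof -
  have sym: "h $ i $ k = h $ k $ i" for i k
    using assms(1) unfolding posdef_def by (metis transpose_def vec_lambda_beta)
  have sf: "v \<bullet> (h *v w) = w \<bullet> (h *v v)" for v w
    using assms(1) unfolding posdef_def sym_form_iff_transpose[symmetric] sym_form_def by blast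
  have "0 < (\<Sum>i\<in>UNIV. \<Sum>k\<in>UNIV. h $ i $ k * (t $ i \<bullet> (h *v t $ k)))"
  proof (rule sum_posdef_pos)
    show "bilinear (\<lambda>u v. u \<bullet> (h *v v))"
      by (auto simp: bilinear_def linear_iff algebra_simps inner_add_left)
    show "0 < (\<Sum>i\<in>UNIV. \<Sum>k\<in>UNIV. h $ i $ k * (x i * x k))" if "\<exists>i\<in>UNIV. x i \<noteq> 0" for x
    proof -
      have "(\<chi> i. x i) \<noteq> 0" using that by (auto simp: vec_eq_iff)
      then have "0 < (\<chi> i. x i) \<bullet> (h *v (\<chi> i. x i))" using assms(1) unfolding posdef_def by blast
      then show ?thesis unfolding inner_matrix_sum by simp
    qed
    show "\<exists>i\<in>UNIV. t $ i \<noteq> 0" using assms(2) by (auto simp: vec_eq_iff)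
  qed (use assms(1) sym sf in \<open>auto simp: posdef_def\<close>)
  also have "(\<Sum>i\<in>UNIV. \<Sum>k\<in>UNIV. h $ i $ k * (t $ i \<bullet> (h *v t $ k))) = t \<bullet> (h ** t ** h)"
  proof -
    have "t $ i \<bullet> ((h ** t ** h) $ i) = (\<Sum>k\<in>UNIV. h $ i $ k * (t $ i \<bullet> (h *v t $ k)))" for i
    proof -
      have "(h ** t ** h) $ i = (\<Sum>k\<in>UNIV. h $ i $ k *\<^sub>R (h *v t $ k))"
      proof (subst vec_eq_iff, intro allI)
        fix l
        have "(h ** t ** h) $ i $ l = (\<Sum>j\<in>UNIV. \<Sum>k\<in>UNIV. h $ i $ k * t $ k $ j * h $ j $ l)"
          by (simp add: matrix_matrix_mult_def sum_distrib_right)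
        also have "\<dots> = (\<Sum>k\<in>UNIV. \<Sum>j\<in>UNIV. h $ i $ k * t $ k $ j * h $ j $ l)" by (rule sum.swap)
        also have "\<dots> = (\<Sum>k\<in>UNIV. h $ i $ k *\<^sub>R (h *v t $ k)) $ l"
          using sym[of l] by (simp add: matrix_vector_mult_def sum_distrib_left mult_ac)
        finally show "(h ** t ** h) $ i $ l = (\<Sum>k\<in>UNIV. h $ i $ k *\<^sub>R (h *v t $ k)) $ l" .
      qed
      then show ?thesis by (simp add: inner_sum_right)
    qed
    then show ?thesis by (simp add: inner_vec_def[of t])
  qed
  finally show ?thesis .
qed

text \<open>Positive definiteness gives injectivity, which for a square matrix is invertibility.\<close>

lemma posdef_matrix_inv:
  assumes "posdef h"
  shows "h ** matrix_inv h = mat 1" "matrix_inv h ** h = mat 1" "transpose (matrix_inv h) = matrix_inv h"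
proof -
  have "inj ((*v) h)"
  proof (rule injI)
    fix x y assume "h *v x = h *v y"
    then have "(x - y) \<bullet> (h *v (x - y)) = 0" by (simp add: matrix_vector_mult_diff_distrib)
    then show "x = y" using assms unfolding posdef_def by (metis eq_iff_diff_eq_0 less_irrefl)
  qed
  then have "\<exists>A'. h ** A' = mat 1 \<and> A' ** h = mat 1"
    by (metis matrix_left_right_inverse matrix_left_invertible_injective)
  then show i: "h ** matrix_inv h = mat 1" "matrix_inv h ** h = mat 1"
    unfolding matrix_inv_def by (metis (mono_tags, lifting) someI_ex)+
  have "transpose (matrix_inv h) ** h = mat 1"
    using i(1) assms unfolding posdef_def by (metis matrix_transpose_mul transpose_mat)
  then show "transpose (matrix_inv h) = matrix_inv h"
    by (metis i(1) matrix_mul_assoc matrix_mul_lid matrix_mul_rid)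
qed

text \<open>By homogeneity only unit vectors matter, and the product of a compact set with the unit sphere is
  compact.\<close>

lemma quadratic_form_bounds:
  fixes q :: "'x::metric_space \<Rightarrow> 'c::euclidean_space \<Rightarrow> real"
  assumes "compact K" "continuous_on (K \<times> UNIV) (\<lambda>(x, v). q x v)"
    and "\<And>x r v. x \<in> K \<Longrightarrow> q x (r *\<^sub>R v) = r\<^sup>2 * q x v" "\<And>x v. x \<in> K \<Longrightarrow> v \<noteq> 0 \<Longrightarrow> 0 < q x v"
  obtains a b where "0 < a" "0 < b" "\<And>x v. x \<in> K \<Longrightarrow> a * (norm v)\<^sup>2 \<le> q x v \<and> q x v \<le> b * (norm v)\<^sup>2"
proof (cases "K = {}")
  case False
  let ?C = "K \<times> sphere (0::'c) 1"
  have C: "compact ?C" "?C \<noteq> {}" using assms(1) False by (auto intro!: compact_Times)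
  have cont: "continuous_on ?C (\<lambda>(x, v). q x v)" using assms(2) by (rule continuous_on_subset) auto
  obtain z where z: "z \<in> ?C" "\<And>y. y \<in> ?C \<Longrightarrow> (case z of (x, v) \<Rightarrow> q x v) \<le> (case y of (x, v) \<Rightarrow> q x v)"
    using continuous_attains_inf[OF C cont] by blast
  obtain z' where z': "z' \<in> ?C" "\<And>y. y \<in> ?C \<Longrightarrow> (case y of (x, v) \<Rightarrow> q x v) \<le> (case z' of (x, v) \<Rightarrow> q x v)"
    using continuous_attains_sup[OF C cont] by blast
  define a b where "a = (case z of (x, v) \<Rightarrow> q x v)" and "b = (case z' of (x, v) \<Rightarrow> q x v)"
  have a: "0 < a" 
  proof -
    obtain x v where "z = (x, v)" by (cases z)
    with z(1) have "x \<in> K" "v \<noteq> 0" by auto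
    with \<open>z = (x, v)\<close> assms(4) show ?thesis by (simp add: a_def)
  qed
  have ab: "a \<le> b" unfolding a_def b_def using z z' by blast
  show ?thesis
  proof (rule that[of a b])
    fix x v assume x: "x \<in> K"
    show "a * (norm v)\<^sup>2 \<le> q x v \<and> q x v \<le> b * (norm v)\<^sup>2"
    proof (cases "v = 0")
      case True
      then show ?thesis using assms(3)[OF x, of 0 0] by simp
    next
      case False
      let ?u = "(1 / norm v) *\<^sub>R v"
      have u: "(x, ?u) \<in> ?C" using x False by simp
      have "q x v = (norm v)\<^sup>2 * q x ?u" using assms(3)[OF x, of "norm v" ?u] False by simp
      with z(2)[OF u] z'(2)[OF u] show ?thesis
        by (simp add: a_def b_def mult.commute[of _ "(norm v)\<^sup>2"] mult_left_mono)
    qed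
  qed (use a ab in auto)
qed (rule that[of 1 1], auto)

section \<open>Charts\<close>

definition cimg :: "('a, 'n::finite) chart \<Rightarrow> (real^'n) set" where
  "cimg c = snd c ` fst c"

text \<open>Both a manifold and each of its chart domains, as open submanifolds, are instances.\<close>

locale atlas =
  fixes M :: "('a, 'n::finite) manifold"
  assumes Hausdorff: "Hausdorff_space (mtop M)"
    and is_chart: "c \<in> charts M \<Longrightarrow> is_chart (mtop M) c"
    and cover: "(\<Union>c\<in>charts M. fst c) = topspace (mtop M)"
    and compatible: "c \<in> charts M \<Longrightarrow> d \<in> charts M \<Longrightarrow> compatible c d"
begin

lemma open_cimg [simp, intro]: "c \<in> charts M \<Longrightarrow> open (cimg c)"
  using is_chart unfolding is_chart_def cimg_def by blast

lemma openin_chart: "c \<in> charts M \<Longrightarrow> openin (mtop M) (fst c)"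
  using is_chart unfolding is_chart_def by blast

lemma topspace_chart: "c \<in> charts M \<Longrightarrow> topspace (subtopology (mtop M) (fst c)) = fst c"
  using openin_subset[OF openin_chart[of c]] by auto

lemma homeo: "c \<in> charts M \<Longrightarrow> homeomorphic_map (subtopology (mtop M) (fst c)) (top_of_set (cimg c)) (snd c)"
  using is_chart unfolding is_chart_def cimg_def by blast

lemma chart_inj: "c \<in> charts M \<Longrightarrow> inj_on (snd c) (fst c)"
  using homeomorphic_imp_injective_map[OF homeo] topspace_chart by metis

lemma chart_inv_left [simp]: "c \<in> charts M \<Longrightarrow> p \<in> fst c \<Longrightarrow> chart_inv c (snd c p) = p"
  unfolding chart_inv_def by (rule inv_into_f_f[OF chart_inj])

lemma chart_inv_right [simp]: "x \<in> cimg c \<Longrightarrow> snd c (chart_inv c x) = x"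
  unfolding chart_inv_def cimg_def by (rule f_inv_into_f)

lemma chart_inv_in [simp]: "x \<in> cimg c \<Longrightarrow> chart_inv c x \<in> fst c"
  unfolding chart_inv_def cimg_def by (rule inv_into_into)

lemma snd_in_cimg [simp]: "p \<in> fst c \<Longrightarrow> snd c p \<in> cimg c"
  unfolding cimg_def by blast

lemma open_chart_image:
  assumes "c \<in> charts M" "openin (mtop M) U"
  shows "open (snd c ` (fst c \<inter> U))"
proof -
  have "openin (subtopology (mtop M) (fst c)) (fst c \<inter> U)"
    using assms(2) by (auto simp: openin_subtopology)
  then have "openin (top_of_set (cimg c)) (snd c ` (fst c \<inter> U))"
    using homeomorphic_map_openness_eq[OF homeo[OF assms(1)]] by blast
  then show ?thesis using openin_open_trans open_cimg[OF assms(1)] by blast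
qed

lemma openin_chart_preimage:
  assumes "c \<in> charts M" "open V"
  shows "openin (mtop M) {p \<in> fst c. snd c p \<in> V}"
proof -
  have "openin (top_of_set (cimg c)) (cimg c \<inter> V)" using assms(2) by (rule openin_open_Int)
  then have "openin (subtopology (mtop M) (fst c)) {p \<in> topspace (subtopology (mtop M) (fst c)). snd c p \<in> cimg c \<inter> V}"
    by (rule openin_continuous_map_preimage[OF homeomorphic_imp_continuous_map[OF homeo[OF assms(1)]]])
  moreover have "{p \<in> topspace (subtopology (mtop M) (fst c)). snd c p \<in> cimg c \<inter> V} = {p \<in> fst c. snd c p \<in> V}"
    using topspace_chart[OF assms(1)] by auto
  ultimately show ?thesis
    using openin_chart[OF assms(1)] openin_trans_full by metis
qed

lemma compact_chart_image:
  assumes "c \<in> charts M" "compactin (mtop M) K" "K \<subseteq> fst c"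
  shows "compact (snd c ` K)"
proof -
  have "compactin (subtopology (mtop M) (fst c)) K" using assms by (simp add: compactin_subtopology)
  then have "compactin (top_of_set (cimg c)) (snd c ` K)"
    by (rule image_compactin[OF _ homeomorphic_imp_continuous_map[OF homeo[OF assms(1)]]])
  then show ?thesis by (simp add: compactin_subtopology)
qed

lemma compactin_chart_inv:
  assumes "c \<in> charts M" "compact L" "L \<subseteq> cimg c"
  shows "compactin (mtop M) (chart_inv c ` L)"
proof -
  have "chart_inv c ` L \<subseteq> topspace (subtopology (mtop M) (fst c))"
    using assms topspace_chart by auto
  moreover have "snd c ` (chart_inv c ` L) = L" using assms(3) by (force simp: image_image)
  moreover have "compactin (top_of_set (cimg c)) L" using assms by (simp add: compactin_subtopology)
  ultimately have "compactin (subtopology (mtop M) (fst c)) (chart_inv c ` L)"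
    using homeomorphic_map_compactness[OF homeo[OF assms(1)]] by metis
  then show ?thesis by (simp add: compactin_subtopology)
qed

lemma chart_at:
  assumes "c \<in> charts M" "p \<in> fst c"
  shows "chart_at M p \<in> charts M \<and> p \<in> fst (chart_at M p)"
proof -
  have "\<exists>c. c \<in> charts M \<and> p \<in> fst c" using assms by blast
  then show ?thesis unfolding chart_at_def by (rule someI_ex)
qed

text \<open>Coordinate balls with compact closure inside a chart are neighbourhoods of their centres, so finitely
  many of them suffice.\<close>

lemma compact_chart_cover:
  assumes "compactin (mtop M) K"
  obtains I where "finite I" "\<And>c L. (c, L) \<in> I \<Longrightarrow> c \<in> charts M \<and> compact L \<and> L \<subseteq> cimg c"
    "K \<subseteq> (\<Union>(c, L)\<in>I. chart_inv c ` L)"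
proof -
  have "\<exists>c L. c \<in> charts M \<and> p \<in> fst c \<and> compact L \<and> L \<subseteq> cimg c \<and> snd c p \<in> interior L" if "p \<in> K" for p
  proof -
    have "p \<in> topspace (mtop M)" using assms that by (auto simp: compactin_def)
    then obtain c where c: "c \<in> charts M" "p \<in> fst c" using cover by blast
    then obtain e where "0 < e" "cball (snd c p) e \<subseteq> cimg c"
      using open_contains_cball[of "cimg c"] snd_in_cimg[OF c(2)] open_cimg[OF c(1)] by blast
    with c show ?thesis by (intro exI[of _ c] exI[of _ "cball (snd c p) e"]) auto
  qed
  then obtain C L where CL: "\<And>p. p \<in> K \<Longrightarrow> C p \<in> charts M \<and> p \<in> fst (C p) \<and> compact (L p) \<and>
      L p \<subseteq> cimg (C p) \<and> snd (C p) p \<in> interior (L p)" by metis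
  define U where "U p = {q \<in> fst (C p). snd (C p) q \<in> interior (L p)}" for p
  have "\<forall>B\<in>U ` K. openin (mtop M) B" using CL openin_chart_preimage unfolding U_def by blast
  moreover have "K \<subseteq> \<Union>(U ` K)" using CL by (auto simp: U_def)
  ultimately obtain FF where FF: "finite FF" "FF \<subseteq> U ` K" "K \<subseteq> \<Union>FF"
    using assms unfolding compactin_def by meson
  obtain F where F: "F \<subseteq> K" "finite F" "FF = U ` F" using finite_subset_image[OF FF(1,2)] by blast
  show ?thesis
  proof (rule that[of "(\<lambda>p. (C p, L p)) ` F"])
    show "K \<subseteq> (\<Union>(c, l)\<in>(\<lambda>p. (C p, L p)) ` F. chart_inv c ` l)"
    proof
      fix q assume "q \<in> K"
      then obtain p where p: "p \<in> F" "q \<in> U p" using FF F by blast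
      then have "q = chart_inv (C p) (snd (C p) q)" "snd (C p) q \<in> L p"
        using CL[of p] F interior_subset[of "L p"] by (auto simp: U_def)
      with p show "q \<in> (\<Union>(c, l)\<in>(\<lambda>p. (C p, L p)) ` F. chart_inv c ` l)" by auto
    qed
    show "c \<in> charts M \<and> compact l \<and> l \<subseteq> cimg c" if "(c, l) \<in> (\<lambda>p. (C p, L p)) ` F" for c l
    proof -
      from that obtain p where "p \<in> F" "c = C p" "l = L p" by blast
      then show ?thesis using CL[of p] F(1) by blast
    qed
  qed (use F in auto)
qed

definition overlap :: "('a, 'n) chart \<Rightarrow> ('a, 'n) chart \<Rightarrow> (real^'n) set" where
  "overlap c d = snd c ` (fst c \<inter> fst d)"

lemma open_overlap [simp, intro]: "c \<in> charts M \<Longrightarrow> d \<in> charts M \<Longrightarrow> open (overlap c d)"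
  unfolding overlap_def by (intro open_chart_image openin_chart)

lemma overlap_iff: "c \<in> charts M \<Longrightarrow> x \<in> overlap c d \<longleftrightarrow> x \<in> cimg c \<and> chart_inv c x \<in> fst d"
  unfolding overlap_def cimg_def by (auto simp: image_iff)

lemma overlap_subset: "overlap c d \<subseteq> cimg c"
  unfolding overlap_def cimg_def by blast

lemma snd_in_overlap [simp]: "p \<in> fst c \<Longrightarrow> p \<in> fst d \<Longrightarrow> snd c p \<in> overlap c d"
  unfolding overlap_def by blast

lemma transition_apply [simp]: "c \<in> charts M \<Longrightarrow> p \<in> fst c \<Longrightarrow> transition c d (snd c p) = snd d p"
  by (simp add: transition_def)

lemma transition_in: "c \<in> charts M \<Longrightarrow> x \<in> overlap c d \<Longrightarrow> transition c d x \<in> overlap d c"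
  unfolding overlap_def by auto

lemma chart_inv_transition: 
  "c \<in> charts M \<Longrightarrow> d \<in> charts M \<Longrightarrow> x \<in> overlap c d \<Longrightarrow> chart_inv d (transition c d x) = chart_inv c x"
  unfolding overlap_def by auto

lemma transition_inverse: 
  "c \<in> charts M \<Longrightarrow> d \<in> charts M \<Longrightarrow> x \<in> overlap c d \<Longrightarrow> transition d c (transition c d x) = x"
  unfolding overlap_def by auto

lemma smooth_transition: "c \<in> charts M \<Longrightarrow> d \<in> charts M \<Longrightarrow> smooth_on (overlap c d) (transition c d)"
  using compatible unfolding compatible_def overlap_def by blast

lemma smooth_on_transition_compose:
  assumes "c \<in> charts M" "d \<in> charts M" "smooth_on (overlap d c) f"
  shows "smooth_on (overlap c d) (\<lambda>x. f (transition c d x))"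
  by (rule smooth_on_compose[OF open_overlap[OF assms(1,2)] open_overlap[OF assms(2,1)]
        smooth_transition[OF assms(1,2)] transition_in[OF assms(1)] assms(3)])

lemma closedin_chart_inv:
  assumes "c \<in> charts M" "compact L" "L \<subseteq> cimg c"
  shows "closedin (mtop M) (chart_inv c ` L)"
  using compactin_imp_closedin[OF Hausdorff compactin_chart_inv[OF assms]] .

text \<open>Functions on an overlap that vanish outside a compact subset of the other chart extend
  smoothly by zero: compact sets are closed because the space is Hausdorff.\<close>

lemma smooth_on_extend_zero:
  assumes cd: "c \<in> charts M" "d \<in> charts M" and L: "compact L" "L \<subseteq> cimg c"
    and h: "smooth_on (overlap d c) h" "\<And>y. y \<in> overlap d c \<Longrightarrow> transition d c y \<notin> L \<Longrightarrow> h y = 0"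
  shows "smooth_on (cimg d) (\<lambda>y. if y \<in> overlap d c then h y else 0)"
proof (rule smooth_on_locally)
  fix x assume x: "x \<in> cimg d"
  show "\<exists>U. open U \<and> x \<in> U \<and> smooth_on U (\<lambda>y. if y \<in> overlap d c then h y else 0)"
  proof (cases "x \<in> overlap d c")
    case True
    have "smooth_on (overlap d c) (\<lambda>y. if y \<in> overlap d c then h y else 0)"
      using h(1) cd by (intro smooth_on_cong[OF _ _ h(1)]) auto
    with True cd show ?thesis by blast
  next
    case False
    define U where "U = snd d ` (fst d \<inter> (topspace (mtop M) - chart_inv c ` L))"
    have "open U" unfolding U_def
      using closedin_chart_inv[OF cd(1) L] by (intro open_chart_image cd) (auto simp: closedin_def)
    moreover have "x \<in> U"
    proof -
      have "chart_inv d x \<notin> fst c" using False x overlap_iff[OF cd(2)] by blast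
      then have "chart_inv d x \<notin> chart_inv c ` L" using L(2) by auto
      moreover have "chart_inv d x \<in> topspace (mtop M)"
        using x cd cover chart_inv_in[OF x] by blast
      ultimately show ?thesis unfolding U_def using x
        by (intro image_eqI[of _ _ "chart_inv d x"]) auto
    qed
    moreover have "smooth_on U (\<lambda>y. if y \<in> overlap d c then h y else 0)"
    proof (rule smooth_on_cong[OF \<open>open U\<close>])
      show "smooth_on U (\<lambda>_. 0)" unfolding smooth_on_iff_moderate_on by (rule moderate_on_const)
      fix y assume "y \<in> U"
      then obtain q where q: "q \<in> fst d" "q \<notin> chart_inv c ` L" "y = snd d q" by (auto simp: U_def)
      show "0 = (if y \<in> overlap d c then h y else 0)"
      proof (cases "y \<in> overlap d c")
        case True
        have qc: "q \<in> fst c" using True q cd overlap_iff[OF cd(2), of y c] by auto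
        then have "snd c q \<notin> L" using q(2) cd(1) by (metis chart_inv_left image_eqI)
        then show ?thesis using h(2)[OF True] q cd by auto
      qed simp
    qed
    ultimately show ?thesis by blast
  qed
qed

lemma jacobian_nth: "jacobian c d p $ i $ j = pd j (transition c d) (snd c p) $ i"
  by (simp add: jacobian_def matrix_def pd_def)

lemma frechet_transition:
  assumes "c \<in> charts M" "d \<in> charts M" "p \<in> fst c" "p \<in> fst d"
  shows "(transition c d has_derivative (\<lambda>v. jacobian c d p *v v)) (at (snd c p))"
proof -
  have d: "transition c d differentiable at (snd c p)"
    using smooth_transition[OF assms(1,2)] assms(3,4) by (intro smooth_on_differentiable) auto
  then show ?thesis
    unfolding jacobian_def using matrix_works[OF linear_matrix_vector_mul_eq[THEN iffD2, OF linear_frechet_derivative[OF d]]]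
    by (simp add: frechet_derivative_works)
qed

lemma smooth_jacobian:
  assumes "c \<in> charts M" "d \<in> charts M"
  shows "smooth_on (overlap c d) (\<lambda>x. jacobian c d (chart_inv c x))"
proof (rule smooth_on_cong[OF open_overlap[OF assms]])
  have "moderate_on (overlap c d) (\<lambda>_ x. (\<chi> i j. pd j (transition c d) x $ i))"
    using assms smooth_on_pd[OF smooth_transition[OF assms]]
    by (intro moderate_on_vec) (auto intro!: moderate_intros simp: smooth_on_iff_moderate_on)
  then show "smooth_on (overlap c d) (\<lambda>x. (\<chi> i j. pd j (transition c d) x $ i))"
    unfolding smooth_on_iff_moderate_on .
  fix x assume "x \<in> overlap c d"
  then have "x \<in> cimg c" using overlap_subset by blast
  then show "(\<chi> i j. pd j (transition c d) x $ i) = jacobian c d (chart_inv c x)"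
    by (simp add: vec_eq_iff jacobian_nth)
qed

lemma jacobian_refl:
  assumes "c \<in> charts M" "p \<in> fst c"
  shows "jacobian c c p = mat 1"
proof -
  have "((\<lambda>x. x) has_derivative (\<lambda>v. v)) (at (snd c p))" by simp
  then have "(transition c c has_derivative (\<lambda>v. v)) (at (snd c p))"
    by (rule has_derivative_transform_within_open[of _ _ _ _ "cimg c"]) (use assms in \<open>auto simp: transition_def\<close>)
  then have "(\<lambda>v. jacobian c c p *v v) = (\<lambda>v. v)"
    using frechet_transition[OF assms(1,1,2,2)] has_derivative_unique by blast
  then show ?thesis by (metis matrix_eq matrix_vector_mul_lid)
qed

lemma jacobian_trans:
  assumes "c \<in> charts M" "d \<in> charts M" "e \<in> charts M" "p \<in> fst c" "p \<in> fst d" "p \<in> fst e"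
  shows "jacobian d e p ** jacobian c d p = jacobian c e p"
proof -
  have "((transition d e \<circ> transition c d) has_derivative ((\<lambda>v. jacobian d e p *v v) \<circ> (\<lambda>v. jacobian c d p *v v))) (at (snd c p))"
    using frechet_transition[OF assms(1,2,4,5)] frechet_transition[OF assms(2,3,5,6)] assms
    by (intro diff_chain_at) auto
  then have "(transition c e has_derivative ((\<lambda>v. jacobian d e p *v v) \<circ> (\<lambda>v. jacobian c d p *v v))) (at (snd c p))"
  proof (rule has_derivative_transform_within_open[of _ _ _ _ "overlap c d"])
    fix x assume "x \<in> overlap c d"
    then show "(transition d e \<circ> transition c d) x = transition c e x"
      using assms chart_inv_transition[of c d x] by (simp add: transition_def)
  qed (use assms in auto)
  then have "((\<lambda>v. jacobian d e p *v v) \<circ> (\<lambda>v. jacobian c d p *v v)) = (\<lambda>v. jacobian c e p *v v)"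
    using frechet_transition[OF assms(1,3,4,6)] has_derivative_unique by blast
  then show ?thesis by (simp add: matrix_eq fun_eq_iff matrix_vector_mul_assoc)
qed

lemma jacobian_inverse:
  assumes "c \<in> charts M" "d \<in> charts M" "p \<in> fst c" "p \<in> fst d"
  shows "jacobian d c p ** jacobian c d p = mat 1"
  using jacobian_trans[of c d c p] jacobian_refl[of c p] assms by simp

lemma chart_deriv_transition:
  assumes cd: "c \<in> charts M" "d \<in> charts M" "p \<in> fst c" "p \<in> fst d" and f: "smooth_in_chart d f"
  shows "chart_deriv c p v f = chart_deriv d p (jacobian c d p *v v) f"
proof -
  have d: "(f \<circ> chart_inv d) differentiable at (snd d p)"
    using f cd unfolding smooth_in_chart_def by (intro smooth_on_differentiable) auto
  have "(((f \<circ> chart_inv d) \<circ> transition c d) has_derivative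
      (frechet_derivative (f \<circ> chart_inv d) (at (snd d p)) \<circ> (\<lambda>v. jacobian c d p *v v))) (at (snd c p))"
    using frechet_transition[OF cd] d cd by (intro diff_chain_at) (auto simp: frechet_derivative_works)
  then have "((f \<circ> chart_inv c) has_derivative
      (frechet_derivative (f \<circ> chart_inv d) (at (snd d p)) \<circ> (\<lambda>v. jacobian c d p *v v))) (at (snd c p))"
    by (rule has_derivative_transform_within_open[of _ _ _ _ "overlap c d"])
       (use cd chart_inv_transition[of c d] in auto)
  from frechet_derivative_at[OF this, symmetric] show ?thesis unfolding chart_deriv_def by simp
qed

end

section \<open>Linear differential operators in coordinates\<close>

definition local_diff_op ::
    "(real^'n::finite) set \<Rightarrow> nat \<Rightarrow> ((real^'n \<Rightarrow> 'c::real_normed_vector) \<Rightarrow> real^'n \<Rightarrow> 'c) \<Rightarrow> bool" where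
  "local_diff_op W m L \<longleftrightarrow> (\<exists>a :: 'n list \<Rightarrow> real^'n \<Rightarrow> ('c \<Rightarrow>\<^sub>L 'c). (\<forall>is. smooth_on W (a is)) \<and>
     (\<forall>f. smooth_on W f \<longrightarrow> (\<forall>y\<in>W. L f y = (\<Sum>is | length is \<le> m. blinfun_apply (a is y) (pderivs is f y)))))"

lemma finite_length_le [simp]: "finite {xs :: 'n::finite list. length xs \<le> m}"
  using finite_lists_length_le[of "UNIV :: 'n set" m] by simp

lemma smooth_on_blinfun_apply:
  "open S \<Longrightarrow> smooth_on S A \<Longrightarrow> smooth_on S f \<Longrightarrow> smooth_on S (\<lambda>x. blinfun_apply (A x) (f x))"
  unfolding smooth_on_iff_moderate_on by (rule moderate_on_bilinear[OF bounded_bilinear_blinfun_apply])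

lemma smooth_on_blinfun_compose:
  "open S \<Longrightarrow> smooth_on S A \<Longrightarrow> smooth_on S B \<Longrightarrow> smooth_on S (\<lambda>x. A x o\<^sub>L B x)"
  unfolding smooth_on_iff_moderate_on by (rule moderate_on_bilinear[OF bounded_bilinear_blinfun_compose])

lemma smooth_on_sum:
  "open S \<Longrightarrow> (\<And>i. i \<in> I \<Longrightarrow> smooth_on S (f i)) \<Longrightarrow> smooth_on S (\<lambda>x. \<Sum>i\<in>I. f i x)"
  unfolding smooth_on_iff_moderate_on by (rule moderate_on_sum)

lemma smooth_on_const: "smooth_on S (\<lambda>x. c)"
  unfolding smooth_on_iff_moderate_on by (rule moderate_on_const)

lemma smooth_on_scaleR:
  "open S \<Longrightarrow> smooth_on S A \<Longrightarrow> smooth_on S f \<Longrightarrow> smooth_on S (\<lambda>x. A x *\<^sub>R f x)"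
  unfolding smooth_on_iff_moderate_on by (rule moderate_on_scaleR)

lemma smooth_on_add:
  "open S \<Longrightarrow> smooth_on S f \<Longrightarrow> smooth_on S g \<Longrightarrow> smooth_on S (\<lambda>x. f x + g x)"
  unfolding smooth_on_iff_moderate_on by (rule moderate_on_add)

lemma smooth_on_nth: "open S \<Longrightarrow> smooth_on S f \<Longrightarrow> smooth_on S (\<lambda>x. f x $ i)"
  unfolding smooth_on_iff_moderate_on by (rule moderate_on_nth)

lemma smooth_on_pderivs: "smooth_on S f \<Longrightarrow> smooth_on S (pderivs is f)"
  by (induction "is") (simp_all only: pderivs.simps(1) pderivs_Cons_pd smooth_on_pd)

lemma local_diff_op_smooth:
  assumes "open W" "local_diff_op W m L" "smooth_on W f"
  shows "smooth_on W (L f)"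
proof -
  obtain a where a: "\<And>is. smooth_on W (a is)"
    "\<And>y. y \<in> W \<Longrightarrow> L f y = (\<Sum>is | length is \<le> m. blinfun_apply (a is y) (pderivs is f y))"
    using assms(2,3) unfolding local_diff_op_def by blast
  show ?thesis
  proof (rule smooth_on_cong[OF assms(1)])
    show "smooth_on W (\<lambda>y. \<Sum>is | length is \<le> m. blinfun_apply (a is y) (pderivs is f y))"
      using assms a(1) by (intro smooth_on_sum smooth_on_blinfun_apply smooth_on_pderivs)
  qed (use a(2) in simp)
qed

lemma local_diff_op_id: "local_diff_op W 0 (\<lambda>f y. f y)"
  unfolding local_diff_op_def by (rule exI[of _ "\<lambda>_ _. id_blinfun"]) (auto simp: smooth_on_const)

lemma local_diff_op_mult:
  assumes "open W" "local_diff_op W m L" "smooth_on W A"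
  shows "local_diff_op W m (\<lambda>f y. blinfun_apply (A y) (L f y))"
proof -
  obtain a where a: "\<And>is. smooth_on W (a is)"
    "\<And>f y. smooth_on W f \<Longrightarrow> y \<in> W \<Longrightarrow> L f y = (\<Sum>is | length is \<le> m. blinfun_apply (a is y) (pderivs is f y))"
    using assms(2) unfolding local_diff_op_def by blast
  show ?thesis unfolding local_diff_op_def
    using assms a by (intro exI[of _ "\<lambda>is y. A y o\<^sub>L a is y"])
      (auto intro!: smooth_on_blinfun_compose simp: blinfun.sum_right)
qed

lemma local_diff_op_sum:
  fixes L :: "'i \<Rightarrow> (real^'n::finite \<Rightarrow> 'c::real_normed_vector) \<Rightarrow> real^'n \<Rightarrow> 'c"
  assumes "open W" "\<And>k. k \<in> I \<Longrightarrow> local_diff_op W m (L k)"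
  shows "local_diff_op W m (\<lambda>f y. \<Sum>k\<in>I. L k f y)"
proof -
  have "\<forall>k\<in>I. \<exists>a. (\<forall>is. smooth_on W (a is)) \<and> (\<forall>f. smooth_on W f \<longrightarrow>
      (\<forall>y\<in>W. L k f y = (\<Sum>is | length is \<le> m. blinfun_apply (a is y) (pderivs is f y))))"
    using assms(2) unfolding local_diff_op_def by blast
  then obtain a where "\<forall>k\<in>I. (\<forall>is. smooth_on W (a k is)) \<and> (\<forall>f. smooth_on W f \<longrightarrow>
      (\<forall>y\<in>W. L k f y = (\<Sum>is | length is \<le> m. blinfun_apply (a k is y) (pderivs is f y))))"
    by (rule bchoice[THEN exE])
  then have a: "\<And>k is. k \<in> I \<Longrightarrow> smooth_on W (a k is)"
    "\<And>k f y. k \<in> I \<Longrightarrow> smooth_on W f \<Longrightarrow> y \<in> W \<Longrightarrow> L k f y = (\<Sum>is | length is \<le> m. blinfun_apply (a k is y) (pderivs is f y))"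
    by blast+
  show ?thesis unfolding local_diff_op_def
  proof (intro exI[of _ "\<lambda>is y. \<Sum>k\<in>I. a k is y"] conjI allI impI ballI)
    show "smooth_on W (\<lambda>y. \<Sum>k\<in>I. a k is y)" for "is" using assms(1) a(1) by (intro smooth_on_sum)
    fix f :: "real^'n \<Rightarrow> 'c" and y assume fy: "smooth_on W f" "y \<in> W"
    have "(\<Sum>k\<in>I. L k f y) = (\<Sum>k\<in>I. \<Sum>is | length is \<le> m. blinfun_apply (a k is y) (pderivs is f y))"
      using a(2) fy by simp
    also have "\<dots> = (\<Sum>is | length is \<le> m. \<Sum>k\<in>I. blinfun_apply (a k is y) (pderivs is f y))"
      by (rule sum.swap)
    finally show "(\<Sum>k\<in>I. L k f y) = (\<Sum>is | length is \<le> m. blinfun_apply (\<Sum>k\<in>I. a k is y) (pderivs is f y))"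
      by (simp add: blinfun.sum_left)
  qed
qed

lemma pd_sum:
  assumes "\<And>i. i \<in> I \<Longrightarrow> f i differentiable at x"
  shows "pd k (\<lambda>x. \<Sum>i\<in>I. f i x) x = (\<Sum>i\<in>I. pd k (f i) x)"
proof -
  have "((\<lambda>x. \<Sum>i\<in>I. f i x) has_derivative (\<lambda>h. \<Sum>i\<in>I. frechet_derivative (f i) (at x) h)) (at x)"
    using assms by (intro has_derivative_sum) (simp add: frechet_derivative_works)
  from pd_eq[OF this] show ?thesis by (simp add: pd_def)
qed

lemma local_diff_op_pd:
  fixes L :: "(real^'n::finite \<Rightarrow> 'c::real_normed_vector) \<Rightarrow> real^'n \<Rightarrow> 'c"
  assumes "open W" "local_diff_op W m L"
  shows "local_diff_op W (Suc m) (\<lambda>f. pd k (L f))"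
proof -
  obtain a where a: "\<And>is. smooth_on W (a is)"
    "\<And>f y. smooth_on W f \<Longrightarrow> y \<in> W \<Longrightarrow> L f y = (\<Sum>is | length is \<le> m. blinfun_apply (a is y) (pderivs is f y))"
    using assms(2) unfolding local_diff_op_def by blast
  define a1 where "a1 js y = (if length js \<le> m then pd k (a js) y else 0)" for js y
  define a2 where "a2 js y = (case js of [] \<Rightarrow> 0 | i # is \<Rightarrow> if i = k then a is y else 0)" for js y
  have s1: "smooth_on W (a1 js)" for js
    unfolding a1_def[abs_def] using smooth_on_pd[OF a(1)] smooth_on_const by (cases "length js \<le> m") auto
  have s2: "smooth_on W (a2 js)" for js
    unfolding a2_def[abs_def] using a(1) smooth_on_const
    by (cases js; cases "hd js = k") auto
  show ?thesis unfolding local_diff_op_def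
  proof (intro exI[of _ "\<lambda>is y. a1 is y + a2 is y"] conjI allI impI ballI)
    show "smooth_on W (\<lambda>y. a1 is y + a2 is y)" for "is" using assms(1) s1 s2 by (intro smooth_on_add)
    fix f :: "real^'n \<Rightarrow> 'c" and y assume fy: "smooth_on W f" "y \<in> W"
    note d = smooth_on_differentiable[OF a(1) fy(2)] smooth_on_differentiable[OF smooth_on_pderivs[OF fy(1)] fy(2)]
    have "pd k (L f) y = pd k (\<lambda>y. \<Sum>is | length is \<le> m. blinfun_apply (a is y) (pderivs is f y)) y"
      using a(2)[OF fy(1)] by (intro pd_cong_open[OF assms(1) fy(2)])
    also have "\<dots> = (\<Sum>is | length is \<le> m. pd k (\<lambda>y. blinfun_apply (a is y) (pderivs is f y)) y)"
      by (intro pd_sum differentiable_bilinear[OF bounded_bilinear_blinfun_apply] d)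
    also have "\<dots> = (\<Sum>is | length is \<le> m. blinfun_apply (a is y) (pderivs (k # is) f y) + blinfun_apply (pd k (a is) y) (pderivs is f y))"
      by (simp only: pd_bilinear[OF bounded_bilinear_blinfun_apply d] pderivs_Cons_pd)
    also have "\<dots> = (\<Sum>is | length is \<le> m. blinfun_apply (a is y) (pderivs (k # is) f y)) +
        (\<Sum>is | length is \<le> m. blinfun_apply (pd k (a is) y) (pderivs is f y))"
      by (rule sum.distrib)
    also have "(\<Sum>is | length is \<le> m. blinfun_apply (pd k (a is) y) (pderivs is f y))
      = (\<Sum>js | length js \<le> Suc m. blinfun_apply (a1 js y) (pderivs js f y))"
      by (rule sum.mono_neutral_cong_left) (auto simp: a1_def)
    also have "(\<Sum>is | length is \<le> m. blinfun_apply (a is y) (pderivs (k # is) f y))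
      = (\<Sum>js\<in>(#) k ` {is. length is \<le> m}. blinfun_apply (a2 js y) (pderivs js f y))"
      by (subst sum.reindex) (auto simp: a2_def inj_on_def)
    also have "\<dots> = (\<Sum>js | length js \<le> Suc m. blinfun_apply (a2 js y) (pderivs js f y))"
      by (rule sum.mono_neutral_left) (auto simp: a2_def image_iff split: list.split)
    finally show "pd k (L f) y = (\<Sum>is | length is \<le> Suc m. blinfun_apply (a1 is y + a2 is y) (pderivs is f y))"
      by (simp add: sum.distrib[symmetric] blinfun.add_left add.commute)
  qed
qed

text \<open>A partial derivative of arbitrary order taken in one chart is a differential operator in any
  other chart: every further derivative produces, by the chain rule, first derivatives of the
  operator found so far, with the entries of the Jacobian matrix as coefficients.\<close>

lemma local_diff_op_change_of_chart:
  fixes \<tau> \<sigma> :: "real^'n::finite \<Rightarrow> real^'n"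
  assumes W: "open W" "open W'" and "smooth_on W' \<tau>" "smooth_on W \<sigma>"
    and \<tau>: "\<And>x. x \<in> W' \<Longrightarrow> \<tau> x \<in> W \<and> \<sigma> (\<tau> x) = x" and \<sigma>: "\<And>y. y \<in> W \<Longrightarrow> \<sigma> y \<in> W' \<and> \<tau> (\<sigma> y) = y"
    and A: "smooth_on W' A"
  shows "local_diff_op W (length is) (\<lambda>f y. pderivs is (\<lambda>x. blinfun_apply (A x) (f (\<tau> x))) (\<sigma> y))"
proof (induction "is")
  case Nil
  have "\<And>y. y \<in> W \<Longrightarrow> \<sigma> y \<in> W'" using \<sigma> by blast
  from smooth_on_compose[OF W assms(4) this A] have "smooth_on W (\<lambda>y. A (\<sigma> y))" .
  from local_diff_op_mult[OF W(1) local_diff_op_id this] show ?case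
    unfolding local_diff_op_def using \<sigma> by simp
next
  case (Cons i "is")
  define L where "L = (\<lambda>f y. pderivs is (\<lambda>x. blinfun_apply (A x) (f (\<tau> x))) (\<sigma> y))"
  define B where "B k y = (pd i \<tau> (\<sigma> y) $ k) *\<^sub>R (id_blinfun :: 'a \<Rightarrow>\<^sub>L 'a)" for k y
  have B: "smooth_on W (B k)" for k
  proof -
    have "\<And>y. y \<in> W \<Longrightarrow> \<sigma> y \<in> W'" using \<sigma> by blast
    from smooth_on_compose[OF W assms(4) this smooth_on_pd[OF assms(3)]]
    have "smooth_on W (\<lambda>y. pd i \<tau> (\<sigma> y) $ k)"
      by (rule smooth_on_nth[OF W(1)])
    then show ?thesis unfolding B_def[abs_def] using W by (intro smooth_on_scaleR smooth_on_const)
  qed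
  have IH: "local_diff_op W (length is) L" using Cons unfolding L_def .
  have 1: "local_diff_op W (Suc (length is)) (\<lambda>f y. \<Sum>k\<in>UNIV. blinfun_apply (B k y) (pd k (L f) y))"
    using local_diff_op_pd[OF W(1) IH] W B by (intro local_diff_op_sum local_diff_op_mult)
  have "pderivs (i # is) (\<lambda>x. blinfun_apply (A x) (f (\<tau> x))) (\<sigma> y) = (\<Sum>k\<in>UNIV. blinfun_apply (B k y) (pd k (L f) y))"
    if f: "smooth_on W f" and y: "y \<in> W" for f y
  proof -
    have Lf: "L f differentiable at y"
      using local_diff_op_smooth[OF W(1) IH f] y by (rule smooth_on_differentiable)
    have "pderivs (i # is) (\<lambda>x. blinfun_apply (A x) (f (\<tau> x))) (\<sigma> y) = pd i (\<lambda>x. L f (\<tau> x)) (\<sigma> y)"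
      unfolding pderivs_Cons_pd using W \<sigma> \<tau> y by (intro pd_cong_open[of W']) (auto simp: L_def)
    also have "\<dots> = frechet_derivative (L f) (at y) (frechet_derivative \<tau> (at (\<sigma> y)) (axis i 1))"
    proof (rule pd_eq)
      have "(\<tau> has_derivative frechet_derivative \<tau> (at (\<sigma> y))) (at (\<sigma> y))"
        using smooth_on_differentiable[OF assms(3)] \<sigma> y by (auto simp: frechet_derivative_works)
      moreover have "(L f has_derivative frechet_derivative (L f) (at y)) (at (\<tau> (\<sigma> y)))"
        using Lf \<sigma> y by (auto simp: frechet_derivative_works)
      ultimately show "((\<lambda>x. L f (\<tau> x)) has_derivative (\<lambda>v. frechet_derivative (L f) (at y) (frechet_derivative \<tau> (at (\<sigma> y)) v))) (at (\<sigma> y))"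
        using diff_chain_at unfolding o_def by blast
    qed
    also have "\<dots> = (\<Sum>k\<in>UNIV. blinfun_apply (B k y) (pd k (L f) y))"
      unfolding frechet_derivative_eq_sum_pd[OF Lf] by (simp add: B_def blinfun.scaleR_left pd_def)
    finally show ?thesis .
  qed
  with 1 show ?case unfolding local_diff_op_def by auto
qed

section \<open>Moderate and negligible nets of sections\<close>

text \<open>Functions, vector fields and tensor fields are treated alike: a section has components in each chart,
  and those in the chart \<open>d\<close> are obtained from those in \<open>c\<close> by the linear map \<open>T c d\<close>.  The function
  \<open>mk\<close> makes a section out of a compatible family of components.\<close>

locale section_family = atlas "base F"
  for F :: "('a, 'n::finite, 's::ab_group_add, 'c::euclidean_space) field_kind" +
  fixes T :: "('a, 'n) chart \<Rightarrow> ('a, 'n) chart \<Rightarrow> 'a \<Rightarrow> 'c \<Rightarrow>\<^sub>L 'c"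
    and mk :: "(('a, 'n) chart \<Rightarrow> 'a \<Rightarrow> 'c) \<Rightarrow> 's"
  assumes sections_iff: "s \<in> sections F \<longleftrightarrow> (\<forall>c\<in>charts (base F). smooth_in_chart c (comps F s c)) \<and>
      (\<forall>c\<in>charts (base F). \<forall>d\<in>charts (base F). \<forall>p\<in>fst c \<inter> fst d.
         comps F s d p = blinfun_apply (T c d p) (comps F s c p))"
    and comps_mk: "(\<And>c d p. c \<in> charts (base F) \<Longrightarrow> d \<in> charts (base F) \<Longrightarrow> p \<in> fst c \<Longrightarrow> p \<in> fst d \<Longrightarrow>
         \<phi> d p = blinfun_apply (T c d p) (\<phi> c p)) \<Longrightarrow>
       c \<in> charts (base F) \<Longrightarrow> p \<in> fst c \<Longrightarrow> comps F (mk \<phi>) c p = \<phi> c p"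
    and comps_diff: "comps F (s - t) c p = comps F s c p - comps F t c p"
    and T_smooth: "c \<in> charts (base F) \<Longrightarrow> d \<in> charts (base F) \<Longrightarrow>
       smooth_on (snd c ` (fst c \<inter> fst d)) (\<lambda>x. T c d (chart_inv c x))"
    and T_refl: "c \<in> charts (base F) \<Longrightarrow> p \<in> fst c \<Longrightarrow> blinfun_apply (T c c p) v = v"
    and T_trans: "c \<in> charts (base F) \<Longrightarrow> d \<in> charts (base F) \<Longrightarrow> e \<in> charts (base F) \<Longrightarrow>
       p \<in> fst c \<Longrightarrow> p \<in> fst d \<Longrightarrow> p \<in> fst e \<Longrightarrow>
       blinfun_apply (T d e p) (blinfun_apply (T c d p) v) = blinfun_apply (T c e p) v"
begin

definition loc :: "('a, 'n) chart \<Rightarrow> (real \<Rightarrow> 's) \<Rightarrow> real \<Rightarrow> real^'n \<Rightarrow> 'c" where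
  "loc c u \<epsilon> x = comps F (u \<epsilon>) c (chart_inv c x)"

lemma section_smooth: "s \<in> sections F \<Longrightarrow> c \<in> charts (base F) \<Longrightarrow> smooth_on (cimg c) (\<lambda>x. comps F s c (chart_inv c x))"
  using sections_iff unfolding smooth_in_chart_def cimg_def o_def by blast

lemma section_transform: "s \<in> sections F \<Longrightarrow> c \<in> charts (base F) \<Longrightarrow> d \<in> charts (base F) \<Longrightarrow> p \<in> fst c \<Longrightarrow> p \<in> fst d \<Longrightarrow>
    comps F s d p = blinfun_apply (T c d p) (comps F s c p)"
  using sections_iff by blast

lemma T_smooth_left: "c \<in> charts (base F) \<Longrightarrow> d \<in> charts (base F) \<Longrightarrow> smooth_on (overlap c d) (\<lambda>x. T c d (chart_inv c x))"
  using T_smooth unfolding overlap_def by blast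

lemma T_smooth_right:
  assumes "c \<in> charts (base F)" "d \<in> charts (base F)"
  shows "smooth_on (overlap d c) (\<lambda>x. T c d (chart_inv d x))"
  by (rule smooth_on_cong[OF _ _ smooth_on_transition_compose[OF assms(2,1) T_smooth_left[OF assms]]])
     (use assms chart_inv_transition in auto)

text \<open>Global fields are built from local ones in this way, provided that \<open>f\<close> vanishes outside a compact
  subset of the chart.\<close>

definition extend :: "('a, 'n) chart \<Rightarrow> (real^'n \<Rightarrow> 'c) \<Rightarrow> 's" where
  "extend c f = mk (\<lambda>d p. if p \<in> fst c then blinfun_apply (T c d p) (f (snd c p)) else 0)"

lemma comps_extend:
  assumes "c \<in> charts (base F)" "d \<in> charts (base F)" "p \<in> fst d"
  shows "comps F (extend c f) d p = (if p \<in> fst c then blinfun_apply (T c d p) (f (snd c p)) else 0)"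
  unfolding extend_def using T_trans assms by (subst comps_mk) auto

lemma extend_section:
  assumes c: "c \<in> charts (base F)" and f: "smooth_on (cimg c) f"
    and L: "compact L" "L \<subseteq> cimg c" "\<And>x. x \<in> cimg c \<Longrightarrow> x \<notin> L \<Longrightarrow> f x = 0"
  shows "extend c f \<in> sections F"
  unfolding sections_iff
proof (intro conjI ballI)
  fix d assume d: "d \<in> charts (base F)"
  let ?h = "\<lambda>y. blinfun_apply (T c d (chart_inv d y)) (f (transition d c y))"
  have "smooth_on (overlap d c) ?h"
    using c d smooth_on_subset[OF overlap_subset f]
    by (intro smooth_on_blinfun_apply T_smooth_right smooth_on_transition_compose[of d c f] open_overlap)
  then have "smooth_on (cimg d) (\<lambda>y. if y \<in> overlap d c then ?h y else 0)"
  proof (rule smooth_on_extend_zero[OF c d L(1,2)])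
    fix y assume "y \<in> overlap d c" "transition d c y \<notin> L"
    then have "f (transition d c y) = 0"
      using L(3) transition_in[OF d] subsetD[OF overlap_subset] by metis
    then show "?h y = 0" by (simp add: blinfun.zero_right)
  qed
  then show "smooth_in_chart d (comps F (extend c f) d)"
    unfolding smooth_in_chart_def cimg_def[symmetric]
    by (rule smooth_on_cong[rotated 2])
       (use c d in \<open>auto simp: comps_extend overlap_iff transition_def\<close>)
next
  fix d e p assume "d \<in> charts (base F)" "e \<in> charts (base F)" "p \<in> fst d \<inter> fst e"
  then show "comps F (extend c f) e p = blinfun_apply (T d e p) (comps F (extend c f) d p)"
    using c T_trans by (auto simp: comps_extend)
qed

text \<open>In another chart the coefficients of this operator are those given by the change of charts multiplied
  with the bump function; hence they extend by zero from the overlap to the whole chart domain.\<close>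

lemma diff_op_cutoff_pderivs:
  assumes c: "c \<in> charts (base F)" and \<rho>: "smooth_on UNIV \<rho>"
    and L: "compact L" "L \<subseteq> cimg c" "\<And>x. x \<notin> L \<Longrightarrow> \<rho> x = (0::real)"
  shows "diff_op F (\<lambda>s. extend c (\<lambda>x. \<rho> x *\<^sub>R pderivs is (\<lambda>x. comps F s c (chart_inv c x)) x))"
  unfolding diff_op_def
proof (intro conjI ballI exI[of _ "length is"])
  fix s assume s: "s \<in> sections F"
  show "extend c (\<lambda>x. \<rho> x *\<^sub>R pderivs is (\<lambda>x. comps F s c (chart_inv c x)) x) \<in> sections F"
    by (rule extend_section[OF c _ L(1,2)])
      (use c s L(3) smooth_on_subset[OF subset_UNIV \<rho>] in \<open>auto intro!: smooth_on_scaleR smooth_on_pderivs section_smooth\<close>)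
next
  fix d assume d: "d \<in> charts (base F)"
  have "local_diff_op (overlap d c) (length is)
      (\<lambda>f y. pderivs is (\<lambda>x. blinfun_apply (T d c (chart_inv c x)) (f (transition c d x))) (transition d c y))"
    using c d transition_in transition_inverse smooth_transition T_smooth_right
    by (intro local_diff_op_change_of_chart[where W' = "overlap c d"]) auto
  then obtain a where a: "\<And>js. smooth_on (overlap d c) (a js)"
    "\<And>f y. smooth_on (overlap d c) f \<Longrightarrow> y \<in> overlap d c \<Longrightarrow>
       pderivs is (\<lambda>x. blinfun_apply (T d c (chart_inv c x)) (f (transition c d x))) (transition d c y) =
       (\<Sum>js | length js \<le> length is. blinfun_apply (a js y) (pderivs js f y))"
    unfolding local_diff_op_def by blast
  define b where "b js y = \<rho> (transition d c y) *\<^sub>R (T c d (chart_inv d y) o\<^sub>L a js y)" for js y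
  define b' where "b' js y = (if y \<in> overlap d c then b js y else 0)" for js y
  have b': "smooth_on (cimg d) (b' js)" for js
    unfolding b'_def[abs_def]
  proof (rule smooth_on_extend_zero[OF c d L(1,2)])
    show "smooth_on (overlap d c) (b js)" unfolding b_def[abs_def]
      using c d a(1) smooth_on_subset[OF subset_UNIV \<rho>]
      by (intro smooth_on_scaleR smooth_on_blinfun_compose T_smooth_right
          smooth_on_transition_compose[of d c \<rho>] open_overlap)
  qed (use L(3) in \<open>auto simp: b_def\<close>)
  show "\<exists>a. (\<forall>js. smooth_on (snd d ` fst d) (a js)) \<and>
     (\<forall>s\<in>sections F. \<forall>p\<in>fst d.
        comps F (extend c (\<lambda>x. \<rho> x *\<^sub>R pderivs is (\<lambda>x. comps F s c (chart_inv c x)) x)) d p =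
          (\<Sum>js | length js \<le> length is. blinfun_apply (a js (snd d p)) (pderivs js (comps F s d \<circ> chart_inv d) (snd d p))))"
  proof (intro exI[of _ b'] conjI allI ballI)
    show "smooth_on (snd d ` fst d) (b' js)" for js using b' unfolding cimg_def .
    fix s p assume s: "s \<in> sections F" and p: "p \<in> fst d"
    let ?f = "comps F s d \<circ> chart_inv d"
    show "comps F (extend c (\<lambda>x. \<rho> x *\<^sub>R pderivs is (\<lambda>x. comps F s c (chart_inv c x)) x)) d p =
          (\<Sum>js | length js \<le> length is. blinfun_apply (b' js (snd d p)) (pderivs js ?f (snd d p)))"
    proof (cases "p \<in> fst c")
      case False
      then have "snd d p \<notin> overlap d c" using p d overlap_iff by auto
      with False show ?thesis using c d p by (simp add: comps_extend b'_def blinfun.zero_left)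
    next
      case True
      have y: "snd d p \<in> overlap d c" using p True by simp
      have f: "smooth_on (overlap d c) ?f"
        using smooth_on_subset[OF overlap_subset section_smooth[OF s d]] by (simp add: o_def)
      have "pderivs is (\<lambda>x. comps F s c (chart_inv c x)) (snd c p) =
         pderivs is (\<lambda>x. blinfun_apply (T d c (chart_inv c x)) (?f (transition c d x))) (snd c p)"
      proof (rule pderivs_cong_open[of "overlap c d"])
        fix x assume x: "x \<in> overlap c d"
        then show "comps F s c (chart_inv c x) = blinfun_apply (T d c (chart_inv c x)) (?f (transition c d x))"
          using section_transform[OF s d c, of "chart_inv c x"] overlap_iff[OF c] chart_inv_transition[OF c d x] by auto
      qed (use c d p True in auto)
      also have "\<dots> = (\<Sum>js | length js \<le> length is. blinfun_apply (a js (snd d p)) (pderivs js ?f (snd d p)))"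
        using a(2)[OF f y] d p by simp
      finally show ?thesis
        using c d p True y by (simp add: comps_extend b'_def b_def blinfun.scaleR_left blinfun.scaleR_right
            blinfun.sum_right scaleR_sum_right)
    qed
  qed
qed

end

text \<open>A lower estimate of the fibre norms is enough to pass from global growth conditions to those in
  charts; the converse uses an upper estimate and the independence of the norms of the chart.\<close>

locale vector_bundle = section_family F T mk
  for F :: "('a, 'n::finite, 's::ab_group_add, 'c::euclidean_space) field_kind" and T mk +
  assumes norms_nonempty: "fibre_norms F \<noteq> {}"
    and norm_lower: "\<nu> \<in> fibre_norms F \<Longrightarrow> c \<in> charts (base F) \<Longrightarrow> compact L \<Longrightarrow> L \<subseteq> cimg c \<Longrightarrow>
       \<exists>a>0. \<forall>x\<in>L. \<forall>v. a * norm v \<le> \<nu> c (chart_inv c x) v"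
begin

lemma moderate_section: "moderate F u \<Longrightarrow> \<epsilon> \<in> {0<..1} \<Longrightarrow> u \<epsilon> \<in> sections F"
  unfolding moderate_def by blast

text \<open>The derivatives in a chart of a section near a compact set are the values of a globally
  defined differential operator, namely a partial derivative multiplied with a bump function.\<close>

theorem moderate_imp_moderate_on:
  assumes u: "moderate F u" and c: "c \<in> charts (base F)"
  shows "moderate_on (cimg c) (loc c u)"
  unfolding moderate_on_iff_pderivs
proof (intro conjI ballI allI)
  show "smooth_on (cimg c) (loc c u \<epsilon>)" if "\<epsilon> \<in> {0<..1}" for \<epsilon>
    using section_smooth[OF moderate_section[OF u that] c] unfolding loc_def[abs_def] .
  fix js
  show "tempered_on (cimg c) (\<lambda>\<epsilon>. pderivs js (loc c u \<epsilon>))"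
  proof (rule tempered_onI)
    fix K assume K: "compact K" "K \<subseteq> cimg c"
    obtain \<rho> :: "real^'n \<Rightarrow> real" and L where \<rho>: "smooth_on UNIV \<rho>" "\<And>x. 0 \<le> \<rho> x" "\<And>x. x \<in> K \<Longrightarrow> 0 < \<rho> x"
      "compact L" "L \<subseteq> cimg c" "\<And>x. x \<notin> L \<Longrightarrow> \<rho> x = 0"
      by (rule bump_exists[OF K open_cimg[OF c]]) (rule that)
    let ?P = "\<lambda>s. extend c (\<lambda>x. \<rho> x *\<^sub>R pderivs js (\<lambda>x. comps F s c (chart_inv c x)) x)"
    have P: "diff_op F ?P" by (rule diff_op_cutoff_pderivs[OF c \<rho>(1,4-6)])
    obtain \<nu> where \<nu>: "\<nu> \<in> fibre_norms F" using norms_nonempty by blast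
    obtain a where a: "0 < a" "\<And>x v. x \<in> K \<Longrightarrow> a * norm v \<le> \<nu> c (chart_inv c x) v"
      using norm_lower[OF \<nu> c K] by blast
    obtain r where r: "0 < r" "\<And>x. x \<in> K \<Longrightarrow> r \<le> \<rho> x"
    proof (cases "K = {}")
      case False
      then obtain x where "x \<in> K" "\<And>y. y \<in> K \<Longrightarrow> \<rho> x \<le> \<rho> y"
        using continuous_attains_inf[OF K(1)] continuous_on_subset[OF smooth_on_continuous[OF \<rho>(1)]]
        by (metis subset_UNIV)
      with \<rho>(3) show ?thesis by (intro that[of "\<rho> x"]) auto
    qed (rule that[of 1], auto)
    obtain N C where NC: "\<forall>\<^sub>F \<epsilon> in at_right 0. sup_bound F (chart_inv c ` K) (?P (u \<epsilon>)) \<nu> (C / \<epsilon> ^ N)"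
      using u P \<nu> compactin_chart_inv[OF c K] unfolding moderate_def by meson
    then have "\<forall>\<^sub>F \<epsilon> in at_right 0. \<forall>x\<in>K. norm (pderivs js (loc c u \<epsilon>) x) \<le> (C / (a * r)) * (1 / \<epsilon>) ^ N"
    proof eventually_elim
      case (elim \<epsilon>)
      show ?case
      proof
        fix x assume x: "x \<in> K"
        then have xc: "x \<in> cimg c" using K by blast
        let ?v = "pderivs js (loc c u \<epsilon>) x"
        have "\<nu> c (chart_inv c x) (comps F (?P (u \<epsilon>)) c (chart_inv c x)) \<le> C / \<epsilon> ^ N"
          using elim x xc c unfolding sup_bound_def by auto
        then have "\<nu> c (chart_inv c x) (\<rho> x *\<^sub>R ?v) \<le> C / \<epsilon> ^ N"
          using c xc by (simp add: comps_extend T_refl loc_def[abs_def])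
        then have "a * norm (\<rho> x *\<^sub>R ?v) \<le> C / \<epsilon> ^ N" using a(2)[OF x] order_trans by blast
        moreover have "a * (r * norm ?v) \<le> a * norm (\<rho> x *\<^sub>R ?v)"
          using a(1) r(2)[OF x] \<rho>(2)[of x] by (auto intro!: mult_left_mono mult_right_mono)
        ultimately have "a * (r * norm ?v) \<le> C / \<epsilon> ^ N" by linarith
        then have "a * (r * norm ?v) / (a * r) \<le> C / \<epsilon> ^ N / (a * r)"
          using a(1) r(1) by (intro divide_right_mono) simp_all
        then show "norm ?v \<le> (C / (a * r)) * (1 / \<epsilon>) ^ N"
          using a(1) r(1) by (simp add: power_divide mult_ac)
      qed
    qed
    then show "\<exists>N C. \<forall>\<^sub>F \<epsilon> in at_right 0. \<forall>x\<in>K. norm (pderivs js (loc c u \<epsilon>) x) \<le> C * (1 / \<epsilon>) ^ N" by blast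
  qed
qed

text \<open>Compact subsets of a chart are compact in the manifold, where the fibre norm dominates the Euclidean one.\<close>

theorem negligible_imp_negligible_on:
  assumes u: "negligible_net F u" and c: "c \<in> charts (base F)"
  shows "negligible_on (cimg c) (loc c u)"
proof (rule negligible_onI)
  fix K m assume K: "compact K" "K \<subseteq> cimg c"
  obtain \<nu> where \<nu>: "\<nu> \<in> fibre_norms F" using norms_nonempty by blast
  obtain a where a: "0 < a" "\<And>x v. x \<in> K \<Longrightarrow> a * norm v \<le> \<nu> c (chart_inv c x) v"
    using norm_lower[OF \<nu> c K] by blast
  obtain C where C: "\<forall>\<^sub>F \<epsilon> in at_right 0. sup_bound F (chart_inv c ` K) (u \<epsilon>) \<nu> (C * \<epsilon> ^ m)"
    using u \<nu> compactin_chart_inv[OF c K] unfolding negligible_net_def by meson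
  then have "\<forall>\<^sub>F \<epsilon> in at_right 0. \<forall>x\<in>K. norm (loc c u \<epsilon> x) \<le> (C / a) * \<epsilon> ^ m"
  proof eventually_elim
    case (elim \<epsilon>)
    show ?case
    proof
      fix x assume x: "x \<in> K"
      then have xc: "x \<in> cimg c" using K by blast
      then have "\<nu> c (chart_inv c x) (loc c u \<epsilon> x) \<le> C * \<epsilon> ^ m"
        using elim x c unfolding sup_bound_def loc_def by auto
      then have "a * norm (loc c u \<epsilon> x) \<le> C * \<epsilon> ^ m" using a(2)[OF x] order_trans by blast
      then show "norm (loc c u \<epsilon> x) \<le> (C / a) * \<epsilon> ^ m" using a(1) by (simp add: field_simps)
    qed
  qed
  then show "\<exists>C. \<forall>\<^sub>F \<epsilon> in at_right 0. \<forall>x\<in>K. norm (loc c u \<epsilon> x) \<le> C * \<epsilon> ^ m" by blast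
qed

lemma loc_diff: "loc c (\<lambda>\<epsilon>. u \<epsilon> - v \<epsilon>) \<epsilon> x = loc c u \<epsilon> x - loc c v \<epsilon> x"
  by (simp add: loc_def comps_diff)

end

lemma finite_eventually_bound:
  fixes Q :: "'i \<Rightarrow> real \<Rightarrow> real \<Rightarrow> bool"
  assumes "finite I" "\<And>i. i \<in> I \<Longrightarrow> \<exists>N. \<forall>\<^sub>F \<epsilon> in at_right 0. Q i \<epsilon> ((1 / \<epsilon>) ^ N)"
    and mono: "\<And>i \<epsilon> b b'. Q i \<epsilon> b \<Longrightarrow> b \<le> b' \<Longrightarrow> Q i \<epsilon> b'"
  shows "\<exists>N. \<forall>\<^sub>F \<epsilon> in at_right 0. \<forall>i\<in>I. Q i \<epsilon> ((1 / \<epsilon>) ^ N)"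
proof -
  obtain n where n: "\<And>i. i \<in> I \<Longrightarrow> \<forall>\<^sub>F \<epsilon> in at_right 0. Q i \<epsilon> ((1 / \<epsilon>) ^ n i)" using assms(2) by metis
  have "\<forall>\<^sub>F \<epsilon> in at_right 0. \<forall>i\<in>I. Q i \<epsilon> ((1 / \<epsilon>) ^ n i)" 
    using n assms(1) by (intro eventually_ball_finite) auto
  then have "\<forall>\<^sub>F \<epsilon> in at_right 0. \<forall>i\<in>I. Q i \<epsilon> ((1 / \<epsilon>) ^ (\<Sum>i\<in>I. n i))"
    using eventually_small[of 1, simplified]
  proof eventually_elim
    case (elim \<epsilon>)
    show ?case
    proof
      fix i assume i: "i \<in> I"
      then have "(1 / \<epsilon>) ^ n i \<le> (1 / \<epsilon>) ^ (\<Sum>i\<in>I. n i)"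
        using elim assms(1) by (intro inverse_power_mono member_le_sum) auto
      with elim i mono show "Q i \<epsilon> ((1 / \<epsilon>) ^ (\<Sum>i\<in>I. n i))" by blast
    qed
  qed
  then show ?thesis by blast
qed

locale normed_bundle = vector_bundle F T mk
  for F :: "('a, 'n::finite, 's::ab_group_add, 'c::euclidean_space) field_kind" and T mk +
  assumes comps_add: "comps F (s + t) c p = comps F s c p + comps F t c p"
    and norm_upper: "\<nu> \<in> fibre_norms F \<Longrightarrow> c \<in> charts (base F) \<Longrightarrow> compact L \<Longrightarrow> L \<subseteq> cimg c \<Longrightarrow>
       \<exists>b>0. \<forall>x\<in>L. \<forall>v. \<nu> c (chart_inv c x) v \<le> b * norm v"
    and norm_invariant: "\<nu> \<in> fibre_norms F \<Longrightarrow> c \<in> charts (base F) \<Longrightarrow> d \<in> charts (base F) \<Longrightarrow>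
       p \<in> fst c \<Longrightarrow> p \<in> fst d \<Longrightarrow> \<nu> d p (blinfun_apply (T c d p) v) = \<nu> c p v"
begin

lemma sup_bound_chart:
  assumes s: "s \<in> sections F" and \<nu>: "\<nu> \<in> fibre_norms F" and c: "c \<in> charts (base F)" "L \<subseteq> cimg c"
    and b: "\<And>x. x \<in> L \<Longrightarrow> \<nu> c (chart_inv c x) (comps F s c (chart_inv c x)) \<le> b"
  shows "sup_bound F (chart_inv c ` L) s \<nu> b"
  unfolding sup_bound_def
proof (intro ballI impI)
  fix p d assume p: "p \<in> chart_inv c ` L" and d: "d \<in> charts (base F)" "p \<in> fst d"
  then obtain x where x: "x \<in> L" "p = chart_inv c x" by blast
  then have "p \<in> fst c" using c by auto
  then have "\<nu> d p (comps F s d p) = \<nu> c p (comps F s c p)"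
    using section_transform[OF s c(1) d(1)] norm_invariant[OF \<nu> c(1) d(1)] d by simp
  with b[OF x(1)] x show "\<nu> d p (comps F s d p) \<le> b" by simp
qed

lemma sup_bound_mono: "sup_bound F K s \<nu> b \<Longrightarrow> b \<le> b' \<Longrightarrow> K' \<subseteq> K \<Longrightarrow> sup_bound F K' s \<nu> b'"
  unfolding sup_bound_def
proof (intro ballI impI)
  fix p c assume 1: "\<forall>p\<in>K. \<forall>c\<in>charts (base F). p \<in> fst c \<longrightarrow> \<nu> c p (comps F s c p) \<le> b"
    and 2: "b \<le> b'" "K' \<subseteq> K" "p \<in> K'" "c \<in> charts (base F)" "p \<in> fst c"
  then have "\<nu> c p (comps F s c p) \<le> b" by blast
  with 2(1) show "\<nu> c p (comps F s c p) \<le> b'" by simp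
qed

lemma sup_bound_UN: "(\<And>i. i \<in> I \<Longrightarrow> sup_bound F (K i) s \<nu> b) \<Longrightarrow> sup_bound F (\<Union>i\<in>I. K i) s \<nu> b"
  unfolding sup_bound_def by blast

text \<open>In each chart a differential operator is a finite sum of smooth coefficients times partial
  derivatives, so it preserves moderateness in charts; a compact set is covered by closed
  coordinate balls of finitely many charts, for which there is a common exponent.\<close>

theorem moderateI:
  assumes sec: "\<And>\<epsilon>. \<epsilon> \<in> {0<..1} \<Longrightarrow> u \<epsilon> \<in> sections F"
    and mod: "\<And>c. c \<in> charts (base F) \<Longrightarrow> moderate_on (cimg c) (loc c u)"
  shows "moderate F u"
  unfolding moderate_def
proof (intro conjI ballI allI impI)
  fix K P \<nu> assume \<nu>: "\<nu> \<in> fibre_norms F" and KP: "compactin (mtop (base F)) K \<and> diff_op F P"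
  from KP have K: "compactin (mtop (base F)) K" and P: "diff_op F P" by auto
  obtain I where I: "finite I" "\<And>c L. (c, L) \<in> I \<Longrightarrow> c \<in> charts (base F) \<and> compact L \<and> L \<subseteq> cimg c"
    "K \<subseteq> (\<Union>(c, L)\<in>I. chart_inv c ` L)"
    by (rule compact_chart_cover[OF K]) (rule that)
  have "\<exists>N. \<forall>\<^sub>F \<epsilon> in at_right 0. sup_bound F (chart_inv c ` L) (P (u \<epsilon>)) \<nu> ((1 / \<epsilon>) ^ N)" if cL: "(c, L) \<in> I" for c L
  proof -
    have c: "c \<in> charts (base F)" and L: "compact L" "L \<subseteq> cimg c" using I(2)[OF cL] by auto
    obtain m a where a: "\<And>is. smooth_on (cimg c) (a is)"
      "\<And>s p. s \<in> sections F \<Longrightarrow> p \<in> fst c \<Longrightarrow> comps F (P s) c p =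
        (\<Sum>is | length is \<le> m. blinfun_apply (a is (snd c p)) (pderivs is (comps F s c \<circ> chart_inv c) (snd c p)))"
    proof -
      from P obtain m where "\<forall>c\<in>charts (base F). \<exists>a :: 'n list \<Rightarrow> real^'n \<Rightarrow> ('c \<Rightarrow>\<^sub>L 'c).
        (\<forall>is. smooth_on (snd c ` fst c) (a is)) \<and>
        (\<forall>s\<in>sections F. \<forall>p\<in>fst c. comps F (P s) c p =
          (\<Sum>is | length is \<le> m. blinfun_apply (a is (snd c p)) (pderivs is (comps F s c \<circ> chart_inv c) (snd c p))))"
        unfolding diff_op_def by blast
      from bspec[OF this c] show ?thesis unfolding cimg_def[symmetric] using that by blast
    qed
    define q where "q \<epsilon> x = (\<Sum>is | length is \<le> m. blinfun_apply (a is x) (pderivs is (loc c u \<epsilon>) x))" for \<epsilon> x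
    have "moderate_on (cimg c) (\<lambda>\<epsilon>. pderivs is (loc c u \<epsilon>))" for "is"
      using mod[OF c] by (induction "is") (simp_all only: pderivs.simps(1) pderivs_Cons_pd moderate_on_pd)
    then have "moderate_on (cimg c) q"
      unfolding q_def[abs_def] using c a(1)[unfolded smooth_on_iff_moderate_on]
      by (intro moderate_on_sum moderate_on_bilinear[OF bounded_bilinear_blinfun_apply] open_cimg)
    from tempered_onE[OF moderate_on_tempered[OF this] L] obtain N where
      N: "\<forall>\<^sub>F \<epsilon> in at_right 0. \<forall>x\<in>L. norm (q \<epsilon> x) \<le> (1 / \<epsilon>) ^ N" .
    obtain b where b: "0 < b" "\<And>x v. x \<in> L \<Longrightarrow> \<nu> c (chart_inv c x) v \<le> b * norm v"
      using norm_upper[OF \<nu> c L] by blast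
    have "\<forall>\<^sub>F \<epsilon> in at_right 0. sup_bound F (chart_inv c ` L) (P (u \<epsilon>)) \<nu> ((1 / \<epsilon>) ^ Suc N)"
      using N eventually_absorb_pos[of b N]
    proof eventually_elim
      case (elim \<epsilon>)
      have s: "u \<epsilon> \<in> sections F" "P (u \<epsilon>) \<in> sections F"
        using sec[of \<epsilon>] elim P unfolding diff_op_def by auto
      show ?case
      proof (rule sup_bound_chart[OF s(2) \<nu> c L(2)])
        fix x assume x: "x \<in> L"
        have "comps F (P (u \<epsilon>)) c (chart_inv c x) = q \<epsilon> x"
          using a(2)[OF s(1), of "chart_inv c x"] x L by (auto simp: q_def loc_def[abs_def] o_def)
        moreover have "b * norm (q \<epsilon> x) \<le> b * (1 / \<epsilon>) ^ N" using elim x b(1) by (intro mult_left_mono) auto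
        ultimately show "\<nu> c (chart_inv c x) (comps F (P (u \<epsilon>)) c (chart_inv c x)) \<le> (1 / \<epsilon>) ^ Suc N"
          using order_trans[OF b(2)[OF x, of "q \<epsilon> x"]] elim by (metis order_trans)
      qed
    qed
    then show ?thesis by blast
  qed
  then have "\<exists>N. \<forall>\<^sub>F \<epsilon> in at_right 0. \<forall>i\<in>I. sup_bound F (case i of (c, L) \<Rightarrow> chart_inv c ` L) (P (u \<epsilon>)) \<nu> ((1 / \<epsilon>) ^ N)"
    by (intro finite_eventually_bound I(1)) (auto elim: sup_bound_mono)
  then obtain N where "\<forall>\<^sub>F \<epsilon> in at_right 0. \<forall>i\<in>I. sup_bound F (case i of (c, L) \<Rightarrow> chart_inv c ` L) (P (u \<epsilon>)) \<nu> ((1 / \<epsilon>) ^ N)" ..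
  then have "\<forall>\<^sub>F \<epsilon> in at_right 0. sup_bound F K (P (u \<epsilon>)) \<nu> (1 / \<epsilon> ^ N)"
  proof eventually_elim
    case (elim \<epsilon>)
    then have "sup_bound F (\<Union>i\<in>I. case i of (c, L) \<Rightarrow> chart_inv c ` L) (P (u \<epsilon>)) \<nu> ((1 / \<epsilon>) ^ N)"
      by (intro sup_bound_UN) auto
    then show ?case by (rule sup_bound_mono) (use I(3) in \<open>auto simp: power_divide\<close>)
  qed
  then show "\<exists>N C. \<forall>\<^sub>F \<epsilon> in at_right 0. sup_bound F K (P (u \<epsilon>)) \<nu> (C / \<epsilon> ^ N)" by blast
qed (rule sec)

text \<open>No differential operators occur here, so that only a finite cover by charts and an upper estimate of
  the norm are needed.\<close>

theorem negligibleI: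
  assumes u: "moderate F u"
    and neg: "\<And>c. c \<in> charts (base F) \<Longrightarrow> negligible_on (cimg c) (loc c u)"
  shows "negligible_net F u"
  unfolding negligible_net_def
proof (intro conjI ballI allI impI u)
  fix K \<nu> m assume \<nu>: "\<nu> \<in> fibre_norms F" and K: "compactin (mtop (base F)) K"
  obtain I where I: "finite I" "\<And>c L. (c, L) \<in> I \<Longrightarrow> c \<in> charts (base F) \<and> compact L \<and> L \<subseteq> cimg c"
    "K \<subseteq> (\<Union>(c, L)\<in>I. chart_inv c ` L)"
    by (rule compact_chart_cover[OF K]) (rule that)
  have "\<forall>\<^sub>F \<epsilon> in at_right 0. sup_bound F (chart_inv c ` L) (u \<epsilon>) \<nu> (\<epsilon> ^ m)" if cL: "(c, L) \<in> I" for c L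
  proof -
    have c: "c \<in> charts (base F)" and L: "compact L" "L \<subseteq> cimg c" using I(2)[OF cL] by auto
    obtain b where b: "0 < b" "\<And>x v. x \<in> L \<Longrightarrow> \<nu> c (chart_inv c x) v \<le> b * norm v"
      using norm_upper[OF \<nu> c L] by blast
    show ?thesis using negligible_onD[OF neg[OF c] L, of "Suc m"] eventually_absorb_neg[of b m]
    proof eventually_elim
      case (elim \<epsilon>)
      then have s: "u \<epsilon> \<in> sections F" by (intro moderate_section[OF u]) auto
      show ?case
      proof (rule sup_bound_chart[OF s \<nu> c L(2)])
        fix x assume x: "x \<in> L"
        have "b * norm (loc c u \<epsilon> x) \<le> b * \<epsilon> ^ Suc m" using elim x b(1) by (intro mult_left_mono) auto
        then show "\<nu> c (chart_inv c x) (comps F (u \<epsilon>) c (chart_inv c x)) \<le> \<epsilon> ^ m"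
          using b(2)[OF x, of "loc c u \<epsilon> x"] elim unfolding loc_def by linarith
      qed
    qed
  qed
  then have "\<forall>\<^sub>F \<epsilon> in at_right 0. \<forall>i\<in>I. sup_bound F (case i of (c, L) \<Rightarrow> chart_inv c ` L) (u \<epsilon>) \<nu> (\<epsilon> ^ m)"
    by (intro eventually_ball_finite I(1)) auto
  then have "\<forall>\<^sub>F \<epsilon> in at_right 0. sup_bound F K (u \<epsilon>) \<nu> (1 * \<epsilon> ^ m)"
  proof eventually_elim
    case (elim \<epsilon>)
    then have "sup_bound F (\<Union>i\<in>I. case i of (c, L) \<Rightarrow> chart_inv c ` L) (u \<epsilon>) \<nu> (\<epsilon> ^ m)"
      by (intro sup_bound_UN) auto
    then show ?case by (rule sup_bound_mono) (use I(3) in auto)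
  qed
  then show "\<exists>C. \<forall>\<^sub>F \<epsilon> in at_right 0. sup_bound F K (u \<epsilon>) \<nu> (C * \<epsilon> ^ m)" by blast
qed

lemma sections_diff:
  assumes "s \<in> sections F" "t \<in> sections F" shows "s - t \<in> sections F"
  unfolding sections_iff
proof (intro conjI ballI)
  fix c assume c: "c \<in> charts (base F)"
  have "moderate_on (cimg c) (\<lambda>_ x. comps F s c (chart_inv c x) - comps F t c (chart_inv c x))"
    using section_smooth[OF assms(1) c] section_smooth[OF assms(2) c] c
    unfolding smooth_on_iff_moderate_on by (intro moderate_on_diff open_cimg)
  then show "smooth_in_chart c (comps F (s - t) c)"
    unfolding smooth_in_chart_def cimg_def[symmetric] smooth_on_iff_moderate_on o_def comps_diff .
next
  fix c d p assume "c \<in> charts (base F)" "d \<in> charts (base F)" "p \<in> fst c \<inter> fst d"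
  then show "comps F (s - t) d p = blinfun_apply (T c d p) (comps F (s - t) c p)"
    using section_transform[OF assms(1), of c d p] section_transform[OF assms(2), of c d p]
    by (simp add: comps_diff blinfun.diff_right)
qed

lemma sections_add:
  assumes "s \<in> sections F" "t \<in> sections F" shows "s + t \<in> sections F"
  unfolding sections_iff
proof (intro conjI ballI)
  fix c assume c: "c \<in> charts (base F)"
  have "moderate_on (cimg c) (\<lambda>_ x. comps F s c (chart_inv c x) + comps F t c (chart_inv c x))"
    using section_smooth[OF assms(1) c] section_smooth[OF assms(2) c] c
    unfolding smooth_on_iff_moderate_on by (intro moderate_on_add open_cimg)
  then show "smooth_in_chart c (comps F (s + t) c)"
    unfolding smooth_in_chart_def cimg_def[symmetric] smooth_on_iff_moderate_on o_def comps_add .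
next
  fix c d p assume "c \<in> charts (base F)" "d \<in> charts (base F)" "p \<in> fst c \<inter> fst d"
  then show "comps F (s + t) d p = blinfun_apply (T c d p) (comps F (s + t) c p)"
    using section_transform[OF assms(1), of c d p] section_transform[OF assms(2), of c d p]
    by (simp add: comps_add blinfun.add_right)
qed

lemma loc_add: "loc c (\<lambda>\<epsilon>. u \<epsilon> + v \<epsilon>) \<epsilon> x = loc c u \<epsilon> x + loc c v \<epsilon> x"
  by (simp add: loc_def comps_add)

lemma moderate_diff:
  assumes "moderate F u" "moderate F v" shows "moderate F (\<lambda>\<epsilon>. u \<epsilon> - v \<epsilon>)"
proof (rule moderateI)
  fix c assume "c \<in> charts (base F)"
  then have "moderate_on (cimg c) (\<lambda>\<epsilon> x. loc c u \<epsilon> x - loc c v \<epsilon> x)"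
    using assms by (intro moderate_on_diff moderate_imp_moderate_on open_cimg)
  then show "moderate_on (cimg c) (loc c (\<lambda>\<epsilon>. u \<epsilon> - v \<epsilon>))" by (simp add: loc_diff[abs_def])
qed (intro sections_diff moderate_section[OF assms(1)] moderate_section[OF assms(2)])

lemma moderate_add:
  assumes "moderate F u" "moderate F v" shows "moderate F (\<lambda>\<epsilon>. u \<epsilon> + v \<epsilon>)"
proof (rule moderateI)
  fix c assume "c \<in> charts (base F)"
  then have "moderate_on (cimg c) (\<lambda>\<epsilon> x. loc c u \<epsilon> x + loc c v \<epsilon> x)"
    using assms by (intro moderate_on_add moderate_imp_moderate_on open_cimg)
  then show "moderate_on (cimg c) (loc c (\<lambda>\<epsilon>. u \<epsilon> + v \<epsilon>))" by (simp add: loc_add[abs_def])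
qed (intro sections_add moderate_section[OF assms(1)] moderate_section[OF assms(2)])

theorem net_rel_iff:
  "(u, v) \<in> net_rel F \<longleftrightarrow> moderate F u \<and> moderate F v \<and>
     (\<forall>c\<in>charts (base F). negligible_on (cimg c) (\<lambda>\<epsilon> x. loc c u \<epsilon> x - loc c v \<epsilon> x))"
  (is "?L \<longleftrightarrow> ?R")
proof
  assume ?L
  then have "moderate F u" "moderate F v" "negligible_net F (\<lambda>\<epsilon>. u \<epsilon> - v \<epsilon>)" by (auto simp: net_rel_def)
  with negligible_imp_negligible_on[of "\<lambda>\<epsilon>. u \<epsilon> - v \<epsilon>"] show ?R by (simp add: loc_diff[abs_def])
next
  assume R: ?R
  then have "negligible_net F (\<lambda>\<epsilon>. u \<epsilon> - v \<epsilon>)"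
    by (intro negligibleI moderate_diff) (auto simp: loc_diff[abs_def])
  with R show ?L by (simp add: net_rel_def)
qed

lemma net_rel_refl: "moderate F u \<Longrightarrow> (u, u) \<in> net_rel F"
  by (simp add: net_rel_iff negligible_on_zero)

lemma net_rel_sym: "(u, v) \<in> net_rel F \<Longrightarrow> (v, u) \<in> net_rel F"
  unfolding net_rel_iff using negligible_on_minus by fastforce

lemma net_rel_trans:
  assumes "(u, v) \<in> net_rel F" "(v, w) \<in> net_rel F" shows "(u, w) \<in> net_rel F"
  unfolding net_rel_iff
proof (intro conjI ballI)
  fix c assume "c \<in> charts (base F)"
  then have "negligible_on (cimg c) (\<lambda>\<epsilon> x. (loc c u \<epsilon> x - loc c v \<epsilon> x) + (loc c v \<epsilon> x - loc c w \<epsilon> x))"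
    using assms unfolding net_rel_iff by (intro negligible_on_add) auto
  then show "negligible_on (cimg c) (\<lambda>\<epsilon> x. loc c u \<epsilon> x - loc c w \<epsilon> x)" by simp
qed (use assms in \<open>auto simp: net_rel_iff\<close>)

lemma gclass_eq_iff:
  assumes "moderate F u" "moderate F v"
  shows "gclass F u = gclass F v \<longleftrightarrow> (u, v) \<in> net_rel F"
  unfolding gclass_def using net_rel_refl[OF assms(1)] net_rel_refl[OF assms(2)] net_rel_sym net_rel_trans by blast

lemma gclass_eqI: "(u, v) \<in> net_rel F \<Longrightarrow> gclass F u = gclass F v"
  using gclass_eq_iff[of u v] unfolding net_rel_iff by blast

lemma gen_fields_iff: "X \<in> gen_fields F \<longleftrightarrow> (\<exists>u. moderate F u \<and> X = gclass F u)"
  unfolding gen_fields_def gclass_def quotient_def by blast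

lemma gclass_in_gen_fields: "moderate F u \<Longrightarrow> gclass F u \<in> gen_fields F"
  unfolding gen_fields_iff by blast

lemma mem_gclass: "v \<in> gclass F u \<longleftrightarrow> (u, v) \<in> net_rel F"
  unfolding gclass_def by blast

end

text \<open>Operations on classes are unions over all representatives; if the operation respects the relation,
  all members of the union coincide.\<close>

lemma lift2_gclass:
  assumes "normed_bundle F T mk" and "u \<in> U" "v \<in> V"
    and "\<And>u' v'. u' \<in> U \<Longrightarrow> v' \<in> V \<Longrightarrow> (\<lambda>\<epsilon>. f (u \<epsilon>) (v \<epsilon>), \<lambda>\<epsilon>. f (u' \<epsilon>) (v' \<epsilon>)) \<in> net_rel F"
  shows "lift2 F f U V = gclass F (\<lambda>\<epsilon>. f (u \<epsilon>) (v \<epsilon>))"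
proof -
  interpret normed_bundle F T mk by fact
  have "gclass F (\<lambda>\<epsilon>. f (u' \<epsilon>) (v' \<epsilon>)) = gclass F (\<lambda>\<epsilon>. f (u \<epsilon>) (v \<epsilon>))"
    if "u' \<in> U" "v' \<in> V" for u' v'
    using gclass_eqI[OF assms(4)[OF that]] by (rule sym)
  then show ?thesis unfolding lift2_def using assms(2,3) by blast
qed

section \<open>Functions, vector fields and tensor fields as sections\<close>

lemma Fun_simps [simp]:
  "base (Fun M) = M" "sections (Fun M) = smooth_functions M" "comps (Fun M) = (\<lambda>u c. u)"
  "fibre_norms (Fun M) = {\<lambda>c p x. \<bar>x\<bar>}"
  by (simp_all add: Fun_def)

lemma Vec_simps [simp]:
  "base (Vec M) = M" "sections (Vec M) = smooth_vfields M" "comps (Vec M) = (\<lambda>\<xi>. \<xi>)"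
  "fibre_norms (Vec M) = {\<lambda>c p v. sqrt (v \<bullet> (h c p *v v)) | h. riemannian M h}"
  by (simp_all add: Vec_def)

lemma Ten_simps [simp]:
  "base (Ten M) = M" "sections (Ten M) = smooth_tfields M" "comps (Ten M) = (\<lambda>g. g)"
  by (simp_all add: Ten_def)

definition mvL :: "real^'n^'n::finite \<Rightarrow> (real^'n) \<Rightarrow>\<^sub>L (real^'n)" where
  "mvL A = Blinfun ((*v) A)"

lemma mvL_apply [simp]: "blinfun_apply (mvL A) v = A *v v"
  by (simp add: mvL_def bounded_linear_Blinfun_apply)

lemma bounded_linear_mvL: "bounded_linear mvL"
  by (subst linear_conv_bounded_linear[symmetric])
     (auto simp: linear_iff blinfun.add_left blinfun.scaleR_left matrix_vector_mult_add_rdistrib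
       scaleR_matrix_vector_assoc intro!: blinfun_eqI)

definition sandwich :: "real^'n^'n::finite \<Rightarrow> real^'n^'n \<Rightarrow> (real^'n^'n) \<Rightarrow>\<^sub>L (real^'n^'n)" where
  "sandwich A B = Blinfun (\<lambda>t. transpose A ** t ** B)"

lemma sandwich_apply [simp]: "blinfun_apply (sandwich A B) t = transpose A ** t ** B"
proof -
  have "bounded_linear (\<lambda>t. transpose A ** t ** B)"
    using bounded_linear_compose[OF bounded_bilinear.bounded_linear_left[OF bounded_bilinear_matrix_matrix]
        bounded_bilinear.bounded_linear_right[OF bounded_bilinear_matrix_matrix]] by blast
  then show ?thesis by (simp add: sandwich_def bounded_linear_Blinfun_apply)
qed

lemma bounded_bilinear_sandwich: "bounded_bilinear (sandwich :: real^'n::finite^'n \<Rightarrow> _)"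
proof (subst bilinear_conv_bounded_bilinear[symmetric])
  have "transpose (A + B) = transpose A + transpose B" "transpose (c *\<^sub>R A) = c *\<^sub>R transpose A" for A B :: "real^'n^'n" and c
    by (simp_all add: transpose_def vec_eq_iff)
  then show "bilinear (sandwich :: real^'n^'n \<Rightarrow> _)"
    by (auto simp: bilinear_def linear_iff blinfun.add_left blinfun.scaleR_left matrix_add_ldistrib
        bounded_bilinear.add_left[OF bounded_bilinear_matrix_matrix]
        bounded_bilinear.scaleR_left[OF bounded_bilinear_matrix_matrix]
        bounded_bilinear.scaleR_right[OF bounded_bilinear_matrix_matrix] intro!: blinfun_eqI)
qed

lemma Fun_normed_bundle:
  assumes "atlas M"
  shows "normed_bundle (Fun M) (\<lambda>_ _ _. id_blinfun) (\<lambda>\<phi> p. \<phi> (chart_at M p) p)"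
proof -
  interpret atlas M by fact
  show ?thesis
  proof (intro normed_bundle.intro vector_bundle.intro section_family.intro
      section_family_axioms.intro vector_bundle_axioms.intro normed_bundle_axioms.intro, goal_cases)
    case (3 \<phi> c p)
    then have c: "c \<in> charts M" "p \<in> fst c" by auto
    have "\<phi> (chart_at M p) p = blinfun_apply id_blinfun (\<phi> c p)"
      by (rule 3(1)) (use c chart_at[OF c] in auto)
    then show ?case by simp
  next
    case (9 \<nu> c L)
    then show ?case by (auto intro!: exI[of _ 1])
  next
    case (11 \<nu> c L)
    then show ?case by (auto intro!: exI[of _ 1])
  qed (use assms in \<open>simp_all add: smooth_functions_def smooth_on_const\<close>)
qed

lemma Vec_section_family:
  assumes "atlas M"
  shows "section_family (Vec M) (\<lambda>c d p. mvL (jacobian c d p)) (\<lambda>\<phi>. \<phi>)"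
proof -
  interpret atlas M by fact
  show ?thesis
  proof (intro section_family.intro section_family_axioms.intro, goal_cases)
    case (5 c d)
    then have "smooth_on (overlap c d) (\<lambda>x. mvL (jacobian c d (chart_inv c x)))"
      using smooth_jacobian[of c d] unfolding smooth_on_iff_moderate_on
      by (intro moderate_on_linear[OF bounded_linear_mvL] open_overlap) auto
    then show ?case unfolding overlap_def .
  next
    case (7 c d e p v)
    then show ?case using jacobian_trans[of c d e p] by (simp add: matrix_vector_mul_assoc)
  next
    case (3 \<phi> c p)
    show ?case by simp
  qed (use assms in \<open>simp_all add: smooth_vfields_def jacobian_refl\<close>)
qed

lemma Ten_section_family:
  fixes M :: "('a, 'n::finite) manifold"
  assumes "atlas M"
  shows "section_family (Ten M) (\<lambda>c d p. sandwich (jacobian d c p) (jacobian d c p)) (\<lambda>\<phi>. \<phi>)"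
proof -
  interpret atlas M by fact
  show ?thesis
  proof (intro section_family.intro section_family_axioms.intro, goal_cases)
    case (2 s)
    have sw: "(\<forall>c\<in>A. \<forall>d\<in>A. \<forall>p\<in>fst c \<inter> fst d. R c d p) = (\<forall>c\<in>A. \<forall>d\<in>A. \<forall>p\<in>fst c \<inter> fst d. R d c p)"
      for A :: "('a, 'n) chart set" and R by blast
    show ?case
      unfolding Ten_simps smooth_tfields_def mem_Collect_eq sandwich_apply
      by (rule arg_cong2[where f = "(\<and>)", OF refl sw])
  next
    case (5 c d)
    then have cd: "c \<in> charts M" "d \<in> charts M" by auto
    have J: "smooth_on (overlap c d) (\<lambda>x. jacobian d c (chart_inv d (transition c d x)))"
      using smooth_on_transition_compose[OF cd smooth_jacobian[OF cd(2,1)]] .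
    have "smooth_on (overlap c d) (\<lambda>x. sandwich (jacobian d c (chart_inv d (transition c d x))) (jacobian d c (chart_inv d (transition c d x))))"
      using moderate_on_bilinear[OF bounded_bilinear_sandwich open_overlap[OF cd]
          J[unfolded smooth_on_iff_moderate_on] J[unfolded smooth_on_iff_moderate_on]]
      unfolding smooth_on_iff_moderate_on .
    then have "smooth_on (overlap c d) (\<lambda>x. sandwich (jacobian d c (chart_inv c x)) (jacobian d c (chart_inv c x)))"
      by (rule smooth_on_cong[OF open_overlap[OF cd], rotated]) (simp add: chart_inv_transition[OF cd])
    then show ?case unfolding overlap_def .
  next
    case (6 c p v)
    then show ?case by (simp add: jacobian_refl transpose_mat)
  next
    case (7 c d e p v)
    have "jacobian e c p = jacobian d c p ** jacobian e d p"
      using jacobian_trans[of e d c p] 7 by simp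
    then show ?case by (simp add: matrix_transpose_mul matrix_mul_assoc)
  next
    case (3 \<phi> c p)
    show ?case by simp
  qed (use assms in simp_all)
qed

section \<open>Existence of Riemannian metrics\<close>

lemma locally_finite_inD:
  assumes "locally_finite_in X \<V>" "x \<in> topspace X"
  obtains U where "openin X U" "x \<in> U" "finite {V \<in> \<V>. V \<inter> U \<noteq> {}}"
  using assms unfolding locally_finite_in_def by blast

text \<open>A chart-adapted form of a partition of unity, without the normalisation.  The cover is
  refined twice: the sets of the second refinement have their closures inside the sets of the first
  one, and by local finiteness the union of the closures belonging to one set of the first refinement
  is closed, hence compact inside a closed coordinate ball.\<close>

lemma locally_finite_bumps:
  fixes M :: "('a, 'n::finite) manifold"
  assumes "smooth_manifold M"
  obtains \<V> :: "'a set set" and C :: "'a set \<Rightarrow> ('a, 'n) chart" and \<rho> L where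
    "locally_finite_in (mtop M) \<V>"
    "\<And>V. V \<in> \<V> \<Longrightarrow> C V \<in> charts M \<and> V \<subseteq> fst (C V) \<and> smooth_on UNIV (\<rho> V) \<and> (\<forall>x. 0 \<le> \<rho> V x) \<and>
       compact (L V) \<and> L V \<subseteq> snd (C V) ` V \<and> (\<forall>x. x \<notin> L V \<longrightarrow> \<rho> V x = (0::real))"
    "\<And>p. p \<in> topspace (mtop M) \<Longrightarrow> \<exists>V\<in>\<V>. p \<in> V \<and> 0 < \<rho> V (snd (C V) p)"
proof -
  interpret atlas M using assms unfolding smooth_manifold_def by unfold_locales auto
  let ?X = "mtop M"
  have para: "\<exists>\<V>. (\<forall>V\<in>\<V>. openin ?X V \<and> (\<exists>U\<in>\<U>. V \<subseteq> U)) \<and> \<Union>\<V> = topspace ?X \<and> locally_finite_in ?X \<V>"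
    if "\<forall>U\<in>\<U>. openin ?X U" "\<Union>\<U> = topspace ?X" for \<U>
    using assms that unfolding smooth_manifold_def paracompact_space_def by blast
  \<comment> \<open>every point has arbitrarily small neighbourhoods that are coordinate balls\<close>
  have ball: "\<exists>e>0. cball (snd c p) e \<subseteq> snd c ` (fst c \<inter> V)" if "c \<in> charts M" "openin ?X V" "p \<in> fst c" "p \<in> V" for c p V
  proof -
    have "snd c p \<in> snd c ` (fst c \<inter> V)" using that by blast
    then show ?thesis using open_chart_image[OF that(1,2)] open_contains_cball by blast
  qed
  define B where "B c p e = {q \<in> fst c. snd c q \<in> ball (snd c p) e}" for c :: "('a, 'n) chart" and p e
  have B_open: "openin ?X (B c p e)" if "c \<in> charts M" for c p e
    unfolding B_def using that by (intro openin_chart_preimage) auto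
  have "\<forall>p\<in>topspace ?X. \<exists>c. c \<in> charts M \<and> p \<in> fst c" using cover by blast
  then obtain c where c: "\<And>p. p \<in> topspace ?X \<Longrightarrow> c p \<in> charts M \<and> p \<in> fst (c p)" by metis
  have "\<forall>p\<in>topspace ?X. \<exists>e. 0 < e \<and> cball (snd (c p) p) e \<subseteq> cimg (c p)"
  proof
    fix p assume "p \<in> topspace ?X"
    then have "snd (c p) p \<in> cimg (c p)" "open (cimg (c p))" using c by auto
    then show "\<exists>e. 0 < e \<and> cball (snd (c p) p) e \<subseteq> cimg (c p)"
      using open_contains_cball[of "cimg (c p)"] by blast
  qed
  then obtain e where "\<forall>p\<in>topspace ?X. 0 < e p \<and> cball (snd (c p) p) (e p) \<subseteq> cimg (c p)"
    by (rule bchoice[THEN exE])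
  then have e: "\<And>p. p \<in> topspace ?X \<Longrightarrow> 0 < e p \<and> cball (snd (c p) p) (e p) \<subseteq> cimg (c p)" by blast
  have "\<forall>U\<in>(\<lambda>p. B (c p) p (e p)) ` topspace ?X. openin ?X U" using c B_open by blast
  moreover have "\<Union>((\<lambda>p. B (c p) p (e p)) ` topspace ?X) = topspace ?X"
  proof
    show "topspace ?X \<subseteq> \<Union>((\<lambda>p. B (c p) p (e p)) ` topspace ?X)"
      using c e by (auto simp: B_def)
  qed (use c B_open openin_subset in blast)
  ultimately obtain \<V> where \<V>0: "\<forall>V\<in>\<V>. openin ?X V \<and> (\<exists>U\<in>(\<lambda>p. B (c p) p (e p)) ` topspace ?X. V \<subseteq> U)"
    and \<V>: "\<Union>\<V> = topspace ?X" "locally_finite_in ?X \<V>"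
    using para[of "(\<lambda>p. B (c p) p (e p)) ` topspace ?X"] by blast
  have "\<forall>V\<in>\<V>. \<exists>p. p \<in> topspace ?X \<and> V \<subseteq> B (c p) p (e p)" using \<V>0 by blast
  then obtain P where "\<forall>V\<in>\<V>. P V \<in> topspace ?X \<and> V \<subseteq> B (c (P V)) (P V) (e (P V))"
    by (rule bchoice[THEN exE])
  then have P: "\<And>V. V \<in> \<V> \<Longrightarrow> P V \<in> topspace ?X \<and> V \<subseteq> B (c (P V)) (P V) (e (P V))" by blast
  define C where "C V = c (P V)" for V
  have C: "C V \<in> charts M" "V \<subseteq> fst (C V)" if "V \<in> \<V>" for V
    using P[OF that] c[of "P V"] unfolding C_def B_def by blast+
  have "\<forall>q\<in>topspace ?X. \<exists>V. V \<in> \<V> \<and> q \<in> V" using \<V>(1) by blast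
  then obtain N where "\<forall>q\<in>topspace ?X. N q \<in> \<V> \<and> q \<in> N q" by (rule bchoice[THEN exE])
  then have N: "\<And>q. q \<in> topspace ?X \<Longrightarrow> N q \<in> \<V> \<and> q \<in> N q" by blast
  have "\<forall>q\<in>topspace ?X. \<exists>r. 0 < r \<and> cball (snd (C (N q)) q) r \<subseteq> snd (C (N q)) ` (fst (C (N q)) \<inter> N q)"
  proof
    fix q assume "q \<in> topspace ?X"
    then have "N q \<in> \<V>" "q \<in> N q" using N by auto
    then show "\<exists>r. 0 < r \<and> cball (snd (C (N q)) q) r \<subseteq> snd (C (N q)) ` (fst (C (N q)) \<inter> N q)"
      using ball[of "C (N q)" "N q" q] C[of "N q"] \<V>0 by blast
  qed
  then obtain r where "\<forall>q\<in>topspace ?X. 0 < r q \<and> 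
      cball (snd (C (N q)) q) (r q) \<subseteq> snd (C (N q)) ` (fst (C (N q)) \<inter> N q)" by (rule bchoice[THEN exE])
  then have r: "\<And>q. q \<in> topspace ?X \<Longrightarrow> 0 < r q \<and> 
      cball (snd (C (N q)) q) (r q) \<subseteq> snd (C (N q)) ` (fst (C (N q)) \<inter> N q)" by blast
  define D where "D q = B (C (N q)) q (r q)" for q
  have oD: "\<forall>U\<in>D ` topspace ?X. openin ?X U" unfolding D_def using C N B_open by blast
  moreover have "\<Union>(D ` topspace ?X) = topspace ?X"
  proof
    show "topspace ?X \<subseteq> \<Union>(D ` topspace ?X)"
    proof
      fix q assume q: "q \<in> topspace ?X"
      then have "q \<in> D q" using C[of "N q"] N[OF q] r[OF q] by (auto simp: D_def B_def)
      with q show "q \<in> \<Union>(D ` topspace ?X)" by blast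
    qed
    show "\<Union>(D ` topspace ?X) \<subseteq> topspace ?X"
      using oD openin_subset[of ?X] by (simp add: UN_subset_iff)
  qed
  ultimately obtain \<W> where \<W>: "\<forall>W\<in>\<W>. openin ?X W \<and> (\<exists>U\<in>D ` topspace ?X. W \<subseteq> U)"
    "\<Union>\<W> = topspace ?X" "locally_finite_in ?X \<W>"
    using para[of "D ` topspace ?X"] by blast
  have "\<forall>W\<in>\<W>. \<exists>q. q \<in> topspace ?X \<and> W \<subseteq> D q" using \<W>(1) by blast
  then obtain Q where "\<forall>W\<in>\<W>. Q W \<in> topspace ?X \<and> W \<subseteq> D (Q W)"
    by (rule bchoice[THEN exE])
  then have Q: "\<And>W. W \<in> \<W> \<Longrightarrow> Q W \<in> topspace ?X \<and> W \<subseteq> D (Q W)" by blast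
  have clW: "?X closure_of W \<subseteq> N (Q W)" if W: "W \<in> \<W>" for W
  proof -
    let ?c = "C (N (Q W))" and ?K = "cball (snd (C (N (Q W))) (Q W)) (r (Q W))"
    have q: "Q W \<in> topspace ?X" using Q W by blast
    have cc: "?c \<in> charts M" using C N q by blast
    have K: "compact ?K" "?K \<subseteq> snd ?c ` (fst ?c \<inter> N (Q W))" using r[OF q] by auto
    then have "closedin ?X (chart_inv ?c ` ?K)"
      by (intro closedin_chart_inv cc) (auto simp: cimg_def)
    moreover have "W \<subseteq> chart_inv ?c ` ?K"
    proof
      fix w assume "w \<in> W"
      then have "w \<in> fst ?c" "snd ?c w \<in> ?K" using Q[OF W] by (auto simp: D_def B_def)
      then show "w \<in> chart_inv ?c ` ?K" using cc by (metis chart_inv_left image_eqI)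
    qed
    ultimately have "?X closure_of W \<subseteq> chart_inv ?c ` ?K" by (simp add: closure_of_minimal)
    also have "\<dots> \<subseteq> N (Q W)" using K(2) cc by auto
    finally show ?thesis .
  qed
  define A where "A V = \<Union>((\<lambda>W. ?X closure_of W) ` {W \<in> \<W>. N (Q W) = V})" for V
  have A_sub: "A V \<subseteq> V" for V unfolding A_def using clW by blast
  have A_compact: "compactin ?X (A V)" if V: "V \<in> \<V>" for V
  proof -
    have "closedin ?X (A V)" unfolding A_def
      using locally_finite_in_subset[OF \<W>(3)] by (intro closedin_Union_locally_finite_closure) auto
    moreover have "compactin ?X (chart_inv (C V) ` cball (snd (C V) (P V)) (e (P V)))"
      using C[OF V] e P[OF V] by (intro compactin_chart_inv) (auto simp: C_def)
    moreover have "A V \<subseteq> chart_inv (C V) ` cball (snd (C V) (P V)) (e (P V))"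
    proof
      fix a assume "a \<in> A V"
      then have "a \<in> V" using A_sub by blast
      then have "a \<in> fst (C V)" "snd (C V) a \<in> cball (snd (C V) (P V)) (e (P V))"
        using P[OF V] by (auto simp: C_def B_def)
      then show "a \<in> chart_inv (C V) ` cball (snd (C V) (P V)) (e (P V))"
        using C[OF V] by (metis chart_inv_left image_eqI)
    qed
    ultimately show ?thesis using closed_compactin by blast
  qed
  have "\<forall>V\<in>\<V>. \<exists>\<rho>L. case \<rho>L of (\<rho>, L) \<Rightarrow> smooth_on UNIV \<rho> \<and> (\<forall>x. 0 \<le> \<rho> x) \<and> (\<forall>x\<in>snd (C V) ` A V. 0 < \<rho> x) \<and>
     compact L \<and> L \<subseteq> snd (C V) ` V \<and> (\<forall>x. x \<notin> L \<longrightarrow> \<rho> x = (0::real))"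
  proof
    fix V assume V: "V \<in> \<V>"
    have "compact (snd (C V) ` A V)"
      using compact_chart_image[OF C(1)[OF V] A_compact[OF V]] A_sub[of V] C(2)[OF V] by blast
    moreover have "snd (C V) ` A V \<subseteq> snd (C V) ` V" using A_sub by blast
    moreover have "open (snd (C V) ` V)"
      using open_chart_image[OF C(1)[OF V], of V] bspec[OF \<V>0 V] C(2)[OF V] by (simp add: Int_absorb1)
    ultimately obtain \<rho> :: "real^'n \<Rightarrow> real" and L where "smooth_on UNIV \<rho>" "\<And>x. 0 \<le> \<rho> x" "\<And>x. x \<in> snd (C V) ` A V \<Longrightarrow> 0 < \<rho> x"
      "compact L" "L \<subseteq> snd (C V) ` V" "\<And>x. x \<notin> L \<Longrightarrow> \<rho> x = 0"
      by (rule bump_exists) (rule that)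
    then show "\<exists>\<rho>L. case \<rho>L of (\<rho>, L) \<Rightarrow> smooth_on UNIV \<rho> \<and> (\<forall>x. 0 \<le> \<rho> x) \<and> (\<forall>x\<in>snd (C V) ` A V. 0 < \<rho> x) \<and>
     compact L \<and> L \<subseteq> snd (C V) ` V \<and> (\<forall>x. x \<notin> L \<longrightarrow> \<rho> x = (0::real))"
      by (intro exI[of _ "(\<rho>, L)"]) simp
  qed
  then obtain \<rho>L where \<rho>L: "\<forall>V\<in>\<V>. case \<rho>L V of (\<rho>, L) \<Rightarrow> smooth_on UNIV \<rho> \<and> (\<forall>x. 0 \<le> \<rho> x) \<and> (\<forall>x\<in>snd (C V) ` A V. 0 < \<rho> x) \<and>
     compact L \<and> L \<subseteq> snd (C V) ` V \<and> (\<forall>x. x \<notin> L \<longrightarrow> \<rho> x = (0::real))"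
    by (rule bchoice[THEN exE])
  define \<rho> where "\<rho> V = fst (\<rho>L V)" for V
  define L where "L V = snd (\<rho>L V)" for V
  have \<rho>: "\<And>V. V \<in> \<V> \<Longrightarrow> smooth_on UNIV (\<rho> V) \<and> (\<forall>x. 0 \<le> \<rho> V x) \<and> (\<forall>x\<in>snd (C V) ` A V. 0 < \<rho> V x) \<and>
     compact (L V) \<and> L V \<subseteq> snd (C V) ` V \<and> (\<forall>x. x \<notin> L V \<longrightarrow> \<rho> V x = (0::real))"
    using \<rho>L by (simp add: \<rho>_def L_def case_prod_beta)
  show ?thesis
  proof (rule that[of \<V> C \<rho> L])
    show "locally_finite_in ?X \<V>" by fact
    show "C V \<in> charts M \<and> V \<subseteq> fst (C V) \<and> smooth_on UNIV (\<rho> V) \<and> (\<forall>x. 0 \<le> \<rho> V x) \<and>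
       compact (L V) \<and> L V \<subseteq> snd (C V) ` V \<and> (\<forall>x. x \<notin> L V \<longrightarrow> \<rho> V x = (0::real))" if "V \<in> \<V>" for V
      using C[OF that] \<rho>[OF that] by blast
    fix p assume p: "p \<in> topspace ?X"
    then obtain W where W: "W \<in> \<W>" "p \<in> W" using \<W>(2) by blast
    have "openin ?X W" using \<W>(1) W(1) by blast
    then have "p \<in> ?X closure_of W" using closure_of_subset[OF openin_subset, of ?X W] W(2) by blast
    then have "p \<in> A (N (Q W))" using W by (auto simp: A_def)
    moreover have "N (Q W) \<in> \<V>" using N Q W by blast
    ultimately have "p \<in> N (Q W)" "0 < \<rho> (N (Q W)) (snd (C (N (Q W))) p)"
      using \<rho>[of "N (Q W)"] A_sub[of "N (Q W)"] by blast+
    with \<open>N (Q W) \<in> \<V>\<close> show "\<exists>V\<in>\<V>. p \<in> V \<and> 0 < \<rho> V (snd (C V) p)" by blast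
  qed
qed

text \<open>The Euclidean metrics of the charts are multiplied with the bump functions and added; the sum is
  positive definite because a Jacobian matrix is injective.\<close>

theorem riemannian_metric_exists:
  fixes M :: "('a, 'n::finite) manifold"
  assumes "smooth_manifold M"
  obtains h where "riemannian M h"
proof -
  interpret atlas M using assms unfolding smooth_manifold_def by unfold_locales auto
  interpret Ten: section_family "Ten M" "\<lambda>c d p. sandwich (jacobian d c p) (jacobian d c p)" "\<lambda>\<phi>. \<phi>"
    by (rule Ten_section_family) unfold_locales
  obtain \<V> :: "'a set set" and C :: "'a set \<Rightarrow> ('a, 'n) chart" and \<rho> L where
    lf: "locally_finite_in (mtop M) \<V>" and
    V: "\<And>V. V \<in> \<V> \<Longrightarrow> C V \<in> charts M \<and> V \<subseteq> fst (C V) \<and> smooth_on UNIV (\<rho> V) \<and> (\<forall>x. 0 \<le> \<rho> V x) \<and>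
       compact (L V) \<and> L V \<subseteq> snd (C V) ` V \<and> (\<forall>x. x \<notin> L V \<longrightarrow> \<rho> V x = (0::real))" and
    pos: "\<And>p. p \<in> topspace (mtop M) \<Longrightarrow> \<exists>V\<in>\<V>. p \<in> V \<and> 0 < \<rho> V (snd (C V) p)"
    by (rule locally_finite_bumps[OF assms]) (rule that)
  define E where "E V = Ten.extend (C V) (\<lambda>x. \<rho> V x *\<^sub>R mat 1)" for V
  have E: "E V \<in> smooth_tfields M" if "V \<in> \<V>" for V
  proof -
    have "E V \<in> sections (Ten M)" unfolding E_def
    proof (rule Ten.extend_section[of "C V" _ "L V"])
      show "smooth_on (cimg (C V)) (\<lambda>x. \<rho> V x *\<^sub>R (mat 1 :: real^'n^'n))"
        using V[OF that] smooth_on_subset[OF subset_UNIV, of "\<rho> V"]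
        by (intro smooth_on_scaleR smooth_on_const open_cimg) auto
      have "snd (C V) ` V \<subseteq> cimg (C V)" unfolding cimg_def using V[OF that] by (intro image_mono) blast
      then show "L V \<subseteq> cimg (C V)" using V[OF that] by blast
    qed (use V[OF that] in auto)
    then show ?thesis by simp
  qed
  have E_eq: "E V d p = (if p \<in> fst (C V) then \<rho> V (snd (C V) p) *\<^sub>R (transpose (jacobian d (C V) p) ** jacobian d (C V) p) else 0)"
    if "V \<in> \<V>" "d \<in> charts M" "p \<in> fst d" for V d p
    using Ten.comps_extend[of "C V" d p] V[OF that(1)] that
    by (simp add: E_def bounded_bilinear.scaleR_left[OF bounded_bilinear_matrix_matrix]
      bounded_bilinear.scaleR_right[OF bounded_bilinear_matrix_matrix])
  have E0: "E V d p = 0" if "V \<in> \<V>" "d \<in> charts M" "p \<in> fst d" "p \<notin> V" for V d p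
  proof (cases "p \<in> fst (C V)")
    case True
    have "snd (C V) p \<notin> snd (C V) ` V"
      using V[OF that(1)] True that(4) chart_inj[of "C V"] by (meson inj_on_image_mem_iff)
    then have "\<rho> V (snd (C V) p) = 0" using V[OF that(1)] by blast
    then show ?thesis using E_eq[OF that(1-3)] by simp
  qed (use E_eq[OF that(1-3)] in simp)
  define h where "h d p = (\<Sum>V | V \<in> \<V> \<and> p \<in> V. E V d p)" for d p
  have h_eq: "h d p = (\<Sum>V\<in>{V \<in> \<V>. V \<inter> U \<noteq> {}}. E V d p)"
    if "finite {V \<in> \<V>. V \<inter> U \<noteq> {}}" "p \<in> U" "d \<in> charts M" "p \<in> fst d" for U d p
    unfolding h_def using that E0 by (intro sum.mono_neutral_left) auto
  have nbhd: "\<exists>U. openin (mtop M) U \<and> p \<in> U \<and> finite {V \<in> \<V>. V \<inter> U \<noteq> {}}" if "d \<in> charts M" "p \<in> fst d" for d p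
    using locally_finite_inD[OF lf, of p] that cover by blast
  have "riemannian M h"
    unfolding riemannian_def
  proof (intro conjI ballI allI impI)
    have "h \<in> sections (Ten M)"
      unfolding Ten.sections_iff
    proof (intro conjI ballI)
      fix d assume "d \<in> charts (base (Ten M))"
      then have d: "d \<in> charts M" by simp
      have "smooth_on (cimg d) (h d \<circ> chart_inv d)"
      proof (rule smooth_on_locally)
        fix x assume x: "x \<in> cimg d"
        obtain U where U: "openin (mtop M) U" "chart_inv d x \<in> U" "finite {V \<in> \<V>. V \<inter> U \<noteq> {}}"
          using nbhd[OF d chart_inv_in[OF x]] by blast
        let ?W = "snd d ` (fst d \<inter> U)"
        have W: "open ?W" by (rule open_chart_image[OF d U(1)])
        have "smooth_on ?W (h d \<circ> chart_inv d)"
        proof (rule smooth_on_cong[OF W])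
          have "smooth_on ?W (\<lambda>x. E V d (chart_inv d x))" if "V \<in> \<V>" for V
            using E[OF that] Ten.section_smooth[of "E V" d] d
            by (intro smooth_on_subset[of ?W "cimg d"]) (auto simp: cimg_def)
          then show "smooth_on ?W (\<lambda>x. \<Sum>V\<in>{V \<in> \<V>. V \<inter> U \<noteq> {}}. E V d (chart_inv d x))"
            by (intro smooth_on_sum W) auto
          show "(\<Sum>V\<in>{V \<in> \<V>. V \<inter> U \<noteq> {}}. E V d (chart_inv d x)) = (h d \<circ> chart_inv d) x" if "x \<in> ?W" for x
            using that d h_eq[OF U(3), of _ d] by auto
        qed
        moreover have "x \<in> ?W" using x U(2) by (intro image_eqI[of _ _ "chart_inv d x"]) auto
        ultimately show "\<exists>U. open U \<and> x \<in> U \<and> smooth_on U (h d \<circ> chart_inv d)" using W by blast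
      qed
      then show "smooth_in_chart d (comps (Ten M) h d)" by (simp add: smooth_in_chart_def cimg_def)
    next
      fix c d p assume "c \<in> charts (base (Ten M))" "d \<in> charts (base (Ten M))" "p \<in> fst c \<inter> fst d"
      then show "comps (Ten M) h d p = blinfun_apply (sandwich (jacobian d c p) (jacobian d c p)) (comps (Ten M) h c p)"
        using E Ten.section_transform[of _ c d p]
        by (simp add: h_def blinfun.sum_right del: sandwich_apply)
    qed
    then show "h \<in> smooth_tfields M" by simp
  next
    fix d p assume d: "d \<in> charts M" "p \<in> fst d"
    show "sym_form (h d p)"
    proof -
      have "transpose (E V d p) = E V d p" if "V \<in> \<V>" for V
        using E_eq[OF that d]
        by (simp add: matrix_transpose_mul linear_0[OF bounded_linear.linear[OF bounded_linear_transpose]]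
            linear_scale[OF bounded_linear.linear[OF bounded_linear_transpose]])
      then show ?thesis unfolding sym_form_iff_transpose h_def
        by (subst linear_sum[OF bounded_linear.linear[OF bounded_linear_transpose]]) simp
    qed
    fix v :: "real^'n" assume v: "v \<noteq> 0"
    obtain U where U: "openin (mtop M) U" "p \<in> U" "finite {V \<in> \<V>. V \<inter> U \<noteq> {}}"
      using nbhd[OF d] by blast
    have E_form: "v \<bullet> (E V d p *v v) = \<rho> V (snd (C V) p) * (norm (jacobian d (C V) p *v v))\<^sup>2" if "V \<in> \<V>" "p \<in> fst (C V)" for V
    proof -
      have "v \<bullet> ((transpose J ** J) *v v) = (norm (J *v v))\<^sup>2" for J :: "real^'n^'n"
        using transpose_inner[of J "J *v v" v]
        by (simp add: matrix_vector_mul_assoc[symmetric] power2_norm_eq_inner inner_commute)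
      then show ?thesis using E_eq[OF that(1) d] that(2) by (simp add: scaleR_matrix_vector_assoc[symmetric])
    qed
    have E_nonneg: "0 \<le> v \<bullet> (E V d p *v v)" if "V \<in> \<V>" for V
      using E_form[OF that] E_eq[OF that d] V[OF that] by (cases "p \<in> fst (C V)") auto
    obtain V0 where V0: "V0 \<in> \<V>" "p \<in> V0" "0 < \<rho> V0 (snd (C V0) p)" using pos cover d by blast
    have "v \<bullet> (h d p *v v) = (\<Sum>V\<in>{V \<in> \<V>. V \<inter> U \<noteq> {}}. v \<bullet> (E V d p *v v))"
      unfolding h_eq[OF U(3,2) d] by (simp add: bounded_bilinear.sum_left[OF bounded_bilinear_matrix_vector] inner_sum_right)
    also have "\<dots> > 0"
    proof (rule sum_pos2[OF U(3), of V0])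
      show "V0 \<in> {V \<in> \<V>. V \<inter> U \<noteq> {}}" using V0 U by blast
      have "p \<in> fst (C V0)" using V V0 by blast
      moreover have "jacobian d (C V0) p *v v \<noteq> 0"
      proof
        assume "jacobian d (C V0) p *v v = 0"
        then have "(jacobian (C V0) d p ** jacobian d (C V0) p) *v v = 0"
          by (simp add: matrix_vector_mul_assoc[symmetric])
        then show False using jacobian_inverse[of d "C V0" p] V[OF V0(1)] d \<open>p \<in> fst (C V0)\<close> v by simp
      qed
      ultimately show "0 < v \<bullet> (E V0 d p *v v)" using E_form V0 by simp
    qed (use E_nonneg in auto)
    finally show "0 < v \<bullet> (h d p *v v)" .
  qed
  then show ?thesis by (rule that)
qed

section \<open>The norms induced by a Riemannian metric\<close>

lemma riemannian_posdef: "riemannian M h \<Longrightarrow> c \<in> charts M \<Longrightarrow> p \<in> fst c \<Longrightarrow> posdef (h c p)"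
  unfolding riemannian_def posdef_def sym_form_iff_transpose by blast

lemma riemannian_continuous:
  assumes "riemannian M h" "c \<in> charts M" "L \<subseteq> cimg c"
  shows "continuous_on (L \<times> UNIV) (\<lambda>z. h c (chart_inv c (fst z)))"
proof -
  have "smooth_on (cimg c) (h c \<circ> chart_inv c)"
    using assms unfolding riemannian_def smooth_tfields_def smooth_in_chart_def cimg_def by blast
  then have "continuous_on (cimg c) (h c \<circ> chart_inv c)" by (rule smooth_on_continuous)
  then have "continuous_on (L \<times> UNIV) ((h c \<circ> chart_inv c) \<circ> fst)"
    using assms(3) by (intro continuous_on_compose continuous_on_fst continuous_on_id) (auto elim: continuous_on_subset)
  then show ?thesis by (simp add: o_def)
qed

lemma riemannian_norm_bounds:
  fixes M :: "('a, 'n::finite) manifold"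
  assumes "riemannian M h" "c \<in> charts M" "compact L" "L \<subseteq> cimg c" "atlas M"
  obtains a b where "0 < a" "0 < b" "\<And>x v. x \<in> L \<Longrightarrow>
    a * norm v \<le> sqrt (v \<bullet> (h c (chart_inv c x) *v v)) \<and> sqrt (v \<bullet> (h c (chart_inv c x) *v v)) \<le> b * norm v"
proof -
  interpret atlas M by fact
  let ?q = "\<lambda>x v. v \<bullet> (h c (chart_inv c x) *v v)"
  have "continuous_on (L \<times> UNIV) (\<lambda>z. snd z \<bullet> (h c (chart_inv c (fst z)) *v snd z))"
    by (intro continuous_on_inner bounded_bilinear.continuous_on[OF bounded_bilinear_matrix_vector]
        riemannian_continuous[OF assms(1,2,4)] continuous_on_snd continuous_on_id)
  then have cont: "continuous_on (L \<times> UNIV) (\<lambda>(x, v). ?q x v)" by (simp add: case_prod_beta)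
  obtain a b where ab: "0 < a" "0 < b" "\<And>x v. x \<in> L \<Longrightarrow> a * (norm v)\<^sup>2 \<le> ?q x v \<and> ?q x v \<le> b * (norm v)\<^sup>2"
  proof (rule quadratic_form_bounds[OF assms(3) cont])
    fix x and v :: "real^'n" assume "x \<in> L"
    show "?q x (r *\<^sub>R v) = r\<^sup>2 * ?q x v" for r by (simp add: matrix_vector_mult_scaleR power2_eq_square)
    assume "v \<noteq> 0"
    then show "0 < ?q x v" using riemannian_posdef[OF assms(1,2), of "chart_inv c x"] \<open>x \<in> L\<close> assms(4)
      unfolding posdef_def by auto
  qed (rule that)
  show ?thesis
  proof (rule that[of "sqrt a" "sqrt b"])
    fix x and v :: "real^'n" assume "x \<in> L"
    then have "sqrt (a * (norm v)\<^sup>2) \<le> sqrt (?q x v)" "sqrt (?q x v) \<le> sqrt (b * (norm v)\<^sup>2)"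
      using ab(3) by auto
    then show "sqrt a * norm v \<le> sqrt (?q x v) \<and> sqrt (?q x v) \<le> sqrt b * norm v"
      by (simp add: real_sqrt_mult)
  qed (use ab in auto)
qed

lemma Vec_normed_bundle:
  assumes "smooth_manifold M"
  shows "normed_bundle (Vec M) (\<lambda>c d p. mvL (jacobian c d p)) (\<lambda>\<phi>. \<phi>)"
proof -
  have "atlas M" using assms unfolding smooth_manifold_def by unfold_locales auto
  then interpret atlas M .
  obtain h0 where "riemannian M h0" using riemannian_metric_exists[OF assms] .
  show ?thesis
  proof (intro normed_bundle.intro vector_bundle.intro Vec_section_family \<open>atlas M\<close>
      vector_bundle_axioms.intro normed_bundle_axioms.intro, goal_cases)
    case 1
    then show ?case using \<open>riemannian M h0\<close> by auto
  next
    case (2 \<nu> c L)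
    then obtain h where h: "riemannian M h" "\<nu> = (\<lambda>c p v. sqrt (v \<bullet> (h c p *v v)))" by auto
    obtain a b where "0 < a" "0 < b" "\<And>x v. x \<in> L \<Longrightarrow>
    a * norm v \<le> sqrt (v \<bullet> (h c (chart_inv c x) *v v)) \<and> sqrt (v \<bullet> (h c (chart_inv c x) *v v)) \<le> b * norm v"
      using riemannian_norm_bounds[OF h(1), of c L] 2 \<open>atlas M\<close> by auto
    then show ?case unfolding h(2) by blast
  next
    case (4 \<nu> c L)
    then obtain h where h: "riemannian M h" "\<nu> = (\<lambda>c p v. sqrt (v \<bullet> (h c p *v v)))" by auto
    obtain a b where "0 < a" "0 < b" "\<And>x v. x \<in> L \<Longrightarrow>
    a * norm v \<le> sqrt (v \<bullet> (h c (chart_inv c x) *v v)) \<and> sqrt (v \<bullet> (h c (chart_inv c x) *v v)) \<le> b * norm v"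
      using riemannian_norm_bounds[OF h(1), of c L] 4 \<open>atlas M\<close> by auto
    then show ?case unfolding h(2) by blast
  next
    case (5 \<nu> c d p v)
    then obtain h where h: "riemannian M h" "\<nu> = (\<lambda>c p v. sqrt (v \<bullet> (h c p *v v)))" by auto
    let ?J = "jacobian c d p"
    have "h c p = transpose ?J ** h d p ** ?J"
      using 5(2-5) h(1) unfolding riemannian_def smooth_tfields_def Vec_simps by blast
    then have "(?J *v v) \<bullet> (h d p *v (?J *v v)) = v \<bullet> (h c p *v v)"
      using transpose_inner[of ?J "h d p *v (?J *v v)" v]
      by (simp add: matrix_vector_mul_assoc[symmetric] inner_commute)
    then show ?case by (simp add: h(2))
  qed auto
qed

text \<open>The square of the norm is \<open>t \<bullet> (H t H)\<close> with the inverse \<open>H\<close> of the metric \<open>h\<close>.  In terms of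
  \<open>s = H t H\<close>, that is \<open>t = h s h\<close>, it is the quadratic form \<open>q1 s = s \<bullet> (h s h)\<close>, while \<open>\<bar>t\<bar>\<^sup>2\<close>
  is \<open>q2 s = \<bar>h s h\<bar>\<^sup>2\<close>.  Both forms involve only \<open>h\<close>, which is continuous, and both are
  equivalent to \<open>\<bar>s\<bar>\<^sup>2\<close> on compact sets; comparing them avoids the inverse matrix.\<close>

lemma Ten_vector_bundle:
  fixes M :: "('a, 'n::finite) manifold"
  assumes "smooth_manifold M"
  shows "vector_bundle (Ten M) (\<lambda>c d p. sandwich (jacobian d c p) (jacobian d c p)) (\<lambda>\<phi>. \<phi>)"
proof -
  have "atlas M" using assms unfolding smooth_manifold_def by unfold_locales auto
  then interpret atlas M .
  obtain h0 where "riemannian M h0" using riemannian_metric_exists[OF assms] .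
  show ?thesis
  proof (intro vector_bundle.intro Ten_section_family \<open>atlas M\<close> vector_bundle_axioms.intro, goal_cases)
    case 1
    then show ?case using \<open>riemannian M h0\<close> by (auto simp: Ten_def)
  next
    case (2 \<nu> c L)
    then have c: "c \<in> charts M" "compact L" "L \<subseteq> cimg c" by auto
    from 2 obtain h where h: "riemannian M h" and \<nu>: "\<nu> = (\<lambda>c p t. let H = matrix_inv (h c p) in
                 sqrt (\<Sum>i\<in>UNIV. \<Sum>j\<in>UNIV. \<Sum>k\<in>UNIV. \<Sum>l\<in>UNIV.
                         H $ i $ k * H $ j $ l * t $ i $ j * t $ k $ l))" by (auto simp: Ten_def)
    define hx where "hx x = h c (chart_inv c x)" for x
    have pd: "posdef (hx x)" if "x \<in> L" for x
      unfolding hx_def using riemannian_posdef[OF h c(1)] c(3) that by auto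
    have hc: "continuous_on (L \<times> UNIV) (\<lambda>z. hx (fst z) ** snd z ** hx (fst z))"
      unfolding hx_def
      by (intro bounded_bilinear.continuous_on[OF bounded_bilinear_matrix_matrix]
          riemannian_continuous[OF h c(1,3)] continuous_on_snd continuous_on_id)
    have scale: "hx x ** (r *\<^sub>R s) ** hx x = r *\<^sub>R (hx x ** s ** hx x)" for x r s
      by (simp add: bounded_bilinear.scaleR_left[OF bounded_bilinear_matrix_matrix]
          bounded_bilinear.scaleR_right[OF bounded_bilinear_matrix_matrix])
    define q1 where "q1 x s = s \<bullet> (hx x ** s ** hx x)" for x s
    define q2 where "q2 x s = (hx x ** s ** hx x) \<bullet> (hx x ** s ** hx x)" for x s
    have cont: "continuous_on (L \<times> UNIV) (\<lambda>(x, v). q1 x v)" "continuous_on (L \<times> UNIV) (\<lambda>(x, v). q2 x v)"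
      unfolding case_prod_beta q1_def q2_def
      by (intro continuous_on_inner hc continuous_on_snd continuous_on_id)+
    obtain a1 b1 where ab1: "0 < a1" "0 < b1" "\<And>x v. x \<in> L \<Longrightarrow> a1 * (norm v)\<^sup>2 \<le> q1 x v \<and> q1 x v \<le> b1 * (norm v)\<^sup>2"
    proof (rule quadratic_form_bounds[OF c(2) cont(1)])
      fix x and v :: "real^'n^'n" assume "x \<in> L"
      show "q1 x (r *\<^sub>R v) = r\<^sup>2 * q1 x v" for r unfolding q1_def scale by (simp add: power2_eq_square)
      assume "v \<noteq> 0"
      then show "0 < q1 x v" unfolding q1_def by (rule posdef_sandwich[OF pd[OF \<open>x \<in> L\<close>]])
    qed (rule that)
    obtain a2 b2 where ab2: "0 < a2" "0 < b2" "\<And>x v. x \<in> L \<Longrightarrow> a2 * (norm v)\<^sup>2 \<le> q2 x v \<and> q2 x v \<le> b2 * (norm v)\<^sup>2"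
    proof (rule quadratic_form_bounds[OF c(2) cont(2)])
      fix x and v :: "real^'n^'n" assume x: "x \<in> L"
      show "q2 x (r *\<^sub>R v) = r\<^sup>2 * q2 x v" for r unfolding q2_def scale by (simp add: power2_eq_square)
      assume v: "v \<noteq> 0"
      have "v = matrix_inv (hx x) ** (hx x ** v ** hx x) ** matrix_inv (hx x)"
        using posdef_matrix_inv[OF pd[OF x]] by (metis matrix_mul_assoc matrix_mul_lid matrix_mul_rid)
      then have "hx x ** v ** hx x \<noteq> 0"
        using v bounded_bilinear.zero_left[OF bounded_bilinear_matrix_matrix]
          bounded_bilinear.zero_right[OF bounded_bilinear_matrix_matrix] by metis
      then show "0 < q2 x v" unfolding q2_def by simp
    qed (rule that)
    show ?case
    proof (intro exI[of _ "sqrt (a1 / b2)"] conjI ballI allI)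
      show "0 < sqrt (a1 / b2)" using ab1 ab2 by simp
      fix x and t :: "real^'n^'n" assume x: "x \<in> L"
      let ?H = "matrix_inv (hx x)"
      define s where "s = ?H ** t ** ?H"
      note inv = posdef_matrix_inv[OF pd[OF x]]
      have t: "t = hx x ** s ** hx x"
        unfolding s_def using inv by (metis matrix_mul_assoc matrix_mul_lid matrix_mul_rid)
      have Hs: "?H $ i $ j = ?H $ j $ i" for i j
      proof -
        have "transpose ?H $ j $ i = ?H $ i $ j" by (simp add: transpose_def)
        then show ?thesis by (simp only: inv(3))
      qed
      have "(\<Sum>i\<in>UNIV. \<Sum>j\<in>UNIV. \<Sum>k\<in>UNIV. \<Sum>l\<in>UNIV. ?H $ i $ k * ?H $ j $ l * t $ i $ j * t $ k $ l) = t \<bullet> s"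
      proof -
        have "s $ i $ j = (\<Sum>k\<in>UNIV. \<Sum>l\<in>UNIV. ?H $ i $ k * ?H $ j $ l * t $ k $ l)" for i j
        proof -
          have "s $ i $ j = (\<Sum>l\<in>UNIV. \<Sum>k\<in>UNIV. ?H $ i $ k * t $ k $ l * ?H $ l $ j)"
            by (simp add: s_def matrix_matrix_mult_def sum_distrib_right)
          also have "\<dots> = (\<Sum>k\<in>UNIV. \<Sum>l\<in>UNIV. ?H $ i $ k * t $ k $ l * ?H $ l $ j)" by (rule sum.swap)
          also have "\<dots> = (\<Sum>k\<in>UNIV. \<Sum>l\<in>UNIV. ?H $ i $ k * ?H $ j $ l * t $ k $ l)"
          proof (intro sum.cong refl)
            fix k l
            show "?H $ i $ k * t $ k $ l * ?H $ l $ j = ?H $ i $ k * ?H $ j $ l * t $ k $ l"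
              unfolding Hs[of l j] by simp
          qed
          finally show ?thesis .
        qed
        then show ?thesis by (simp only: inner_vec_def inner_real_def sum_distrib_left) (simp only: mult_ac)
      qed
      then have "\<nu> c (chart_inv c x) t = sqrt (t \<bullet> s)" unfolding \<nu> Let_def hx_def[symmetric] by simp
      also have "t \<bullet> s = q1 x s" unfolding q1_def t[symmetric] by (rule inner_commute)
      finally have \<nu>_eq: "\<nu> c (chart_inv c x) t = sqrt (q1 x s)" .
      have "(norm t)\<^sup>2 = q2 x s" unfolding q2_def t[symmetric] by (rule power2_norm_eq_inner)
      then have "(norm t)\<^sup>2 \<le> b2 * (norm s)\<^sup>2" using ab2(3)[OF x] by metis
      then have "a1 / b2 * (norm t)\<^sup>2 \<le> a1 / b2 * (b2 * (norm s)\<^sup>2)"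
        using ab1 ab2 by (intro mult_left_mono) auto
      also have "\<dots> = a1 * (norm s)\<^sup>2" using ab2 by simp
      also have "\<dots> \<le> q1 x s" using ab1(3)[OF x] by blast
      finally have "sqrt (a1 / b2 * (norm t)\<^sup>2) \<le> sqrt (q1 x s)" by simp
      moreover have "sqrt (a1 / b2 * (norm t)\<^sup>2) = sqrt (a1 / b2) * norm t"
        by (simp only: real_sqrt_mult real_sqrt_abs abs_norm_cancel)
      ultimately show "sqrt (a1 / b2) * norm t \<le> \<nu> c (chart_inv c x) t"
        unfolding \<nu>_eq by (simp only:)
    qed
  qed
qed

section \<open>Equality of nets up to negligible ones\<close>

text \<open>Including the moderateness of both nets makes this a congruence for all operations below,
  differentiation among them, without further growth conditions.\<close>

definition net_eq ::
    "(real^'n::finite) set \<Rightarrow> (real \<Rightarrow> real^'n \<Rightarrow> 'b::real_normed_vector) \<Rightarrow> (real \<Rightarrow> real^'n \<Rightarrow> 'b) \<Rightarrow> bool"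
  where
  "net_eq S f g \<longleftrightarrow> moderate_on S f \<and> moderate_on S g \<and> negligible_on S (\<lambda>\<epsilon> x. f \<epsilon> x - g \<epsilon> x)"

lemma net_eq_refl: "moderate_on S f \<Longrightarrow> net_eq S f f"
  by (simp add: net_eq_def negligible_on_zero)

lemma net_eq_sym: "net_eq S f g \<Longrightarrow> net_eq S g f"
  unfolding net_eq_def using negligible_on_minus[of S "\<lambda>\<epsilon> x. f \<epsilon> x - g \<epsilon> x"] by simp

lemma net_eq_trans: "net_eq S f g \<Longrightarrow> net_eq S g h \<Longrightarrow> net_eq S f h"
  unfolding net_eq_def
  using negligible_on_add[of S "\<lambda>\<epsilon> x. f \<epsilon> x - g \<epsilon> x" "\<lambda>\<epsilon> x. g \<epsilon> x - h \<epsilon> x"] by simp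

lemma net_eq_left: "net_eq S f g \<Longrightarrow> moderate_on S f"
  and net_eq_right: "net_eq S f g \<Longrightarrow> moderate_on S g"
  and net_eq_negligible: "net_eq S f g \<Longrightarrow> negligible_on S (\<lambda>\<epsilon> x. f \<epsilon> x - g \<epsilon> x)"
  by (simp_all add: net_eq_def)

lemma net_eq_cong:
  assumes "open S" "net_eq S f g"
    and "\<And>\<epsilon> x. \<epsilon> \<in> {0<..1} \<Longrightarrow> x \<in> S \<Longrightarrow> f \<epsilon> x = f' \<epsilon> x"
    and "\<And>\<epsilon> x. \<epsilon> \<in> {0<..1} \<Longrightarrow> x \<in> S \<Longrightarrow> g \<epsilon> x = g' \<epsilon> x"
  shows "net_eq S f' g'"
  unfolding net_eq_def
proof (intro conjI)
  show "moderate_on S f'" "moderate_on S g'"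
    using assms moderate_on_cong[of S f f'] moderate_on_cong[of S g g'] by (auto simp: net_eq_def)
  show "negligible_on S (\<lambda>\<epsilon> x. f' \<epsilon> x - g' \<epsilon> x)"
    by (rule negligible_on_cong[OF _ net_eq_negligible[OF assms(2)]]) (use assms(3,4) in simp)
qed

lemma net_eq_add:
  assumes "open S" "net_eq S f f'" "net_eq S g g'"
  shows "net_eq S (\<lambda>\<epsilon> x. f \<epsilon> x + g \<epsilon> x) (\<lambda>\<epsilon> x. f' \<epsilon> x + g' \<epsilon> x)"
proof -
  have "negligible_on S (\<lambda>\<epsilon> x. (f \<epsilon> x - f' \<epsilon> x) + (g \<epsilon> x - g' \<epsilon> x))"
    using assms by (intro negligible_on_add net_eq_negligible)
  then show ?thesis using assms by (auto simp: net_eq_def algebra_simps intro: moderate_on_add)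
qed

lemma net_eq_linear:
  assumes "bounded_linear L" "open S" "net_eq S f f'"
  shows "net_eq S (\<lambda>\<epsilon> x. L (f \<epsilon> x)) (\<lambda>\<epsilon> x. L (f' \<epsilon> x))"
  using assms negligible_on_linear[OF assms(1) net_eq_negligible[OF assms(3)]]
  by (auto simp: net_eq_def linear_diff[OF bounded_linear.linear[OF assms(1)]] moderate_on_linear[OF assms(1)])

lemma net_eq_minus:
  "open S \<Longrightarrow> net_eq S f f' \<Longrightarrow> net_eq S (\<lambda>\<epsilon> x. - f \<epsilon> x) (\<lambda>\<epsilon> x. - f' \<epsilon> x)"
  by (rule net_eq_linear[OF bounded_linear_minus[OF bounded_linear_ident]])

lemma net_eq_diff:
  "open S \<Longrightarrow> net_eq S f f' \<Longrightarrow> net_eq S g g' \<Longrightarrow> net_eq S (\<lambda>\<epsilon> x. f \<epsilon> x - g \<epsilon> x) (\<lambda>\<epsilon> x. f' \<epsilon> x - g' \<epsilon> x)"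
  using net_eq_add[of S f f' "\<lambda>\<epsilon> x. - g \<epsilon> x" "\<lambda>\<epsilon> x. - g' \<epsilon> x"] net_eq_minus[of S g g'] by simp

lemma net_eq_bilinear:
  assumes B: "bounded_bilinear B" and "open S" and f: "net_eq S f f'" and g: "net_eq S g g'"
  shows "net_eq S (\<lambda>\<epsilon> x. B (f \<epsilon> x) (g \<epsilon> x)) (\<lambda>\<epsilon> x. B (f' \<epsilon> x) (g' \<epsilon> x))"
proof -
  interpret bounded_bilinear B by fact
  have "negligible_on S (\<lambda>\<epsilon> x. B (f \<epsilon> x - f' \<epsilon> x) (g \<epsilon> x) + B (f' \<epsilon> x) (g \<epsilon> x - g' \<epsilon> x))"
    using f g by (intro negligible_on_add negligible_on_bilinear_left[OF B] negligible_on_bilinear_right[OF B])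
      (auto simp: net_eq_def intro: moderate_on_tempered)
  then have "negligible_on S (\<lambda>\<epsilon> x. B (f \<epsilon> x) (g \<epsilon> x) - B (f' \<epsilon> x) (g' \<epsilon> x))"
    by (simp add: diff_left diff_right)
  then show ?thesis using assms by (auto simp: net_eq_def moderate_on_bilinear[OF B])
qed

lemma net_eq_sum:
  assumes "open S" "\<And>i. i \<in> I \<Longrightarrow> net_eq S (f i) (g i)"
  shows "net_eq S (\<lambda>\<epsilon> x. \<Sum>i\<in>I. f i \<epsilon> x) (\<lambda>\<epsilon> x. \<Sum>i\<in>I. g i \<epsilon> x)"
  using assms(2)
proof (induction I rule: infinite_finite_induct)
  case (insert i I)
  then show ?case by (simp add: net_eq_add[OF assms(1)])
qed (simp_all add: net_eq_refl moderate_on_const)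

lemma net_eq_prod:
  fixes f :: "'i \<Rightarrow> real \<Rightarrow> real^'n::finite \<Rightarrow> real"
  assumes "open S" "\<And>i. i \<in> I \<Longrightarrow> net_eq S (f i) (g i)"
  shows "net_eq S (\<lambda>\<epsilon> x. \<Prod>i\<in>I. f i \<epsilon> x) (\<lambda>\<epsilon> x. \<Prod>i\<in>I. g i \<epsilon> x)"
  using assms(2)
proof (induction I rule: infinite_finite_induct)
  case (insert i I)
  then show ?case by (simp add: net_eq_bilinear[OF bounded_bilinear_mult assms(1)])
qed (simp_all add: net_eq_refl moderate_on_const)

text \<open>This is where it matters that negligible values of a moderate net entail negligible derivatives.\<close>

lemma net_eq_pd:
  assumes "open S" "net_eq S f g" shows "net_eq S (\<lambda>\<epsilon>. pd i (f \<epsilon>)) (\<lambda>\<epsilon>. pd i (g \<epsilon>))"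
proof -
  have m: "moderate_on S f" "moderate_on S g" using assms by (auto simp: net_eq_def)
  have "negligible_on S (\<lambda>\<epsilon>. pd i (\<lambda>x. f \<epsilon> x - g \<epsilon> x))"
    using assms by (intro negligible_on_pd moderate_on_diff) (auto simp: net_eq_def)
  then have "negligible_on S (\<lambda>\<epsilon> x. pd i (f \<epsilon>) x - pd i (g \<epsilon>) x)"
    by (rule negligible_on_cong[rotated]) (simp add: pd_diff moderate_on_differentiable[OF m(1)] moderate_on_differentiable[OF m(2)])
  then show ?thesis using m by (auto simp: net_eq_def moderate_on_pd)
qed

lemmas net_eq_scaleR = net_eq_bilinear[OF bounded_bilinear_scaleR]
lemmas net_eq_mult = net_eq_bilinear[OF bounded_bilinear_mult]
lemmas net_eq_inner = net_eq_bilinear[OF bounded_bilinear_inner]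
lemmas net_eq_matrix_vector = net_eq_bilinear[OF bounded_bilinear_matrix_vector]
lemmas net_eq_nth = net_eq_linear[OF bounded_linear_vec_nth]

lemma net_eq_vec:
  fixes f :: "real \<Rightarrow> real^'n::finite \<Rightarrow> 'b::real_normed_vector^'m"
  assumes "open S" "\<And>i. net_eq S (\<lambda>\<epsilon> x. f \<epsilon> x $ i) (\<lambda>\<epsilon> x. g \<epsilon> x $ i)"
  shows "net_eq S f g"
proof -
  have "net_eq S (\<lambda>\<epsilon> x. \<Sum>i\<in>UNIV. axis i (f \<epsilon> x $ i)) (\<lambda>\<epsilon> x. \<Sum>i\<in>UNIV. axis i (g \<epsilon> x $ i))"
    using assms by (intro net_eq_sum net_eq_linear[OF bounded_linear_axis])
  moreover have "(\<Sum>i\<in>UNIV. axis i (v $ i)) = v" for v :: "'b^'m"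
    by (simp add: vec_eq_iff axis_def)
  ultimately show ?thesis by simp
qed

lemma net_eq_det:
  fixes A :: "real \<Rightarrow> real^'n::finite \<Rightarrow> real^'k^'k"
  assumes "open S" "net_eq S A B"
  shows "net_eq S (\<lambda>\<epsilon> x. det (A \<epsilon> x)) (\<lambda>\<epsilon> x. det (B \<epsilon> x))"
  unfolding det_def
  by (intro net_eq_sum net_eq_mult net_eq_refl[OF moderate_on_const] net_eq_prod net_eq_nth assms)

lemma net_eq_cramer_vec:
  fixes A :: "real \<Rightarrow> real^'n::finite \<Rightarrow> real^'k^'k"
  assumes S: "open S" and A: "net_eq S A A'" and b: "net_eq S b b'"
  shows "net_eq S (\<lambda>\<epsilon> x. cramer_vec (A \<epsilon> x) (b \<epsilon> x)) (\<lambda>\<epsilon> x. cramer_vec (A' \<epsilon> x) (b' \<epsilon> x))"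
proof (rule net_eq_vec[OF S])
  fix k :: 'k
  have "net_eq S (\<lambda>\<epsilon> x. (\<chi> i j. if j = k then b \<epsilon> x $ i else A \<epsilon> x $ i $ j) :: real^'k^'k)
      (\<lambda>\<epsilon> x. (\<chi> i j. if j = k then b' \<epsilon> x $ i else A' \<epsilon> x $ i $ j))"
  proof (intro net_eq_vec[OF S], goal_cases)
    case (1 i j)
    show ?case
    proof (cases "j = k")
      case True
      then show ?thesis using net_eq_nth[OF S b] by simp
    next
      case False
      then show ?thesis using net_eq_nth[OF S net_eq_nth[OF S A]] by simp
    qed
  qed
  from net_eq_det[OF S this]
  show "net_eq S (\<lambda>\<epsilon> x. cramer_vec (A \<epsilon> x) (b \<epsilon> x) $ k) (\<lambda>\<epsilon> x. cramer_vec (A' \<epsilon> x) (b' \<epsilon> x) $ k)"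
    by (simp add: cramer_vec_def)
qed

lemma moderate_on_cramer_vec:
  assumes "open S" "moderate_on S A" "moderate_on S b"
  shows "moderate_on S (\<lambda>\<epsilon> x. cramer_vec (A \<epsilon> x) (b \<epsilon> x))"
  using net_eq_cramer_vec[OF assms(1) net_eq_refl net_eq_refl, OF assms(2,3)] by (rule net_eq_left)

text \<open>Nets with this property are the invertible elements of the Colombeau algebra on \<open>S\<close>, among the
  moderate ones.  The property is insensitive to negligible changes, whereas nonvanishing for every
  parameter is not.\<close>

definition strictly_nonzero_on :: "(real^'n::finite) set \<Rightarrow> (real \<Rightarrow> real^'n \<Rightarrow> real) \<Rightarrow> bool" where
  "strictly_nonzero_on S f \<longleftrightarrow> (\<forall>K. compact K \<and> K \<subseteq> S \<longrightarrow>
     (\<exists>N. \<forall>\<^sub>F \<epsilon> in at_right 0. \<forall>x\<in>K. \<epsilon> ^ N \<le> \<bar>f \<epsilon> x\<bar>))"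

lemma strictly_nonzero_on_tempered_inverse:
  assumes "strictly_nonzero_on S f" shows "tempered_on S (\<lambda>\<epsilon> x. inverse (f \<epsilon> x))"
proof (rule tempered_onI)
  fix K assume "compact K" "K \<subseteq> S"
  then obtain N where "\<forall>\<^sub>F \<epsilon> in at_right 0. \<forall>x\<in>K. \<epsilon> ^ N \<le> \<bar>f \<epsilon> x\<bar>"
    using assms unfolding strictly_nonzero_on_def by blast
  then have "\<forall>\<^sub>F \<epsilon> in at_right 0. \<forall>x\<in>K. norm (inverse (f \<epsilon> x)) \<le> 1 * (1 / \<epsilon>) ^ N"
    using eventually_small[of 1, simplified]
  proof eventually_elim
    case (elim \<epsilon>)
    show ?case
    proof
      fix x assume "x \<in> K"
      then have "inverse \<bar>f \<epsilon> x\<bar> \<le> inverse (\<epsilon> ^ N)" using elim by (intro le_imp_inverse_le) auto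
      then show "norm (inverse (f \<epsilon> x)) \<le> 1 * (1 / \<epsilon>) ^ N" by (simp add: power_divide inverse_eq_divide)
    qed
  qed
  then show "\<exists>N C. \<forall>\<^sub>F \<epsilon> in at_right 0. \<forall>x\<in>K. norm (inverse (f \<epsilon> x)) \<le> C * (1 / \<epsilon>) ^ N" by blast
qed

lemma strictly_nonzero_on_eventually:
  assumes "strictly_nonzero_on S f" "compact K" "K \<subseteq> S"
  shows "\<forall>\<^sub>F \<epsilon> in at_right 0. \<forall>x\<in>K. f \<epsilon> x \<noteq> 0"
proof -
  obtain N where "\<forall>\<^sub>F \<epsilon> in at_right 0. \<forall>x\<in>K. \<epsilon> ^ N \<le> \<bar>f \<epsilon> x\<bar>"
    using assms unfolding strictly_nonzero_on_def by blast
  then show ?thesis using eventually_small[of 1, simplified]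
  proof eventually_elim
    case (elim \<epsilon>)
    show ?case
    proof
      fix x assume "x \<in> K"
      with elim have "0 < \<epsilon> ^ N" "\<epsilon> ^ N \<le> \<bar>f \<epsilon> x\<bar>" by auto
      then show "f \<epsilon> x \<noteq> 0" by auto
    qed
  qed
qed

lemma strictly_nonzero_on_net_eq:
  assumes f: "strictly_nonzero_on S f" and fg: "negligible_on S (\<lambda>\<epsilon> x. f \<epsilon> x - g \<epsilon> x)"
  shows "strictly_nonzero_on S g"
  unfolding strictly_nonzero_on_def
proof (intro allI impI)
  fix K assume K: "compact K \<and> K \<subseteq> S"
  then obtain N where "\<forall>\<^sub>F \<epsilon> in at_right 0. \<forall>x\<in>K. \<epsilon> ^ N \<le> \<bar>f \<epsilon> x\<bar>"
    using f unfolding strictly_nonzero_on_def by blast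
  moreover have "\<forall>\<^sub>F \<epsilon> in at_right 0. \<forall>x\<in>K. norm (f \<epsilon> x - g \<epsilon> x) \<le> \<epsilon> ^ Suc N"
    using negligible_onD[OF fg] K by blast
  ultimately have "\<forall>\<^sub>F \<epsilon> in at_right 0. \<forall>x\<in>K. \<epsilon> ^ Suc N \<le> \<bar>g \<epsilon> x\<bar>"
    using eventually_absorb_neg[of 2 N]
  proof eventually_elim
    case (elim \<epsilon>)
    show ?case
    proof
      fix x assume "x \<in> K"
      with elim have "\<epsilon> ^ N \<le> \<bar>f \<epsilon> x\<bar>" "\<bar>f \<epsilon> x - g \<epsilon> x\<bar> \<le> \<epsilon> ^ Suc N" "2 * \<epsilon> ^ Suc N \<le> \<epsilon> ^ N" by auto
      then show "\<epsilon> ^ Suc N \<le> \<bar>g \<epsilon> x\<bar>" by linarith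
    qed
  qed
  then show "\<exists>N. \<forall>\<^sub>F \<epsilon> in at_right 0. \<forall>x\<in>K. \<epsilon> ^ N \<le> \<bar>g \<epsilon> x\<bar>" by blast
qed

text \<open>By Cramer's rule the determinant times the vector depends polynomially on the image of the vector, so
  only the determinant has to be divided out, which costs a power of the parameter.\<close>

lemma net_eq_cancel_matrix:
  assumes S: "open S" and A: "moderate_on S A" and d: "strictly_nonzero_on S (\<lambda>\<epsilon> x. det (A \<epsilon> x))"
    and v: "moderate_on S v" and w: "moderate_on S w"
    and eq: "net_eq S (\<lambda>\<epsilon> x. A \<epsilon> x *v v \<epsilon> x) (\<lambda>\<epsilon> x. A \<epsilon> x *v w \<epsilon> x)"
  shows "net_eq S v w"
proof -
  have "net_eq S (\<lambda>\<epsilon> x. cramer_vec (A \<epsilon> x) (A \<epsilon> x *v v \<epsilon> x)) (\<lambda>\<epsilon> x. cramer_vec (A \<epsilon> x) (A \<epsilon> x *v w \<epsilon> x))"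
    by (intro net_eq_cramer_vec S net_eq_refl A eq)
  then have "negligible_on S (\<lambda>\<epsilon> x. det (A \<epsilon> x) *\<^sub>R (v \<epsilon> x - w \<epsilon> x))"
    by (simp add: cramer_vec_mult net_eq_def scaleR_diff_right)
  from negligible_on_bilinear_right[OF bounded_bilinear_scaleR strictly_nonzero_on_tempered_inverse[OF d] this]
  have neg: "negligible_on S (\<lambda>\<epsilon> x. inverse (det (A \<epsilon> x)) *\<^sub>R det (A \<epsilon> x) *\<^sub>R (v \<epsilon> x - w \<epsilon> x))" .
  have "negligible_on S (\<lambda>\<epsilon> x. v \<epsilon> x - w \<epsilon> x)"
  proof (rule negligible_on_eventually_cong[OF _ neg])
    fix K assume "compact K" "K \<subseteq> S"
    from strictly_nonzero_on_eventually[OF d this]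
    show "\<forall>\<^sub>F \<epsilon> in at_right 0. \<forall>x\<in>K. inverse (det (A \<epsilon> x)) *\<^sub>R det (A \<epsilon> x) *\<^sub>R (v \<epsilon> x - w \<epsilon> x) = v \<epsilon> x - w \<epsilon> x"
      by eventually_elim auto
  qed
  with v w show ?thesis by (simp add: net_eq_def)
qed

section \<open>The Koszul formula in coordinates\<close>

definition dir :: "real^'n::finite \<Rightarrow> (real^'n \<Rightarrow> 'b::real_normed_vector) \<Rightarrow> real^'n \<Rightarrow> 'b" where
  "dir v f x = (\<Sum>i\<in>UNIV. v $ i *\<^sub>R pd i f x)"

lemma frechet_derivative_eq_dir: "f differentiable at x \<Longrightarrow> frechet_derivative f (at x) v = dir v f x"
  unfolding dir_def by (rule frechet_derivative_eq_sum_pd)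

lemma dir_cong_open: "open S \<Longrightarrow> x \<in> S \<Longrightarrow> (\<And>y. y \<in> S \<Longrightarrow> f y = g y) \<Longrightarrow> dir v f x = dir v g x"
  unfolding dir_def using pd_cong_open[of S x f g] by simp

lemma dir_add_left: "dir (v + w) f x = dir v f x + dir w f x"
  by (simp add: dir_def scaleR_add_left sum.distrib)

lemma dir_scaleR_left: "dir (r *\<^sub>R v) f x = r *\<^sub>R dir v f x"
  by (simp add: dir_def scaleR_sum_right)

lemma dir_add: "f differentiable at x \<Longrightarrow> g differentiable at x \<Longrightarrow> dir v (\<lambda>x. f x + g x) x = dir v f x + dir v g x"
  by (simp add: dir_def pd_add scaleR_add_right sum.distrib)

lemma dir_bilinear:
  assumes B: "bounded_bilinear B" and "f differentiable at x" "g differentiable at x"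
  shows "dir v (\<lambda>x. B (f x) (g x)) x = B (f x) (dir v g x) + B (dir v f x) (g x)"
proof -
  interpret bounded_bilinear B by fact
  show ?thesis
    by (simp add: dir_def pd_bilinear[OF assms] scaleR_add_right sum.distrib sum_left sum_right scaleR_left scaleR_right)
qed

lemma dir_linear:
  assumes L: "bounded_linear L" and "f differentiable at x"
  shows "dir v (\<lambda>x. L (f x)) x = L (dir v f x)"
  by (simp add: dir_def pd_linear[OF assms] linear_sum[OF bounded_linear.linear[OF L]]
      linear_scale[OF bounded_linear.linear[OF L]])

lemma moderate_on_dir:
  "open S \<Longrightarrow> moderate_on S v \<Longrightarrow> moderate_on S f \<Longrightarrow> moderate_on S (\<lambda>\<epsilon> x. dir (v \<epsilon> x) (f \<epsilon>) x)"
  unfolding dir_def by (intro moderate_on_sum moderate_on_scaleR moderate_on_nth moderate_on_pd)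

lemma net_eq_dir:
  "open S \<Longrightarrow> net_eq S v v' \<Longrightarrow> net_eq S f f' \<Longrightarrow>
   net_eq S (\<lambda>\<epsilon> x. dir (v \<epsilon> x) (f \<epsilon>) x) (\<lambda>\<epsilon> x. dir (v' \<epsilon> x) (f' \<epsilon>) x)"
  unfolding dir_def by (intro net_eq_sum net_eq_scaleR net_eq_nth net_eq_pd)

text \<open>\<open>koszul_form g \<xi> \<eta>\<close> is twice the covariant derivative with its index lowered; in other words
  \<open>2 g (\<partial>\<^sub>\<xi>\<eta>) + 2 \<Gamma>(\<xi>, \<eta>)\<close> with the Christoffel symbols of the first kind.\<close>

definition koszul_form ::
    "(real^'n::finite \<Rightarrow> real^'n^'n) \<Rightarrow> (real^'n \<Rightarrow> real^'n) \<Rightarrow> (real^'n \<Rightarrow> real^'n) \<Rightarrow> real^'n \<Rightarrow> real^'n" where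
  "koszul_form g \<xi> \<eta> x = 2 *\<^sub>R (g x *v dir (\<xi> x) \<eta> x) + dir (\<xi> x) g x *v \<eta> x + dir (\<eta> x) g x *v \<xi> x
     - (\<chi> k. \<xi> x \<bullet> (pd k g x *v \<eta> x))"

lemma inner_gradient: "\<zeta> \<bullet> (\<chi> k. a \<bullet> (pd k g x *v b)) = a \<bullet> (dir \<zeta> g x *v b)"
  for \<zeta> :: "real^'n::finite" and g :: "real^'n \<Rightarrow> real^'n^'n"
proof -
  have "dir \<zeta> g x *v b = (\<Sum>k\<in>UNIV. \<zeta> $ k *\<^sub>R (pd k g x *v b))"
    by (simp add: dir_def bounded_bilinear.sum_left[OF bounded_bilinear_matrix_vector] scaleR_matrix_vector_assoc)
  then show ?thesis by (simp add: inner_vec_def[of \<zeta>] inner_sum_right)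
qed

lemma sym_dir:
  fixes g :: "real^'n::finite \<Rightarrow> real^'n^'n"
  assumes "open S" "x \<in> S" "\<And>y. y \<in> S \<Longrightarrow> transpose (g y) = g y" "g differentiable at x"
  shows "transpose (dir v g x) = dir v g x"
proof -
  have "transpose (dir v g x) = dir v (\<lambda>x. transpose (g x)) x"
    using dir_linear[OF bounded_linear_transpose assms(4)] by simp
  also have "\<dots> = dir v g x" using assms(3) by (intro dir_cong_open[OF assms(1,2)])
  finally show ?thesis .
qed

lemma sym_inner: "transpose A = A \<Longrightarrow> v \<bullet> (A *v w) = w \<bullet> (A *v v)" for A :: "real^'n::finite^'n"
  unfolding sym_form_iff_transpose[symmetric] sym_form_def by blast

lemma dir_metric:
  fixes g :: "real^'n::finite \<Rightarrow> real^'n^'n"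
  assumes "g differentiable at x" "\<eta> differentiable at x" "\<zeta> differentiable at x"
  shows "dir v (\<lambda>y. \<eta> y \<bullet> (g y *v \<zeta> y)) x =
    dir v \<eta> x \<bullet> (g x *v \<zeta> x) + \<eta> x \<bullet> (dir v g x *v \<zeta> x) + \<eta> x \<bullet> (g x *v dir v \<zeta> x)"
  using assms
  by (simp add: dir_bilinear[OF bounded_bilinear_inner] dir_bilinear[OF bounded_bilinear_matrix_vector]
      differentiable_bilinear[OF bounded_bilinear_matrix_vector] inner_add_right)

text \<open>Of all derivatives of the three fields only that of \<open>\<eta>\<close> in the direction of \<open>\<xi>\<close> survives.  In
  particular \<open>\<zeta>\<close> is not differentiated on the right hand side, which makes it a covector applied to
  \<open>\<zeta>\<close>.\<close>

theorem koszul_identity: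
  assumes S: "open S" "x \<in> S" and sym: "\<And>y. y \<in> S \<Longrightarrow> transpose (g y) = g y"
    and d: "g differentiable at x" "\<xi> differentiable at x" "\<eta> differentiable at x" "\<zeta> differentiable at x"
  shows "dir (\<xi> x) (\<lambda>y. \<eta> y \<bullet> (g y *v \<zeta> y)) x + dir (\<eta> x) (\<lambda>y. \<zeta> y \<bullet> (g y *v \<xi> y)) x
      - dir (\<zeta> x) (\<lambda>y. \<xi> y \<bullet> (g y *v \<eta> y)) x
      - \<xi> x \<bullet> (g x *v (dir (\<eta> x) \<zeta> x - dir (\<zeta> x) \<eta> x))
      + \<eta> x \<bullet> (g x *v (dir (\<zeta> x) \<xi> x - dir (\<xi> x) \<zeta> x))
      + \<zeta> x \<bullet> (g x *v (dir (\<xi> x) \<eta> x - dir (\<eta> x) \<xi> x))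
    = \<zeta> x \<bullet> koszul_form g \<xi> \<eta> x"
proof -
  have s: "v \<bullet> (g x *v w) = w \<bullet> (g x *v v)" and sd: "v \<bullet> (dir a g x *v w) = w \<bullet> (dir a g x *v v)" for v w a
    using sym_inner[OF sym[OF S(2)]] sym_inner[OF sym_dir[OF S sym d(1), of a]] by blast+
  show ?thesis
    unfolding koszul_form_def dir_metric[OF d(1,3,4)] dir_metric[OF d(1,4,2)] dir_metric[OF d(1,2,3)]
      inner_diff_right inner_add_right inner_scaleR_right matrix_vector_mult_diff_distrib inner_gradient
    using s[of "dir (\<xi> x) \<eta> x" "\<zeta> x"] s[of "\<xi> x" "dir (\<eta> x) \<zeta> x"] s[of "\<xi> x" "dir (\<zeta> x) \<eta> x"]
      s[of "dir (\<zeta> x) \<xi> x" "\<eta> x"] s[of "dir (\<eta> x) \<xi> x" "\<zeta> x"] s[of "dir (\<eta> x) \<zeta> x" "\<xi> x"]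
      sd[of "\<xi> x" "\<eta> x" "\<zeta> x"] sd[of "\<eta> x" "\<xi> x" "\<zeta> x"] sd[of "\<zeta> x" "\<eta> x" "\<xi> x"] sd[of "\<zeta> x" "\<xi> x" "\<eta> x"]
    by linarith
qed

text \<open>The terms with derivatives of \<open>g\<close> are symmetric in \<open>\<xi>\<close> and \<open>\<eta>\<close>.\<close>

lemma koszul_form_torsion:
  assumes S: "open S" "x \<in> S" and sym: "\<And>y. y \<in> S \<Longrightarrow> transpose (g y) = g y" and d: "g differentiable at x"
  shows "koszul_form g \<xi> \<eta> x - koszul_form g \<eta> \<xi> x = 2 *\<^sub>R (g x *v (dir (\<xi> x) \<eta> x - dir (\<eta> x) \<xi> x))"
proof -
  have "transpose (pd k g x) = pd k g x" for k
    using sym_dir[OF S sym d, of "axis k 1"] by (simp add: dir_def axis_def if_distrib[of "\<lambda>r. r *\<^sub>R _"] cong: if_cong)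
  then have "\<xi> x \<bullet> (pd k g x *v \<eta> x) = \<eta> x \<bullet> (pd k g x *v \<xi> x)" for k by (rule sym_inner)
  then show ?thesis
    by (simp add: koszul_form_def matrix_vector_mult_diff_distrib scaleR_diff_right)
qed

text \<open>The derivatives of \<open>g\<close> in directions other than \<open>\<xi>\<close> cancel.\<close>

lemma koszul_form_metric:
  assumes S: "open S" "x \<in> S" and sym: "\<And>y. y \<in> S \<Longrightarrow> transpose (g y) = g y"
    and d: "g differentiable at x" "\<eta> differentiable at x" "\<zeta> differentiable at x"
  shows "\<zeta> x \<bullet> koszul_form g \<xi> \<eta> x + \<eta> x \<bullet> koszul_form g \<xi> \<zeta> x = 2 * dir (\<xi> x) (\<lambda>y. \<eta> y \<bullet> (g y *v \<zeta> y)) x"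
proof -
  have s: "v \<bullet> (g x *v w) = w \<bullet> (g x *v v)" and sd: "v \<bullet> (dir a g x *v w) = w \<bullet> (dir a g x *v v)" for v w a
    using sym_inner[OF sym[OF S(2)]] sym_inner[OF sym_dir[OF S sym d(1), of a]] by blast+
  show ?thesis
    unfolding koszul_form_def dir_metric[OF d(1,2,3)]
      inner_diff_right inner_add_right inner_scaleR_right inner_gradient
    using s[of "dir (\<xi> x) \<eta> x" "\<zeta> x"] sd[of "\<zeta> x" "\<xi> x" "\<eta> x"] sd[of "\<eta> x" "\<zeta> x" "\<xi> x"] sd[of "\<zeta> x" "\<eta> x" "\<xi> x"]
    by (simp add: distrib_left)
qed

lemma koszul_form_add_left:
  "koszul_form g (\<lambda>x. \<xi> x + \<xi>' x) \<eta> x = koszul_form g \<xi> \<eta> x + koszul_form g \<xi>' \<eta> x"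
  by (simp add: koszul_form_def dir_add_left matrix_vector_mult_add_rdistrib matrix_vector_right_distrib
      inner_add_left scaleR_add_right vec_eq_iff)

lemma koszul_form_scaleR_left:
  "koszul_form g (\<lambda>x. u x *\<^sub>R \<xi> x) \<eta> x = u x *\<^sub>R koszul_form g \<xi> \<eta> x"
  by (simp add: koszul_form_def dir_scaleR_left matrix_vector_mult_scaleR scaleR_matrix_vector_assoc[symmetric]
      scaleR_add_right scaleR_diff_right vec_eq_iff algebra_simps)

lemma koszul_form_add_right:
  assumes "\<eta> differentiable at x" "\<eta>' differentiable at x"
  shows "koszul_form g \<xi> (\<lambda>x. \<eta> x + \<eta>' x) x = koszul_form g \<xi> \<eta> x + koszul_form g \<xi> \<eta>' x"
  using assms
  by (simp add: koszul_form_def dir_add dir_add_left matrix_vector_mult_add_rdistrib matrix_vector_right_distrib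
      inner_add_right scaleR_add_right vec_eq_iff)

text \<open>The Leibniz rule comes from the single term in which \<open>\<eta>\<close> is differentiated.\<close>

lemma koszul_form_scaleR_right:
  assumes "u differentiable at x" "\<eta> differentiable at x"
  shows "koszul_form g \<xi> (\<lambda>x. u x *\<^sub>R \<eta> x) x = u x *\<^sub>R koszul_form g \<xi> \<eta> x + 2 *\<^sub>R (g x *v (dir (\<xi> x) u x *\<^sub>R \<eta> x))"
  using assms
  by (simp add: koszul_form_def dir_bilinear[OF bounded_bilinear_scaleR] dir_scaleR_left matrix_vector_mult_scaleR
      scaleR_matrix_vector_assoc[symmetric] matrix_vector_right_distrib scaleR_add_right scaleR_diff_right
      vec_eq_iff algebra_simps)

lemma moderate_on_koszul_form:
  assumes "open S" "moderate_on S g" "moderate_on S \<xi>" "moderate_on S \<eta>"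
  shows "moderate_on S (\<lambda>\<epsilon> x. koszul_form (g \<epsilon>) (\<xi> \<epsilon>) (\<eta> \<epsilon>) x)"
proof -
  have "moderate_on S (\<lambda>\<epsilon> x. (\<chi> k. \<xi> \<epsilon> x \<bullet> (pd k (g \<epsilon>) x *v \<eta> \<epsilon> x)) :: real^'a)"
    using assms by (intro moderate_on_vec) (simp_all add: moderate_on_inner moderate_on_matrix_vector moderate_on_pd)
  then show ?thesis unfolding koszul_form_def using assms
    by (intro moderate_on_add moderate_on_diff moderate_on_scaleR moderate_on_const moderate_on_matrix_vector moderate_on_dir)
qed

lemma net_eq_koszul_form:
  assumes "open S" "net_eq S g g'" "net_eq S \<xi> \<xi>'" "net_eq S \<eta> \<eta>'"
  shows "net_eq S (\<lambda>\<epsilon> x. koszul_form (g \<epsilon>) (\<xi> \<epsilon>) (\<eta> \<epsilon>) x) (\<lambda>\<epsilon> x. koszul_form (g' \<epsilon>) (\<xi>' \<epsilon>) (\<eta>' \<epsilon>) x)"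
proof -
  have "net_eq S (\<lambda>\<epsilon> x. (\<chi> k. \<xi> \<epsilon> x \<bullet> (pd k (g \<epsilon>) x *v \<eta> \<epsilon> x)) :: real^'a) (\<lambda>\<epsilon> x. (\<chi> k. \<xi>' \<epsilon> x \<bullet> (pd k (g' \<epsilon>) x *v \<eta>' \<epsilon> x)))"
    using assms by (intro net_eq_vec) (simp_all add: net_eq_inner net_eq_matrix_vector net_eq_pd)
  then show ?thesis unfolding koszul_form_def using assms
    by (intro net_eq_add net_eq_diff net_eq_scaleR net_eq_refl[OF moderate_on_const] net_eq_matrix_vector net_eq_dir)
qed

section \<open>Operations on generalized fields\<close>

definition fun_loc :: "('a, 'n::finite) chart \<Rightarrow> (real \<Rightarrow> 'a \<Rightarrow> real) \<Rightarrow> real \<Rightarrow> real^'n \<Rightarrow> real" where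
  "fun_loc c u \<epsilon> x = u \<epsilon> (chart_inv c x)"

definition comp_loc ::
    "('a, 'n::finite) chart \<Rightarrow> (real \<Rightarrow> ('a, 'n) chart \<Rightarrow> 'a \<Rightarrow> 'c) \<Rightarrow> real \<Rightarrow> real^'n \<Rightarrow> 'c" where
  "comp_loc c \<xi> \<epsilon> x = \<xi> \<epsilon> c (chart_inv c x)"

definition vector_law :: "('a, 'n::finite) manifold \<Rightarrow> ('a, 'n) vfield \<Rightarrow> bool" where
  "vector_law M \<xi> \<longleftrightarrow> (\<forall>c\<in>charts M. \<forall>d\<in>charts M. \<forall>p\<in>fst c \<inter> fst d. \<xi> d p = jacobian c d p *v \<xi> c p)"

lemma vector_lawD: "vector_law M \<xi> \<Longrightarrow> c \<in> charts M \<Longrightarrow> d \<in> charts M \<Longrightarrow> p \<in> fst c \<Longrightarrow> p \<in> fst d \<Longrightarrow>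
    \<xi> d p = jacobian c d p *v \<xi> c p"
  unfolding vector_law_def by blast

lemma vector_law_scaleR: "vector_law M \<xi> \<Longrightarrow> vector_law M (\<lambda>c p. u p *\<^sub>R \<xi> c p)"
  unfolding vector_law_def[of M "\<lambda>c p. u p *\<^sub>R \<xi> c p"]
proof (intro ballI)
  fix c d p assume "vector_law M \<xi>" "c \<in> charts M" "d \<in> charts M" "p \<in> fst c \<inter> fst d"
  then have "\<xi> d p = jacobian c d p *v \<xi> c p" using vector_lawD[of M \<xi> c d p] by blast
  then show "u p *\<^sub>R \<xi> d p = jacobian c d p *v (u p *\<^sub>R \<xi> c p)" by (simp add: matrix_vector_mult_scaleR)
qed

lemma vector_law_add:
  assumes "vector_law M \<xi>" "vector_law M \<eta>"
  shows "vector_law M (\<xi> + \<eta>)" "vector_law M (\<xi> - \<eta>)"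
proof -
  have "(\<xi> + \<eta>) d p = jacobian c d p *v (\<xi> + \<eta>) c p \<and> (\<xi> - \<eta>) d p = jacobian c d p *v (\<xi> - \<eta>) c p"
    if "c \<in> charts M" "d \<in> charts M" "p \<in> fst c \<inter> fst d" for c d p
    using vector_lawD[OF assms(1), of c d p] vector_lawD[OF assms(2), of c d p] that
    by (simp add: matrix_vector_right_distrib matrix_vector_mult_diff_distrib)
  then show "vector_law M (\<xi> + \<eta>)" "vector_law M (\<xi> - \<eta>)" unfolding vector_law_def by blast+
qed

lemma smooth_vfields_iff: "\<xi> \<in> smooth_vfields M \<longleftrightarrow> vector_law M \<xi> \<and>
    (\<forall>c\<in>charts M. smooth_on (cimg c) (\<lambda>x. \<xi> c (chart_inv c x)))"
  unfolding smooth_vfields_def vector_law_def smooth_in_chart_def cimg_def o_def by blast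

lemma smooth_functions_iff: "u \<in> smooth_functions M \<longleftrightarrow> (\<forall>c\<in>charts M. smooth_on (cimg c) (\<lambda>x. u (chart_inv c x)))"
  unfolding smooth_functions_def smooth_in_chart_def cimg_def o_def by blast

lemma smooth_tfieldsD:
  assumes "g \<in> smooth_tfields M" "c \<in> charts M"
  shows "smooth_on (cimg c) (\<lambda>x. g c (chart_inv c x))"
    and "\<And>d p. d \<in> charts M \<Longrightarrow> p \<in> fst c \<Longrightarrow> p \<in> fst d \<Longrightarrow>
      g c p = transpose (jacobian c d p) ** g d p ** jacobian c d p"
  using assms unfolding smooth_tfields_def smooth_in_chart_def cimg_def o_def by blast+

locale smooth_mf =
  fixes M :: "('a, 'n::finite) manifold"
  assumes smooth_manifold: "smooth_manifold M"

sublocale smooth_mf \<subseteq> atlas M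
  using smooth_manifold unfolding smooth_manifold_def by unfold_locales auto

sublocale smooth_mf \<subseteq> Fn: normed_bundle "Fun M" "\<lambda>_ _ _. id_blinfun" "\<lambda>\<phi> p. \<phi> (chart_at M p) p"
  by (rule Fun_normed_bundle) unfold_locales

sublocale smooth_mf \<subseteq> Vc: normed_bundle "Vec M" "\<lambda>c d p. mvL (jacobian c d p)" "\<lambda>\<phi>. \<phi>"
  by (rule Vec_normed_bundle[OF smooth_manifold])

sublocale smooth_mf \<subseteq> Tn: vector_bundle "Ten M" "\<lambda>c d p. sandwich (jacobian d c p) (jacobian d c p)" "\<lambda>\<phi>. \<phi>"
  by (rule Ten_vector_bundle[OF smooth_manifold])

context smooth_mf
begin

lemma Fn_loc [simp]: "Fn.loc c u = fun_loc c u"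
  by (simp add: Fn.loc_def fun_loc_def fun_eq_iff)

lemma Vc_loc [simp]: "Vc.loc c u = comp_loc c u"
  by (simp add: Vc.loc_def comp_loc_def fun_eq_iff)

lemma Tn_loc [simp]: "Tn.loc c u = comp_loc c u"
  by (simp add: Tn.loc_def comp_loc_def fun_eq_iff)

lemma Fun_moderate_iff: "moderate (Fun M) u \<longleftrightarrow> (\<forall>c\<in>charts M. moderate_on (cimg c) (fun_loc c u))"
proof
  assume "moderate (Fun M) u"
  then show "\<forall>c\<in>charts M. moderate_on (cimg c) (fun_loc c u)"
    using Fn.moderate_imp_moderate_on[of u] by simp
next
  assume m: "\<forall>c\<in>charts M. moderate_on (cimg c) (fun_loc c u)"
  show "moderate (Fun M) u"
  proof (rule Fn.moderateI)
    fix \<epsilon> :: real assume \<epsilon>: "\<epsilon> \<in> {0<..1}"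
    show "u \<epsilon> \<in> sections (Fun M)"
      using moderate_on_smooth[OF _ \<epsilon>] m unfolding Fun_simps smooth_functions_iff fun_loc_def[abs_def] by blast
  qed (use m in simp)
qed

lemma Vec_moderate_iff:
  "moderate (Vec M) \<xi> \<longleftrightarrow> (\<forall>\<epsilon>\<in>{0<..1}. vector_law M (\<xi> \<epsilon>)) \<and> (\<forall>c\<in>charts M. moderate_on (cimg c) (comp_loc c \<xi>))"
proof
  assume m: "moderate (Vec M) \<xi>"
  then show "(\<forall>\<epsilon>\<in>{0<..1}. vector_law M (\<xi> \<epsilon>)) \<and> (\<forall>c\<in>charts M. moderate_on (cimg c) (comp_loc c \<xi>))"
    using Vc.moderate_imp_moderate_on[OF m] Vc.moderate_section[OF m] by (simp add: smooth_vfields_iff)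
next
  assume m: "(\<forall>\<epsilon>\<in>{0<..1}. vector_law M (\<xi> \<epsilon>)) \<and> (\<forall>c\<in>charts M. moderate_on (cimg c) (comp_loc c \<xi>))"
  show "moderate (Vec M) \<xi>"
  proof (rule Vc.moderateI)
    fix \<epsilon> :: real assume \<epsilon>: "\<epsilon> \<in> {0<..1}"
    show "\<xi> \<epsilon> \<in> sections (Vec M)"
      using moderate_on_smooth[OF _ \<epsilon>] m \<epsilon> unfolding Vec_simps smooth_vfields_iff comp_loc_def[abs_def] by blast
  qed (use m in simp)
qed

lemma Fun_net_rel_iff: "(u, v) \<in> net_rel (Fun M) \<longleftrightarrow> (\<forall>c\<in>charts M. net_eq (cimg c) (fun_loc c u) (fun_loc c v))"
  unfolding Fn.net_rel_iff Fun_moderate_iff net_eq_def by auto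

lemma Vec_net_rel_iff: "(\<xi>, \<eta>) \<in> net_rel (Vec M) \<longleftrightarrow>
    (\<forall>\<epsilon>\<in>{0<..1}. vector_law M (\<xi> \<epsilon>) \<and> vector_law M (\<eta> \<epsilon>)) \<and> (\<forall>c\<in>charts M. net_eq (cimg c) (comp_loc c \<xi>) (comp_loc c \<eta>))"
  unfolding Vc.net_rel_iff Vec_moderate_iff net_eq_def by auto

lemma Fun_moderate_section: "moderate (Fun M) u \<Longrightarrow> \<epsilon> \<in> {0<..1} \<Longrightarrow> u \<epsilon> \<in> smooth_functions M"
  using Fn.moderate_section by simp

lemma Vec_moderate_section: "moderate (Vec M) \<xi> \<Longrightarrow> \<epsilon> \<in> {0<..1} \<Longrightarrow> \<xi> \<epsilon> \<in> smooth_vfields M"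
  using Vc.moderate_section by simp

lemma Vec_moderate_law: "moderate (Vec M) \<xi> \<Longrightarrow> \<epsilon> \<in> {0<..1} \<Longrightarrow> vector_law M (\<xi> \<epsilon>)"
  unfolding Vec_moderate_iff by blast

lemma Vec_moderate_loc: "moderate (Vec M) \<xi> \<Longrightarrow> c \<in> charts M \<Longrightarrow> moderate_on (cimg c) (comp_loc c \<xi>)"
  unfolding Vec_moderate_iff by blast

lemma Fun_moderate_loc: "moderate (Fun M) u \<Longrightarrow> c \<in> charts M \<Longrightarrow> moderate_on (cimg c) (fun_loc c u)"
  unfolding Fun_moderate_iff by blast

lemma net_rel_moderate:
  "(u, v) \<in> net_rel F \<Longrightarrow> moderate F u" "(u, v) \<in> net_rel F \<Longrightarrow> moderate F v"
  by (auto simp: net_rel_def)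

lemma Fun_gclass_eq_iff:
  "moderate (Fun M) u \<Longrightarrow> moderate (Fun M) v \<Longrightarrow> gclass (Fun M) u = gclass (Fun M) v \<longleftrightarrow>
   (\<forall>c\<in>charts M. net_eq (cimg c) (fun_loc c u) (fun_loc c v))"
  unfolding Fn.gclass_eq_iff Fun_net_rel_iff ..

lemma Vec_gclass_eq_iff:
  assumes "moderate (Vec M) \<xi>" "moderate (Vec M) \<eta>"
  shows "gclass (Vec M) \<xi> = gclass (Vec M) \<eta> \<longleftrightarrow> (\<forall>c\<in>charts M. net_eq (cimg c) (comp_loc c \<xi>) (comp_loc c \<eta>))"
  unfolding Vc.gclass_eq_iff[OF assms] Vec_net_rel_iff using assms Vec_moderate_law by blast

subsection \<open>Coordinate formulas\<close>

lemma chart_deriv_dir: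
  assumes "smooth_on (cimg c) (\<lambda>x. f (chart_inv c x))" "c \<in> charts M" "p \<in> fst c"
  shows "chart_deriv c p v f = dir v (\<lambda>x. f (chart_inv c x)) (snd c p)"
proof -
  have "(\<lambda>x. f (chart_inv c x)) differentiable at (snd c p)"
    using assms by (intro smooth_on_differentiable[OF assms(1)]) auto
  then show ?thesis unfolding chart_deriv_def o_def by (rule frechet_derivative_eq_dir)
qed

lemma vfield_apply_chart:
  assumes "vector_law M \<xi>" "u \<in> smooth_functions M" "c \<in> charts M" "x \<in> cimg c"
  shows "vfield_apply M \<xi> u (chart_inv c x) = dir (\<xi> c (chart_inv c x)) (\<lambda>y. u (chart_inv c y)) x"
proof -
  let ?p = "chart_inv c x" and ?d = "chart_at M (chart_inv c x)"
  have p: "?p \<in> fst c" using assms by simp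
  have d: "?d \<in> charts M" "?p \<in> fst ?d" using chart_at[OF assms(3) p] by auto
  have "vfield_apply M \<xi> u ?p = chart_deriv ?d ?p (\<xi> ?d ?p) u" by (simp add: vfield_apply_def Let_def)
  also have "\<dots> = chart_deriv c ?p (jacobian ?d c ?p *v \<xi> ?d ?p) u"
    using assms d p by (intro chart_deriv_transition) (auto simp: smooth_functions_def)
  also have "jacobian ?d c ?p *v \<xi> ?d ?p = \<xi> c ?p"
    using vector_lawD[OF assms(1) d(1) assms(3) d(2) p] by simp
  also have "chart_deriv c ?p (\<xi> c ?p) u = dir (\<xi> c ?p) (\<lambda>y. u (chart_inv c y)) x"
    using chart_deriv_dir[of c u ?p] assms p by (simp add: smooth_functions_iff)
  finally show ?thesis .
qed

lemma inner_jacobian: "v \<bullet> ((transpose J ** g ** J) *v w) = (J *v v) \<bullet> (g *v (J *v w))" for J g :: "real^'n^'n"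
  using transpose_inner[of J "g *v (J *v w)" v] by (simp add: matrix_vector_mul_assoc[symmetric] inner_commute)

lemma tfield_apply_chart:
  assumes "g \<in> smooth_tfields M" "vector_law M \<xi>" "vector_law M \<eta>" "c \<in> charts M" "x \<in> cimg c"
  shows "tfield_apply M g \<xi> \<eta> (chart_inv c x) = \<xi> c (chart_inv c x) \<bullet> (g c (chart_inv c x) *v \<eta> c (chart_inv c x))"
proof -
  let ?p = "chart_inv c x" and ?d = "chart_at M (chart_inv c x)"
  have p: "?p \<in> fst c" using assms by simp
  have d: "?d \<in> charts M" "?p \<in> fst ?d" using chart_at[OF assms(4) p] by auto
  have "\<xi> c ?p \<bullet> (g c ?p *v \<eta> c ?p) = \<xi> ?d ?p \<bullet> (g ?d ?p *v \<eta> ?d ?p)"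
    unfolding smooth_tfieldsD(2)[OF assms(1,4) d(1) p d(2)] inner_jacobian
    using vector_lawD[OF assms(2,4) d(1) p d(2)] vector_lawD[OF assms(3,4) d(1) p d(2)] by simp
  then show ?thesis by (simp add: tfield_apply_def Let_def)
qed

lemma lie_bracket_chart:
  assumes "\<xi> \<in> smooth_vfields M" "\<eta> \<in> smooth_vfields M" "c \<in> charts M" "x \<in> cimg c"
  shows "lie_bracket \<xi> \<eta> c (chart_inv c x) =
    dir (\<xi> c (chart_inv c x)) (\<lambda>y. \<eta> c (chart_inv c y)) x - dir (\<eta> c (chart_inv c x)) (\<lambda>y. \<xi> c (chart_inv c y)) x"
  using assms by (simp add: lie_bracket_def chart_deriv_dir smooth_vfields_iff)

text \<open>The second derivatives of the change of coordinates cancel in the bracket because they are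
  symmetric.\<close>

lemma lie_bracket_law:
  assumes \<xi>: "\<xi> \<in> smooth_vfields M" and \<eta>: "\<eta> \<in> smooth_vfields M"
  shows "vector_law M (lie_bracket \<xi> \<eta>)"
  unfolding vector_law_def
proof (intro ballI)
  fix c d p assume c: "c \<in> charts M" and d: "d \<in> charts M" and "p \<in> fst c \<inter> fst d"
  then have p: "p \<in> fst c" "p \<in> fst d" by auto
  let ?x = "snd c p"
  define J where "J y = jacobian c d (chart_inv c y)" for y
  have x: "?x \<in> overlap c d" using p by simp
  have Jd: "J differentiable at ?x"
    unfolding J_def[abs_def] using smooth_jacobian[OF c d] x by (rule smooth_on_differentiable)
  have Jp: "J ?x = jacobian c d p" using c p by (simp add: J_def)
  have Jd_sym: "dir a J ?x *v b = dir b J ?x *v a" for a b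
  proof -
    have pdJ: "pd k J ?x $ i $ j = pd k (pd j (\<lambda>y. transition c d y $ i)) ?x" for i j k
    proof -
      have "pd k J ?x $ i $ j = pd k (\<lambda>y. J y $ i $ j) ?x"
        using pd_linear[OF bounded_linear_compose[OF bounded_linear_vec_nth[of j] bounded_linear_vec_nth[of i]] Jd, of k] by simp
      also have "\<dots> = pd k (pd j (\<lambda>y. transition c d y $ i)) ?x"
      proof (rule pd_cong_open[OF open_overlap[OF c d] x])
        fix y assume y: "y \<in> overlap c d"
        have "transition c d differentiable at y" using smooth_transition[OF c d] y by (rule smooth_on_differentiable)
        then show "J y $ i $ j = pd j (\<lambda>y. transition c d y $ i) y"
          using subsetD[OF overlap_subset y] by (simp add: J_def jacobian_nth pd_linear[OF bounded_linear_vec_nth])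
      qed
      finally show ?thesis .
    qed
    have sm: "smooth_on (overlap c d) (\<lambda>y. transition c d y $ i)" for i
      using smooth_transition[OF c d] open_overlap[OF c d] by (intro smooth_on_nth)
    have sym: "pd k J ?x $ i $ j = pd j J ?x $ i $ k" for i j k
      unfolding pdJ by (rule pd_commute[OF open_overlap[OF c d] sm x])
    have expand: "(dir a J ?x *v b) $ i = (\<Sum>k\<in>UNIV. \<Sum>j\<in>UNIV. a $ k * pd k J ?x $ i $ j * b $ j)" for a b i
    proof -
      have "(dir a J ?x *v b) $ i = (\<Sum>j\<in>UNIV. \<Sum>k\<in>UNIV. a $ k * pd k J ?x $ i $ j * b $ j)"
        by (simp add: matrix_vector_mult_def dir_def sum_distrib_right)
      also have "\<dots> = (\<Sum>k\<in>UNIV. \<Sum>j\<in>UNIV. a $ k * pd k J ?x $ i $ j * b $ j)" by (rule sum.swap)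
      finally show ?thesis .
    qed
    have "(dir a J ?x *v b) $ i = (dir b J ?x *v a) $ i" for i
    proof -
      have "(dir a J ?x *v b) $ i = (\<Sum>j\<in>UNIV. \<Sum>k\<in>UNIV. a $ k * pd k J ?x $ i $ j * b $ j)"
        unfolding expand by (rule sum.swap)
      also have "\<dots> = (dir b J ?x *v a) $ i"
        unfolding expand
      proof (intro sum.cong refl)
        fix j k show "a $ k * pd k J ?x $ i $ j * b $ j = b $ j * pd j J ?x $ i $ k * a $ k"
          unfolding sym[of k i j] by simp
      qed
      finally show ?thesis .
    qed
    then show ?thesis by (simp add: vec_eq_iff)
  qed
  have deriv: "chart_deriv d p (a d p) (b d) = dir (a c p) J ?x *v b c p + jacobian c d p *v chart_deriv c p (a c p) (b c)"
    if a: "a \<in> smooth_vfields M" and b: "b \<in> smooth_vfields M" for a b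
  proof -
    have bs: "smooth_on (cimg c) (\<lambda>y. b c (chart_inv c y))" using b c by (simp add: smooth_vfields_iff)
    have bd: "(\<lambda>y. b c (chart_inv c y)) differentiable at ?x"
      using bs by (rule smooth_on_differentiable) (use p in simp)
    have al: "a d p = jacobian c d p *v a c p"
      using a vector_lawD[OF _ c d p] unfolding smooth_vfields_iff by blast
    have "smooth_in_chart d (b d)" using b d unfolding smooth_vfields_def by blast
    from chart_deriv_transition[OF c d p this, of "a c p"]
    have "chart_deriv d p (a d p) (b d) = chart_deriv c p (a c p) (b d)" unfolding al ..
    also have "\<dots> = frechet_derivative (\<lambda>y. J y *v b c (chart_inv c y)) (at ?x) (a c p)"
      unfolding chart_deriv_def
    proof (subst frechet_derivative_cong_open[OF open_overlap[OF c d] x])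
      fix y assume y: "y \<in> overlap c d"
      then have "chart_inv c y \<in> fst c" "chart_inv c y \<in> fst d" using overlap_iff[OF c] by auto
      then show "(b d \<circ> chart_inv c) y = J y *v b c (chart_inv c y)"
        using vector_lawD[OF _ c d, of b "chart_inv c y"] b unfolding smooth_vfields_iff J_def o_def by blast
    qed simp
    also have "\<dots> = dir (a c p) (\<lambda>y. J y *v b c (chart_inv c y)) ?x"
      by (intro frechet_derivative_eq_dir differentiable_bilinear[OF bounded_bilinear_matrix_vector] Jd bd)
    also have "\<dots> = J ?x *v dir (a c p) (\<lambda>y. b c (chart_inv c y)) ?x + dir (a c p) J ?x *v b c (chart_inv c ?x)"
      by (rule dir_bilinear[OF bounded_bilinear_matrix_vector Jd bd])
    finally show ?thesis
      using c p by (simp add: Jp chart_deriv_dir[OF bs c p(1)])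
  qed
  show "lie_bracket \<xi> \<eta> d p = jacobian c d p *v lie_bracket \<xi> \<eta> c p"
    unfolding lie_bracket_def deriv[OF \<xi> \<eta>] deriv[OF \<eta> \<xi>] Jd_sym[of "\<xi> c p" "\<eta> c p"]
    by (simp add: matrix_vector_mult_diff_distrib)
qed

subsection \<open>The operations on classes\<close>

lemma vfield_apply_net_rel:
  assumes "(\<xi>, \<xi>') \<in> net_rel (Vec M)" "(u, u') \<in> net_rel (Fun M)"
  shows "(\<lambda>\<epsilon>. vfield_apply M (\<xi> \<epsilon>) (u \<epsilon>), \<lambda>\<epsilon>. vfield_apply M (\<xi>' \<epsilon>) (u' \<epsilon>)) \<in> net_rel (Fun M)"
  unfolding Fun_net_rel_iff
proof
  fix c assume c: "c \<in> charts M"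
  note mod = net_rel_moderate[OF assms(1)] net_rel_moderate[OF assms(2)]
  have "net_eq (cimg c) (\<lambda>\<epsilon> x. dir (comp_loc c \<xi> \<epsilon> x) (fun_loc c u \<epsilon>) x) (\<lambda>\<epsilon> x. dir (comp_loc c \<xi>' \<epsilon> x) (fun_loc c u' \<epsilon>) x)"
    using assms c unfolding Fun_net_rel_iff Vec_net_rel_iff by (intro net_eq_dir) auto
  then show "net_eq (cimg c) (fun_loc c (\<lambda>\<epsilon>. vfield_apply M (\<xi> \<epsilon>) (u \<epsilon>))) (fun_loc c (\<lambda>\<epsilon>. vfield_apply M (\<xi>' \<epsilon>) (u' \<epsilon>)))"
    by (rule net_eq_cong[OF open_cimg[OF c]])
       (simp_all add: fun_loc_def[abs_def] comp_loc_def c vfield_apply_chart Vec_moderate_law[OF mod(1)]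
         Vec_moderate_law[OF mod(2)] Fun_moderate_section[OF mod(3)] Fun_moderate_section[OF mod(4)])
qed

lemma lie_bracket_net_rel:
  assumes "(\<xi>, \<xi>') \<in> net_rel (Vec M)" "(\<eta>, \<eta>') \<in> net_rel (Vec M)"
  shows "(\<lambda>\<epsilon>. lie_bracket (\<xi> \<epsilon>) (\<eta> \<epsilon>), \<lambda>\<epsilon>. lie_bracket (\<xi>' \<epsilon>) (\<eta>' \<epsilon>)) \<in> net_rel (Vec M)"
  unfolding Vec_net_rel_iff
proof (intro conjI ballI)
  note mod = net_rel_moderate[OF assms(1)] net_rel_moderate[OF assms(2)]
  show "vector_law M (lie_bracket (\<xi> \<epsilon>) (\<eta> \<epsilon>))" "vector_law M (lie_bracket (\<xi>' \<epsilon>) (\<eta>' \<epsilon>))" if "\<epsilon> \<in> {0<..1}" for \<epsilon>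
    by (intro lie_bracket_law Vec_moderate_section[OF mod(1) that] Vec_moderate_section[OF mod(2) that]
        Vec_moderate_section[OF mod(3) that] Vec_moderate_section[OF mod(4) that])+
  fix c assume c: "c \<in> charts M"
  have "net_eq (cimg c) (\<lambda>\<epsilon> x. dir (comp_loc c \<xi> \<epsilon> x) (comp_loc c \<eta> \<epsilon>) x - dir (comp_loc c \<eta> \<epsilon> x) (comp_loc c \<xi> \<epsilon>) x)
      (\<lambda>\<epsilon> x. dir (comp_loc c \<xi>' \<epsilon> x) (comp_loc c \<eta>' \<epsilon>) x - dir (comp_loc c \<eta>' \<epsilon> x) (comp_loc c \<xi>' \<epsilon>) x)"
    using assms c unfolding Vec_net_rel_iff by (intro net_eq_dir net_eq_diff) auto
  then show "net_eq (cimg c) (comp_loc c (\<lambda>\<epsilon>. lie_bracket (\<xi> \<epsilon>) (\<eta> \<epsilon>))) (comp_loc c (\<lambda>\<epsilon>. lie_bracket (\<xi>' \<epsilon>) (\<eta>' \<epsilon>)))"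
    by (rule net_eq_cong[OF open_cimg[OF c]])
       (simp_all add: comp_loc_def[abs_def] c lie_bracket_chart Vec_moderate_section[OF mod(1)]
         Vec_moderate_section[OF mod(2)] Vec_moderate_section[OF mod(3)] Vec_moderate_section[OF mod(4)])
qed

lemma smult_net_rel:
  assumes "(u, u') \<in> net_rel (Fun M)" "(\<xi>, \<xi>') \<in> net_rel (Vec M)"
  shows "(\<lambda>\<epsilon> c p. u \<epsilon> p *\<^sub>R \<xi> \<epsilon> c p, \<lambda>\<epsilon> c p. u' \<epsilon> p *\<^sub>R \<xi>' \<epsilon> c p) \<in> net_rel (Vec M)"
  unfolding Vec_net_rel_iff
proof (intro conjI ballI)
  note mod = net_rel_moderate[OF assms(2)]
  show "vector_law M (\<lambda>c p. u \<epsilon> p *\<^sub>R \<xi> \<epsilon> c p)" "vector_law M (\<lambda>c p. u' \<epsilon> p *\<^sub>R \<xi>' \<epsilon> c p)" if "\<epsilon> \<in> {0<..1}" for \<epsilon>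
    by (intro vector_law_scaleR Vec_moderate_law[OF mod(1) that] Vec_moderate_law[OF mod(2) that])+
  fix c assume c: "c \<in> charts M"
  have "net_eq (cimg c) (\<lambda>\<epsilon> x. fun_loc c u \<epsilon> x *\<^sub>R comp_loc c \<xi> \<epsilon> x) (\<lambda>\<epsilon> x. fun_loc c u' \<epsilon> x *\<^sub>R comp_loc c \<xi>' \<epsilon> x)"
    using assms c unfolding Vec_net_rel_iff Fun_net_rel_iff by (intro net_eq_scaleR) auto
  then show "net_eq (cimg c) (comp_loc c (\<lambda>\<epsilon> c p. u \<epsilon> p *\<^sub>R \<xi> \<epsilon> c p)) (comp_loc c (\<lambda>\<epsilon> c p. u' \<epsilon> p *\<^sub>R \<xi>' \<epsilon> c p))"
    by (simp add: comp_loc_def[abs_def] fun_loc_def)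
qed

lemma moderate_real_Fun:
  assumes "moderate_real r" shows "moderate (Fun M) (\<lambda>\<epsilon> p. r \<epsilon>)"
proof -
  from assms obtain N C where "\<forall>\<^sub>F \<epsilon> in at_right 0. \<bar>r \<epsilon>\<bar> \<le> C / \<epsilon> ^ N" unfolding moderate_real_def by blast
  then have "\<forall>\<^sub>F \<epsilon> in at_right 0. norm (r \<epsilon>) \<le> C * (1 / \<epsilon>) ^ N" by (simp add: power_divide)
  from moderate_on_net_const[OF this] show ?thesis unfolding Fun_moderate_iff fun_loc_def[abs_def] by blast
qed

lemma rmult_net_rel:
  assumes "moderate_real r" "moderate_real r'" "negligible_real (\<lambda>\<epsilon>. r \<epsilon> - r' \<epsilon>)" "(\<xi>, \<xi>') \<in> net_rel (Vec M)"
  shows "(\<lambda>\<epsilon> c p. r \<epsilon> *\<^sub>R \<xi> \<epsilon> c p, \<lambda>\<epsilon> c p. r' \<epsilon> *\<^sub>R \<xi>' \<epsilon> c p) \<in> net_rel (Vec M)"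
proof -
  have "negligible_on S (\<lambda>\<epsilon> x. r \<epsilon> - r' \<epsilon>)" for S :: "(real^'n) set"
  proof (rule negligible_onI)
    fix K :: "(real^'n) set" and m
    obtain C where "\<forall>\<^sub>F \<epsilon> in at_right 0. \<bar>r \<epsilon> - r' \<epsilon>\<bar> \<le> C * \<epsilon> ^ m" using assms(3) unfolding negligible_real_def by blast
    then have "\<forall>\<^sub>F \<epsilon> in at_right 0. \<forall>x\<in>K. norm (r \<epsilon> - r' \<epsilon>) \<le> C * \<epsilon> ^ m" by eventually_elim simp
    then show "\<exists>C. \<forall>\<^sub>F \<epsilon> in at_right 0. \<forall>x\<in>K. norm (r \<epsilon> - r' \<epsilon>) \<le> C * \<epsilon> ^ m" by blast
  qed
  then have "(\<lambda>\<epsilon> p. r \<epsilon>, \<lambda>\<epsilon> p. r' \<epsilon>) \<in> net_rel (Fun M)"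
    using moderate_real_Fun[OF assms(1)] moderate_real_Fun[OF assms(2)]
    unfolding Fun_net_rel_iff net_eq_def Fun_moderate_iff fun_loc_def[abs_def] by blast
  from smult_net_rel[OF this assms(4)] show ?thesis .
qed

lemma tfield_apply_net_rel:
  assumes g: "\<And>\<epsilon>. \<epsilon> \<in> {0<..1} \<Longrightarrow> g \<epsilon> \<in> smooth_tfields M" "\<And>\<epsilon>. \<epsilon> \<in> {0<..1} \<Longrightarrow> g' \<epsilon> \<in> smooth_tfields M"
    "\<And>c. c \<in> charts M \<Longrightarrow> net_eq (cimg c) (comp_loc c g) (comp_loc c g')"
    and "(\<xi>, \<xi>') \<in> net_rel (Vec M)" "(\<eta>, \<eta>') \<in> net_rel (Vec M)"
  shows "(\<lambda>\<epsilon>. tfield_apply M (g \<epsilon>) (\<xi> \<epsilon>) (\<eta> \<epsilon>), \<lambda>\<epsilon>. tfield_apply M (g' \<epsilon>) (\<xi>' \<epsilon>) (\<eta>' \<epsilon>)) \<in> net_rel (Fun M)"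
  unfolding Fun_net_rel_iff
proof
  fix c assume c: "c \<in> charts M"
  note mod = net_rel_moderate[OF assms(4)] net_rel_moderate[OF assms(5)]
  have "net_eq (cimg c) (\<lambda>\<epsilon> x. comp_loc c \<xi> \<epsilon> x \<bullet> (comp_loc c g \<epsilon> x *v comp_loc c \<eta> \<epsilon> x))
      (\<lambda>\<epsilon> x. comp_loc c \<xi>' \<epsilon> x \<bullet> (comp_loc c g' \<epsilon> x *v comp_loc c \<eta>' \<epsilon> x))"
    using assms(4,5) c g(3)[OF c] unfolding Vec_net_rel_iff by (intro net_eq_inner net_eq_matrix_vector) auto
  then show "net_eq (cimg c) (fun_loc c (\<lambda>\<epsilon>. tfield_apply M (g \<epsilon>) (\<xi> \<epsilon>) (\<eta> \<epsilon>))) (fun_loc c (\<lambda>\<epsilon>. tfield_apply M (g' \<epsilon>) (\<xi>' \<epsilon>) (\<eta>' \<epsilon>)))"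
    by (rule net_eq_cong[OF open_cimg[OF c]])
       (simp_all add: fun_loc_def comp_loc_def c g tfield_apply_chart Vec_moderate_law[OF mod(1)]
         Vec_moderate_law[OF mod(2)] Vec_moderate_law[OF mod(3)] Vec_moderate_law[OF mod(4)])
qed

lemma Fun_add_net_rel:
  assumes "(u, u') \<in> net_rel (Fun M)" "(v, v') \<in> net_rel (Fun M)"
  shows "(\<lambda>\<epsilon>. u \<epsilon> + v \<epsilon>, \<lambda>\<epsilon>. u' \<epsilon> + v' \<epsilon>) \<in> net_rel (Fun M)"
    and "(\<lambda>\<epsilon>. u \<epsilon> - v \<epsilon>, \<lambda>\<epsilon>. u' \<epsilon> - v' \<epsilon>) \<in> net_rel (Fun M)"
proof -
  have "net_eq (cimg c) (fun_loc c (\<lambda>\<epsilon>. u \<epsilon> + v \<epsilon>)) (fun_loc c (\<lambda>\<epsilon>. u' \<epsilon> + v' \<epsilon>)) \<and>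
      net_eq (cimg c) (fun_loc c (\<lambda>\<epsilon>. u \<epsilon> - v \<epsilon>)) (fun_loc c (\<lambda>\<epsilon>. u' \<epsilon> - v' \<epsilon>))" if c: "c \<in> charts M" for c
  proof -
    have "net_eq (cimg c) (fun_loc c u) (fun_loc c u')" "net_eq (cimg c) (fun_loc c v) (fun_loc c v')"
      using assms c unfolding Fun_net_rel_iff by auto
    from net_eq_add[OF open_cimg[OF c] this] net_eq_diff[OF open_cimg[OF c] this]
    show ?thesis by (simp add: fun_loc_def[abs_def])
  qed
  then show "(\<lambda>\<epsilon>. u \<epsilon> + v \<epsilon>, \<lambda>\<epsilon>. u' \<epsilon> + v' \<epsilon>) \<in> net_rel (Fun M)"
    "(\<lambda>\<epsilon>. u \<epsilon> - v \<epsilon>, \<lambda>\<epsilon>. u' \<epsilon> - v' \<epsilon>) \<in> net_rel (Fun M)"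
    unfolding Fun_net_rel_iff by blast+
qed

lemma Vec_add_net_rel:
  assumes "(u, u') \<in> net_rel (Vec M)" "(v, v') \<in> net_rel (Vec M)"
  shows "(\<lambda>\<epsilon>. u \<epsilon> + v \<epsilon>, \<lambda>\<epsilon>. u' \<epsilon> + v' \<epsilon>) \<in> net_rel (Vec M)"
    and "(\<lambda>\<epsilon>. u \<epsilon> - v \<epsilon>, \<lambda>\<epsilon>. u' \<epsilon> - v' \<epsilon>) \<in> net_rel (Vec M)"
proof -
  have "net_eq (cimg c) (comp_loc c (\<lambda>\<epsilon>. u \<epsilon> + v \<epsilon>)) (comp_loc c (\<lambda>\<epsilon>. u' \<epsilon> + v' \<epsilon>)) \<and>
      net_eq (cimg c) (comp_loc c (\<lambda>\<epsilon>. u \<epsilon> - v \<epsilon>)) (comp_loc c (\<lambda>\<epsilon>. u' \<epsilon> - v' \<epsilon>))" if c: "c \<in> charts M" for c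
  proof -
    have "net_eq (cimg c) (comp_loc c u) (comp_loc c u')" "net_eq (cimg c) (comp_loc c v) (comp_loc c v')"
      using assms c unfolding Vec_net_rel_iff by auto
    from net_eq_add[OF open_cimg[OF c] this] net_eq_diff[OF open_cimg[OF c] this]
    show ?thesis by (simp add: comp_loc_def[abs_def])
  qed
  moreover have "vector_law M (u \<epsilon> + v \<epsilon>) \<and> vector_law M (u' \<epsilon> + v' \<epsilon>)"
    "vector_law M (u \<epsilon> - v \<epsilon>) \<and> vector_law M (u' \<epsilon> - v' \<epsilon>)" if "\<epsilon> \<in> {0<..1}" for \<epsilon>
    using assms that unfolding Vec_net_rel_iff by (auto intro: vector_law_add)
  ultimately show "(\<lambda>\<epsilon>. u \<epsilon> + v \<epsilon>, \<lambda>\<epsilon>. u' \<epsilon> + v' \<epsilon>) \<in> net_rel (Vec M)"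
    "(\<lambda>\<epsilon>. u \<epsilon> - v \<epsilon>, \<lambda>\<epsilon>. u' \<epsilon> - v' \<epsilon>) \<in> net_rel (Vec M)"
    unfolding Vec_net_rel_iff by blast+
qed

lemma Fun_mem: "moderate (Fun M) u \<Longrightarrow> u \<in> gclass (Fun M) u"
  and Vec_mem: "moderate (Vec M) \<xi> \<Longrightarrow> \<xi> \<in> gclass (Vec M) \<xi>"
  unfolding Fn.mem_gclass Vc.mem_gclass by (simp_all add: Fn.net_rel_refl Vc.net_rel_refl)

lemma gplus_Fun:
  assumes "moderate (Fun M) u" "moderate (Fun M) v"
  shows "gclass (Fun M) u \<boxplus>\<^bsub>Fun M\<^esub> gclass (Fun M) v = gclass (Fun M) (\<lambda>\<epsilon>. u \<epsilon> + v \<epsilon>)"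
  unfolding gplus_def
  by (rule lift2_gclass[OF Fn.normed_bundle_axioms]) (simp_all add: assms Fn.net_rel_refl Vc.net_rel_refl Fun_mem Fun_add_net_rel Fn.mem_gclass)

lemma gminus_Fun:
  assumes "moderate (Fun M) u" "moderate (Fun M) v"
  shows "gclass (Fun M) u \<boxminus>\<^bsub>Fun M\<^esub> gclass (Fun M) v = gclass (Fun M) (\<lambda>\<epsilon>. u \<epsilon> - v \<epsilon>)"
  unfolding gminus_def
  by (rule lift2_gclass[OF Fn.normed_bundle_axioms]) (simp_all add: assms Fn.net_rel_refl Vc.net_rel_refl Fun_mem Fun_add_net_rel Fn.mem_gclass)

lemma gplus_Vec:
  assumes "moderate (Vec M) u" "moderate (Vec M) v"
  shows "gclass (Vec M) u \<boxplus>\<^bsub>Vec M\<^esub> gclass (Vec M) v = gclass (Vec M) (\<lambda>\<epsilon>. u \<epsilon> + v \<epsilon>)"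
  unfolding gplus_def
  by (rule lift2_gclass[OF Vc.normed_bundle_axioms]) (simp_all add: assms Fn.net_rel_refl Vc.net_rel_refl Vec_mem Vec_add_net_rel Vc.mem_gclass)

lemma gminus_Vec:
  assumes "moderate (Vec M) u" "moderate (Vec M) v"
  shows "gclass (Vec M) u \<boxminus>\<^bsub>Vec M\<^esub> gclass (Vec M) v = gclass (Vec M) (\<lambda>\<epsilon>. u \<epsilon> - v \<epsilon>)"
  unfolding gminus_def
  by (rule lift2_gclass[OF Vc.normed_bundle_axioms]) (simp_all add: assms Fn.net_rel_refl Vc.net_rel_refl Vec_mem Vec_add_net_rel Vc.mem_gclass)

lemma gvec_smult_gclass:
  assumes "moderate (Fun M) u" "moderate (Vec M) \<xi>"
  shows "gvec_smult M (gclass (Fun M) u) (gclass (Vec M) \<xi>) = gclass (Vec M) (\<lambda>\<epsilon> c p. u \<epsilon> p *\<^sub>R \<xi> \<epsilon> c p)"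
  unfolding gvec_smult_def
  by (rule lift2_gclass[OF Vc.normed_bundle_axioms]) (simp_all add: assms Fn.net_rel_refl Vc.net_rel_refl Fun_mem Vec_mem smult_net_rel Fn.mem_gclass Vc.mem_gclass)

lemma gvec_apply_gclass:
  assumes "moderate (Vec M) \<xi>" "moderate (Fun M) u"
  shows "gvec_apply M (gclass (Vec M) \<xi>) (gclass (Fun M) u) = gclass (Fun M) (\<lambda>\<epsilon>. vfield_apply M (\<xi> \<epsilon>) (u \<epsilon>))"
  unfolding gvec_apply_def
  by (rule lift2_gclass[OF Fn.normed_bundle_axioms]) (simp_all add: assms Fn.net_rel_refl Vc.net_rel_refl Fun_mem Vec_mem vfield_apply_net_rel Fn.mem_gclass Vc.mem_gclass)

lemma gbracket_gclass:
  assumes "moderate (Vec M) \<xi>" "moderate (Vec M) \<eta>"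
  shows "gbracket M (gclass (Vec M) \<xi>) (gclass (Vec M) \<eta>) = gclass (Vec M) (\<lambda>\<epsilon>. lie_bracket (\<xi> \<epsilon>) (\<eta> \<epsilon>))"
  unfolding gbracket_def
  by (rule lift2_gclass[OF Vc.normed_bundle_axioms]) (simp_all add: assms Fn.net_rel_refl Vc.net_rel_refl Vec_mem lie_bracket_net_rel Vc.mem_gclass)

lemma gvec_rmult_gclass:
  assumes "R \<in> gen_reals" "moderate (Vec M) \<xi>"
  obtains r where "moderate_real r"
    "\<And>\<xi>. moderate (Vec M) \<xi> \<Longrightarrow> gvec_rmult M R (gclass (Vec M) \<xi>) = gclass (Vec M) (\<lambda>\<epsilon> c p. r \<epsilon> *\<^sub>R \<xi> \<epsilon> c p)"
proof -
  from assms(1) obtain r where r: "moderate_real r"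
    "R = {(r, s). moderate_real r \<and> moderate_real s \<and> negligible_real (\<lambda>\<epsilon>. r \<epsilon> - s \<epsilon>)} `` {r}"
    unfolding gen_reals_def quotient_def by blast
  have mem: "s \<in> R \<longleftrightarrow> moderate_real s \<and> negligible_real (\<lambda>\<epsilon>. r \<epsilon> - s \<epsilon>)" for s
    using r by auto
  have "negligible_real (\<lambda>\<epsilon>. r \<epsilon> - r \<epsilon>)"
    unfolding negligible_real_def by (auto intro!: exI[of _ 0])
  then have "r \<in> R" using mem r by blast
  have "gvec_rmult M R (gclass (Vec M) \<xi>) = gclass (Vec M) (\<lambda>\<epsilon> c p. r \<epsilon> *\<^sub>R \<xi> \<epsilon> c p)" if \<xi>: "moderate (Vec M) \<xi>" for \<xi>
    unfolding gvec_rmult_def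
  proof (rule lift2_gclass[OF Vc.normed_bundle_axioms, where f = "\<lambda>r \<xi> c p. r *\<^sub>R \<xi> c p", OF \<open>r \<in> R\<close> Vec_mem[OF \<xi>]])
    fix r' \<xi>' assume "r' \<in> R" "\<xi>' \<in> gclass (Vec M) \<xi>"
    then show "(\<lambda>\<epsilon> c p. r \<epsilon> *\<^sub>R \<xi> \<epsilon> c p, \<lambda>\<epsilon> c p. r' \<epsilon> *\<^sub>R \<xi>' \<epsilon> c p) \<in> net_rel (Vec M)"
      unfolding mem Vc.mem_gclass using r(1) by (intro rmult_net_rel) auto
  qed
  with r(1) show ?thesis by (rule that)
qed

lemma gfun_two_times_gclass:
  assumes "moderate (Fun M) u"
  shows "gfun_two_times M (gclass (Fun M) u) = gclass (Fun M) (\<lambda>\<epsilon> p. 2 * u \<epsilon> p)"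
proof -
  have "(\<lambda>\<epsilon> p. 2 * u \<epsilon> p, \<lambda>\<epsilon> p. 2 * v \<epsilon> p) \<in> net_rel (Fun M)" if "(u, v) \<in> net_rel (Fun M)" for v
    using that net_eq_linear[OF bounded_linear_mult_right[of "2::real"] open_cimg]
    unfolding Fun_net_rel_iff fun_loc_def[abs_def] by simp
  then have "gclass (Fun M) (\<lambda>\<epsilon> p. 2 * v \<epsilon> p) = gclass (Fun M) (\<lambda>\<epsilon> p. 2 * u \<epsilon> p)" if "v \<in> gclass (Fun M) u" for v
    using that Fn.gclass_eqI unfolding Fn.mem_gclass by blast
  then show ?thesis unfolding gfun_two_times_def lift1_def using Fun_mem[OF assms] by blast
qed

end

section \<open>The Koszul formula for generalized vector fields\<close>

text \<open>The net \<open>g\<close> has the additional property of being symmetric everywhere and for all parameters.  As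
  it is equal to the elements of \<open>G\<close> up to negligible nets in all charts, all calculations with
  classes can be done with it.\<close>

locale metric_net = smooth_mf M
  for M :: "('a, 'n::finite) manifold" +
  fixes G :: "(real \<Rightarrow> ('a, 'n) tfield) set" and g :: "real \<Rightarrow> ('a, 'n) tfield"
  assumes g_section: "\<epsilon> \<in> {0<..1} \<Longrightarrow> g \<epsilon> \<in> smooth_tfields M"
    and g_sym: "\<epsilon> \<in> {0<..1} \<Longrightarrow> c \<in> charts M \<Longrightarrow> p \<in> fst c \<Longrightarrow> transpose (g \<epsilon> c p) = g \<epsilon> c p"
    and g_moderate: "c \<in> charts M \<Longrightarrow> moderate_on (cimg c) (comp_loc c g)"
    and g_det: "c \<in> charts M \<Longrightarrow> strictly_nonzero_on (cimg c) (\<lambda>\<epsilon> x. det (comp_loc c g \<epsilon> x))"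
    and G_nonempty: "G \<noteq> {}"
    and G_section: "\<gamma> \<in> G \<Longrightarrow> \<epsilon> \<in> {0<..1} \<Longrightarrow> \<gamma> \<epsilon> \<in> smooth_tfields M"
    and G_eq: "\<gamma> \<in> G \<Longrightarrow> c \<in> charts M \<Longrightarrow> net_eq (cimg c) (comp_loc c g) (comp_loc c \<gamma>)"
begin

abbreviation ip :: "(real \<Rightarrow> ('a, 'n) vfield) \<Rightarrow> (real \<Rightarrow> ('a, 'n) vfield) \<Rightarrow> real \<Rightarrow> 'a \<Rightarrow> real" where
  "ip \<xi> \<eta> \<equiv> \<lambda>\<epsilon>. tfield_apply M (g \<epsilon>) (\<xi> \<epsilon>) (\<eta> \<epsilon>)"

abbreviation lie_deriv :: "(real \<Rightarrow> ('a, 'n) vfield) \<Rightarrow> (real \<Rightarrow> 'a \<Rightarrow> real) \<Rightarrow> real \<Rightarrow> 'a \<Rightarrow> real" where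
  "lie_deriv \<xi> u \<equiv> \<lambda>\<epsilon>. vfield_apply M (\<xi> \<epsilon>) (u \<epsilon>)"

abbreviation bracket :: "(real \<Rightarrow> ('a, 'n) vfield) \<Rightarrow> (real \<Rightarrow> ('a, 'n) vfield) \<Rightarrow> real \<Rightarrow> ('a, 'n) vfield" where
  "bracket \<xi> \<eta> \<equiv> \<lambda>\<epsilon>. lie_bracket (\<xi> \<epsilon>) (\<eta> \<epsilon>)"

lemma moderate_ip: "moderate (Vec M) \<xi> \<Longrightarrow> moderate (Vec M) \<eta> \<Longrightarrow> moderate (Fun M) (ip \<xi> \<eta>)"
  by (rule net_rel_moderate(1)[OF tfield_apply_net_rel[OF g_section g_section net_eq_refl[OF g_moderate]
        Vc.net_rel_refl Vc.net_rel_refl]])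

lemma moderate_lie_deriv: "moderate (Vec M) \<xi> \<Longrightarrow> moderate (Fun M) u \<Longrightarrow> moderate (Fun M) (lie_deriv \<xi> u)"
  by (rule net_rel_moderate(1)[OF vfield_apply_net_rel[OF Vc.net_rel_refl Fn.net_rel_refl]])

lemma moderate_bracket: "moderate (Vec M) \<xi> \<Longrightarrow> moderate (Vec M) \<eta> \<Longrightarrow> moderate (Vec M) (bracket \<xi> \<eta>)"
  by (rule net_rel_moderate(1)[OF lie_bracket_net_rel[OF Vc.net_rel_refl Vc.net_rel_refl]])

lemma moderate_smult: "moderate (Fun M) u \<Longrightarrow> moderate (Vec M) \<xi> \<Longrightarrow> moderate (Vec M) (\<lambda>\<epsilon> c p. u \<epsilon> p *\<^sub>R \<xi> \<epsilon> c p)"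
  by (rule net_rel_moderate(1)[OF smult_net_rel[OF Fn.net_rel_refl Vc.net_rel_refl]])

text \<open>The metric enters through all of its representatives; each of them may be replaced by \<open>g\<close>.\<close>

lemma gten_apply_gclass:
  assumes "moderate (Vec M) \<xi>" "moderate (Vec M) \<eta>"
  shows "gten_apply M G (gclass (Vec M) \<xi>) (gclass (Vec M) \<eta>) = gclass (Fun M) (ip \<xi> \<eta>)"
proof -
  have eq: "gclass (Fun M) (\<lambda>\<epsilon>. tfield_apply M (\<gamma> \<epsilon>) (\<xi>' \<epsilon>) (\<eta>' \<epsilon>)) = gclass (Fun M) (ip \<xi> \<eta>)"
    if "\<gamma> \<in> G" "\<xi>' \<in> gclass (Vec M) \<xi>" "\<eta>' \<in> gclass (Vec M) \<eta>" for \<gamma> \<xi>' \<eta>'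
    using Fn.gclass_eqI[OF tfield_apply_net_rel[of g \<gamma> \<xi> \<xi>' \<eta> \<eta>']] that
    by (simp add: g_section G_section G_eq Vc.mem_gclass)
  obtain \<gamma> where "\<gamma> \<in> G" using G_nonempty by blast
  show ?thesis
    unfolding gten_apply_def
  proof (intro equalityI subsetI)
    fix z assume "z \<in> gclass (Fun M) (ip \<xi> \<eta>)"
    with eq[OF \<open>\<gamma> \<in> G\<close> Vec_mem[OF assms(1)] Vec_mem[OF assms(2)]]
    show "z \<in> (\<Union>g\<in>G. \<Union>\<xi>\<in>gclass (Vec M) \<xi>. \<Union>\<eta>\<in>gclass (Vec M) \<eta>. gclass (Fun M) (\<lambda>\<epsilon>. tfield_apply M (g \<epsilon>) (\<xi> \<epsilon>) (\<eta> \<epsilon>)))"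
      by (intro UN_I[OF \<open>\<gamma> \<in> G\<close>] UN_I[OF Vec_mem[OF assms(1)]] UN_I[OF Vec_mem[OF assms(2)]]) simp
  qed (elim UN_E, simp only: eq)
qed

lemma ip_loc:
  assumes "moderate (Vec M) \<xi>" "moderate (Vec M) \<eta>" "\<epsilon> \<in> {0<..1}" "c \<in> charts M" "x \<in> cimg c"
  shows "fun_loc c (ip \<xi> \<eta>) \<epsilon> x = comp_loc c \<xi> \<epsilon> x \<bullet> (comp_loc c g \<epsilon> x *v comp_loc c \<eta> \<epsilon> x)"
  unfolding fun_loc_def comp_loc_def
  by (intro tfield_apply_chart g_section Vec_moderate_law assms)

lemma lie_deriv_loc:
  assumes "moderate (Vec M) \<xi>" "moderate (Fun M) u" "\<epsilon> \<in> {0<..1}" "c \<in> charts M" "x \<in> cimg c"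
  shows "fun_loc c (lie_deriv \<xi> u) \<epsilon> x = dir (comp_loc c \<xi> \<epsilon> x) (fun_loc c u \<epsilon>) x"
  unfolding fun_loc_def[abs_def] comp_loc_def
  by (rule vfield_apply_chart[OF Vec_moderate_law[OF assms(1,3)] Fun_moderate_section[OF assms(2,3)] assms(4,5)])

lemma bracket_loc:
  assumes "moderate (Vec M) \<xi>" "moderate (Vec M) \<eta>" "\<epsilon> \<in> {0<..1}" "c \<in> charts M" "x \<in> cimg c"
  shows "comp_loc c (bracket \<xi> \<eta>) \<epsilon> x = dir (comp_loc c \<xi> \<epsilon> x) (comp_loc c \<eta> \<epsilon>) x - dir (comp_loc c \<eta> \<epsilon> x) (comp_loc c \<xi> \<epsilon>) x"
  unfolding comp_loc_def[abs_def]
  by (rule lie_bracket_chart[OF Vec_moderate_section[OF assms(1,3)] Vec_moderate_section[OF assms(2,3)] assms(4,5)])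

lemma loc_differentiable:
  assumes "moderate (Vec M) \<xi>" "\<epsilon> \<in> {0<..1}" "c \<in> charts M" "x \<in> cimg c"
  shows "comp_loc c \<xi> \<epsilon> differentiable at x"
  using moderate_on_differentiable[OF Vec_moderate_loc[OF assms(1,3)] assms(2,4)] .

lemma g_differentiable: "\<epsilon> \<in> {0<..1} \<Longrightarrow> c \<in> charts M \<Longrightarrow> x \<in> cimg c \<Longrightarrow> comp_loc c g \<epsilon> differentiable at x"
  using moderate_on_differentiable[OF g_moderate] by blast

lemma g_loc_sym: "\<epsilon> \<in> {0<..1} \<Longrightarrow> c \<in> charts M \<Longrightarrow> x \<in> cimg c \<Longrightarrow> transpose (comp_loc c g \<epsilon> x) = comp_loc c g \<epsilon> x"
  by (simp add: comp_loc_def g_sym)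

lemma g_loc_inner: "\<epsilon> \<in> {0<..1} \<Longrightarrow> c \<in> charts M \<Longrightarrow> x \<in> cimg c \<Longrightarrow>
    v \<bullet> (comp_loc c g \<epsilon> x *v w) = w \<bullet> (comp_loc c g \<epsilon> x *v v)"
  by (rule sym_inner[OF g_loc_sym])

lemma dir_ip_loc:
  assumes "moderate (Vec M) \<xi>" "moderate (Vec M) \<eta>" "\<epsilon> \<in> {0<..1}" "c \<in> charts M" "x \<in> cimg c"
  shows "dir v (fun_loc c (ip \<xi> \<eta>) \<epsilon>) x = dir v (\<lambda>y. comp_loc c \<xi> \<epsilon> y \<bullet> (comp_loc c g \<epsilon> y *v comp_loc c \<eta> \<epsilon> y)) x"
  by (rule dir_cong_open[OF open_cimg[OF assms(4)] assms(5)]) (rule ip_loc[OF assms(1-4)])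

text \<open>The right hand side of the Koszul formula on the level of representatives.\<close>

definition koszul_net where
  "koszul_net \<xi> \<eta> \<zeta> = (\<lambda>\<epsilon>. lie_deriv \<xi> (ip \<eta> \<zeta>) \<epsilon> + lie_deriv \<eta> (ip \<zeta> \<xi>) \<epsilon> - lie_deriv \<zeta> (ip \<xi> \<eta>) \<epsilon>
     - ip \<xi> (bracket \<eta> \<zeta>) \<epsilon> + ip \<eta> (bracket \<zeta> \<xi>) \<epsilon> + ip \<zeta> (bracket \<xi> \<eta>) \<epsilon>)"

lemma koszul_rhs_gclass:
  assumes "moderate (Vec M) \<xi>" "moderate (Vec M) \<eta>" "moderate (Vec M) \<zeta>"
  shows "gvec_apply M (gclass (Vec M) \<xi>) (gten_apply M G (gclass (Vec M) \<eta>) (gclass (Vec M) \<zeta>))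
          \<boxplus>\<^bsub>Fun M\<^esub> gvec_apply M (gclass (Vec M) \<eta>) (gten_apply M G (gclass (Vec M) \<zeta>) (gclass (Vec M) \<xi>))
          \<boxminus>\<^bsub>Fun M\<^esub> gvec_apply M (gclass (Vec M) \<zeta>) (gten_apply M G (gclass (Vec M) \<xi>) (gclass (Vec M) \<eta>))
          \<boxminus>\<^bsub>Fun M\<^esub> gten_apply M G (gclass (Vec M) \<xi>) (gbracket M (gclass (Vec M) \<eta>) (gclass (Vec M) \<zeta>))
          \<boxplus>\<^bsub>Fun M\<^esub> gten_apply M G (gclass (Vec M) \<eta>) (gbracket M (gclass (Vec M) \<zeta>) (gclass (Vec M) \<xi>))
          \<boxplus>\<^bsub>Fun M\<^esub> gten_apply M G (gclass (Vec M) \<zeta>) (gbracket M (gclass (Vec M) \<xi>) (gclass (Vec M) \<eta>))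
    = gclass (Fun M) (koszul_net \<xi> \<eta> \<zeta>)"
  unfolding koszul_net_def
  using assms
  by (simp add: gten_apply_gclass gvec_apply_gclass gbracket_gclass gplus_Fun gminus_Fun moderate_ip moderate_lie_deriv
      moderate_bracket Fn.moderate_add Fn.moderate_diff)

lemma koszul_net_moderate:
  assumes "moderate (Vec M) \<xi>" "moderate (Vec M) \<eta>" "moderate (Vec M) \<zeta>"
  shows "moderate (Fun M) (koszul_net \<xi> \<eta> \<zeta>)"
  unfolding koszul_net_def using assms
  by (intro Fn.moderate_add Fn.moderate_diff moderate_ip moderate_lie_deriv moderate_bracket)

lemma fun_loc_add: "fun_loc c (\<lambda>\<epsilon>. u \<epsilon> + v \<epsilon>) \<epsilon> x = fun_loc c u \<epsilon> x + fun_loc c v \<epsilon> x"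
  and fun_loc_diff: "fun_loc c (\<lambda>\<epsilon>. u \<epsilon> - v \<epsilon>) \<epsilon> x = fun_loc c u \<epsilon> x - fun_loc c v \<epsilon> x"
  and comp_loc_add: "comp_loc c (\<lambda>\<epsilon>. \<xi> \<epsilon> + \<eta> \<epsilon>) \<epsilon> x = comp_loc c \<xi> \<epsilon> x + comp_loc c \<eta> \<epsilon> x"
  and comp_loc_diff: "comp_loc c (\<lambda>\<epsilon>. \<xi> \<epsilon> - \<eta> \<epsilon>) \<epsilon> x = comp_loc c \<xi> \<epsilon> x - comp_loc c \<eta> \<epsilon> x"
  and comp_loc_smult: "comp_loc c (\<lambda>\<epsilon> c p. u \<epsilon> p *\<^sub>R \<xi> \<epsilon> c p) \<epsilon> x = fun_loc c u \<epsilon> x *\<^sub>R comp_loc c \<xi> \<epsilon> x"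
  for \<xi> \<eta> :: "real \<Rightarrow> ('a, 'n) vfield"
  by (simp_all add: fun_loc_def comp_loc_def)

definition kform where
  "kform c \<xi> \<eta> \<epsilon> x = koszul_form (comp_loc c g \<epsilon>) (comp_loc c \<xi> \<epsilon>) (comp_loc c \<eta> \<epsilon>) x"

lemma koszul_net_loc:
  assumes m: "moderate (Vec M) \<xi>" "moderate (Vec M) \<eta>" "moderate (Vec M) \<zeta>"
    and e: "\<epsilon> \<in> {0<..1}" and c: "c \<in> charts M" and x: "x \<in> cimg c"
  shows "fun_loc c (koszul_net \<xi> \<eta> \<zeta>) \<epsilon> x = comp_loc c \<zeta> \<epsilon> x \<bullet> kform c \<xi> \<eta> \<epsilon> x"
  unfolding koszul_net_def fun_loc_add fun_loc_diff kform_def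
    ip_loc[OF m(1) moderate_bracket[OF m(2,3)] e c x] ip_loc[OF m(2) moderate_bracket[OF m(3,1)] e c x]
    ip_loc[OF m(3) moderate_bracket[OF m(1,2)] e c x]
    bracket_loc[OF m(2,3) e c x] bracket_loc[OF m(3,1) e c x] bracket_loc[OF m(1,2) e c x]
    lie_deriv_loc[OF m(1) moderate_ip[OF m(2,3)] e c x] lie_deriv_loc[OF m(2) moderate_ip[OF m(3,1)] e c x]
    lie_deriv_loc[OF m(3) moderate_ip[OF m(1,2)] e c x]
    dir_ip_loc[OF m(2,3) e c x] dir_ip_loc[OF m(3,1) e c x] dir_ip_loc[OF m(1,2) e c x]
  by (rule koszul_identity[OF open_cimg[OF c] x g_loc_sym[OF e c] g_differentiable[OF e c x]
      loc_differentiable[OF m(1) e c x] loc_differentiable[OF m(2) e c x] loc_differentiable[OF m(3) e c x]])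

lemma kform_moderate:
  "moderate (Vec M) \<xi> \<Longrightarrow> moderate (Vec M) \<eta> \<Longrightarrow> c \<in> charts M \<Longrightarrow> moderate_on (cimg c) (kform c \<xi> \<eta>)"
  unfolding kform_def[abs_def] by (intro moderate_on_koszul_form open_cimg g_moderate Vec_moderate_loc)

text \<open>The factor \<open>2\<close> and the family of local covectors match \<open>koszul_form\<close>, so that the Koszul formula for
  \<open>w = D \<xi> \<eta>\<close> becomes a statement of this kind.\<close>

definition lowers_to :: "(real \<Rightarrow> ('a, 'n) vfield) \<Rightarrow> (('a, 'n) chart \<Rightarrow> real \<Rightarrow> real^'n \<Rightarrow> real^'n) \<Rightarrow> bool" where
  "lowers_to w \<omega> \<longleftrightarrow> (\<forall>c\<in>charts M. net_eq (cimg c) (\<lambda>\<epsilon> x. 2 *\<^sub>R (comp_loc c g \<epsilon> x *v comp_loc c w \<epsilon> x)) (\<omega> c))"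

lemma lowered_moderate: "moderate (Vec M) w \<Longrightarrow> c \<in> charts M \<Longrightarrow>
    moderate_on (cimg c) (\<lambda>\<epsilon> x. 2 *\<^sub>R (comp_loc c g \<epsilon> x *v comp_loc c w \<epsilon> x))"
  by (intro moderate_on_scaleR moderate_on_const moderate_on_matrix_vector open_cimg g_moderate Vec_moderate_loc)

text \<open>The metric can be cancelled because its determinant does not decay too fast.\<close>

lemma lowers_to_unique:
  assumes "moderate (Vec M) w" "moderate (Vec M) w'" "lowers_to w \<omega>" "lowers_to w' \<omega>"
  shows "gclass (Vec M) w = gclass (Vec M) w'"
  unfolding Vec_gclass_eq_iff[OF assms(1,2)]
proof
  fix c assume c: "c \<in> charts M"
  have "net_eq (cimg c) (\<lambda>\<epsilon> x. 2 *\<^sub>R (comp_loc c g \<epsilon> x *v comp_loc c w \<epsilon> x)) (\<lambda>\<epsilon> x. 2 *\<^sub>R (comp_loc c g \<epsilon> x *v comp_loc c w' \<epsilon> x))"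
    using assms(3,4) c unfolding lowers_to_def by (blast intro: net_eq_trans net_eq_sym)
  from net_eq_linear[OF bounded_linear_scaleR_right[of "1/2"] open_cimg[OF c] this]
  have "net_eq (cimg c) (\<lambda>\<epsilon> x. comp_loc c g \<epsilon> x *v comp_loc c w \<epsilon> x) (\<lambda>\<epsilon> x. comp_loc c g \<epsilon> x *v comp_loc c w' \<epsilon> x)"
    by simp
  then show "net_eq (cimg c) (comp_loc c w) (comp_loc c w')"
    by (rule net_eq_cancel_matrix[OF open_cimg[OF c] g_moderate[OF c] g_det[OF c]
          Vec_moderate_loc[OF assms(1) c] Vec_moderate_loc[OF assms(2) c]])
qed

lemma moderate_const_section: "s \<in> smooth_vfields M \<Longrightarrow> moderate (Vec M) (\<lambda>_. s)"
  unfolding Vec_moderate_iff smooth_vfields_iff comp_loc_def[abs_def] smooth_on_iff_moderate_on by blast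

text \<open>The fields in the Koszul formula are global; fields that are constant in coordinates up to a bump
  function serve to extract the components in a chart.\<close>

lemma test_field:
  assumes c: "c \<in> charts M" and K: "compact K" "K \<subseteq> cimg c"
  obtains \<rho> :: "real^'n \<Rightarrow> real" and s where "\<And>v. s v \<in> smooth_vfields M" "continuous_on UNIV \<rho>" "\<And>x. x \<in> K \<Longrightarrow> 0 < \<rho> x"
    "\<And>v x. x \<in> cimg c \<Longrightarrow> s v c (chart_inv c x) = \<rho> x *\<^sub>R v"
proof -
  obtain \<rho> :: "real^'n \<Rightarrow> real" and L where \<rho>: "smooth_on UNIV \<rho>" "\<And>x. 0 \<le> \<rho> x" "\<And>x. x \<in> K \<Longrightarrow> 0 < \<rho> x"
    "compact L" "L \<subseteq> cimg c" "\<And>x. x \<notin> L \<Longrightarrow> \<rho> x = 0"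
    by (rule bump_exists[OF K open_cimg[OF c]]) (rule that)
  define s where "s v = Vc.extend c (\<lambda>x. \<rho> x *\<^sub>R v)" for v
  show ?thesis
  proof (rule that[of s \<rho>])
    fix v
    have "s v \<in> sections (Vec M)" unfolding s_def
      by (rule Vc.extend_section[of c _ L])
        (use c \<rho> smooth_on_subset[OF subset_UNIV \<rho>(1)] in \<open>auto intro!: smooth_on_scaleR smooth_on_const\<close>)
    then show "s v \<in> smooth_vfields M" by simp
    fix x assume "x \<in> cimg c"
    then show "s v c (chart_inv c x) = \<rho> x *\<^sub>R v"
      using Vc.comps_extend[of c c "chart_inv c x"] c jacobian_refl[OF c, of "chart_inv c x"] by (simp add: s_def)
  qed (use \<rho> smooth_on_continuous in auto)
qed

text \<open>The test fields isolate each component, multiplied with a function that is bounded below by a positive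
  constant on the compact set in question; dividing by it keeps negligibility.\<close>

theorem koszul_iff_lowers_to:
  assumes m: "moderate (Vec M) \<xi>" "moderate (Vec M) \<eta>" "moderate (Vec M) w"
  shows "(\<forall>\<zeta>. moderate (Vec M) \<zeta> \<longrightarrow>
      gfun_two_times M (gten_apply M G (gclass (Vec M) w) (gclass (Vec M) \<zeta>)) = gclass (Fun M) (koszul_net \<xi> \<eta> \<zeta>))
    \<longleftrightarrow> lowers_to w (\<lambda>c. kform c \<xi> \<eta>)"
proof -
  define L where "L c \<epsilon> x = 2 *\<^sub>R (comp_loc c g \<epsilon> x *v comp_loc c w \<epsilon> x)" for c \<epsilon> x
  have two: "moderate (Fun M) (\<lambda>\<epsilon> p. 2 * u \<epsilon> p)" if "moderate (Fun M) u" for u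
    using that moderate_on_linear[OF bounded_linear_mult_right[of "2::real"] open_cimg]
    unfolding Fun_moderate_iff fun_loc_def[abs_def] by blast
  have eq: "gfun_two_times M (gten_apply M G (gclass (Vec M) w) (gclass (Vec M) \<zeta>)) = gclass (Fun M) (koszul_net \<xi> \<eta> \<zeta>)
    \<longleftrightarrow> (\<forall>c\<in>charts M. net_eq (cimg c) (\<lambda>\<epsilon> x. comp_loc c \<zeta> \<epsilon> x \<bullet> L c \<epsilon> x) (\<lambda>\<epsilon> x. comp_loc c \<zeta> \<epsilon> x \<bullet> kform c \<xi> \<eta> \<epsilon> x))"
    if \<zeta>: "moderate (Vec M) \<zeta>" for \<zeta>
  proof -
    have l: "fun_loc c (\<lambda>\<epsilon> p. 2 * ip w \<zeta> \<epsilon> p) \<epsilon> x = comp_loc c \<zeta> \<epsilon> x \<bullet> L c \<epsilon> x" 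
      if "\<epsilon> \<in> {0<..1}" "c \<in> charts M" "x \<in> cimg c" for c \<epsilon> x
      using ip_loc[OF m(3) \<zeta> that] g_loc_inner[OF that, of "comp_loc c \<zeta> \<epsilon> x"]
      by (simp add: L_def fun_loc_def)
    have "net_eq (cimg c) (fun_loc c (\<lambda>\<epsilon> p. 2 * ip w \<zeta> \<epsilon> p)) (fun_loc c (koszul_net \<xi> \<eta> \<zeta>)) \<longleftrightarrow>
       net_eq (cimg c) (\<lambda>\<epsilon> x. comp_loc c \<zeta> \<epsilon> x \<bullet> L c \<epsilon> x) (\<lambda>\<epsilon> x. comp_loc c \<zeta> \<epsilon> x \<bullet> kform c \<xi> \<eta> \<epsilon> x)"
      if c: "c \<in> charts M" for c
      using net_eq_cong[OF open_cimg[OF c], of "fun_loc c (\<lambda>\<epsilon> p. 2 * ip w \<zeta> \<epsilon> p)" "fun_loc c (koszul_net \<xi> \<eta> \<zeta>)"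
          "\<lambda>\<epsilon> x. comp_loc c \<zeta> \<epsilon> x \<bullet> L c \<epsilon> x" "\<lambda>\<epsilon> x. comp_loc c \<zeta> \<epsilon> x \<bullet> kform c \<xi> \<eta> \<epsilon> x"]
        net_eq_cong[OF open_cimg[OF c], of "\<lambda>\<epsilon> x. comp_loc c \<zeta> \<epsilon> x \<bullet> L c \<epsilon> x" "\<lambda>\<epsilon> x. comp_loc c \<zeta> \<epsilon> x \<bullet> kform c \<xi> \<eta> \<epsilon> x"
          "fun_loc c (\<lambda>\<epsilon> p. 2 * ip w \<zeta> \<epsilon> p)" "fun_loc c (koszul_net \<xi> \<eta> \<zeta>)"]
        l[OF _ c] koszul_net_loc[OF m(1,2) \<zeta> _ c] by auto
    then show ?thesis
      using m \<zeta> by (simp add: gten_apply_gclass gfun_two_times_gclass moderate_ip Fun_gclass_eq_iff two koszul_net_moderate)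
  qed
  show ?thesis
  proof
    assume lw: "lowers_to w (\<lambda>c. kform c \<xi> \<eta>)"
    show "\<forall>\<zeta>. moderate (Vec M) \<zeta> \<longrightarrow>
      gfun_two_times M (gten_apply M G (gclass (Vec M) w) (gclass (Vec M) \<zeta>)) = gclass (Fun M) (koszul_net \<xi> \<eta> \<zeta>)"
    proof (intro allI impI)
      fix \<zeta> assume \<zeta>: "moderate (Vec M) \<zeta>"
      show "gfun_two_times M (gten_apply M G (gclass (Vec M) w) (gclass (Vec M) \<zeta>)) = gclass (Fun M) (koszul_net \<xi> \<eta> \<zeta>)"
        unfolding eq[OF \<zeta>]
      proof
        fix c assume c: "c \<in> charts M"
        have "net_eq (cimg c) (L c) (kform c \<xi> \<eta>)" using lw c unfolding lowers_to_def L_def[abs_def] by blast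
        from net_eq_inner[OF open_cimg[OF c] net_eq_refl[OF Vec_moderate_loc[OF \<zeta> c]] this]
        show "net_eq (cimg c) (\<lambda>\<epsilon> x. comp_loc c \<zeta> \<epsilon> x \<bullet> L c \<epsilon> x) (\<lambda>\<epsilon> x. comp_loc c \<zeta> \<epsilon> x \<bullet> kform c \<xi> \<eta> \<epsilon> x)" .
      qed
    qed
  next
    assume kz: "\<forall>\<zeta>. moderate (Vec M) \<zeta> \<longrightarrow>
      gfun_two_times M (gten_apply M G (gclass (Vec M) w) (gclass (Vec M) \<zeta>)) = gclass (Fun M) (koszul_net \<xi> \<eta> \<zeta>)"
    show "lowers_to w (\<lambda>c. kform c \<xi> \<eta>)"
      unfolding lowers_to_def
    proof
      fix c assume c: "c \<in> charts M"
      have mod: "moderate_on (cimg c) (L c)" "moderate_on (cimg c) (kform c \<xi> \<eta>)"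
        unfolding L_def[abs_def] using lowered_moderate[OF m(3) c] kform_moderate[OF m(1,2) c] by auto
      have "net_eq (cimg c) (L c) (kform c \<xi> \<eta>)"
      proof (rule net_eq_vec[OF open_cimg[OF c]])
        fix k
        have "negligible_on (cimg c) (\<lambda>\<epsilon> x. L c \<epsilon> x $ k - kform c \<xi> \<eta> \<epsilon> x $ k)"
        proof (rule negligible_onI)
          fix K n assume K: "compact K" "K \<subseteq> cimg c"
          obtain \<rho> :: "real^'n \<Rightarrow> real" and s where s: "\<And>v. s v \<in> smooth_vfields M" and \<rho>: "continuous_on UNIV \<rho>" "\<And>x. x \<in> K \<Longrightarrow> 0 < \<rho> x"
            and s\<rho>: "\<And>v x. x \<in> cimg c \<Longrightarrow> s v c (chart_inv c x) = \<rho> x *\<^sub>R v"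
            by (rule test_field[OF c K]) (rule that)
          obtain r where r: "0 < r" "\<And>x. x \<in> K \<Longrightarrow> r \<le> \<rho> x"
          proof (cases "K = {}")
            case False
            then obtain x where "x \<in> K" "\<And>y. y \<in> K \<Longrightarrow> \<rho> x \<le> \<rho> y"
              using continuous_attains_inf[OF K(1) False continuous_on_subset[OF \<rho>(1) subset_UNIV]] by blast
            with \<rho>(2) show ?thesis by (intro that[of "\<rho> x"]) auto
          qed (rule that[of 1], auto)
          define \<zeta> where "\<zeta> = (\<lambda>_::real. s (axis k 1))"
          have \<zeta>: "moderate (Vec M) \<zeta>" unfolding \<zeta>_def using s by (rule moderate_const_section)
          have "net_eq (cimg c) (\<lambda>\<epsilon> x. comp_loc c \<zeta> \<epsilon> x \<bullet> L c \<epsilon> x) (\<lambda>\<epsilon> x. comp_loc c \<zeta> \<epsilon> x \<bullet> kform c \<xi> \<eta> \<epsilon> x)"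
            using kz \<zeta> eq[OF \<zeta>] c by blast
          from negligible_onD[OF net_eq_negligible[OF this] K, of n]
          have "\<forall>\<^sub>F \<epsilon> in at_right 0. \<forall>x\<in>K. norm (L c \<epsilon> x $ k - kform c \<xi> \<eta> \<epsilon> x $ k) \<le> (1 / r) * \<epsilon> ^ n"
          proof eventually_elim
            case (elim \<epsilon>)
            show ?case
            proof
              fix x assume x: "x \<in> K"
              then have "x \<in> cimg c" using K by blast
              then have "comp_loc c \<zeta> \<epsilon> x = \<rho> x *\<^sub>R axis k 1" by (simp add: comp_loc_def \<zeta>_def s\<rho>)
              then have "comp_loc c \<zeta> \<epsilon> x \<bullet> L c \<epsilon> x - comp_loc c \<zeta> \<epsilon> x \<bullet> kform c \<xi> \<eta> \<epsilon> x = \<rho> x * (L c \<epsilon> x $ k - kform c \<xi> \<eta> \<epsilon> x $ k)"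
                by (simp add: inner_axis' right_diff_distrib)
              with elim x have "\<bar>\<rho> x\<bar> * \<bar>L c \<epsilon> x $ k - kform c \<xi> \<eta> \<epsilon> x $ k\<bar> \<le> \<epsilon> ^ n"
                by (metis abs_mult real_norm_def)
              moreover have "r * \<bar>L c \<epsilon> x $ k - kform c \<xi> \<eta> \<epsilon> x $ k\<bar> \<le> \<bar>\<rho> x\<bar> * \<bar>L c \<epsilon> x $ k - kform c \<xi> \<eta> \<epsilon> x $ k\<bar>"
                using r(2)[OF x] by (intro mult_right_mono) auto
              ultimately have "r * \<bar>L c \<epsilon> x $ k - kform c \<xi> \<eta> \<epsilon> x $ k\<bar> \<le> \<epsilon> ^ n" by linarith
              then show "norm (L c \<epsilon> x $ k - kform c \<xi> \<eta> \<epsilon> x $ k) \<le> (1 / r) * \<epsilon> ^ n"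
                using r(1) by (simp add: pos_le_divide_eq mult.commute)
            qed
          qed
          then show "\<exists>C. \<forall>\<^sub>F \<epsilon> in at_right 0. \<forall>x\<in>K. norm (L c \<epsilon> x $ k - kform c \<xi> \<eta> \<epsilon> x $ k) \<le> C * \<epsilon> ^ n" by blast
        qed
        then show "net_eq (cimg c) (\<lambda>\<epsilon> x. L c \<epsilon> x $ k) (\<lambda>\<epsilon> x. kform c \<xi> \<eta> \<epsilon> x $ k)"
          unfolding net_eq_def using mod c by (intro conjI moderate_on_nth open_cimg)
      qed
      then show "net_eq (cimg c) (\<lambda>\<epsilon> x. 2 *\<^sub>R (comp_loc c g \<epsilon> x *v comp_loc c w \<epsilon> x)) (kform c \<xi> \<eta>)"
        unfolding L_def[abs_def] .
    qed
  qed
qed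

section \<open>Existence of the covariant derivative\<close>

text \<open>The right hand side of the Koszul formula does not depend on the chart, and it is linear in the
  value of the test field; hence it defines a covector.\<close>

lemma kform_law:
  assumes m: "moderate (Vec M) \<xi>" "moderate (Vec M) \<eta>" and e: "\<epsilon> \<in> {0<..1}"
    and c: "c \<in> charts M" and d: "d \<in> charts M" and p: "p \<in> fst c" "p \<in> fst d"
  shows "kform c \<xi> \<eta> \<epsilon> (snd c p) = transpose (jacobian c d p) *v kform d \<xi> \<eta> \<epsilon> (snd d p)"
proof -
  have "{snd c p} \<subseteq> cimg c" using p by simp
  then obtain \<rho> :: "real^'n \<Rightarrow> real" and s where s: "\<And>v. s v \<in> smooth_vfields M" and \<rho>: "continuous_on UNIV \<rho>" "\<And>x. x \<in> {snd c p} \<Longrightarrow> 0 < \<rho> x"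
    and s\<rho>: "\<And>v x. x \<in> cimg c \<Longrightarrow> s v c (chart_inv c x) = \<rho> x *\<^sub>R v"
    by (rule test_field[OF c compact_sing]) (rule that)
  have "v \<bullet> kform c \<xi> \<eta> \<epsilon> (snd c p) = v \<bullet> (transpose (jacobian c d p) *v kform d \<xi> \<eta> \<epsilon> (snd d p))" for v
  proof -
    have \<zeta>: "moderate (Vec M) (\<lambda>_. s v)" using s by (rule moderate_const_section)
    have sc: "s v c p = \<rho> (snd c p) *\<^sub>R v" using s\<rho>[of "snd c p" v] c p by simp
    have sd: "s v d p = jacobian c d p *v (\<rho> (snd c p) *\<^sub>R v)"
      using s[of v] vector_lawD[OF _ c d p, of "s v"] sc unfolding smooth_vfields_iff by simp
    have "\<rho> (snd c p) * (v \<bullet> kform c \<xi> \<eta> \<epsilon> (snd c p)) = koszul_net \<xi> \<eta> (\<lambda>_. s v) \<epsilon> p"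
      using koszul_net_loc[OF m \<zeta> e c, of "snd c p"] c p sc by (simp add: fun_loc_def comp_loc_def)
    also have "\<dots> = (jacobian c d p *v (\<rho> (snd c p) *\<^sub>R v)) \<bullet> kform d \<xi> \<eta> \<epsilon> (snd d p)"
      using koszul_net_loc[OF m \<zeta> e d, of "snd d p"] d p sd by (simp add: fun_loc_def comp_loc_def)
    also have "\<dots> = \<rho> (snd c p) * (v \<bullet> (transpose (jacobian c d p) *v kform d \<xi> \<eta> \<epsilon> (snd d p)))"
      using transpose_inner[of "jacobian c d p" "kform d \<xi> \<eta> \<epsilon> (snd d p)" v]
      by (simp add: matrix_vector_mult_scaleR inner_commute)
    finally show ?thesis using \<rho>(2)[of "snd c p"] by simp
  qed
  then show ?thesis by (metis vector_eq_rdot inner_commute)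
qed

lemma det_riemannian: "riemannian M h \<Longrightarrow> c \<in> charts M \<Longrightarrow> p \<in> fst c \<Longrightarrow> det (h c p) \<noteq> 0"
  using posdef_matrix_inv(1)[OF riemannian_posdef, of M h c p] det_mul[of "h c p" "matrix_inv (h c p)"] det_I
  by (metis mult_zero_left zero_neq_one)

text \<open>For a fixed value of the parameter the metric may be degenerate somewhere, so that its inverse
  cannot be used to raise the index.  By Cramer's rule \<open>det g\<close> times the inverse is a polynomial in
  the entries; the quotient \<open>det g / ((det g)\<^sup>2 + \<delta> (det h)\<^sup>2)\<close> with a Riemannian metric \<open>h\<close>
  replaces \<open>1 / det g\<close>.  It is smooth everywhere.  Under a change of charts it transforms like
  \<open>1 / det g\<close>, because both determinants are multiplied with the square of the Jacobian determinant;
  this is the reason for the factor \<open>(det h)\<^sup>2\<close>.  With \<open>\<delta> = exp (-1/\<epsilon>)\<close> the error is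
  negligible.\<close>

theorem raise_index:
  assumes m: "moderate (Vec M) \<xi>" "moderate (Vec M) \<eta>"
  obtains w where "moderate (Vec M) w" "lowers_to w (\<lambda>c. kform c \<xi> \<eta>)"
proof -
  obtain h where h: "riemannian M h" using riemannian_metric_exists[OF smooth_manifold] .
  define \<delta> where "\<delta> \<epsilon> = exp (- 1 / \<epsilon>)" for \<epsilon> :: real
  define q where "q \<epsilon> c p = (det (g \<epsilon> c p))\<^sup>2 + \<delta> \<epsilon> * (det (h c p))\<^sup>2" for \<epsilon> c p
  define w where "w \<epsilon> c p = (det (g \<epsilon> c p) * inverse (2 * q \<epsilon> c p)) *\<^sub>R cramer_vec (g \<epsilon> c p) (kform c \<xi> \<eta> \<epsilon> (snd c p))"
    for \<epsilon> c p
  have q_pos: "0 < q \<epsilon> c p" if "c \<in> charts M" "p \<in> fst c" for \<epsilon> c p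
    unfolding q_def \<delta>_def using det_riemannian[OF h that] by (simp add: add_nonneg_pos)
  have det_law: "det (t c p) = (det (jacobian c d p))\<^sup>2 * det (t d p)"
    if "t \<in> smooth_tfields M" "c \<in> charts M" "d \<in> charts M" "p \<in> fst c" "p \<in> fst d" for t c d p
    unfolding smooth_tfieldsD(2)[OF that] by (simp add: det_mul power2_eq_square)
  have law: "vector_law M (w \<epsilon>)" if e: "\<epsilon> \<in> {0<..1}" for \<epsilon>
    unfolding vector_law_def
  proof (intro ballI)
    fix c d p assume c: "c \<in> charts M" and d: "d \<in> charts M" and "p \<in> fst c \<inter> fst d"
    then have p: "p \<in> fst c" "p \<in> fst d" by auto
    let ?J = "jacobian c d p"
    note law = det_law[OF g_section[OF e] c d p]
    have "h \<in> smooth_tfields M" using h by (simp add: riemannian_def)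
    note hlaw = det_law[OF this c d p]
    have "jacobian d c p ** ?J = mat 1" by (rule jacobian_inverse[OF c d p])
    then have J: "det ?J \<noteq> 0" by (metis det_I det_mul mult_zero_right zero_neq_one)
    show "w \<epsilon> d p = ?J *v w \<epsilon> c p"
    \<comment> \<open>Where the metric degenerates the field is zero; elsewhere its lowered form is a chart-independent
      multiple of the Koszul form, and the metric can be cancelled.\<close>
    proof (cases "det (g \<epsilon> d p) = 0")
      case True
      with law show ?thesis by (simp add: w_def)
    next
      case False
      then have gc: "det (g \<epsilon> c p) \<noteq> 0" using law J by simp
      have q_law: "q \<epsilon> c p = ((det ?J)\<^sup>2)\<^sup>2 * q \<epsilon> d p" unfolding q_def law hlaw by (simp add: power_mult_distrib ring_distribs)
      have gw: "g \<epsilon> a p *v w \<epsilon> a p = ((det (g \<epsilon> a p))\<^sup>2 * inverse (2 * q \<epsilon> a p)) *\<^sub>R kform a \<xi> \<eta> \<epsilon> (snd a p)" if "det (g \<epsilon> a p) \<noteq> 0" for a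
        unfolding w_def by (simp add: matrix_vector_mult_scaleR mult_cramer_vec[OF that] power2_eq_square)
      have ratio: "(det (g \<epsilon> c p))\<^sup>2 * inverse (2 * q \<epsilon> c p) = (det (g \<epsilon> d p))\<^sup>2 * inverse (2 * q \<epsilon> d p)"
        unfolding q_law law using J q_pos[OF d p(2), of \<epsilon>] by (simp add: field_simps)
      have "transpose ?J *v (g \<epsilon> d p *v (?J *v w \<epsilon> c p)) = g \<epsilon> c p *v w \<epsilon> c p"
        unfolding smooth_tfieldsD(2)[OF g_section[OF e] c d p] by (simp add: matrix_vector_mul_assoc matrix_mul_assoc)
      also have "\<dots> = transpose ?J *v (g \<epsilon> d p *v w \<epsilon> d p)"
        unfolding gw[OF gc] gw[OF False] ratio kform_law[OF m e c d p] by (simp add: matrix_vector_mult_scaleR)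
      finally have eq: "transpose ?J *v (g \<epsilon> d p *v (?J *v w \<epsilon> c p)) = transpose ?J *v (g \<epsilon> d p *v w \<epsilon> d p)" .
      have "inj ((*v) (transpose ?J))" "inj ((*v) (g \<epsilon> d p))"
        using J False by (intro inj_matrix_vector_mult; simp add: invertible_det_nz)+
      from injD[OF this(2) injD[OF this(1) eq]] show ?thesis by (rule sym)
    qed
  qed
  have loc: "moderate_on (cimg c) (comp_loc c w) \<and> 
      net_eq (cimg c) (\<lambda>\<epsilon> x. 2 *\<^sub>R (comp_loc c g \<epsilon> x *v comp_loc c w \<epsilon> x)) (kform c \<xi> \<eta>)" if c: "c \<in> charts M" for c
  proof -
    note S = open_cimg[OF c]
    define D where "D \<epsilon> x = det (comp_loc c g \<epsilon> x)" for \<epsilon> x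
    define E where "E x = det (h c (chart_inv c x))" for x
    define Q where "Q \<epsilon> x = 2 * (D \<epsilon> x * D \<epsilon> x + \<delta> \<epsilon> * (E x * E x))" for \<epsilon> x
    have Dm: "moderate_on (cimg c) D" unfolding D_def[abs_def] by (rule moderate_on_det[OF S g_moderate[OF c]])
    have "smooth_on (cimg c) (\<lambda>x. h c (chart_inv c x))" using h smooth_tfieldsD(1)[OF _ c] unfolding riemannian_def by blast
    then have Em: "moderate_on (cimg c) (\<lambda>_. E)"
      unfolding E_def[abs_def] smooth_on_iff_moderate_on by (rule moderate_on_det[OF S])
    have "\<forall>\<^sub>F \<epsilon> in at_right 0. norm (\<delta> \<epsilon>) \<le> 1 * (1 / \<epsilon>) ^ 0"
      using eventually_small[of 1, simplified] by eventually_elim (simp add: \<delta>_def)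
    then have \<delta>m: "moderate_on (cimg c) (\<lambda>\<epsilon> x. \<delta> \<epsilon>)" by (rule moderate_on_net_const)
    have \<delta>n: "negligible_on (cimg c) (\<lambda>\<epsilon> x. \<delta> \<epsilon>)"
    proof (rule negligible_onI)
      fix K :: "(real^'n) set" and n
      have "\<forall>\<^sub>F \<epsilon> in at_right 0. \<forall>x\<in>K. norm (\<delta> \<epsilon>) \<le> fact n * \<epsilon> ^ n"
        using eventually_small[of 1, simplified] by eventually_elim (use exp_minus_inverse_le in \<open>auto simp: \<delta>_def\<close>)
      then show "\<exists>C. \<forall>\<^sub>F \<epsilon> in at_right 0. \<forall>x\<in>K. norm (\<delta> \<epsilon>) \<le> C * \<epsilon> ^ n" by blast
    qed
    have Qm: "moderate_on (cimg c) Q"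
      unfolding Q_def[abs_def] by (intro moderate_on_mult moderate_on_add moderate_on_const Dm Em \<delta>m S)
    have Qq: "Q \<epsilon> x = 2 * q \<epsilon> c (chart_inv c x)" for \<epsilon> x
      by (simp add: Q_def q_def D_def E_def comp_loc_def power2_eq_square)
    have Qpos: "0 < Q \<epsilon> x" if "x \<in> cimg c" for \<epsilon> x using q_pos[OF c chart_inv_in[OF that]] Qq by simp
    have "strictly_nonzero_on (cimg c) Q"
      unfolding strictly_nonzero_on_def
    proof (intro allI impI)
      fix K assume K: "compact K \<and> K \<subseteq> cimg c"
      then obtain N where "\<forall>\<^sub>F \<epsilon> in at_right 0. \<forall>x\<in>K. \<epsilon> ^ N \<le> \<bar>D \<epsilon> x\<bar>"
        using g_det[OF c] unfolding strictly_nonzero_on_def D_def by blast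
      then have "\<forall>\<^sub>F \<epsilon> in at_right 0. \<forall>x\<in>K. \<epsilon> ^ (N + N) \<le> \<bar>Q \<epsilon> x\<bar>"
        using eventually_small[of 1, simplified]
      proof eventually_elim
        case (elim \<epsilon>)
        show ?case
        proof
          fix x assume "x \<in> K"
          with elim have "\<epsilon> ^ N * \<epsilon> ^ N \<le> \<bar>D \<epsilon> x\<bar> * \<bar>D \<epsilon> x\<bar>" by (intro mult_mono) auto
          then have "\<epsilon> ^ (N + N) \<le> D \<epsilon> x * D \<epsilon> x" by (simp add: power_add)
          moreover have "0 \<le> \<delta> \<epsilon> * (E x * E x)" by (simp add: \<delta>_def)
          moreover have "0 \<le> D \<epsilon> x * D \<epsilon> x" by simp
          moreover have "a \<le> b \<Longrightarrow> 0 \<le> c \<Longrightarrow> 0 \<le> b \<Longrightarrow> a \<le> 2 * (b + c)" for a b c :: real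
            by (simp add: distrib_left)
          ultimately have "\<epsilon> ^ (N + N) \<le> Q \<epsilon> x" unfolding Q_def by blast
          then show "\<epsilon> ^ (N + N) \<le> \<bar>Q \<epsilon> x\<bar>" by linarith
        qed
      qed
      then show "\<exists>N. \<forall>\<^sub>F \<epsilon> in at_right 0. \<forall>x\<in>K. \<epsilon> ^ N \<le> \<bar>Q \<epsilon> x\<bar>" by blast
    qed
    from strictly_nonzero_on_tempered_inverse[OF this]
    have Qi: "moderate_on (cimg c) (\<lambda>\<epsilon> x. inverse (Q \<epsilon> x))"
      using Qpos by (intro moderate_on_inverse[OF S Qm]) (auto simp: less_imp_neq[THEN not_sym])
    have w_loc: "comp_loc c w \<epsilon> x = (D \<epsilon> x * inverse (Q \<epsilon> x)) *\<^sub>R cramer_vec (comp_loc c g \<epsilon> x) (kform c \<xi> \<eta> \<epsilon> x)" if "x \<in> cimg c" for \<epsilon> x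
      using that by (simp add: comp_loc_def w_def D_def Qq)
    have wm: "moderate_on (cimg c) (comp_loc c w)"
    proof (rule moderate_on_cong[OF S])
      show "moderate_on (cimg c) (\<lambda>\<epsilon> x. (D \<epsilon> x * inverse (Q \<epsilon> x)) *\<^sub>R cramer_vec (comp_loc c g \<epsilon> x) (kform c \<xi> \<eta> \<epsilon> x))"
        by (intro moderate_on_scaleR moderate_on_mult Dm Qi S moderate_on_cramer_vec g_moderate[OF c] kform_moderate[OF m c])
    qed (simp add: w_loc)
    have gwm: "moderate_on (cimg c) (\<lambda>\<epsilon> x. 2 *\<^sub>R (comp_loc c g \<epsilon> x *v comp_loc c w \<epsilon> x))"
      by (intro moderate_on_scaleR moderate_on_const moderate_on_matrix_vector S g_moderate[OF c] wm)
    have "tempered_on (cimg c) (\<lambda>\<epsilon> x. (2 * (E x * E x * inverse (Q \<epsilon> x))) *\<^sub>R kform c \<xi> \<eta> \<epsilon> x)"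
      by (intro moderate_on_tempered moderate_on_scaleR moderate_on_mult moderate_on_const Em Qi S kform_moderate[OF m c])
    from negligible_on_minus[OF negligible_on_bilinear_left[OF bounded_bilinear_scaleR \<delta>n this]]
    have neg: "negligible_on (cimg c) (\<lambda>\<epsilon> x. - (\<delta> \<epsilon> *\<^sub>R (2 * (E x * E x * inverse (Q \<epsilon> x))) *\<^sub>R kform c \<xi> \<eta> \<epsilon> x))" .
    have "negligible_on (cimg c) (\<lambda>\<epsilon> x. 2 *\<^sub>R (comp_loc c g \<epsilon> x *v comp_loc c w \<epsilon> x) - kform c \<xi> \<eta> \<epsilon> x)"
    proof (rule negligible_on_eventually_cong[OF _ neg])
      fix K assume K: "compact K" "K \<subseteq> cimg c"
      show "\<forall>\<^sub>F \<epsilon> in at_right 0. \<forall>x\<in>K. - (\<delta> \<epsilon> *\<^sub>R (2 * (E x * E x * inverse (Q \<epsilon> x))) *\<^sub>R kform c \<xi> \<eta> \<epsilon> x) =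
          2 *\<^sub>R (comp_loc c g \<epsilon> x *v comp_loc c w \<epsilon> x) - kform c \<xi> \<eta> \<epsilon> x"
        using strictly_nonzero_on_eventually[OF g_det[OF c] K]
      proof eventually_elim
        case (elim \<epsilon>)
        show ?case
        proof
          fix x assume "x \<in> K"
          then have x: "x \<in> cimg c" and dx: "det (comp_loc c g \<epsilon> x) \<noteq> 0" using K elim by auto
          have "2 *\<^sub>R (comp_loc c g \<epsilon> x *v comp_loc c w \<epsilon> x) = (2 * (D \<epsilon> x * D \<epsilon> x) * inverse (Q \<epsilon> x)) *\<^sub>R kform c \<xi> \<eta> \<epsilon> x"
            unfolding w_loc[OF x] by (simp add: matrix_vector_mult_scaleR mult_cramer_vec[OF dx] D_def[symmetric] mult_ac)
          also have "2 * (D \<epsilon> x * D \<epsilon> x) * inverse (Q \<epsilon> x) = 1 - \<delta> \<epsilon> * (2 * (E x * E x * inverse (Q \<epsilon> x)))"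
          proof -
            have "Q \<epsilon> x * inverse (Q \<epsilon> x) = 1" using Qpos[OF x, of \<epsilon>] by simp
            then show ?thesis unfolding Q_def[of \<epsilon> x] by (simp add: algebra_simps)
          qed
          finally show "- (\<delta> \<epsilon> *\<^sub>R (2 * (E x * E x * inverse (Q \<epsilon> x))) *\<^sub>R kform c \<xi> \<eta> \<epsilon> x) =
              2 *\<^sub>R (comp_loc c g \<epsilon> x *v comp_loc c w \<epsilon> x) - kform c \<xi> \<eta> \<epsilon> x"
            by (simp add: scaleR_diff_left)
        qed
      qed
    qed
    then show ?thesis using wm gwm kform_moderate[OF m c] unfolding net_eq_def by blast
  qed
  show ?thesis
  proof (rule that)
    show "moderate (Vec M) w" unfolding Vec_moderate_iff using law loc by blast
    show "lowers_to w (\<lambda>c. kform c \<xi> \<eta>)" unfolding lowers_to_def using loc by blast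
  qed
qed

end

section \<open>The Levi-Civita connection\<close>

context metric_net
begin

lemma moderate_plus: "moderate (Vec M) \<xi> \<Longrightarrow> moderate (Vec M) \<eta> \<Longrightarrow> moderate (Vec M) (\<lambda>\<epsilon>. \<xi> \<epsilon> + \<eta> \<epsilon>)"
  and moderate_minus: "moderate (Vec M) \<xi> \<Longrightarrow> moderate (Vec M) \<eta> \<Longrightarrow> moderate (Vec M) (\<lambda>\<epsilon>. \<xi> \<epsilon> - \<eta> \<epsilon>)"
  by (rule Vc.moderate_add Vc.moderate_diff; assumption)+

lemma lowers_to_net_rel:
  assumes "lowers_to w \<omega>" "(w, w') \<in> net_rel (Vec M)" "\<And>c. c \<in> charts M \<Longrightarrow> net_eq (cimg c) (\<omega> c) (\<omega>' c)"
  shows "lowers_to w' \<omega>'"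
  unfolding lowers_to_def
proof
  fix c assume c: "c \<in> charts M"
  have "net_eq (cimg c) (comp_loc c w') (comp_loc c w)"
    using assms(2) c unfolding Vec_net_rel_iff by (blast intro: net_eq_sym)
  then have "net_eq (cimg c) (\<lambda>\<epsilon> x. 2 *\<^sub>R (comp_loc c g \<epsilon> x *v comp_loc c w' \<epsilon> x)) (\<lambda>\<epsilon> x. 2 *\<^sub>R (comp_loc c g \<epsilon> x *v comp_loc c w \<epsilon> x))"
    by (intro net_eq_scaleR net_eq_matrix_vector net_eq_refl moderate_on_const g_moderate open_cimg c)
  from net_eq_trans[OF this] net_eq_trans[OF _ assms(3)[OF c]] assms(1) c
  show "net_eq (cimg c) (\<lambda>\<epsilon> x. 2 *\<^sub>R (comp_loc c g \<epsilon> x *v comp_loc c w' \<epsilon> x)) (\<omega>' c)"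
    unfolding lowers_to_def by blast
qed

lemma lowers_to_cong:
  assumes "lowers_to w \<omega>" "\<And>c \<epsilon> x. c \<in> charts M \<Longrightarrow> \<epsilon> \<in> {0<..1} \<Longrightarrow> x \<in> cimg c \<Longrightarrow> \<omega> c \<epsilon> x = \<omega>' c \<epsilon> x"
  shows "lowers_to w \<omega>'"
  unfolding lowers_to_def
proof
  fix c assume c: "c \<in> charts M"
  show "net_eq (cimg c) (\<lambda>\<epsilon> x. 2 *\<^sub>R (comp_loc c g \<epsilon> x *v comp_loc c w \<epsilon> x)) (\<omega>' c)"
    by (rule net_eq_cong[OF open_cimg[OF c] assms(1)[unfolded lowers_to_def, rule_format, OF c]])
      (simp_all add: assms(2) c)
qed

lemma lowers_to_self: "moderate (Vec M) w \<Longrightarrow> lowers_to w (\<lambda>c \<epsilon> x. 2 *\<^sub>R (comp_loc c g \<epsilon> x *v comp_loc c w \<epsilon> x))"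
  unfolding lowers_to_def by (intro ballI net_eq_refl lowered_moderate)

lemma lowers_to_add:
  assumes "lowers_to w \<omega>" "lowers_to w' \<omega>'"
  shows "lowers_to (\<lambda>\<epsilon>. w \<epsilon> + w' \<epsilon>) (\<lambda>c \<epsilon> x. \<omega> c \<epsilon> x + \<omega>' c \<epsilon> x)"
  unfolding lowers_to_def
proof
  fix c assume c: "c \<in> charts M"
  from net_eq_add[OF open_cimg[OF c] assms[unfolded lowers_to_def, THEN bspec, OF c]]
  show "net_eq (cimg c) (\<lambda>\<epsilon> x. 2 *\<^sub>R (comp_loc c g \<epsilon> x *v comp_loc c (\<lambda>\<epsilon>. w \<epsilon> + w' \<epsilon>) \<epsilon> x)) (\<lambda>\<epsilon> x. \<omega> c \<epsilon> x + \<omega>' c \<epsilon> x)"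
    by (simp add: comp_loc_add matrix_vector_right_distrib scaleR_add_right)
qed

lemma lowers_to_diff:
  assumes "lowers_to w \<omega>" "lowers_to w' \<omega>'"
  shows "lowers_to (\<lambda>\<epsilon>. w \<epsilon> - w' \<epsilon>) (\<lambda>c \<epsilon> x. \<omega> c \<epsilon> x - \<omega>' c \<epsilon> x)"
  unfolding lowers_to_def
proof
  fix c assume c: "c \<in> charts M"
  from net_eq_diff[OF open_cimg[OF c] assms[unfolded lowers_to_def, THEN bspec, OF c]]
  show "net_eq (cimg c) (\<lambda>\<epsilon> x. 2 *\<^sub>R (comp_loc c g \<epsilon> x *v comp_loc c (\<lambda>\<epsilon>. w \<epsilon> - w' \<epsilon>) \<epsilon> x)) (\<lambda>\<epsilon> x. \<omega> c \<epsilon> x - \<omega>' c \<epsilon> x)"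
    by (simp add: comp_loc_diff matrix_vector_mult_diff_distrib scaleR_diff_right)
qed

lemma lowers_to_smult:
  assumes "lowers_to w \<omega>" "moderate (Fun M) u"
  shows "lowers_to (\<lambda>\<epsilon> c p. u \<epsilon> p *\<^sub>R w \<epsilon> c p) (\<lambda>c \<epsilon> x. fun_loc c u \<epsilon> x *\<^sub>R \<omega> c \<epsilon> x)"
  unfolding lowers_to_def
proof
  fix c assume c: "c \<in> charts M"
  from net_eq_scaleR[OF open_cimg[OF c] net_eq_refl[OF Fun_moderate_loc[OF assms(2) c]] assms(1)[unfolded lowers_to_def, THEN bspec, OF c]]
  show "net_eq (cimg c) (\<lambda>\<epsilon> x. 2 *\<^sub>R (comp_loc c g \<epsilon> x *v comp_loc c (\<lambda>\<epsilon> c p. u \<epsilon> p *\<^sub>R w \<epsilon> c p) \<epsilon> x)) (\<lambda>\<epsilon> x. fun_loc c u \<epsilon> x *\<^sub>R \<omega> c \<epsilon> x)"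
    by (simp add: comp_loc_smult matrix_vector_mult_scaleR mult.commute)
qed

text \<open>The Koszul formula read in charts and freed from test fields; the algebraic properties of the
  covariant derivative are derived from this form.\<close>

definition koszul_values :: "('a, 'n) gconn \<Rightarrow> bool" where
  "koszul_values D \<longleftrightarrow> (\<forall>\<xi> \<eta> w. moderate (Vec M) \<xi> \<longrightarrow> moderate (Vec M) \<eta> \<longrightarrow> moderate (Vec M) w \<longrightarrow>
     D (gclass (Vec M) \<xi>, gclass (Vec M) \<eta>) = gclass (Vec M) w \<longrightarrow> lowers_to w (\<lambda>c. kform c \<xi> \<eta>))"

lemma Vec_gen_fieldsE:
  assumes "X \<in> gen_fields (Vec M)" obtains \<xi> where "moderate (Vec M) \<xi>" "X = gclass (Vec M) \<xi>"
  using assms unfolding Vc.gen_fields_iff by blast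

lemma Fun_gen_fieldsE:
  assumes "X \<in> gen_fields (Fun M)" obtains u where "moderate (Fun M) u" "X = gclass (Fun M) u"
  using assms unfolding Fn.gen_fields_iff by blast

lemma value_rep:
  assumes "D \<in> gvec_maps M" "moderate (Vec M) \<xi>" "moderate (Vec M) \<eta>"
  obtains w where "moderate (Vec M) w" "D (gclass (Vec M) \<xi>, gclass (Vec M) \<eta>) = gclass (Vec M) w"
proof -
  have "D (gclass (Vec M) \<xi>, gclass (Vec M) \<eta>) \<in> gen_fields (Vec M)"
    using assms unfolding gvec_maps_def by (auto intro: Vc.gclass_in_gen_fields)
  then show ?thesis using that by (rule Vec_gen_fieldsE)
qed

lemma koszul_formula_iff:
  assumes D: "D \<in> gvec_maps M"
  shows "koszul_formula M G D \<longleftrightarrow> koszul_values D"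
proof
  assume kz: "koszul_formula M G D"
  show "koszul_values D"
    unfolding koszul_values_def
  proof (intro allI impI)
    fix \<xi> \<eta> w assume m: "moderate (Vec M) \<xi>" "moderate (Vec M) \<eta>" "moderate (Vec M) w"
      and w: "D (gclass (Vec M) \<xi>, gclass (Vec M) \<eta>) = gclass (Vec M) w"
    show "lowers_to w (\<lambda>c. kform c \<xi> \<eta>)"
      unfolding koszul_iff_lowers_to[OF m, symmetric]
    proof (intro allI impI)
      fix \<zeta> assume \<zeta>: "moderate (Vec M) \<zeta>"
      from kz[unfolded koszul_formula_def, rule_format, OF Vc.gclass_in_gen_fields[OF m(1)] Vc.gclass_in_gen_fields[OF m(2)]
          Vc.gclass_in_gen_fields[OF \<zeta>]]
      show "gfun_two_times M (gten_apply M G (gclass (Vec M) w) (gclass (Vec M) \<zeta>)) = gclass (Fun M) (koszul_net \<xi> \<eta> \<zeta>)"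
        unfolding koszul_rhs_gclass[OF m(1,2) \<zeta>] w .
    qed
  qed
next
  assume kv: "koszul_values D"
  show "koszul_formula M G D"
    unfolding koszul_formula_def
  proof (intro ballI)
    fix X Y Z assume XYZ: "X \<in> gen_fields (Vec M)" "Y \<in> gen_fields (Vec M)" "Z \<in> gen_fields (Vec M)"
    obtain \<xi> where \<xi>: "moderate (Vec M) \<xi>" "X = gclass (Vec M) \<xi>" by (rule Vec_gen_fieldsE[OF XYZ(1)])
    obtain \<eta> where \<eta>: "moderate (Vec M) \<eta>" "Y = gclass (Vec M) \<eta>" by (rule Vec_gen_fieldsE[OF XYZ(2)])
    obtain \<zeta> where \<zeta>: "moderate (Vec M) \<zeta>" "Z = gclass (Vec M) \<zeta>" by (rule Vec_gen_fieldsE[OF XYZ(3)])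
    note m = \<xi>(1) \<eta>(1) \<zeta>(1) and X = \<xi>(2) \<eta>(2) \<zeta>(2)
    obtain w where w: "moderate (Vec M) w" "D (gclass (Vec M) \<xi>, gclass (Vec M) \<eta>) = gclass (Vec M) w"
      by (rule value_rep[OF D m(1,2)])
    have "lowers_to w (\<lambda>c. kform c \<xi> \<eta>)" using kv m w unfolding koszul_values_def by blast
    then have "gfun_two_times M (gten_apply M G (gclass (Vec M) w) (gclass (Vec M) \<zeta>)) = gclass (Fun M) (koszul_net \<xi> \<eta> \<zeta>)"
      using koszul_iff_lowers_to[OF m(1,2) w(1)] m(3) by blast
    then show "gfun_two_times M (gten_apply M G (D (X, Y)) Z) =
          gvec_apply M X (gten_apply M G Y Z) \<boxplus>\<^bsub>Fun M\<^esub> gvec_apply M Y (gten_apply M G Z X)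
          \<boxminus>\<^bsub>Fun M\<^esub> gvec_apply M Z (gten_apply M G X Y) \<boxminus>\<^bsub>Fun M\<^esub> gten_apply M G X (gbracket M Y Z)
          \<boxplus>\<^bsub>Fun M\<^esub> gten_apply M G Y (gbracket M Z X) \<boxplus>\<^bsub>Fun M\<^esub> gten_apply M G Z (gbracket M X Y)"
      unfolding X koszul_rhs_gclass[OF m] w(2) .
  qed
qed

text \<open>Every algebraic law below has the form \<open>D \<xi> \<eta> = a\<close>, and it is proved by lowering the index of \<open>a\<close>.\<close>

lemma koszul_values_unique:
  assumes "D \<in> gvec_maps M" "koszul_values D" "moderate (Vec M) \<xi>" "moderate (Vec M) \<eta>" "moderate (Vec M) a"
    and "lowers_to a (\<lambda>c. kform c \<xi> \<eta>)"
  shows "D (gclass (Vec M) \<xi>, gclass (Vec M) \<eta>) = gclass (Vec M) a"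
proof -
  obtain w where w: "moderate (Vec M) w" "D (gclass (Vec M) \<xi>, gclass (Vec M) \<eta>) = gclass (Vec M) w"
    by (rule value_rep[OF assms(1,3,4)])
  then have "lowers_to w (\<lambda>c. kform c \<xi> \<eta>)" using assms unfolding koszul_values_def by blast
  from lowers_to_unique[OF w(1) assms(5) this assms(6)] w(2) show ?thesis by simp
qed

subsection \<open>The Koszul formula defines a metric connection without torsion\<close>

lemma loc_funs:
  "comp_loc c (\<lambda>\<epsilon>. \<xi> \<epsilon> + \<eta> \<epsilon>) \<epsilon> = (\<lambda>x. comp_loc c \<xi> \<epsilon> x + comp_loc c \<eta> \<epsilon> x)"
  "comp_loc c (\<lambda>\<epsilon> c p. u \<epsilon> p *\<^sub>R \<xi> \<epsilon> c p) \<epsilon> = (\<lambda>x. fun_loc c u \<epsilon> x *\<^sub>R comp_loc c \<xi> \<epsilon> x)"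
  for \<xi> \<eta> :: "real \<Rightarrow> ('a, 'n) vfield"
  by (simp_all add: fun_eq_iff comp_loc_def fun_loc_def)

lemma kform_add_right:
  assumes "moderate (Vec M) \<eta>" "moderate (Vec M) \<eta>'" "\<epsilon> \<in> {0<..1}" "c \<in> charts M" "x \<in> cimg c"
  shows "kform c \<xi> (\<lambda>\<epsilon>. \<eta> \<epsilon> + \<eta>' \<epsilon>) \<epsilon> x = kform c \<xi> \<eta> \<epsilon> x + kform c \<xi> \<eta>' \<epsilon> x"
  unfolding kform_def loc_funs
  by (rule koszul_form_add_right[OF loc_differentiable[OF assms(1,3-5)] loc_differentiable[OF assms(2,3-5)]])

lemma kform_smult_right:
  assumes "moderate (Fun M) u" "moderate (Vec M) \<eta>" "\<epsilon> \<in> {0<..1}" "c \<in> charts M" "x \<in> cimg c"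
  shows "kform c \<xi> (\<lambda>\<epsilon> c p. u \<epsilon> p *\<^sub>R \<eta> \<epsilon> c p) \<epsilon> x = fun_loc c u \<epsilon> x *\<^sub>R kform c \<xi> \<eta> \<epsilon> x +
    2 *\<^sub>R (comp_loc c g \<epsilon> x *v (dir (comp_loc c \<xi> \<epsilon> x) (fun_loc c u \<epsilon>) x *\<^sub>R comp_loc c \<eta> \<epsilon> x))"
  unfolding kform_def loc_funs
  by (rule koszul_form_scaleR_right[OF moderate_on_differentiable[OF Fun_moderate_loc[OF assms(1,4)] assms(3,5)]
      loc_differentiable[OF assms(2-5)]])

lemma kform_add_left: "kform c (\<lambda>\<epsilon>. \<xi> \<epsilon> + \<xi>' \<epsilon>) \<eta> \<epsilon> x = kform c \<xi> \<eta> \<epsilon> x + kform c \<xi>' \<eta> \<epsilon> x"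
  unfolding kform_def loc_funs by (rule koszul_form_add_left)

lemma kform_smult_left: "kform c (\<lambda>\<epsilon> c p. u \<epsilon> p *\<^sub>R \<xi> \<epsilon> c p) \<eta> \<epsilon> x = fun_loc c u \<epsilon> x *\<^sub>R kform c \<xi> \<eta> \<epsilon> x"
  unfolding kform_def loc_funs by (rule koszul_form_scaleR_left)

context
  fixes D :: "('a, 'n) gconn"
  assumes D: "D \<in> gvec_maps M" and kv: "koszul_values D"
begin

lemma koszul_value:
  assumes "moderate (Vec M) \<xi>" "moderate (Vec M) \<eta>"
  obtains w where "moderate (Vec M) w" "D (gclass (Vec M) \<xi>, gclass (Vec M) \<eta>) = gclass (Vec M) w" "lowers_to w (\<lambda>c. kform c \<xi> \<eta>)"
proof -
  obtain w where w: "moderate (Vec M) w" "D (gclass (Vec M) \<xi>, gclass (Vec M) \<eta>) = gclass (Vec M) w"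
    by (rule value_rep[OF D assms])
  then have "lowers_to w (\<lambda>c. kform c \<xi> \<eta>)" using kv assms unfolding koszul_values_def by blast
  with w show ?thesis by (rule that)
qed

lemma koszul_add_right:
  assumes m: "moderate (Vec M) \<xi>" "moderate (Vec M) \<eta>" "moderate (Vec M) \<eta>'"
  shows "D (gclass (Vec M) \<xi>, gclass (Vec M) \<eta> \<boxplus>\<^bsub>Vec M\<^esub> gclass (Vec M) \<eta>') =
    D (gclass (Vec M) \<xi>, gclass (Vec M) \<eta>) \<boxplus>\<^bsub>Vec M\<^esub> D (gclass (Vec M) \<xi>, gclass (Vec M) \<eta>')"
proof -
  obtain w where w: "moderate (Vec M) w" "D (gclass (Vec M) \<xi>, gclass (Vec M) \<eta>) = gclass (Vec M) w" "lowers_to w (\<lambda>c. kform c \<xi> \<eta>)"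
    by (rule koszul_value[OF m(1,2)])
  obtain w' where w': "moderate (Vec M) w'" "D (gclass (Vec M) \<xi>, gclass (Vec M) \<eta>') = gclass (Vec M) w'" "lowers_to w' (\<lambda>c. kform c \<xi> \<eta>')"
    by (rule koszul_value[OF m(1,3)])
  have "lowers_to (\<lambda>\<epsilon>. w \<epsilon> + w' \<epsilon>) (\<lambda>c. kform c \<xi> (\<lambda>\<epsilon>. \<eta> \<epsilon> + \<eta>' \<epsilon>))"
    by (rule lowers_to_cong[OF lowers_to_add[OF w(3) w'(3)]]) (simp add: kform_add_right m)
  from koszul_values_unique[OF D kv m(1) moderate_plus[OF m(2,3)] moderate_plus[OF w(1) w'(1)] this]
  show ?thesis by (simp add: gplus_Vec m w(1,2) w'(1,2))
qed

lemma koszul_add_left: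
  assumes m: "moderate (Vec M) \<xi>" "moderate (Vec M) \<xi>'" "moderate (Vec M) \<eta>"
  shows "D (gclass (Vec M) \<xi> \<boxplus>\<^bsub>Vec M\<^esub> gclass (Vec M) \<xi>', gclass (Vec M) \<eta>) =
    D (gclass (Vec M) \<xi>, gclass (Vec M) \<eta>) \<boxplus>\<^bsub>Vec M\<^esub> D (gclass (Vec M) \<xi>', gclass (Vec M) \<eta>)"
proof -
  obtain w where w: "moderate (Vec M) w" "D (gclass (Vec M) \<xi>, gclass (Vec M) \<eta>) = gclass (Vec M) w" "lowers_to w (\<lambda>c. kform c \<xi> \<eta>)"
    by (rule koszul_value[OF m(1,3)])
  obtain w' where w': "moderate (Vec M) w'" "D (gclass (Vec M) \<xi>', gclass (Vec M) \<eta>) = gclass (Vec M) w'" "lowers_to w' (\<lambda>c. kform c \<xi>' \<eta>)"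
    by (rule koszul_value[OF m(2,3)])
  have "lowers_to (\<lambda>\<epsilon>. w \<epsilon> + w' \<epsilon>) (\<lambda>c. kform c (\<lambda>\<epsilon>. \<xi> \<epsilon> + \<xi>' \<epsilon>) \<eta>)"
    by (rule lowers_to_cong[OF lowers_to_add[OF w(3) w'(3)]]) (simp add: kform_add_left)
  from koszul_values_unique[OF D kv moderate_plus[OF m(1,2)] m(3) moderate_plus[OF w(1) w'(1)] this]
  show ?thesis by (simp add: gplus_Vec m w(1,2) w'(1,2))
qed

lemma koszul_smult_left:
  assumes m: "moderate (Fun M) u" "moderate (Vec M) \<xi>" "moderate (Vec M) \<eta>"
  shows "D (gvec_smult M (gclass (Fun M) u) (gclass (Vec M) \<xi>), gclass (Vec M) \<eta>) =
    gvec_smult M (gclass (Fun M) u) (D (gclass (Vec M) \<xi>, gclass (Vec M) \<eta>))"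
proof -
  obtain w where w: "moderate (Vec M) w" "D (gclass (Vec M) \<xi>, gclass (Vec M) \<eta>) = gclass (Vec M) w" "lowers_to w (\<lambda>c. kform c \<xi> \<eta>)"
    by (rule koszul_value[OF m(2,3)])
  have "lowers_to (\<lambda>\<epsilon> c p. u \<epsilon> p *\<^sub>R w \<epsilon> c p) (\<lambda>c. kform c (\<lambda>\<epsilon> c p. u \<epsilon> p *\<^sub>R \<xi> \<epsilon> c p) \<eta>)"
    by (rule lowers_to_cong[OF lowers_to_smult[OF w(3) m(1)]]) (simp add: kform_smult_left)
  from koszul_values_unique[OF D kv moderate_smult[OF m(1,2)] m(3) moderate_smult[OF m(1) w(1)] this]
  show ?thesis by (simp add: gvec_smult_gclass m w(1,2))
qed

lemma koszul_Leibniz_net: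
  assumes m: "moderate (Fun M) u" "moderate (Vec M) \<xi>" "moderate (Vec M) \<eta>"
    and w: "moderate (Vec M) w" "lowers_to w (\<lambda>c. kform c \<xi> \<eta>)"
  shows "D (gclass (Vec M) \<xi>, gclass (Vec M) (\<lambda>\<epsilon> c p. u \<epsilon> p *\<^sub>R \<eta> \<epsilon> c p)) =
    gclass (Vec M) (\<lambda>\<epsilon>. (\<lambda>c p. u \<epsilon> p *\<^sub>R w \<epsilon> c p) + (\<lambda>c p. lie_deriv \<xi> u \<epsilon> p *\<^sub>R \<eta> \<epsilon> c p))"
proof -
  note \<xi>u = moderate_lie_deriv[OF m(2,1)]
  have "lowers_to (\<lambda>\<epsilon>. (\<lambda>c p. u \<epsilon> p *\<^sub>R w \<epsilon> c p) + (\<lambda>c p. lie_deriv \<xi> u \<epsilon> p *\<^sub>R \<eta> \<epsilon> c p)) (\<lambda>c. kform c \<xi> (\<lambda>\<epsilon> c p. u \<epsilon> p *\<^sub>R \<eta> \<epsilon> c p))"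
    by (rule lowers_to_cong[OF lowers_to_add[OF lowers_to_smult[OF w(2) m(1)] lowers_to_self[OF moderate_smult[OF \<xi>u m(3)]]]])
       (simp add: kform_smult_right m comp_loc_smult lie_deriv_loc)
  then show ?thesis
    by (rule koszul_values_unique[OF D kv m(2) moderate_smult[OF m(1,3)] moderate_plus[OF moderate_smult[OF m(1) w(1)] moderate_smult[OF \<xi>u m(3)]]])
qed

lemma koszul_Leibniz:
  assumes m: "moderate (Fun M) u" "moderate (Vec M) \<xi>" "moderate (Vec M) \<eta>"
  shows "D (gclass (Vec M) \<xi>, gvec_smult M (gclass (Fun M) u) (gclass (Vec M) \<eta>)) =
    gvec_smult M (gclass (Fun M) u) (D (gclass (Vec M) \<xi>, gclass (Vec M) \<eta>)) \<boxplus>\<^bsub>Vec M\<^esub>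
    gvec_smult M (gvec_apply M (gclass (Vec M) \<xi>) (gclass (Fun M) u)) (gclass (Vec M) \<eta>)"
proof -
  obtain w where w: "moderate (Vec M) w" "D (gclass (Vec M) \<xi>, gclass (Vec M) \<eta>) = gclass (Vec M) w" "lowers_to w (\<lambda>c. kform c \<xi> \<eta>)"
    by (rule koszul_value[OF m(2,3)])
  show ?thesis
    using koszul_Leibniz_net[OF m w(1,3)]
    by (simp add: gvec_smult_gclass gvec_apply_gclass gplus_Vec moderate_smult moderate_lie_deriv m w(1,2))
qed

lemma koszul_rmult:
  assumes R: "R \<in> gen_reals" and m: "moderate (Vec M) \<xi>" "moderate (Vec M) \<eta>"
  shows "D (gclass (Vec M) \<xi>, gvec_rmult M R (gclass (Vec M) \<eta>)) = gvec_rmult M R (D (gclass (Vec M) \<xi>, gclass (Vec M) \<eta>))"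
proof -
  obtain w where w: "moderate (Vec M) w" "D (gclass (Vec M) \<xi>, gclass (Vec M) \<eta>) = gclass (Vec M) w" "lowers_to w (\<lambda>c. kform c \<xi> \<eta>)"
    by (rule koszul_value[OF m])
  obtain r where r: "moderate_real r"
    "\<And>\<xi>. moderate (Vec M) \<xi> \<Longrightarrow> gvec_rmult M R (gclass (Vec M) \<xi>) = gclass (Vec M) (\<lambda>\<epsilon> c p. r \<epsilon> *\<^sub>R \<xi> \<epsilon> c p)"
    by (rule gvec_rmult_gclass[OF R m(1)]) (rule that)
  note u = moderate_real_Fun[OF r(1)]
  have const: "fun_loc c (\<lambda>\<epsilon> p. r \<epsilon>) \<epsilon> = (\<lambda>_. r \<epsilon>)" for c :: "('a, 'n) chart" and \<epsilon> by (simp add: fun_loc_def fun_eq_iff)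
  have dir0: "dir v (\<lambda>_. r \<epsilon>) x = 0" for v x :: "real^'n" and \<epsilon> by (simp add: dir_def pd_def)
  have "lowers_to (\<lambda>\<epsilon> c p. r \<epsilon> *\<^sub>R w \<epsilon> c p) (\<lambda>c. kform c \<xi> (\<lambda>\<epsilon> c p. r \<epsilon> *\<^sub>R \<eta> \<epsilon> c p))"
    by (rule lowers_to_cong[OF lowers_to_smult[OF w(3) u]]) (simp add: kform_smult_right[OF u m(2)] const dir0)
  from koszul_values_unique[OF D kv m(1) moderate_smult[OF u m(2)] moderate_smult[OF u w(1)] this]
  show ?thesis unfolding r(2)[OF m(2)] w(2) r(2)[OF w(1)] .
qed

theorem koszul_connection: "gen_connection M D"
  unfolding gen_connection_def
proof (intro conjI ballI D)
  fix X Y Y' assume "X \<in> gen_fields (Vec M)" "Y \<in> gen_fields (Vec M)" "Y' \<in> gen_fields (Vec M)"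
  then show "D (X, Y \<boxplus>\<^bsub>Vec M\<^esub> Y') = D (X, Y) \<boxplus>\<^bsub>Vec M\<^esub> D (X, Y')"
    by (elim Vec_gen_fieldsE) (simp only: koszul_add_right)
next
  fix R X Y assume "R \<in> gen_reals" "X \<in> gen_fields (Vec M)" "Y \<in> gen_fields (Vec M)"
  then show "D (X, gvec_rmult M R Y) = gvec_rmult M R (D (X, Y))"
    by (elim Vec_gen_fieldsE) (simp only: koszul_rmult)
next
  fix X X' Y assume "X \<in> gen_fields (Vec M)" "X' \<in> gen_fields (Vec M)" "Y \<in> gen_fields (Vec M)"
  then show "D (X \<boxplus>\<^bsub>Vec M\<^esub> X', Y) = D (X, Y) \<boxplus>\<^bsub>Vec M\<^esub> D (X', Y)"
    by (elim Vec_gen_fieldsE) (simp only: koszul_add_left)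
next
  fix U X Y assume "U \<in> gen_fields (Fun M)" "X \<in> gen_fields (Vec M)" "Y \<in> gen_fields (Vec M)"
  then show "D (gvec_smult M U X, Y) = gvec_smult M U (D (X, Y))"
    by (elim Vec_gen_fieldsE Fun_gen_fieldsE) (simp only: koszul_smult_left)
next
  fix U X Y assume "U \<in> gen_fields (Fun M)" "X \<in> gen_fields (Vec M)" "Y \<in> gen_fields (Vec M)"
  then show "D (X, gvec_smult M U Y) = gvec_smult M U (D (X, Y)) \<boxplus>\<^bsub>Vec M\<^esub> gvec_smult M (gvec_apply M X U) Y"
    by (elim Vec_gen_fieldsE Fun_gen_fieldsE) (simp only: koszul_Leibniz)
qed

theorem koszul_torsion_free: "torsion_free M D"
  unfolding torsion_free_def
proof (intro ballI)
  fix X Y assume XY: "X \<in> gen_fields (Vec M)" "Y \<in> gen_fields (Vec M)"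
  obtain \<xi> where \<xi>: "moderate (Vec M) \<xi>" "X = gclass (Vec M) \<xi>" by (rule Vec_gen_fieldsE[OF XY(1)])
  obtain \<eta> where \<eta>: "moderate (Vec M) \<eta>" "Y = gclass (Vec M) \<eta>" by (rule Vec_gen_fieldsE[OF XY(2)])
  note m = \<xi>(1) \<eta>(1) and X = \<xi>(2) \<eta>(2)
  obtain w where w: "moderate (Vec M) w" "D (gclass (Vec M) \<xi>, gclass (Vec M) \<eta>) = gclass (Vec M) w" "lowers_to w (\<lambda>c. kform c \<xi> \<eta>)"
    by (rule koszul_value[OF m])
  obtain w' where w': "moderate (Vec M) w'" "D (gclass (Vec M) \<eta>, gclass (Vec M) \<xi>) = gclass (Vec M) w'" "lowers_to w' (\<lambda>c. kform c \<eta> \<xi>)"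
    by (rule koszul_value[OF m(2,1)])
  have "lowers_to (bracket \<xi> \<eta>) (\<lambda>c \<epsilon> x. kform c \<xi> \<eta> \<epsilon> x - kform c \<eta> \<xi> \<epsilon> x)"
  proof (rule lowers_to_cong[OF lowers_to_self[OF moderate_bracket[OF m]]])
    fix c and \<epsilon> :: real and x assume c: "c \<in> charts M" and e: "\<epsilon> \<in> {0<..1}" and x: "x \<in> cimg c"
    show "2 *\<^sub>R (comp_loc c g \<epsilon> x *v comp_loc c (bracket \<xi> \<eta>) \<epsilon> x) = kform c \<xi> \<eta> \<epsilon> x - kform c \<eta> \<xi> \<epsilon> x"
      unfolding kform_def bracket_loc[OF m e c x]
      by (rule koszul_form_torsion[OF open_cimg[OF c] x g_loc_sym[OF e c] g_differentiable[OF e c x], symmetric])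
  qed
  from lowers_to_unique[OF moderate_bracket[OF m] moderate_minus[OF w(1) w'(1)] this lowers_to_diff[OF w(3) w'(3)]]
  show "gbracket M X Y = D (X, Y) \<boxminus>\<^bsub>Vec M\<^esub> D (Y, X)"
    by (simp add: X gbracket_gclass gminus_Vec m w(1,2) w'(1,2))
qed

theorem koszul_metric: "metric_connection M G D"
  unfolding metric_connection_def
proof (intro ballI)
  fix X Y Z assume XYZ: "X \<in> gen_fields (Vec M)" "Y \<in> gen_fields (Vec M)" "Z \<in> gen_fields (Vec M)"
  obtain \<xi> where \<xi>: "moderate (Vec M) \<xi>" "X = gclass (Vec M) \<xi>" by (rule Vec_gen_fieldsE[OF XYZ(1)])
  obtain \<eta> where \<eta>: "moderate (Vec M) \<eta>" "Y = gclass (Vec M) \<eta>" by (rule Vec_gen_fieldsE[OF XYZ(2)])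
  obtain \<zeta> where \<zeta>: "moderate (Vec M) \<zeta>" "Z = gclass (Vec M) \<zeta>" by (rule Vec_gen_fieldsE[OF XYZ(3)])
  note m = \<xi>(1) \<eta>(1) \<zeta>(1) and X = \<xi>(2) \<eta>(2) \<zeta>(2)
  obtain a where a: "moderate (Vec M) a" "D (gclass (Vec M) \<xi>, gclass (Vec M) \<eta>) = gclass (Vec M) a" "lowers_to a (\<lambda>c. kform c \<xi> \<eta>)"
    by (rule koszul_value[OF m(1,2)])
  obtain b where b: "moderate (Vec M) b" "D (gclass (Vec M) \<xi>, gclass (Vec M) \<zeta>) = gclass (Vec M) b" "lowers_to b (\<lambda>c. kform c \<xi> \<zeta>)"
    by (rule koszul_value[OF m(1,3)])
  have "gclass (Fun M) (lie_deriv \<xi> (ip \<eta> \<zeta>)) = gclass (Fun M) (\<lambda>\<epsilon>. ip a \<zeta> \<epsilon> + ip \<eta> b \<epsilon>)"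
  proof (subst Fun_gclass_eq_iff, goal_cases)
    case 3
    show ?case
    proof
      fix c assume c: "c \<in> charts M"
      note S = open_cimg[OF c]
      let ?A = "\<lambda>\<epsilon> x. 2 *\<^sub>R (comp_loc c g \<epsilon> x *v comp_loc c a \<epsilon> x)" and ?B = "\<lambda>\<epsilon> x. 2 *\<^sub>R (comp_loc c g \<epsilon> x *v comp_loc c b \<epsilon> x)"
      have "net_eq (cimg c) (kform c \<xi> \<eta>) ?A" "net_eq (cimg c) (kform c \<xi> \<zeta>) ?B"
        using a(3) b(3) c net_eq_sym unfolding lowers_to_def by blast+
      then have "net_eq (cimg c) (\<lambda>\<epsilon> x. (1/2) * (comp_loc c \<zeta> \<epsilon> x \<bullet> kform c \<xi> \<eta> \<epsilon> x + comp_loc c \<eta> \<epsilon> x \<bullet> kform c \<xi> \<zeta> \<epsilon> x))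
        (\<lambda>\<epsilon> x. (1/2) * (comp_loc c \<zeta> \<epsilon> x \<bullet> ?A \<epsilon> x + comp_loc c \<eta> \<epsilon> x \<bullet> ?B \<epsilon> x))"
        by (intro net_eq_mult net_eq_add net_eq_inner S net_eq_refl[OF moderate_on_const]
            net_eq_refl[OF Vec_moderate_loc[OF m(3) c]] net_eq_refl[OF Vec_moderate_loc[OF m(2) c]])
      then show "net_eq (cimg c) (fun_loc c (lie_deriv \<xi> (ip \<eta> \<zeta>))) (fun_loc c (\<lambda>\<epsilon>. ip a \<zeta> \<epsilon> + ip \<eta> b \<epsilon>))"
      proof (rule net_eq_cong[OF S])
        fix \<epsilon> :: real and x assume e: "\<epsilon> \<in> {0<..1}" and x: "x \<in> cimg c"
        have "comp_loc c \<zeta> \<epsilon> x \<bullet> kform c \<xi> \<eta> \<epsilon> x + comp_loc c \<eta> \<epsilon> x \<bullet> kform c \<xi> \<zeta> \<epsilon> x =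
            2 * dir (comp_loc c \<xi> \<epsilon> x) (\<lambda>y. comp_loc c \<eta> \<epsilon> y \<bullet> (comp_loc c g \<epsilon> y *v comp_loc c \<zeta> \<epsilon> y)) x"
          unfolding kform_def
          by (rule koszul_form_metric[OF S x g_loc_sym[OF e c] g_differentiable[OF e c x]
              loc_differentiable[OF m(2) e c x] loc_differentiable[OF m(3) e c x]])
        then show "(1/2) * (comp_loc c \<zeta> \<epsilon> x \<bullet> kform c \<xi> \<eta> \<epsilon> x + comp_loc c \<eta> \<epsilon> x \<bullet> kform c \<xi> \<zeta> \<epsilon> x) =
            fun_loc c (lie_deriv \<xi> (ip \<eta> \<zeta>)) \<epsilon> x"
          unfolding lie_deriv_loc[OF m(1) moderate_ip[OF m(2,3)] e c x] dir_ip_loc[OF m(2,3) e c x] by simp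
        show "(1/2) * (comp_loc c \<zeta> \<epsilon> x \<bullet> ?A \<epsilon> x + comp_loc c \<eta> \<epsilon> x \<bullet> ?B \<epsilon> x) = fun_loc c (\<lambda>\<epsilon>. ip a \<zeta> \<epsilon> + ip \<eta> b \<epsilon>) \<epsilon> x"
          unfolding fun_loc_add ip_loc[OF a(1) m(3) e c x] ip_loc[OF m(2) b(1) e c x]
          using g_loc_inner[OF e c x, of "comp_loc c \<zeta> \<epsilon> x" "comp_loc c a \<epsilon> x"] by simp
      qed
    qed
  qed (intro moderate_lie_deriv moderate_ip Fn.moderate_add m a(1) b(1))+
  then show "gvec_apply M X (gten_apply M G Y Z) = gten_apply M G (D (X, Y)) Z \<boxplus>\<^bsub>Fun M\<^esub> gten_apply M G Y (D (X, Z))"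
    by (simp add: X a(1,2) b(1,2) gten_apply_gclass gvec_apply_gclass gplus_Fun moderate_ip m)
qed

end

subsection \<open>Conversely, such a connection satisfies the Koszul formula\<close>

text \<open>The classical derivation: three instances of the metric identity and three of the torsion identity
  are combined with the signs of the Koszul formula.  It is carried out in charts, for representatives of the six covariant derivatives
  involved; the definition \<open>\<beta>\<close> abbreviates the inner product.\<close>

theorem connection_koszul:
  assumes D: "D \<in> gvec_maps M" and tf: "torsion_free M D" and mc: "metric_connection M G D"
  shows "koszul_formula M G D"
  unfolding koszul_formula_def
proof (intro ballI)
  have torsion: "net_eq (cimg c) (comp_loc c (bracket \<xi> \<eta>)) (\<lambda>\<epsilon> x. comp_loc c a \<epsilon> x - comp_loc c b \<epsilon> x)"
    if m: "moderate (Vec M) \<xi>" "moderate (Vec M) \<eta>" "moderate (Vec M) a" "moderate (Vec M) b"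
      and ab: "D (gclass (Vec M) \<xi>, gclass (Vec M) \<eta>) = gclass (Vec M) a" "D (gclass (Vec M) \<eta>, gclass (Vec M) \<xi>) = gclass (Vec M) b"
      and c: "c \<in> charts M" for \<xi> \<eta> a b c
  proof -
    have "gclass (Vec M) (bracket \<xi> \<eta>) = gclass (Vec M) (\<lambda>\<epsilon>. a \<epsilon> - b \<epsilon>)"
      using tf[unfolded torsion_free_def, rule_format, OF Vc.gclass_in_gen_fields[OF m(1)] Vc.gclass_in_gen_fields[OF m(2)]]
      unfolding ab gbracket_gclass[OF m(1,2)] gminus_Vec[OF m(3,4)] .
    then have "net_eq (cimg c) (comp_loc c (bracket \<xi> \<eta>)) (comp_loc c (\<lambda>\<epsilon>. a \<epsilon> - b \<epsilon>))"
      using c unfolding Vec_gclass_eq_iff[OF moderate_bracket[OF m(1,2)] moderate_minus[OF m(3,4)]] by blast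
    then show ?thesis by (simp add: comp_loc_diff[abs_def])
  qed
  have metric: "net_eq (cimg c) (fun_loc c (lie_deriv \<xi> (ip \<eta> \<zeta>))) 
      (\<lambda>\<epsilon> x. comp_loc c a \<epsilon> x \<bullet> (comp_loc c g \<epsilon> x *v comp_loc c \<zeta> \<epsilon> x) + comp_loc c \<eta> \<epsilon> x \<bullet> (comp_loc c g \<epsilon> x *v comp_loc c b \<epsilon> x))"
    if m: "moderate (Vec M) \<xi>" "moderate (Vec M) \<eta>" "moderate (Vec M) \<zeta>" "moderate (Vec M) a" "moderate (Vec M) b"
      and ab: "D (gclass (Vec M) \<xi>, gclass (Vec M) \<eta>) = gclass (Vec M) a" "D (gclass (Vec M) \<xi>, gclass (Vec M) \<zeta>) = gclass (Vec M) b"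
      and c: "c \<in> charts M" for \<xi> \<eta> \<zeta> a b c
  proof -
    from mc[unfolded metric_connection_def, rule_format, OF Vc.gclass_in_gen_fields[OF m(1)] Vc.gclass_in_gen_fields[OF m(2)]
        Vc.gclass_in_gen_fields[OF m(3)]]
    have "gclass (Fun M) (lie_deriv \<xi> (ip \<eta> \<zeta>)) = gclass (Fun M) (\<lambda>\<epsilon>. ip a \<zeta> \<epsilon> + ip \<eta> b \<epsilon>)"
      by (simp add: ab gten_apply_gclass gvec_apply_gclass gplus_Fun moderate_ip m)
    then have "net_eq (cimg c) (fun_loc c (lie_deriv \<xi> (ip \<eta> \<zeta>))) (fun_loc c (\<lambda>\<epsilon>. ip a \<zeta> \<epsilon> + ip \<eta> b \<epsilon>))"
      using c Fun_gclass_eq_iff[OF moderate_lie_deriv[OF m(1) moderate_ip[OF m(2,3)]] Fn.moderate_add[OF moderate_ip[OF m(4,3)] moderate_ip[OF m(2,5)]]]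
      by blast
    then show ?thesis
      by (rule net_eq_cong[OF open_cimg[OF c]]) (simp_all add: fun_loc_add ip_loc m c)
  qed
  fix X Y Z assume XYZ: "X \<in> gen_fields (Vec M)" "Y \<in> gen_fields (Vec M)" "Z \<in> gen_fields (Vec M)"
  obtain \<xi> where \<xi>: "moderate (Vec M) \<xi>" "X = gclass (Vec M) \<xi>" by (rule Vec_gen_fieldsE[OF XYZ(1)])
  obtain \<eta> where \<eta>: "moderate (Vec M) \<eta>" "Y = gclass (Vec M) \<eta>" by (rule Vec_gen_fieldsE[OF XYZ(2)])
  obtain \<zeta> where \<zeta>: "moderate (Vec M) \<zeta>" "Z = gclass (Vec M) \<zeta>" by (rule Vec_gen_fieldsE[OF XYZ(3)])
  note m = \<xi>(1) \<eta>(1) \<zeta>(1) and X = \<xi>(2) \<eta>(2) \<zeta>(2)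
  obtain a where a: "moderate (Vec M) a" "D (gclass (Vec M) \<xi>, gclass (Vec M) \<eta>) = gclass (Vec M) a" by (rule value_rep[OF D m(1,2)])
  obtain b where b: "moderate (Vec M) b" "D (gclass (Vec M) \<xi>, gclass (Vec M) \<zeta>) = gclass (Vec M) b" by (rule value_rep[OF D m(1,3)])
  obtain a' where a': "moderate (Vec M) a'" "D (gclass (Vec M) \<eta>, gclass (Vec M) \<zeta>) = gclass (Vec M) a'" by (rule value_rep[OF D m(2,3)])
  obtain b' where b': "moderate (Vec M) b'" "D (gclass (Vec M) \<eta>, gclass (Vec M) \<xi>) = gclass (Vec M) b'" by (rule value_rep[OF D m(2,1)])
  obtain a'' where a'': "moderate (Vec M) a''" "D (gclass (Vec M) \<zeta>, gclass (Vec M) \<xi>) = gclass (Vec M) a''" by (rule value_rep[OF D m(3,1)])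
  obtain b'' where b'': "moderate (Vec M) b''" "D (gclass (Vec M) \<zeta>, gclass (Vec M) \<eta>) = gclass (Vec M) b''" by (rule value_rep[OF D m(3,2)])
  have "\<forall>c\<in>charts M. net_eq (cimg c) (fun_loc c (\<lambda>\<epsilon> p. 2 * ip a \<zeta> \<epsilon> p)) (fun_loc c (koszul_net \<xi> \<eta> \<zeta>))"
  proof
    fix c assume c: "c \<in> charts M"
    note S = open_cimg[OF c]
    define \<beta> where "\<beta> v w \<epsilon> x = comp_loc c v \<epsilon> x \<bullet> (comp_loc c g \<epsilon> x *v comp_loc c w \<epsilon> x)" for v w :: "real \<Rightarrow> ('a, 'n) vfield" and \<epsilon> :: real and x :: "real^'n"
    have ip_torsion: "net_eq (cimg c) (fun_loc c (ip v (bracket u1 u2))) (\<lambda>\<epsilon> x. \<beta> v r \<epsilon> x - \<beta> v s \<epsilon> x)"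
      if mm: "moderate (Vec M) v" "moderate (Vec M) u1" "moderate (Vec M) u2" 
        and t: "net_eq (cimg c) (comp_loc c (bracket u1 u2)) (\<lambda>\<epsilon> x. comp_loc c r \<epsilon> x - comp_loc c s \<epsilon> x)" for v u1 u2 r s
    proof (rule net_eq_cong[OF S net_eq_inner[OF S net_eq_refl[OF Vec_moderate_loc[OF mm(1) c]]
          net_eq_matrix_vector[OF S net_eq_refl[OF g_moderate[OF c]] t]]])
      fix \<epsilon> :: real and x assume e: "\<epsilon> \<in> {0<..1}" and x: "x \<in> cimg c"
      show "comp_loc c v \<epsilon> x \<bullet> (comp_loc c g \<epsilon> x *v comp_loc c (bracket u1 u2) \<epsilon> x) = fun_loc c (ip v (bracket u1 u2)) \<epsilon> x"
        by (rule ip_loc[OF mm(1) moderate_bracket[OF mm(2,3)] e c x, symmetric])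
      show "comp_loc c v \<epsilon> x \<bullet> (comp_loc c g \<epsilon> x *v (comp_loc c r \<epsilon> x - comp_loc c s \<epsilon> x)) = \<beta> v r \<epsilon> x - \<beta> v s \<epsilon> x"
        by (simp add: \<beta>_def matrix_vector_mult_diff_distrib inner_diff_right)
    qed
    note t1 = ip_torsion[OF m(1,2,3) torsion[OF m(2,3) a'(1) b''(1) a'(2) b''(2) c]]
      and t2 = ip_torsion[OF m(2,3,1) torsion[OF m(3,1) a''(1) b(1) a''(2) b(2) c]]
      and t3 = ip_torsion[OF m(3,1,2) torsion[OF m(1,2) a(1) b'(1) a(2) b'(2) c]]
    note m1 = metric[OF m a(1) b(1) a(2) b(2) c, folded \<beta>_def]
      and m2 = metric[OF m(2,3,1) a'(1) b'(1) a'(2) b'(2) c, folded \<beta>_def]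
      and m3 = metric[OF m(3,1,2) a''(1) b''(1) a''(2) b''(2) c, folded \<beta>_def]
    show "net_eq (cimg c) (fun_loc c (\<lambda>\<epsilon> p. 2 * ip a \<zeta> \<epsilon> p)) (fun_loc c (koszul_net \<xi> \<eta> \<zeta>))"
    proof (rule net_eq_cong[OF S net_eq_sym[OF net_eq_add[OF S net_eq_add[OF S net_eq_diff[OF S net_eq_diff[OF S net_eq_add[OF S m1 m2] m3] t1] t2] t3]]])
      fix \<epsilon> :: real and x assume e: "\<epsilon> \<in> {0<..1}" and x: "x \<in> cimg c"
      have \<beta>: "\<beta> v w \<epsilon> x = \<beta> w v \<epsilon> x" for v w unfolding \<beta>_def by (rule g_loc_inner[OF e c x])
      have "fun_loc c (\<lambda>\<epsilon> p. 2 * ip a \<zeta> \<epsilon> p) \<epsilon> x = 2 * \<beta> a \<zeta> \<epsilon> x"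
        using ip_loc[OF a(1) m(3) e c x] by (simp add: \<beta>_def fun_loc_def)
      then show "\<beta> a \<zeta> \<epsilon> x + \<beta> \<eta> b \<epsilon> x + (\<beta> a' \<xi> \<epsilon> x + \<beta> \<zeta> b' \<epsilon> x) - (\<beta> a'' \<eta> \<epsilon> x + \<beta> \<xi> b'' \<epsilon> x) -
         (\<beta> \<xi> a' \<epsilon> x - \<beta> \<xi> b'' \<epsilon> x) + (\<beta> \<eta> a'' \<epsilon> x - \<beta> \<eta> b \<epsilon> x) + (\<beta> \<zeta> a \<epsilon> x - \<beta> \<zeta> b' \<epsilon> x) = fun_loc c (\<lambda>\<epsilon> p. 2 * ip a \<zeta> \<epsilon> p) \<epsilon> x"
        using \<beta>[of a' \<xi>] \<beta>[of a'' \<eta>] \<beta>[of a \<zeta>] by linarith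
    qed (simp only: koszul_net_def fun_loc_add fun_loc_diff)
  qed
  moreover have "moderate (Fun M) (\<lambda>\<epsilon> p. 2 * ip a \<zeta> \<epsilon> p)"
    using calculation net_eq_left unfolding Fun_moderate_iff by blast
  ultimately have "gclass (Fun M) (\<lambda>\<epsilon> p. 2 * ip a \<zeta> \<epsilon> p) = gclass (Fun M) (koszul_net \<xi> \<eta> \<zeta>)"
    using Fun_gclass_eq_iff koszul_net_moderate[OF m] by blast
  then show "gfun_two_times M (gten_apply M G (D (X, Y)) Z) =
          gvec_apply M X (gten_apply M G Y Z) \<boxplus>\<^bsub>Fun M\<^esub> gvec_apply M Y (gten_apply M G Z X)
          \<boxminus>\<^bsub>Fun M\<^esub> gvec_apply M Z (gten_apply M G X Y) \<boxminus>\<^bsub>Fun M\<^esub> gten_apply M G X (gbracket M Y Z)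
          \<boxplus>\<^bsub>Fun M\<^esub> gten_apply M G Y (gbracket M Z X) \<boxplus>\<^bsub>Fun M\<^esub> gten_apply M G Z (gbracket M X Y)"
    unfolding X koszul_rhs_gclass[OF m] a(2) gten_apply_gclass[OF a(1) m(3)] gfun_two_times_gclass[OF moderate_ip[OF a(1) m(3)]] .
qed

subsection \<open>Existence and uniqueness\<close>

text \<open>Representatives of the arguments and of the value are chosen; the Koszul form depends on the
  representatives only up to negligible nets, so the choice does not matter.\<close>

lemma koszul_map_exists: "\<exists>D\<in>gvec_maps M. koszul_values D"
proof -
  define r where "r X = (SOME \<xi>. moderate (Vec M) \<xi> \<and> X = gclass (Vec M) \<xi>)" for X
  define v where "v X Y = (SOME w. moderate (Vec M) w \<and> lowers_to w (\<lambda>c. kform c (r X) (r Y)))" for X Y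
  define D where "D = restrict (\<lambda>(X, Y). gclass (Vec M) (v X Y)) (gen_fields (Vec M) \<times> gen_fields (Vec M))"
  have r: "moderate (Vec M) (r X) \<and> X = gclass (Vec M) (r X)" if "X \<in> gen_fields (Vec M)" for X
  proof -
    have "\<exists>\<xi>. moderate (Vec M) \<xi> \<and> X = gclass (Vec M) \<xi>" using that unfolding Vc.gen_fields_iff .
    then show ?thesis unfolding r_def by (rule someI_ex)
  qed
  have v: "moderate (Vec M) (v X Y) \<and> lowers_to (v X Y) (\<lambda>c. kform c (r X) (r Y))"
    if "X \<in> gen_fields (Vec M)" "Y \<in> gen_fields (Vec M)" for X Y
  proof -
    have mr: "moderate (Vec M) (r X)" "moderate (Vec M) (r Y)" using r that by auto
    obtain w where "moderate (Vec M) w" "lowers_to w (\<lambda>c. kform c (r X) (r Y))"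
      by (rule raise_index[OF mr])
    then have "\<exists>w. moderate (Vec M) w \<and> lowers_to w (\<lambda>c. kform c (r X) (r Y))" by blast
    then show ?thesis unfolding v_def by (rule someI_ex)
  qed
  have "D \<in> gvec_maps M"
    unfolding gvec_maps_def D_def
    by (rule restrict_PiE_iff[THEN iffD2]) (use v in \<open>auto intro!: Vc.gclass_in_gen_fields\<close>)
  moreover have "koszul_values D"
    unfolding koszul_values_def
  proof (intro allI impI)
    fix \<xi> \<eta> w assume m: "moderate (Vec M) \<xi>" "moderate (Vec M) \<eta>" "moderate (Vec M) w"
      and w: "D (gclass (Vec M) \<xi>, gclass (Vec M) \<eta>) = gclass (Vec M) w"
    define X Y where "X = gclass (Vec M) \<xi>" and "Y = gclass (Vec M) \<eta>"
    have XY: "X \<in> gen_fields (Vec M)" "Y \<in> gen_fields (Vec M)" unfolding X_def Y_def by (intro Vc.gclass_in_gen_fields m)+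
    have "gclass (Vec M) (v X Y) = gclass (Vec M) w" using w XY by (simp add: D_def X_def Y_def)
    then have vw: "(v X Y, w) \<in> net_rel (Vec M)" using Vc.gclass_eq_iff v[OF XY] m(3) by blast
    have rel: "(r X, \<xi>) \<in> net_rel (Vec M)" "(r Y, \<eta>) \<in> net_rel (Vec M)"
      using Vc.gclass_eq_iff r[OF XY(1)] r[OF XY(2)] m unfolding X_def Y_def by metis+
    show "lowers_to w (\<lambda>c. kform c \<xi> \<eta>)"
    proof (rule lowers_to_net_rel[OF conjunct2[OF v[OF XY]] vw])
      fix c assume c: "c \<in> charts M"
      show "net_eq (cimg c) (kform c (r X) (r Y)) (kform c \<xi> \<eta>)"
        unfolding kform_def[abs_def] using rel c unfolding Vec_net_rel_iff
        by (intro net_eq_koszul_form open_cimg net_eq_refl g_moderate) auto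
    qed
  qed
  ultimately show ?thesis by blast
qed

lemma koszul_map_unique:
  assumes "D \<in> gvec_maps M" "koszul_values D" "D' \<in> gvec_maps M" "koszul_values D'"
  shows "D = D'"
proof (rule PiE_ext)
  show "D \<in> gen_fields (Vec M) \<times> gen_fields (Vec M) \<rightarrow>\<^sub>E gen_fields (Vec M)"
    "D' \<in> gen_fields (Vec M) \<times> gen_fields (Vec M) \<rightarrow>\<^sub>E gen_fields (Vec M)"
    using assms unfolding gvec_maps_def by auto
  fix P assume "P \<in> gen_fields (Vec M) \<times> gen_fields (Vec M)"
  then obtain \<xi> \<eta> where m: "moderate (Vec M) \<xi>" "moderate (Vec M) \<eta>" and P: "P = (gclass (Vec M) \<xi>, gclass (Vec M) \<eta>)"
    by (auto elim!: Vec_gen_fieldsE)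
  obtain w where "moderate (Vec M) w" "lowers_to w (\<lambda>c. kform c \<xi> \<eta>)" by (rule raise_index[OF m])
  then show "D P = D' P" unfolding P using koszul_values_unique m assms by metis
qed

theorem levi_civita:
  "(\<exists>!D. gen_connection M D \<and> torsion_free M D \<and> metric_connection M G D) \<and>
   (\<forall>D\<in>gvec_maps M. (gen_connection M D \<and> torsion_free M D \<and> metric_connection M G D) \<longleftrightarrow> koszul_formula M G D)"
proof -
  have iff: "(gen_connection M D \<and> torsion_free M D \<and> metric_connection M G D) \<longleftrightarrow> koszul_formula M G D" if "D \<in> gvec_maps M" for D
    using koszul_connection koszul_torsion_free koszul_metric connection_koszul koszul_formula_iff that by blast
  have maps: "D \<in> gvec_maps M" if "gen_connection M D" for D using that unfolding gen_connection_def by blast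
  obtain D where D: "D \<in> gvec_maps M" "koszul_values D" using koszul_map_exists by blast
  have "\<exists>!D. gen_connection M D \<and> torsion_free M D \<and> metric_connection M G D"
  proof (rule ex1I[of _ D])
    show "gen_connection M D \<and> torsion_free M D \<and> metric_connection M G D"
      using D iff koszul_formula_iff by blast
    fix D' assume D': "gen_connection M D' \<and> torsion_free M D' \<and> metric_connection M G D'"
    then show "D' = D" using koszul_map_unique[of D' D] maps iff koszul_formula_iff D by blast
  qed
  with iff show ?thesis by blast
qed

end

section \<open>Symmetric representatives\<close>

lemma atlas_open_submanifold:
  assumes "atlas M" "c \<in> charts M"
  shows "atlas (open_submanifold M (fst c))"
proof -
  interpret atlas M by fact
  let ?N = "open_submanifold M (fst c)"
  have N: "mtop ?N = subtopology (mtop M) (fst c)" "charts ?N = {d \<in> charts M. fst d \<subseteq> fst c}"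
    by (simp_all add: open_submanifold_def)
  show ?thesis
  proof
    show "Hausdorff_space (mtop ?N)" unfolding N by (rule Hausdorff_space_subtopology[OF Hausdorff])
    show "is_chart (mtop ?N) d" if "d \<in> charts ?N" for d
    proof -
      have d: "d \<in> charts M" "fst d \<subseteq> fst c" using that N by auto
      have "subtopology (subtopology (mtop M) (fst c)) (fst d) = subtopology (mtop M) (fst d)"
        using d(2) by (simp add: subtopology_subtopology Int_absorb1)
      moreover have "openin (subtopology (mtop M) (fst c)) (fst d)"
        using openin_chart[OF d(1)] d(2) by (auto simp: openin_subtopology)
      ultimately show ?thesis using is_chart[OF d(1)] unfolding is_chart_def N by simp
    qed
    show "(\<Union>c\<in>charts ?N. fst c) = topspace (mtop ?N)"
      unfolding N topspace_chart[OF assms(2)] using assms(2) by auto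
    show "compatible d e" if "d \<in> charts ?N" "e \<in> charts ?N" for d e
      using that compatible unfolding N by blast
  qed
qed

text \<open>An inverse of a generalized function has moderate growth; hence the function itself cannot
  decay faster than every power of the parameter.\<close>

lemma invertible_det_strictly_nonzero:
  assumes M: "atlas (M :: ('a, 'n::finite) manifold)" and c: "c \<in> charts M"
    and inv: "gfun_invertible (open_submanifold M (fst c)) (gten_det M c G)"
  obtains \<gamma> where "\<gamma> \<in> G" "strictly_nonzero_on (cimg c) (\<lambda>\<epsilon> x. det (comp_loc c \<gamma> \<epsilon> x))"
proof -
  let ?N = "open_submanifold M (fst c)"
  have N: "atlas ?N" by (rule atlas_open_submanifold[OF M c])
  interpret atlas ?N by fact
  interpret F: normed_bundle "Fun ?N" "\<lambda>_ _ _. id_blinfun" "\<lambda>\<phi> p. \<phi> (chart_at ?N p) p"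
    by (rule Fun_normed_bundle[OF N])
  have cN: "c \<in> charts ?N" using c by (simp add: open_submanifold_def)
  have loc: "F.loc d u \<epsilon> x = u \<epsilon> (chart_inv d x)" for d u \<epsilon> x by (simp add: F.loc_def)
  have one: "moderate (Fun ?N) (\<lambda>\<epsilon> p. 1)"
    by (rule F.moderateI) (auto simp: loc[abs_def] moderate_on_const smooth_functions_iff smooth_on_const)
  obtain v where v: "v \<in> gen_fields (Fun ?N)" "gfun_mult ?N (gten_det M c G) v = gfun_one ?N"
    using inv unfolding gfun_invertible_def by blast
  have "(\<lambda>\<epsilon> p. 1) \<in> gfun_one ?N" unfolding gfun_one_def F.mem_gclass by (rule F.net_rel_refl[OF one])
  then have "(\<lambda>\<epsilon> p. 1) \<in> gfun_mult ?N (gten_det M c G) v" using v(2) by simp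
  then obtain \<gamma> u v' where \<gamma>: "\<gamma> \<in> G" and u: "u \<in> gclass (Fun ?N) (\<lambda>\<epsilon> p. det (\<gamma> \<epsilon> c p))" and v': "v' \<in> v"
    and uv: "(\<lambda>\<epsilon> p. 1) \<in> gclass (Fun ?N) (\<lambda>\<epsilon>. u \<epsilon> * v' \<epsilon>)"
    unfolding gfun_mult_def lift2_def gten_det_def lift1_def by blast
  obtain v0 where "v = gclass (Fun ?N) v0" using v(1) unfolding F.gen_fields_iff by blast
  then have "(v0, v') \<in> net_rel (Fun ?N)" using v' by (simp add: F.mem_gclass)
  then have "moderate (Fun ?N) v'" unfolding net_rel_def by auto
  from moderate_on_tempered[OF F.moderate_imp_moderate_on[OF this]]
  have vt: "tempered_on (cimg c) (\<lambda>\<epsilon> x. v' \<epsilon> (chart_inv c x))" using cN by (simp add: loc[abs_def])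
  have du: "negligible_on (cimg c) (\<lambda>\<epsilon> x. det (comp_loc c \<gamma> \<epsilon> x) - u \<epsilon> (chart_inv c x))"
    using u cN unfolding F.mem_gclass F.net_rel_iff by (simp add: loc comp_loc_def)
  have uv1: "negligible_on (cimg c) (\<lambda>\<epsilon> x. u \<epsilon> (chart_inv c x) * v' \<epsilon> (chart_inv c x) - 1)"
    using uv cN unfolding F.mem_gclass F.net_rel_iff by (simp add: loc)
  have "negligible_on (cimg c) (\<lambda>\<epsilon> x. (det (comp_loc c \<gamma> \<epsilon> x) - u \<epsilon> (chart_inv c x)) * v' \<epsilon> (chart_inv c x) +
      (u \<epsilon> (chart_inv c x) * v' \<epsilon> (chart_inv c x) - 1))"
    by (rule negligible_on_add[OF negligible_on_bilinear_left[OF bounded_bilinear_mult du vt] uv1])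
  then have dv: "negligible_on (cimg c) (\<lambda>\<epsilon> x. det (comp_loc c \<gamma> \<epsilon> x) * v' \<epsilon> (chart_inv c x) - 1)"
    by (simp add: algebra_simps)
  have "strictly_nonzero_on (cimg c) (\<lambda>\<epsilon> x. det (comp_loc c \<gamma> \<epsilon> x))"
    unfolding strictly_nonzero_on_def
  proof (intro allI impI)
    fix K assume K: "compact K \<and> K \<subseteq> cimg c"
    obtain n where n: "\<forall>\<^sub>F \<epsilon> in at_right 0. \<forall>x\<in>K. norm (v' \<epsilon> (chart_inv c x)) \<le> (1 / \<epsilon>) ^ n"
      using tempered_onE[OF vt] K by blast
    have "\<forall>\<^sub>F \<epsilon> in at_right 0. \<forall>x\<in>K. norm (det (comp_loc c \<gamma> \<epsilon> x) * v' \<epsilon> (chart_inv c x) - 1) \<le> \<epsilon> ^ 1"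
      using negligible_onD[OF dv] K by blast
    with n have "\<forall>\<^sub>F \<epsilon> in at_right 0. \<forall>x\<in>K. \<epsilon> ^ Suc n \<le> \<bar>det (comp_loc c \<gamma> \<epsilon> x)\<bar>"
      using eventually_small[of "1/2", simplified]
    proof eventually_elim
      case (elim \<epsilon>)
      show ?case
      proof
        fix x assume x: "x \<in> K"
        let ?d = "det (comp_loc c \<gamma> \<epsilon> x)" and ?v = "v' \<epsilon> (chart_inv c x)"
        have "\<bar>?d * ?v - 1\<bar> \<le> \<epsilon>" "\<bar>?v\<bar> \<le> (1 / \<epsilon>) ^ n" "0 < \<epsilon>" "\<epsilon> < 1/2" using elim x by auto
        then have "\<epsilon> \<le> \<bar>?d * ?v\<bar>" by linarith
        also have "\<dots> \<le> \<bar>?d\<bar> * (1 / \<epsilon>) ^ n" unfolding abs_mult using \<open>\<bar>?v\<bar> \<le> _\<close> by (intro mult_left_mono) auto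
        finally have "\<epsilon> * \<epsilon> ^ n \<le> \<bar>?d\<bar> * (1 / \<epsilon>) ^ n * \<epsilon> ^ n" using \<open>0 < \<epsilon>\<close> by (intro mult_right_mono) auto
        then show "\<epsilon> ^ Suc n \<le> \<bar>?d\<bar>" using \<open>0 < \<epsilon>\<close> by (simp add: power_divide)
      qed
    qed
    then show "\<exists>N. \<forall>\<^sub>F \<epsilon> in at_right 0. \<forall>x\<in>K. \<epsilon> ^ N \<le> \<bar>det (comp_loc c \<gamma> \<epsilon> x)\<bar>" by blast
  qed
  with \<gamma> show ?thesis by (rule that)
qed

text \<open>On a coordinate neighbourhood of a compact set, the given net differs by a negligible one from a net
  that is symmetric there for small parameters.  Hence its antisymmetric part is negligible, and
  symmetrization does not change the class.  The symmetrized net inherits the growth of the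
  determinant from a representative.\<close>

theorem symmetric_representative:
  assumes M: "smooth_manifold (M :: ('a, 'n::finite) manifold)" and G: "gen_pseudo_riemannian_metric M G"
  obtains g where "metric_net M G g"
proof -
  interpret smooth_mf M by (rule smooth_mf.intro[OF M])
  obtain g0 where g0: "moderate (Ten M) g0" and Geq: "G = net_rel (Ten M) `` {g0}"
    using G unfolding gen_pseudo_riemannian_metric_def gen_fields_def quotient_def by blast
  have GD: "moderate (Ten M) \<gamma> \<and> negligible_net (Ten M) (\<lambda>\<epsilon>. g0 \<epsilon> - \<gamma> \<epsilon>)" if "\<gamma> \<in> G" for \<gamma>
    using that unfolding Geq net_rel_def by blast
  obtain j where j0: "\<forall>V. openin (mtop M) V \<and> compactin (mtop M) (mtop M closure_of V) \<longrightarrow>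
      (\<exists>\<gamma>\<in>G. \<exists>\<epsilon>0>0. \<forall>\<epsilon>\<in>{0<..1}. \<epsilon> < \<epsilon>0 \<longrightarrow> pseudo_riemannian_on M V j (\<gamma> \<epsilon>))"
    using G[unfolded gen_pseudo_riemannian_metric_def] by (elim conjE exE) (rule that)
  note j = j0[rule_format, OF conjI]
  have sec0: "g0 \<epsilon> \<in> smooth_tfields M" if "\<epsilon> \<in> {0<..1}" for \<epsilon>
    using Tn.moderate_section[OF g0 that] by simp
  have mod0: "moderate_on (cimg c) (comp_loc c g0)" if "c \<in> charts M" for c
    using Tn.moderate_imp_moderate_on[OF g0, of c] that by simp
  have neg: "negligible_on (cimg c) (\<lambda>\<epsilon> x. comp_loc c g0 \<epsilon> x - comp_loc c \<gamma> \<epsilon> x)" if "\<gamma> \<in> G" "c \<in> charts M" for \<gamma> c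
    using Tn.negligible_imp_negligible_on[of "\<lambda>\<epsilon>. g0 \<epsilon> - \<gamma> \<epsilon>" c] GD[OF that(1)] that(2)
    by (simp add: comp_loc_def[abs_def])
  define g where "g \<epsilon> c p = (1/2) *\<^sub>R (g0 \<epsilon> c p + transpose (g0 \<epsilon> c p))" for \<epsilon> c p
  have tl: "linear (transpose :: real^'n^'n \<Rightarrow> _)" by (rule bounded_linear.linear[OF bounded_linear_transpose])
  have gm: "moderate_on (cimg c) (comp_loc c g)" if c: "c \<in> charts M" for c
  proof -
    have "moderate_on (cimg c) (\<lambda>\<epsilon> x. (1/2) *\<^sub>R (comp_loc c g0 \<epsilon> x + transpose (comp_loc c g0 \<epsilon> x)))"
      by (intro moderate_on_scaleR moderate_on_add moderate_on_transpose moderate_on_const open_cimg mod0 c)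
    then show ?thesis by (simp add: comp_loc_def[abs_def] g_def)
  qed
  have gs: "g \<epsilon> \<in> smooth_tfields M" if e: "\<epsilon> \<in> {0<..1}" for \<epsilon>
    unfolding smooth_tfields_def mem_Collect_eq
  proof (intro conjI ballI)
    fix c assume "c \<in> charts M"
    from moderate_on_smooth[OF gm[OF this] e]
    show "smooth_in_chart c (g \<epsilon> c)" by (simp add: smooth_in_chart_def cimg_def comp_loc_def[abs_def] o_def)
  next
    fix c d p assume "c \<in> charts M" "d \<in> charts M" "p \<in> fst c \<inter> fst d"
    then have "g0 \<epsilon> c p = transpose (jacobian c d p) ** g0 \<epsilon> d p ** jacobian c d p"
      using smooth_tfieldsD(2)[OF sec0[OF e], of c d p] by blast
    then show "g \<epsilon> c p = transpose (jacobian c d p) ** g \<epsilon> d p ** jacobian c d p"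
      unfolding g_def
      by (simp add: matrix_transpose_mul matrix_mul_assoc matrix_add_ldistrib
          bounded_bilinear.add_left[OF bounded_bilinear_matrix_matrix]
          bounded_bilinear.scaleR_left[OF bounded_bilinear_matrix_matrix]
          bounded_bilinear.scaleR_right[OF bounded_bilinear_matrix_matrix])
  qed
  have g_g0: "negligible_on (cimg c) (\<lambda>\<epsilon> x. comp_loc c g \<epsilon> x - comp_loc c g0 \<epsilon> x)" if c: "c \<in> charts M" for c
    unfolding negligible_on_def
  proof (intro allI impI)
    fix K m assume "compact K \<and> K \<subseteq> cimg c"
    then have K: "compact K" "K \<subseteq> cimg c" by auto
    obtain r where r: "0 < r" "compact {x + y | x y. x \<in> K \<and> y \<in> cball 0 r}" 
      "{x + y | x y. x \<in> K \<and> y \<in> cball 0 r} \<subseteq> cimg c"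
      by (rule compact_enlarge[OF K open_cimg[OF c]])
    define L where "L = {x + y | x y. x \<in> K \<and> y \<in> cball 0 r}"
    define V where "V = {p \<in> fst c. snd c p \<in> (\<Union>x\<in>K. ball x r)}"
    have V: "openin (mtop M) V" unfolding V_def by (intro openin_chart_preimage c) auto
    have "V \<subseteq> chart_inv c ` L"
    proof
      fix p assume p: "p \<in> V"
      then obtain x where x: "x \<in> K" "dist x (snd c p) < r" "p \<in> fst c" by (auto simp: V_def)
      then have "snd c p \<in> L" unfolding L_def
        by (intro CollectI exI[of _ x] exI[of _ "snd c p - x"]) (auto simp: dist_norm norm_minus_commute)
      then show "p \<in> chart_inv c ` L" using x c by (metis chart_inv_left image_eqI)
    qed
    then have "mtop M closure_of V \<subseteq> chart_inv c ` L"
      using r by (intro closure_of_minimal closedin_chart_inv c) (auto simp: L_def)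
    then have "compactin (mtop M) (mtop M closure_of V)"
      using r by (intro closed_compactin[OF compactin_chart_inv[OF c, of L]]) (auto simp: L_def)
    from j[OF V this] obtain \<gamma> \<epsilon>0 where \<gamma>: "\<gamma> \<in> G" "0 < \<epsilon>0"
      "\<And>\<epsilon>. \<epsilon> \<in> {0<..1} \<Longrightarrow> \<epsilon> < \<epsilon>0 \<Longrightarrow> pseudo_riemannian_on M V j (\<gamma> \<epsilon>)" by blast
    let ?n = "\<lambda>\<epsilon> x. comp_loc c g0 \<epsilon> x - comp_loc c \<gamma> \<epsilon> x"
    have "negligible_on (cimg c) (\<lambda>\<epsilon> x. (1/2) *\<^sub>R (transpose (?n \<epsilon> x) - ?n \<epsilon> x))"
      by (intro negligible_on_linear[OF bounded_linear_scaleR_right] negligible_on_diff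
          negligible_on_linear[OF bounded_linear_transpose] neg[OF \<gamma>(1) c])
    from negligible_onD[OF this K, of m] eventually_small[OF \<gamma>(2)] eventually_small[of 1, simplified]
    show "\<forall>\<^sub>F \<epsilon> in at_right 0. \<forall>x\<in>K. norm (comp_loc c g \<epsilon> x - comp_loc c g0 \<epsilon> x) \<le> \<epsilon> ^ m"
    proof eventually_elim
      case (elim \<epsilon>)
      show ?case
      proof
        fix x assume x: "x \<in> K"
        then have xc: "x \<in> cimg c" using K by blast
        then have "chart_inv c x \<in> fst c \<inter> V" using x r(1) by (auto simp: V_def intro!: bexI[of _ x])
        moreover have "pseudo_riemannian_on M V j (\<gamma> \<epsilon>)" using \<gamma>(3) elim by simp
        ultimately have "sym_form (\<gamma> \<epsilon> c (chart_inv c x))" using c unfolding pseudo_riemannian_on_def by blast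
        then have "transpose (comp_loc c \<gamma> \<epsilon> x) = comp_loc c \<gamma> \<epsilon> x" unfolding comp_loc_def by (simp add: sym_form_iff_transpose)
        then have "(1/2) *\<^sub>R (transpose (?n \<epsilon> x) - ?n \<epsilon> x) = (1/2) *\<^sub>R (transpose (comp_loc c g0 \<epsilon> x) - comp_loc c g0 \<epsilon> x)"
          by (simp add: linear_diff[OF tl])
        also have "\<dots> = comp_loc c g \<epsilon> x - comp_loc c g0 \<epsilon> x"
          by (simp add: comp_loc_def g_def vec_eq_iff field_simps)
        finally show "norm (comp_loc c g \<epsilon> x - comp_loc c g0 \<epsilon> x) \<le> \<epsilon> ^ m" using elim x by metis
      qed
    qed
  qed
  have G_eq: "net_eq (cimg c) (comp_loc c g) (comp_loc c \<gamma>)" if "\<gamma> \<in> G" "c \<in> charts M" for \<gamma> c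
    unfolding net_eq_def
  proof (intro conjI)
    show "moderate_on (cimg c) (comp_loc c g)" by (rule gm[OF that(2)])
    show "moderate_on (cimg c) (comp_loc c \<gamma>)"
      using Tn.moderate_imp_moderate_on[of \<gamma> c] GD[OF that(1)] that(2) by simp
    show "negligible_on (cimg c) (\<lambda>\<epsilon> x. comp_loc c g \<epsilon> x - comp_loc c \<gamma> \<epsilon> x)"
      using negligible_on_add[OF g_g0[OF that(2)] neg[OF that]] by simp
  qed
  have "metric_net M G g"
  proof (intro metric_net.intro metric_net_axioms.intro smooth_mf.intro M)
    show "transpose (g \<epsilon> c p) = g \<epsilon> c p" for \<epsilon> c p
      by (simp add: g_def linear_add[OF tl] linear_scale[OF tl] add.commute)
    show "strictly_nonzero_on (cimg c) (\<lambda>\<epsilon> x. det (comp_loc c g \<epsilon> x))" if c: "c \<in> charts M" for c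
    proof -
      have "gfun_invertible (open_submanifold M (fst c)) (gten_det M c G)"
        using G[unfolded gen_pseudo_riemannian_metric_def, THEN conjunct2, THEN conjunct1] c by (rule bspec)
      from invertible_det_strictly_nonzero[OF atlas_axioms c this] obtain \<gamma> where
        \<gamma>: "\<gamma> \<in> G" "strictly_nonzero_on (cimg c) (\<lambda>\<epsilon> x. det (comp_loc c \<gamma> \<epsilon> x))" .
      show ?thesis
        by (rule strictly_nonzero_on_net_eq[OF \<gamma>(2) net_eq_negligible[OF net_eq_det[OF open_cimg[OF c] net_eq_sym[OF G_eq[OF \<gamma>(1) c]]]]])
    qed
    have "\<exists>\<gamma>. \<gamma> \<in> G" using j[of "{}"] by auto
    then show "G \<noteq> {}" by blast
    show "\<gamma> \<epsilon> \<in> smooth_tfields M" if "\<gamma> \<in> G" "\<epsilon> \<in> {0<..1}" for \<gamma> \<epsilon>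
      using Tn.moderate_section[OF _ that(2)] GD[OF that(1)] by simp
  qed (simp_all add: gs gm G_eq)
  then show ?thesis by (rule that)
qed

theorem theorem5p2:
  fixes M :: "('a, 'n::finite) manifold"
    and G :: "(real \<Rightarrow> ('a, 'n) tfield) set"
  assumes "smooth_manifold M"
    and "gen_pseudo_riemannian_metric M G"
  shows "(\<exists>!D. gen_connection M D \<and> torsion_free M D \<and> metric_connection M G D) \<and>
         (\<forall>D\<in>gvec_maps M.
            (gen_connection M D \<and> torsion_free M D \<and> metric_connection M G D) \<longleftrightarrow>
            koszul_formula M G D)"
proof -
  obtain g where "metric_net M G g" by (rule symmetric_representative[OF assms])
  then show ?thesis by (rule metric_net.levi_civita)
qed

end
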